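(* Let $Z$ be a real-valued Lévy process, let $c>0$, let $\Phi(\theta)=\mathbb{E}[\exp(\theta Z(1))]$ be the moment generating function of $Z(1)$ and let $\mu:=\mathbb{E}[Z(1)]$. Denote by $\mathrm{i_d}$ the identity function on $[0,1]$. (i) Under $(\mathcal{C})$, i.e. if $\Phi(\theta)<\infty$ for all $\theta\in\mathbb{R}$, a functional Erdős–Rényi law (FERL) holds for $(\mathcal{L}_n^{\mathbb{N}})$ in $(D(0,1),d_{\mathcal{U}})$, with limit set $K_{1/c}+\mu\,\mathrm{i_d}$. (ii) Assume that the generating triplet $(A,\nu,\gamma)$ of $Z$ satisfies $A=0$ and $\int_{|x|\le1}|x|\,\nu(dx)<\infty$. Then, under $(\mathcal{A})$, i.e. if $\Phi(\theta)<\infty$ for $\theta$ in a neighborhood of $0$, a FERL holds for $(\mathcal{L}_n^{\mathbb{N}})$ in $(BV_0(0,1),d_{\mathcal{H}})$, with limit set $L_{1/c}+\mu\,\mathrm{i_d}$. Here $K_{1/c}$ and $L_{1/c}$ are the sublevel sets, defined in the context, of the rate functions $I$ and $J$ built from $\Phi$.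
   Context: A Lévy process $Z=\{Z(t):t\ge0\}$ is a stochastically continuous real-valued process with stationary independent increments and $Z(0)=0$ a.s.; it is defined on a probability space $(\Omega,\mathcal{F},P)$, and all its sample paths are assumed càdlàg on $[0,\infty)$. Its generating triplet is $(A,\nu,\gamma)$: $A\ge0$ is the variance of the Gaussian component, $\nu$ is a measure on $\mathbb{R}$ with $\nu(\{0\})=0$ and $\int_{\mathbb{R}}(x^2\wedge1)\,\nu(dx)<\infty$ (the Lévy measure), and $\gamma\in\mathbb{R}$. For $x\ge0$, $\lambda>0$: $\eta_{x,\lambda}:[0,1]\to\mathbb{R}$, $\eta_{x,\lambda}(s)=\lambda^{-1}(Z(x+s\lambda)-Z(x))$. For $n>1$, $A_n$ is the integer part of $c\log n$, and $\mathcal{L}_n^{\mathbb{N}}:=\{\eta_{x,A_n}:x\in[0,n-A_n]\cap\mathbb{N}\}$, with $0\in\mathbb{N}$ (only large $n$ matter). A subset of $\Omega$ is negligible if it is contained in a set of $\mathcal{F}$ of probability $0$; $\mathcal{N}^{c}$ is the class of complements of negligible sets. For subsets $E_n$ of $\Omega$, $\{E_n\text{ ult.}\}=\bigcup_{n>1}\bigcap_{k\ge n}E_k$. For a metric space $(\mathcal{E},d)$ of functions on $[0,1]$, $K\subset\mathcal{E}$ and $\epsilon>0$, $K^{\epsilon;d}:=\{f\in\mathcal{E}:\exists g\in K,\ d(f,g)<\epsilon\}$. A FERL holds for $(\mathcal{L}_n^{\mathbb{N}})$ in $(\mathcal{E},d)$ with limit set $\mathcal{K}\subset\mathcal{E}$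 if for every $\epsilon>0$, $\{\mathcal{L}_n^{\mathbb{N}}\subset\mathcal{K}^{\epsilon;d}\text{ ult.}\}\in\mathcal{N}^{c}$ and $\{\mathcal{K}\subset(\mathcal{L}_n^{\mathbb{N}})^{\epsilon;d}\text{ ult.}\}\in\mathcal{N}^{c}$. $D(0,1)$ is the space of càdlàg functions on $[0,1]$ and $d_{\mathcal{U}}$ is the uniform distance on it. $BV_0(0,1)$ is the space of functions of bounded variation on $[0,1]$ that vanish at $0$, and $d_{\mathcal{H}}(f,g)=\int_0^1|f(u)-g(u)|\,du+|f(1)-g(1)|$ for $f,g\in BV_0(0,1)$. Under the assumptions of (ii), almost surely all $\eta_{x,\lambda}$ lie in $BV_0(0,1)$. Rate functions: let $\Psi(a):=\sup\{a\theta-\log\Phi(\theta):\Phi(\theta)<\infty\}$, $a\in\mathbb{R}$, where $\Phi$ is the moment generating function of $Z(1)$. Define $I:D(0,1)\to[0,\infty]$ by $I(f)=\int_0^1\Psi\big(\tfrac{\mathrm{d}f}{\mathrm{d}s}(s)\big)\,ds$ if $f$ is absolutely continuous with $f(0)=0$, and $I(f)=\infty$ otherwise. Let $\theta_0:=\sup\{\theta:\Phi(\theta)<\infty\}>0$ and $\theta_1:=\inf\{\theta:\Phi(\theta)<\infty\}<0$. For $f\in BV_0(0,1)$, write $f=f_+-f_-$, where $\mathrm{d}f=\mathrm{d}f_+-\mathrm{d}f_-$ is the Hahn–Jordan decomposition of $\mathrm{d}f$; for $g\in BV_0(0,1)$, write $g=g^A+g^S$, where $\mathrm{d}g=\mathrm{d}g^A+\mathrm{d}g^S$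 is the Lebesgue decomposition of $\mathrm{d}g$ into its absolutely continuous and singular components. Define $J:BV_0(0,1)\to[0,\infty]$ by $J(f)=\int_0^1\Psi\big(\tfrac{\mathrm{d}f^A}{\mathrm{d}s}(s)\big)\,ds+\theta_0f_+^S(1)-\theta_1f_-^S(1)$ (with $\infty\cdot0=0$). For $\alpha>0$, $K_\alpha:=\{f\in D(0,1):I(f)\le\alpha\}$ and $L_\alpha:=\{f\in BV_0(0,1):J(f)\le\alpha\}$.
   Formalization: The rate functions I and J are built from the moment generating function of the centred variable Z(1)−μ instead of Z(1); as printed the claim counts μ twice and fails for μ≠0 (e.g. Z(t)=t, where the printed limit set would be {2 i_d}). For μ=0 nothing changes. *)

theory Defs
  imports "HOL-Probability.Probability"
begin

text \<open>Functions on [0,1] are represented by functions of type \<^typ>\<open>real \<Rightarrow> real\<close>; every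
  notion below depends only on their values on [0,1]. Likewise a process Z is only used at
  times \<open>t \<ge> 0\<close>.\<close>

section \<open>Levy processes\<close>

definition levy_process :: "'a measure \<Rightarrow> (real \<Rightarrow> 'a \<Rightarrow> real) \<Rightarrow> bool" where
  "levy_process M Z \<longleftrightarrow>
     prob_space M \<and>
     (\<forall>t\<ge>0. Z t \<in> borel_measurable M) \<and>
     (AE \<omega> in M. Z 0 \<omega> = 0) \<and>
     (\<forall>s\<ge>0. \<forall>h\<ge>0. distr M borel (\<lambda>\<omega>. Z (s + h) \<omega> - Z s \<omega>)
                     = distr M borel (\<lambda>\<omega>. Z h \<omega> - Z 0 \<omega>)) \<and>
     (\<forall>n (t :: nat \<Rightarrow> real). 0 \<le> t 0 \<and> (\<forall>i<n. t i < t (Suc i)) \<longrightarrow>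
        prob_space.indep_vars M (\<lambda>_. borel) (\<lambda>i \<omega>. Z (t (Suc i)) \<omega> - Z (t i) \<omega>) {..<n}) \<and>
     (\<forall>t\<ge>0. \<forall>\<epsilon>>0.
        ((\<lambda>s. measure M {\<omega> \<in> space M. \<bar>Z s \<omega> - Z t \<omega>\<bar> > \<epsilon>}) \<longlongrightarrow> 0) (at t within {0..})) \<and>
     (\<forall>\<omega>\<in>space M.
        (\<forall>t\<ge>0. continuous (at_right t) (\<lambda>s. Z s \<omega>)) \<and>
        (\<forall>t>0. \<exists>l. ((\<lambda>s. Z s \<omega>) \<longlongrightarrow> l) (at_left t)))"

definition levy_measure :: "real measure \<Rightarrow> bool" where
  "levy_measure \<nu> \<longleftrightarrow>
     sets \<nu> = sets borel \<and> emeasure \<nu> {0} = 0 \<and> (\<integral>\<^sup>+x. ennreal (min (x\<^sup>2) 1) \<partial>\<nu>) < \<infinity>"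

text \<open>The Levy--Khintchine representation of the law of \<open>Z(1)\<close>, with the truncation function
  \<open>x \<mapsto> x 1{|x| \<le> 1}\<close>.\<close>

definition generating_triplet ::
  "'a measure \<Rightarrow> (real \<Rightarrow> 'a \<Rightarrow> real) \<Rightarrow> real \<Rightarrow> real measure \<Rightarrow> real \<Rightarrow> bool" where
  "generating_triplet M Z A \<nu> \<gamma> \<longleftrightarrow>
     A \<ge> 0 \<and> levy_measure \<nu> \<and>
     (\<forall>u. char (distr M borel (Z 1)) u =
        exp (- complex_of_real (A * u\<^sup>2 / 2) + \<i> * complex_of_real (\<gamma> * u)
          + (CLINT x|\<nu>. iexp (u * x) - 1
                 - \<i> * complex_of_real (u * x * indicator {-1..1} x))))"

definition mgf :: "'a measure \<Rightarrow> ('a \<Rightarrow> real) \<Rightarrow> real \<Rightarrow> ennreal" where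
  "mgf M X \<theta> = (\<integral>\<^sup>+\<omega>. ennreal (exp (\<theta> * X \<omega>)) \<partial>M)"

section \<open>Increment functions\<close>

definition eta :: "(real \<Rightarrow> 'a \<Rightarrow> real) \<Rightarrow> real \<Rightarrow> real \<Rightarrow> 'a \<Rightarrow> real \<Rightarrow> real" where
  "eta Z x l \<omega> = (\<lambda>s. (Z (x + s * l) \<omega> - Z x \<omega>) / l)"

definition A_seq :: "real \<Rightarrow> nat \<Rightarrow> nat" where
  "A_seq c n = nat \<lfloor>c * ln (real n)\<rfloor>"

definition increments :: "(real \<Rightarrow> 'a \<Rightarrow> real) \<Rightarrow> real \<Rightarrow> nat \<Rightarrow> 'a \<Rightarrow> (real \<Rightarrow> real) set" where
  "increments Z c n \<omega> =
     {eta Z (real x) (real (A_seq c n)) \<omega> | x :: nat. real x \<le> real n - real (A_seq c n)}"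

section \<open>Functional Erdos--Renyi laws\<close>

definition nbhd ::
  "'f set \<Rightarrow> ('f \<Rightarrow> 'f \<Rightarrow> real) \<Rightarrow> 'f set \<Rightarrow> real \<Rightarrow> 'f set" where
  "nbhd E d K \<epsilon> = {f \<in> E. \<exists>g\<in>K. d f g < \<epsilon>}"

text \<open>An event, measurable or not, has a negligible complement exactly if it holds \<open>AE\<close>.\<close>

definition FERL ::
  "'a measure \<Rightarrow> 'f set \<Rightarrow> ('f \<Rightarrow> 'f \<Rightarrow> real) \<Rightarrow> (nat \<Rightarrow> 'a \<Rightarrow> 'f set) \<Rightarrow> 'f set \<Rightarrow> bool" where
  "FERL M E d L K \<longleftrightarrow>
     K \<subseteq> E \<and>
     (\<forall>\<epsilon>>0. (AE \<omega> in M. \<forall>\<^sub>F n in sequentially. L n \<omega> \<subseteq> nbhd E d K \<epsilon>) \<and>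
             (AE \<omega> in M. \<forall>\<^sub>F n in sequentially. K \<subseteq> nbhd E d (L n \<omega>) \<epsilon>))"

section \<open>Function spaces on [0,1]\<close>

definition D01 :: "(real \<Rightarrow> real) set" where
  "D01 = {f. (\<forall>s\<in>{0..<1}. continuous (at_right s) f) \<and>
             (\<forall>s\<in>{0<..1}. \<exists>l. (f \<longlongrightarrow> l) (at_left s))}"

definition d_unif :: "(real \<Rightarrow> real) \<Rightarrow> (real \<Rightarrow> real) \<Rightarrow> real" where
  "d_unif f g = (SUP s\<in>{0..1}. \<bar>f s - g s\<bar>)"

definition bounded_variation01 :: "(real \<Rightarrow> real) \<Rightarrow> bool" where
  "bounded_variation01 f \<longleftrightarrow>
     (\<exists>B. \<forall>n (t :: nat \<Rightarrow> real). mono t \<and> range t \<subseteq> {0..1} \<longrightarrow>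
        (\<Sum>i<n. \<bar>f (t (Suc i)) - f (t i)\<bar>) \<le> B)"

definition BV0 :: "(real \<Rightarrow> real) set" where
  "BV0 = {f. bounded_variation01 f \<and> f 0 = 0}"

definition d_hyb :: "(real \<Rightarrow> real) \<Rightarrow> (real \<Rightarrow> real) \<Rightarrow> real" where
  "d_hyb f g = (LBINT u:{0..1}. \<bar>f u - g u\<bar>) + \<bar>f 1 - g 1\<bar>"

definition abs_continuous01 :: "(real \<Rightarrow> real) \<Rightarrow> bool" where
  "abs_continuous01 f \<longleftrightarrow>
     (\<forall>\<epsilon>>0. \<exists>\<delta>>0. \<forall>n (a :: nat \<Rightarrow> real) b.
        (\<forall>i<n. 0 \<le> a i \<and> a i \<le> b i \<and> b i \<le> 1) \<and>
        disjoint_family_on (\<lambda>i. {a i<..<b i}) {..<n} \<and>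
        (\<Sum>i<n. b i - a i) < \<delta> \<longrightarrow>
        (\<Sum>i<n. \<bar>f (b i) - f (a i)\<bar>) < \<epsilon>)"

section \<open>Rate functions\<close>

text \<open>All objects of this section take the moment generating function \<open>\<Phi>\<close> as a parameter.
  If \<open>\<Phi>\<close> is the one of an integrable X, then \<open>\<Psi> \<Phi>\<close> vanishes at \<open>E X\<close>, so that the
  sublevel sets below contain \<open>E X\<close> times the identity function. A limit set of the form
  ``sublevel set plus \<open>E X\<close> times the identity'' therefore goes with the moment generating
  function of the centred variable \<open>X - E X\<close>, whose \<open>\<Psi>\<close> vanishes at 0.\<close>

definition \<Psi> :: "(real \<Rightarrow> ennreal) \<Rightarrow> real \<Rightarrow> ereal" where
  "\<Psi> \<Phi> a = (SUP \<theta>\<in>{\<theta>. \<Phi> \<theta> < \<infinity>}. ereal (a * \<theta> - ln (enn2real (\<Phi> \<theta>))))"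

definition \<theta>\<^sub>0 :: "(real \<Rightarrow> ennreal) \<Rightarrow> ereal" where
  "\<theta>\<^sub>0 \<Phi> = (SUP \<theta>\<in>{\<theta>. \<Phi> \<theta> < \<infinity>}. ereal \<theta>)"

definition \<theta>\<^sub>1 :: "(real \<Rightarrow> ennreal) \<Rightarrow> ereal" where
  "\<theta>\<^sub>1 \<Phi> = (INF \<theta>\<in>{\<theta>. \<Phi> \<theta> < \<infinity>}. ereal \<theta>)"

text \<open>For \<open>\<Phi> 0 = 1\<close> one has \<open>\<Psi> \<Phi> \<ge> 0\<close> and \<open>\<theta>\<^sub>1 \<Phi> \<le> 0 \<le> \<theta>\<^sub>0 \<Phi>\<close>, so that \<^const>\<open>e2ennreal\<close>
  loses nothing below.\<close>

definition rate_I :: "(real \<Rightarrow> ennreal) \<Rightarrow> (real \<Rightarrow> real) \<Rightarrow> ennreal" where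
  "rate_I \<Phi> f =
     (if abs_continuous01 f \<and> f 0 = 0
      then \<integral>\<^sup>+s\<in>{0..1}. e2ennreal (\<Psi> \<Phi> (deriv f s)) \<partial>lborel else \<infinity>)"

text \<open>\<open>jordan_measures f\<close> is the Hahn--Jordan decomposition \<open>(df\<^sub>+, df\<^sub>-)\<close> of the signed measure
  \<open>df\<close> on [0,1]; measures on [0,1] are represented by Borel measures on the real line that do
  not charge the complement. As f need not be right-continuous, \<open>df\<close> is given by
  \<open>df[0,t] = f(t+)\<close> for \<open>t < 1\<close> and \<open>df[0,1] = f(1)\<close>. Thus \<open>df\<close> may have an atom at 0.\<close>

definition jordan_measures :: "(real \<Rightarrow> real) \<Rightarrow> real measure \<times> real measure" where
  "jordan_measures f = (THE (P, N).
     sets P = sets borel \<and> sets N = sets borel \<and>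
     finite_measure P \<and> finite_measure N \<and>
     emeasure P (- {0..1}) = 0 \<and> emeasure N (- {0..1}) = 0 \<and>
     (\<exists>H\<in>sets borel. emeasure P (- H) = 0 \<and> emeasure N H = 0) \<and>
     (\<forall>t\<in>{0..<1}. (f \<longlongrightarrow> measure P {0..t} - measure N {0..t}) (at_right t)) \<and>
     f 1 = measure P {0..1} - measure N {0..1})"

definition lebesgue_decomposition :: "real measure \<Rightarrow> real measure \<times> real measure" where
  "lebesgue_decomposition m = (THE (A, S).
     sets A = sets borel \<and> sets S = sets borel \<and>
     (\<forall>B\<in>sets borel. emeasure m B = emeasure A B + emeasure S B) \<and>
     absolutely_continuous lborel A \<and>
     (\<exists>H\<in>null_sets lborel. emeasure S (- H) = 0))"

text \<open>The absolutely continuous (singular) part of \<open>df\<close> is the difference of those of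
  \<open>df\<^sub>+\<close> and \<open>df\<^sub>-\<close>.\<close>

definition ac_part :: "(real \<Rightarrow> real) \<Rightarrow> real \<Rightarrow> real" where
  "ac_part f t =
     (let (P, N) = jordan_measures f in
        measure (fst (lebesgue_decomposition P)) {0..t}
        - measure (fst (lebesgue_decomposition N)) {0..t})"

definition sing_pos_mass :: "(real \<Rightarrow> real) \<Rightarrow> ennreal" where
  "sing_pos_mass f = emeasure (snd (lebesgue_decomposition (fst (jordan_measures f)))) {0..1}"

definition sing_neg_mass :: "(real \<Rightarrow> real) \<Rightarrow> ennreal" where
  "sing_neg_mass f = emeasure (snd (lebesgue_decomposition (snd (jordan_measures f)))) {0..1}"

definition rate_J :: "(real \<Rightarrow> ennreal) \<Rightarrow> (real \<Rightarrow> real) \<Rightarrow> ennreal" where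
  "rate_J \<Phi> f =
     (\<integral>\<^sup>+s\<in>{0..1}. e2ennreal (\<Psi> \<Phi> (deriv (ac_part f) s)) \<partial>lborel)
     + e2ennreal (\<theta>\<^sub>0 \<Phi>) * sing_pos_mass f + e2ennreal (- \<theta>\<^sub>1 \<Phi>) * sing_neg_mass f"

definition K_set :: "(real \<Rightarrow> ennreal) \<Rightarrow> real \<Rightarrow> (real \<Rightarrow> real) set" where
  "K_set \<Phi> \<alpha> = {f \<in> D01. rate_I \<Phi> f \<le> ennreal \<alpha>}"

definition L_set :: "(real \<Rightarrow> ennreal) \<Rightarrow> real \<Rightarrow> (real \<Rightarrow> real) set" where
  "L_set \<Phi> \<alpha> = {f \<in> BV0. rate_J \<Phi> f \<le> ennreal \<alpha>}"

definition add_drift :: "(real \<Rightarrow> real) set \<Rightarrow> real \<Rightarrow> (real \<Rightarrow> real) set" where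
  "add_drift K \<mu> = (\<lambda>f s. f s + \<mu> * s) ` K"

end

theory Submission
  imports Defs "HOL-Real_Asymp.Real_Asymp"
begin

text \<open>Fix \<open>\<alpha> = 1 / c\<close> and subtract the drift, so that the increments \<open>X\<^sub>j\<close> of the centred process
  over unit intervals are independent, identically distributed and of mean 0. Cut a window of
  length A into m blocks. The exponential moments of the oscillations over unit intervals
  (Ottaviani's inequality) show that the increment function is close to the polygon through its
  block increments, except with probability \<open>exp (- A (\<alpha> + 1))\<close>. The rate of a polygon is the
  discretised rate of its increments. Round the increments to a grid: the finitely many vectors
  of rate above \<open>\<alpha>\<close> are excluded by Chernoff's bound, while a vector of rate below \<open>\<alpha>\<close> is hit in
  one of about \<open>exp (A \<alpha>) / A\<close> disjoint windows by Cramer's lower bound. As the number of windows depends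
  on n only through \<open>exp (A \<alpha>) \<le> n \<le> exp ((A + 1) \<alpha>)\<close>, the Borel--Cantelli lemma is applied along the
  values A of \<open>A_seq c n\<close>.

  Conversely, by convexity the polygon through points of f has at most the rate of f, where the
  singular mass of f is charged at the extreme slopes \<open>\<theta>\<^sub>0\<close> and \<open>\<theta>\<^sub>1\<close>, and a bound on the rate makes
  f uniformly close to such polygons.

  In part (ii) the characteristic function of \<open>Z(1 / N)\<close> is \<open>exp (\<psi> / N)\<close>, and
  \<open>\<Sum>j. (1 - cos (2^j x)) / 2^j\<close> is comparable to \<open>min \<bar>x\<bar> 1\<close>. Hence the sums of the small dyadic
  increments are bounded in mean uniformly in the mesh, and the paths have bounded variation.\<close>

text \<open>Two obstacles shape the argument. First, \<open>\<Phi>\<^sub>c\<close> may be infinite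
  away from 0 and an optimal exponent need not exist; the lower bound therefore tilts truncated
  variables, and a compactness argument over the truncation level shows that almost nothing is lost.
  Second, with exponential moments only near 0 a single block may oscillate by a multiple of A at a
  finite exponential cost, so uniform closeness to polygons can fail. But the integral in
  \<open>d_hyb\<close> averages over m blocks, which divides the total oscillation by m, and the
  endpoint is met exactly. When all moments are finite, such a block costs arbitrarily much, and
  closeness is uniform. Centring enters through Jensen's inequality: \<open>\<Phi>\<^sub>c\<close>
  is at least 1, so its logarithm is nonnegative and \<open>psi\<close> grows with the distance from
  0. Hence rounding towards 0 and multiplication by \<open>1 - k\<close> never raise a rate, and the
  factor leaves a margin \<open>k * \<alpha>\<close> by which the number of disjoint windows beats
  the inverse probability of a hit. The exponent \<open>\<alpha> + 1\<close> of the exceptional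
  events beats the number of window positions by a factor of order \<open>exp (- A)\<close>.\<close>

section \<open>Lebesgue differentiation\<close>

text \<open>The cited theorem treats averages over intervals to the right of a point. Applied to h
  and to its reflection it yields both one-sided derivatives, and \<open>a < t\<close> leaves room
  on the left.\<close>

lemma lebesgue_differentiation:
  fixes h :: "real \<Rightarrow> real"
  assumes h: "integrable lborel h"
  shows "AE t in lborel. \<forall>a<t. ((\<lambda>t. LBINT u:{a..t}. h u) has_real_derivative h t) (at t)"
proof -
  have si: "set_integrable lborel {a..b} h" for a b :: real
    by (rule set_integrable_subset[of _ UNIV]) (use h in \<open>auto simp: set_integrable_def\<close>)
  have int: "h integrable_on {a..b}" for a b
    by (rule set_borel_integral_eq_integral[OF si])
  have int': "(\<lambda>x. h (- x)) integrable_on {a..b}" for a b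
    using int[of "- b" "- a"] Henstock_Kurzweil_Integration.integrable_reflect_real[where f=h and a="- b" and b="- a"] by simp
  obtain N1 where N1: "negligible N1"
    "\<And>x e. \<lbrakk>x \<notin> N1; 0 < e\<rbrakk> \<Longrightarrow> \<exists>d>0. \<forall>k. 0 < k \<and> k < d \<longrightarrow>
        norm (integral {x..x + k} h /\<^sub>R k - h x) < e"
    using integrable_ccontinuous_explicit[of h] int by (auto simp: cbox_interval)
  obtain N2 where N2: "negligible N2"
    "\<And>x e. \<lbrakk>x \<notin> N2; 0 < e\<rbrakk> \<Longrightarrow> \<exists>d>0. \<forall>k. 0 < k \<and> k < d \<longrightarrow>
        norm (integral {x..x + k} (\<lambda>x. h (- x)) /\<^sub>R k - h (- x)) < e"
    using integrable_ccontinuous_explicit[of "\<lambda>x. h (- x)"] int' by (auto simp: cbox_interval)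
  have neg: "negligible (N1 \<union> uminus ` N2)"
    using N1(1) negligible_differentiable_image_negligible[OF _ N2(1), of uminus]
    by (intro negligible_Un) (auto intro: differentiable_on_minus)
  have main: "((\<lambda>t. LBINT u:{a..t}. h u) has_real_derivative h t) (at t)"
    if t: "t \<notin> N1 \<union> uminus ` N2" and a: "a < t" for t a
  proof -
    let ?F = "\<lambda>t. LBINT u:{a..t}. h u"
    have F: "?F t = integral {a..t} h" for t
      by (rule set_borel_integral_eq_integral(2)[OF si])
    have diff: "?F y - ?F x = integral {x..y} h" if "a \<le> x" "x \<le> y" for x y
      using Henstock_Kurzweil_Integration.integral_combine[OF that int] by (simp add: F)
    have t1: "t \<notin> N1" using t by auto
    have t2: "- t \<notin> N2" using t by (auto simp: image_iff)
    have R: "((\<lambda>y. (?F y - ?F t) / (y - t)) \<longlongrightarrow> h t) (at_right t)"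
    proof (rule tendstoI)
      fix e :: real assume "e > 0"
      then obtain d where d: "d > 0" "\<And>k. 0 < k \<Longrightarrow> k < d \<Longrightarrow>
        norm (integral {t..t + k} h /\<^sub>R k - h t) < e" using N1(2)[OF t1] by blast
      show "\<forall>\<^sub>F y in at_right t. dist ((?F y - ?F t) / (y - t)) (h t) < e"
        unfolding eventually_at_right_field
      proof (intro exI[of _ "t + d"] conjI allI impI)
        fix y assume y: "t < y" "y < t + d"
        show "dist ((?F y - ?F t) / (y - t)) (h t) < e"
          using d(2)[of "y - t"] y a diff[of t y] by (simp add: dist_norm divide_inverse mult.commute)
      qed (use \<open>d > 0\<close> in auto)
    qed
    have L: "((\<lambda>y. (?F y - ?F t) / (y - t)) \<longlongrightarrow> h t) (at_left t)"
    proof (rule tendstoI)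
      fix e :: real assume "e > 0"
      then obtain d where d: "d > 0" "\<And>k. 0 < k \<Longrightarrow> k < d \<Longrightarrow>
        norm (integral {- t..- t + k} (\<lambda>x. h (- x)) /\<^sub>R k - h t) < e"
        using N2(2)[OF t2, of e] unfolding minus_minus by blast
      show "\<forall>\<^sub>F y in at_left t. dist ((?F y - ?F t) / (y - t)) (h t) < e"
        unfolding eventually_at_left_field
      proof (intro exI[of _ "max a (t - d)"] conjI allI impI)
        fix y assume y: "max a (t - d) < y" "y < t"
        have "integral {- t..- y} (\<lambda>x. h (- x)) = integral {y..t} h"
          using Henstock_Kurzweil_Integration.integral_reflect_real[where f=h and a=y and b=t] by simp
        moreover have "(?F y - ?F t) / (y - t) = (?F t - ?F y) / (t - y)"
          by (metis minus_diff_eq minus_divide_divide)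
        ultimately show "dist ((?F y - ?F t) / (y - t)) (h t) < e"
          using d(2)[of "t - y"] y a diff[of y t] by (simp add: dist_norm divide_inverse mult.commute)
      qed (use \<open>d > 0\<close> a in auto)
    qed
    show ?thesis
      unfolding has_field_derivative_iff using L R by (simp add: filterlim_at_split)
  qed
  have "N1 \<union> uminus ` N2 \<in> null_sets lebesgue"
    using neg by (simp add: negligible_iff_null_sets)
  then have "AE t in lebesgue. t \<notin> N1 \<union> uminus ` N2"
    by (rule AE_not_in)
  then have "AE t in lborel. t \<notin> N1 \<union> uminus ` N2"
    by (simp add: AE_completion_iff)
  then show ?thesis
    by eventually_elim (use main in blast)
qed

subsection \<open>Lebesgue decomposition\<close>

lemma emeasure_Int_Diff:
  assumes "B \<in> sets m" "K \<in> sets m"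
  shows "emeasure m B = emeasure m (B \<inter> K) + emeasure m (B - K)"
proof -
  have "emeasure m (B \<inter> K) + emeasure m (B - K) = emeasure m (B \<inter> K \<union> (B - K))"
    using assms by (intro plus_emeasure) auto
  then show ?thesis by (simp add: Int_Diff_Un)
qed

text \<open>Exhaustion: H is the union of a sequence of null sets along which m approaches its
  supremum over null sets. A null set with mass outside H could be added to H and would exceed that
  supremum, as m is finite.\<close>

lemma lebesgue_decomposition_exists:
  fixes m :: "real measure"
  assumes m: "finite_measure m" "sets m = sets borel"
  obtains H where "H \<in> null_sets lborel"
    "\<And>B. B \<in> null_sets lborel \<Longrightarrow> emeasure m (B - H) = 0"
proof -
  interpret finite_measure m by fact
  have mb: "\<And>B. B \<in> null_sets lborel \<Longrightarrow> B \<in> sets m" using m(2) null_setsD2 sets_lborel by blast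
  define s where "s = (SUP B\<in>null_sets lborel. emeasure m B)"
  have "emeasure m ` null_sets lborel \<noteq> {}" by auto
  then obtain f :: "nat \<Rightarrow> ennreal" where f: "range f \<subseteq> emeasure m ` null_sets lborel" "s = Sup (range f)"
    unfolding s_def using ennreal_Sup_countable_SUP by metis
  then have "\<forall>n. \<exists>B. B \<in> null_sets lborel \<and> f n = emeasure m B" by auto
  then obtain B where B: "\<And>n. B n \<in> null_sets lborel" "\<And>n. f n = emeasure m (B n)" by metis
  define H where "H = (\<Union>n. B n)"
  have H: "H \<in> null_sets lborel" using B unfolding H_def by auto
  have "s \<le> emeasure m H"
    unfolding f(2) by (rule SUP_least) (auto simp: B(2) H_def intro!: emeasure_mono mb[OF H, unfolded H_def])
  have "emeasure m (C - H) = 0" if C: "C \<in> null_sets lborel" for C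
  proof -
    have CH: "C - H \<in> sets m" using mb[OF C] mb[OF H] by auto
    have "emeasure m H + emeasure m (C - H) = emeasure m (H \<union> C)"
      using plus_emeasure[OF mb[OF H] CH] by (simp add: Un_Diff_cancel)
    also have "\<dots> \<le> s" unfolding s_def using H C by (intro SUP_upper) auto
    also have "\<dots> \<le> emeasure m H" by fact
    finally have "emeasure m H + emeasure m (C - H) \<le> emeasure m H + 0" by simp
    then show ?thesis using emeasure_finite[of H]
      by (metis ennreal_add_left_cancel_le le_zero_eq infinity_ennreal_def)
  qed
  with H that show ?thesis by blast
qed

text \<open>On \<open>K = H \<union> H'\<close>, a null set, both absolutely continuous parts
  vanish; off K both singular parts vanish. So \<open>eq\<close> separates into one equation for
  each part.\<close>

lemma lebesgue_decomposition_unique: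
  fixes A S A' S' :: "real measure"
  assumes "sets A = sets borel" "sets S = sets borel" "sets A' = sets borel" "sets S' = sets borel"
    and eq: "\<And>B. B \<in> sets borel \<Longrightarrow> emeasure A B + emeasure S B = emeasure A' B + emeasure S' B"
    and ac: "absolutely_continuous lborel A" "absolutely_continuous lborel A'"
    and H: "H \<in> null_sets lborel" "emeasure S (- H) = 0" and H': "H' \<in> null_sets lborel" "emeasure S' (- H') = 0"
  shows "A = A' \<and> S = S'"
proof -
  have null: "emeasure A B = 0" "emeasure A' B = 0" if "B \<in> null_sets lborel" for B
    using ac that by (auto simp: absolutely_continuous_def)
  have [measurable]: "H \<in> sets borel" "H' \<in> sets borel" using H H' by auto
  define K where "K = H \<union> H'"
  have K: "K \<in> null_sets lborel" and [measurable]: "K \<in> sets borel" using H H' by (auto simp: K_def)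
  have SK: "emeasure S (B - K) = 0" "emeasure S' (B - K) = 0" if [measurable]: "B \<in> sets borel" for B
    using emeasure_mono[of "B - K" "- H" S] emeasure_mono[of "B - K" "- H'" S'] H H' assms(1-4)
    by (auto simp: K_def)
  have split: "emeasure m B = emeasure m (B \<inter> K) + emeasure m (B - K)"
    if "B \<in> sets borel" "sets m = sets borel" for m :: "real measure" and B :: "real set"
    by (rule emeasure_Int_Diff) (use that in simp_all)
  have BK: "B \<inter> K \<in> null_sets lborel" if "B \<in> sets borel" for B
    using K that by (intro null_set_Int1[of K, simplified Int_commute[of K]]) auto
  have S: "emeasure S B = emeasure S' B" if B[measurable]: "B \<in> sets borel" for B
    using eq[of "B \<inter> K"] null[OF BK[OF B]] SK[OF B] split[OF B] assms(1-4) by auto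
  have A: "emeasure A B = emeasure A' B" if B[measurable]: "B \<in> sets borel" for B
    using eq[of "B - K"] null[OF BK[OF B]] SK[OF B] split[OF B] assms(1-4) by auto
  show ?thesis
    using measure_eqI[of A A'] measure_eqI[of S S'] S A by (simp add: assms(1-4))
qed

text \<open>The decomposition of m along a Lebesgue-null set that is maximal for m.\<close>

lemma lebesgue_decomposition_eq:
  assumes "finite_measure m" "sets m = sets borel"
    and H: "H \<in> null_sets lborel" "\<And>B. B \<in> null_sets lborel \<Longrightarrow> emeasure m (B - H) = 0"
  shows "lebesgue_decomposition m = (density m (indicator (- H)), density m (indicator H))"
proof -
  have [measurable_cong, simp]: "sets m = sets borel" by fact
  have [simp]: "space m = UNIV" using sets_eq_imp_space_eq[OF assms(2)] by simp
  have [measurable]: "H \<in> sets borel" using H(1) by auto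
  have e: "emeasure (density m (indicator (- H))) B = emeasure m (B - H)"
    "emeasure (density m (indicator H)) B = emeasure m (B \<inter> H)" if [measurable]: "B \<in> sets borel" for B
    by (simp_all add: emeasure_density Diff_eq Int_commute
        flip: indicator_inter_arith)
  have ac: "absolutely_continuous lborel (density m (indicator (- H)))"
    unfolding absolutely_continuous_def
  proof
    fix B :: "real set" assume B: "B \<in> null_sets lborel"
    then show "B \<in> null_sets (density m (indicator (- H)))"
      using H(2)[OF B] by (intro null_setsI) (auto simp: e)
  qed
  let ?P = "\<lambda>(A, S). sets A = sets borel \<and> sets S = sets borel \<and>
     (\<forall>B\<in>sets borel. emeasure m B = emeasure A B + emeasure S B) \<and>
     absolutely_continuous lborel A \<and> (\<exists>H\<in>null_sets lborel. emeasure S (- H) = 0)"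
  have sum: "emeasure m B = emeasure (density m (indicator (- H))) B + emeasure (density m (indicator H)) B"
    if [measurable]: "B \<in> sets borel" for B
    using emeasure_Int_Diff[of B m H] by (simp add: e add.commute)
  have SH: "emeasure (density m (indicator H)) (- H) = 0" by (simp add: e)
  have P: "?P (density m (indicator (- H)), density m (indicator H))"
    unfolding prod.case
  proof (intro conjI ballI)
    show "\<exists>H'\<in>null_sets lborel. emeasure (density m (indicator H)) (- H') = 0"
      using SH H(1) by blast
  qed (use sum ac in simp_all)
  show ?thesis
    unfolding lebesgue_decomposition_def
  proof (rule the_equality[of ?P, OF P])
    fix q assume q: "?P q"
    obtain A S where [simp]: "q = (A, S)" by (cases q)
    from q obtain H' where H': "H' \<in> null_sets lborel" "emeasure S (- H') = 0" by auto
    have eq: "emeasure A B + emeasure S B =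
        emeasure (density m (indicator (- H))) B + emeasure (density m (indicator H)) B"
      if "B \<in> sets borel" for B
      using q sum[OF that] that by simp
    have "A = density m (indicator (- H)) \<and> S = density m (indicator H)"
      by (rule lebesgue_decomposition_unique[OF _ _ _ _ eq _ ac H' H(1) SH]) (use q in simp_all)
    then show "q = (density m (indicator (- H)), density m (indicator H))" by simp
  qed
qed

subsection \<open>The measure of a function of bounded variation\<close>

text \<open>The predicate inside the definite description of \<open>jordan_measures\<close>, named
  so that existence and uniqueness can be proved separately.\<close>

definition jordan_pair :: "(real \<Rightarrow> real) \<Rightarrow> real measure \<Rightarrow> real measure \<Rightarrow> bool" where
  "jordan_pair f P N \<longleftrightarrow>
     sets P = sets borel \<and> sets N = sets borel \<and>
     finite_measure P \<and> finite_measure N \<and>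
     emeasure P (- {0..1}) = 0 \<and> emeasure N (- {0..1}) = 0 \<and>
     (\<exists>H\<in>sets borel. emeasure P (- H) = 0 \<and> emeasure N H = 0) \<and>
     (\<forall>t\<in>{0..<1}. (f \<longlongrightarrow> measure P {0..t} - measure N {0..t}) (at_right t)) \<and>
     f 1 = measure P {0..1} - measure N {0..1}"

text \<open>Identities between differences of measures are turned into identities between sums, to
  which the uniqueness theorem for finite measures applies.\<close>

lemma ex_sum_measure:
  fixes P N :: "real measure"
  assumes "sets P = sets borel" "sets N = sets borel"
  obtains S where "sets S = sets borel"
    "\<And>B. B \<in> sets borel \<Longrightarrow> emeasure S B = emeasure P B + emeasure N B"
proof
  define S where "S = measure_of UNIV (sets borel) (\<lambda>B. emeasure P B + emeasure N B)"
  show "sets S = sets borel" by (simp add: S_def sets.sigma_sets_eq[of borel, simplified])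
  fix B :: "real set" assume B: "B \<in> sets borel"
  show "emeasure S B = emeasure P B + emeasure N B"
    unfolding S_def
  proof (rule emeasure_measure_of_sigma)
    show "sigma_algebra UNIV (sets borel :: real set set)"
      using sets.sigma_algebra_axioms[of borel] by simp
    show "positive (sets borel) (\<lambda>B. emeasure P B + emeasure N B)"
      by (simp add: positive_def)
    show "countably_additive (sets borel) (\<lambda>B. emeasure P B + emeasure N B)"
      unfolding countably_additive_def
    proof (intro allI impI)
      fix A :: "nat \<Rightarrow> real set"
      assume A: "range A \<subseteq> sets borel" "disjoint_family A"
      have "(\<Sum>i. emeasure P (A i) + emeasure N (A i)) = (\<Sum>i. emeasure P (A i)) + (\<Sum>i. emeasure N (A i))"
        by (intro suminf_add[symmetric]) auto
      also have "\<dots> = emeasure P (\<Union>i. A i) + emeasure N (\<Union>i. A i)"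
        using A assms by (simp add: suminf_emeasure)
      finally show "(\<Sum>i. emeasure P (A i) + emeasure N (A i)) = emeasure P (\<Union>i. A i) + emeasure N (\<Union>i. A i)" .
    qed
  qed (use B in simp)
qed

lemma measure_atMost_01:
  fixes P :: "real measure"
  assumes "sets P = sets borel" "emeasure P (- {0..1}) = 0"
  shows "emeasure P {..t} = emeasure P {0..min t 1}"
proof (rule emeasure_eq_AE)
  have "AE x in P. x \<notin> - {0..1}"
    using assms by (intro AE_not_in) (auto simp: null_sets_def)
  then show "AE x in P. (x \<in> {..t}) = (x \<in> {0..min t 1})"
    by eventually_elim auto
qed (simp_all add: assms)

lemma measures_eq_01:
  fixes P N :: "real measure"
  assumes "sets P = sets borel" "sets N = sets borel" "finite_measure P" "finite_measure N"
    and "emeasure P (- {0..1}) = 0" "emeasure N (- {0..1}) = 0"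
    and eq: "\<And>t. t \<in> {0..1} \<Longrightarrow> measure P {0..t} = measure N {0..t}"
  shows "P = N"
proof (rule cdf_unique')
  show "finite_borel_measure P" "finite_borel_measure N"
    using assms by (auto simp: finite_borel_measure_def finite_borel_measure_axioms_def)
  show "cdf P = cdf N"
  proof
    fix t
    have "measure P {0..min t 1} = measure N {0..min t 1}"
      using eq[of "min t 1"] by (cases "t < 0") auto
    then show "cdf P t = cdf N t"
      using measure_atMost_01[of P t] measure_atMost_01[of N t] assms(1-6)
      by (simp add: cdf_def measure_def)
  qed
qed

text \<open>Both differences have the same values on the intervals [0, t], hence
  \<open>P + N' = P' + N\<close> as measures. On a set that carries P and is null for N this gives P
  \<le> P'; exchanging the pairs gives equality, and then P can be cancelled.\<close>

lemma jordan_pair_unique: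
  assumes "jordan_pair f P N" "jordan_pair f P' N'"
  shows "P = P' \<and> N = N'"
proof -
  have s [measurable_cong]: "sets P = sets borel" "sets N = sets borel" "sets P' = sets borel" "sets N' = sets borel"
    and fin: "finite_measure P" "finite_measure N" "finite_measure P'" "finite_measure N'"
    and o: "emeasure P (- {0..1}) = 0" "emeasure N (- {0..1}) = 0"
      "emeasure P' (- {0..1}) = 0" "emeasure N' (- {0..1}) = 0"
    using assms unfolding jordan_pair_def by blast+
  have sing: "\<exists>H\<in>sets borel. emeasure P (- H) = 0 \<and> emeasure N H = 0"
    "\<exists>H\<in>sets borel. emeasure P' (- H) = 0 \<and> emeasure N' H = 0"
    using assms unfolding jordan_pair_def by blast+
  have R: "\<forall>t\<in>{0..<1}. (f \<longlongrightarrow> measure P {0..t} - measure N {0..t}) (at_right t)"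
    "\<forall>t\<in>{0..<1}. (f \<longlongrightarrow> measure P' {0..t} - measure N' {0..t}) (at_right t)"
    and f1: "f 1 = measure P {0..1} - measure N {0..1}" "f 1 = measure P' {0..1} - measure N' {0..1}"
    using assms unfolding jordan_pair_def by blast+
  \<comment> \<open>Below 1 both differences are the right limit of f; at 1 they are the value of f
    itself.\<close>
  have eq: "measure P {0..t} - measure N {0..t} = measure P' {0..t} - measure N' {0..t}"
    if "t \<in> {0..1}" for t
  proof (cases "t = 1")
    case False
    with that have "(f \<longlongrightarrow> measure P {0..t} - measure N {0..t}) (at_right t)"
      "(f \<longlongrightarrow> measure P' {0..t} - measure N' {0..t}) (at_right t)"
      using R by auto
    then show ?thesis by (rule tendsto_unique[rotated]) simp
  next
    case True
    then show ?thesis using f1 by simp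
  qed
  obtain S where S: "sets S = sets borel" "\<And>B. B \<in> sets borel \<Longrightarrow> emeasure S B = emeasure P B + emeasure N' B"
    using ex_sum_measure[OF s(1,4)] by blast
  obtain S' where S': "sets S' = sets borel" "\<And>B. B \<in> sets borel \<Longrightarrow> emeasure S' B = emeasure P' B + emeasure N B"
    using ex_sum_measure[OF s(3,2)] by blast
  have fS: "finite_measure S" "finite_measure S'"
    using fin sets_eq_imp_space_eq[OF S(1)] sets_eq_imp_space_eq[OF S'(1)]
    by (auto intro!: finite_measureI simp: finite_measure.emeasure_finite S(2) S'(2))
  have m: "measure m B + measure m' B = measure mm B"
    if "finite_measure m" "finite_measure m'" "emeasure mm B = emeasure m B + emeasure m' B"
    for m m' mm :: "real measure" and B
    using that by (simp add: measure_def[of mm] finite_measure.emeasure_eq_measure flip: ennreal_plus)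
  have "S = S'"
  proof (rule measures_eq_01[OF S(1) S'(1) fS])
    fix t :: real assume t: "t \<in> {0..1}"
    show "measure S {0..t} = measure S' {0..t}"
      using eq[OF t] m[OF fin(1,4), of S "{0..t}"] m[OF fin(3,2), of S' "{0..t}"] S(2) S'(2) by simp
  qed (use S(2) S'(2) o in simp_all)
  then have E: "emeasure P B + emeasure N' B = emeasure P' B + emeasure N B" if "B \<in> sets borel" for B
    using S(2)[OF that] S'(2)[OF that] by simp
  have le: "emeasure P B \<le> emeasure P' B"
    if sing: "\<exists>H\<in>sets borel. emeasure P (- H) = 0 \<and> emeasure N H = 0"
      and eq: "\<And>B. B \<in> sets borel \<Longrightarrow> emeasure P B + emeasure N' B = emeasure P' B + emeasure N B"
      and s: "sets P = sets borel" "sets N = sets borel" "sets P' = sets borel" and B: "B \<in> sets borel"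
    for P N P' N' :: "real measure" and B
  proof -
    obtain H where H: "H \<in> sets borel" "emeasure P (- H) = 0" "emeasure N H = 0" using sing by blast
    have "AE x in P. x \<notin> - H" using H by (intro AE_not_in) (simp add: null_sets_def s)
    then have "emeasure P B = emeasure P (B \<inter> H)"
      by (intro emeasure_eq_AE) (use H(1) B s in auto)
    also have "\<dots> \<le> emeasure P (B \<inter> H) + emeasure N' (B \<inter> H)" by simp
    also have "\<dots> = emeasure P' (B \<inter> H) + emeasure N (B \<inter> H)"
      by (rule eq) (use H(1) B in auto)
    also have "emeasure N (B \<inter> H) = 0"
      using emeasure_mono[of "B \<inter> H" H N] H by (simp add: s)
    also have "emeasure P' (B \<inter> H) + 0 \<le> emeasure P' B"
      using s B by (auto intro!: emeasure_mono)
    finally show ?thesis .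
  qed
  have PP: "P = P'"
  proof (rule measure_eqI)
    fix B assume "B \<in> sets P"
    then have B: "B \<in> sets borel" by (simp add: s)
    have "emeasure P B \<le> emeasure P' B"
      by (rule le[OF sing(1) E s(1,2,3) B])
    moreover have "emeasure P' B \<le> emeasure P B"
      by (rule le[OF sing(2) E[symmetric] s(3,4,1) B])
    ultimately show "emeasure P B = emeasure P' B" by simp
  qed (simp add: s)
  moreover have "N = N'"
  proof (rule measure_eqI)
    fix B assume "B \<in> sets N"
    then have "emeasure P B + emeasure N' B = emeasure P B + emeasure N B"
      using E[of B] PP by (simp add: s)
    then show "emeasure N B = emeasure N' B"
      using finite_measure.emeasure_finite[OF fin(1), of B] by (simp add: ennreal_add_left_cancel)
  qed (simp add: s)
  ultimately show ?thesis by simp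
qed

lemma jordan_measures_eq:
  assumes "jordan_pair f P N"
  shows "jordan_measures f = (P, N)"
proof -
  have "jordan_measures f = (THE (P, N). jordan_pair f P N)"
    unfolding jordan_measures_def jordan_pair_def ..
  also have "\<dots> = (P, N)"
  proof (rule the_equality)
    show "case (P, N) of (P, N) \<Rightarrow> jordan_pair f P N" using assms by simp
  next
    fix q assume "case q of (P, N) \<Rightarrow> jordan_pair f P N"
    then show "q = (P, N)" using jordan_pair_unique[OF assms, of "fst q" "snd q"] by (cases q) simp
  qed
  finally show ?thesis .
qed

text \<open>G is the right-continuous modification of k, as needed for a Stieltjes measure.\<close>

lemma mono_right_limit:
  fixes k :: "real \<Rightarrow> real"
  assumes k: "mono k"
  defines "G \<equiv> \<lambda>x. INF y\<in>{x<..}. k y"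
  shows "mono G" "(k \<longlongrightarrow> G x) (at_right x)" "continuous (at_right x) G"
    "\<And>x y. x < y \<Longrightarrow> G x \<le> k y" "\<And>x. k x \<le> G x"
proof -
  have bdd: "bdd_below (k ` {x<..})" for x
    by (rule bdd_belowI2[of _ "k x"]) (simp add: monoD[OF k])
  show up: "\<And>x y. x < y \<Longrightarrow> G x \<le> k y"
    unfolding G_def by (rule cINF_lower[OF bdd]) auto
  show lo: "\<And>x. k x \<le> G x"
    unfolding G_def by (rule cINF_greatest) (simp_all add: monoD[OF k])
  show mono: "mono G"
  proof
    fix x y :: real assume "x \<le> y"
    show "G x \<le> G y" unfolding G_def[of ]
      by (rule cINF_superset_mono[OF _ bdd]) (use \<open>x \<le> y\<close> in auto)
  qed
  have close: "\<exists>y>x. \<forall>z. x < z \<and> z < y \<longrightarrow> k z < G x + e" if "e > 0" for x e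
  proof -
    have "\<exists>y\<in>{x<..}. k y < G x + e"
      using cINF_less_iff[OF _ bdd, of x "G x + e"] that by (simp add: G_def)
    then obtain y where y: "y > x" "k y < G x + e" by auto
    have "k z < G x + e" if "z < y" for z
      using monoD[OF k, of z y] y that by simp
    with y show ?thesis by blast
  qed
  show "(k \<longlongrightarrow> G x) (at_right x)" for x
  proof (rule tendstoI)
    fix e :: real assume "e > 0"
    from close[OF this, of x] obtain y where y: "y > x" "\<And>z. x < z \<Longrightarrow> z < y \<Longrightarrow> k z < G x + e" by blast
    show "\<forall>\<^sub>F z in at_right x. dist (k z) (G x) < e"
      unfolding eventually_at_right_field
    proof (intro exI[of _ y] conjI allI impI)
      fix z assume "x < z" "z < y"
      then show "dist (k z) (G x) < e"
        using y(2)[of z] up[of x z] \<open>e > 0\<close> by (auto simp: dist_real_def)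
    qed (use y in auto)
  qed
  show "continuous (at_right x) G"
    unfolding continuous_within
  proof (rule tendstoI)
    fix e :: real assume "e > 0"
    from close[OF this, of x] obtain y where y: "y > x" "\<And>z. x < z \<Longrightarrow> z < y \<Longrightarrow> k z < G x + e" by blast
    show "\<forall>\<^sub>F z in at_right x. dist (G z) (G x) < e"
      unfolding eventually_at_right_field
    proof (intro exI[of _ y] conjI allI impI)
      fix z assume z: "x < z" "z < y"
      have "G x \<le> G z" using monoD[OF mono, of x z] z by simp
      \<comment> \<open>\<open>G z\<close> is bounded only by values of k strictly to the right of
        z, so an intermediate point is taken.\<close>
      moreover have "G z \<le> k ((z + y) / 2)" using z by (intro up) auto
      moreover have "k ((z + y) / 2) < G x + e" using z by (intro y) auto
      ultimately show "dist (G z) (G x) < e" by (auto simp: dist_real_def)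
    qed (use y in auto)
  qed
qed

text \<open>\<open>v t\<close> is the variation of f on [0, t]. The single inequality makes both v
  and \<open>v - f\<close> nondecreasing, which is Jordan's decomposition of f.\<close>

lemma bounded_variation01_split:
  assumes "bounded_variation01 f"
  obtains v where "\<And>s t. 0 \<le> s \<Longrightarrow> s \<le> t \<Longrightarrow> t \<le> 1 \<Longrightarrow> v s + \<bar>f t - f s\<bar> \<le> v t"
proof -
  obtain B where B: "\<And>n (u :: nat \<Rightarrow> real). mono u \<Longrightarrow> range u \<subseteq> {0..1} \<Longrightarrow>
        (\<Sum>i<n. \<bar>f (u (Suc i)) - f (u i)\<bar>) \<le> B"
    using assms unfolding bounded_variation01_def by blast
  define S where "S t = {(\<Sum>i<n. \<bar>f (u (Suc i)) - f (u i)\<bar>) | n (u :: nat \<Rightarrow> real). mono u \<and> range u \<subseteq> {0..t}}" for t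
  define v where "v t = Sup (S t)" for t
  have bdd: "bdd_above (S t)" if "t \<le> 1" for t
  proof (rule bdd_aboveI[of _ B])
    fix x assume "x \<in> S t"
    then obtain n u where u: "x = (\<Sum>i<n. \<bar>f (u (Suc i)) - f (u i)\<bar>)" "mono u" "range u \<subseteq> {0..t}"
      unfolding S_def by blast
    have "range u \<subseteq> {0..1}" using u(3) that by fastforce
    then show "x \<le> B" using B[OF u(2)] u(1) by simp
  qed
  have "v s + \<bar>f t - f s\<bar> \<le> v t" if st: "0 \<le> s" "s \<le> t" "t \<le> 1" for s t
  proof -
    have "x \<le> v t - \<bar>f t - f s\<bar>" if xS: "x \<in> S s" for x
    proof -
      obtain n u where u: "x = (\<Sum>i<n. \<bar>f (u (Suc i)) - f (u i)\<bar>)" "mono u" "range u \<subseteq> {0..s}"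
        using xS unfolding S_def by blast
      have us: "u i \<in> {0..s}" for i using range_subsetD[OF u(3)] .
      \<comment> \<open>The partition of [0, s] is continued by s and t and then stays constant,
        since partitions are given by monotone sequences on all natural numbers.\<close>
      define w where "w i = (if i \<le> n then u i else if i = Suc n then s else t)" for i
      have "mono w"
      proof (rule incseq_SucI)
        fix i show "w i \<le> w (Suc i)"
          using us[of i] us[of "Suc i"] st incseq_SucD[OF u(2), of i] by (auto simp: w_def)
      qed
      moreover have "range w \<subseteq> {0..t}"
      proof
        fix x assume "x \<in> range w"
        then obtain i where "x = w i" by blast
        then show "x \<in> {0..t}" using us[of i] st by (auto simp: w_def)
      qed
      ultimately have "(\<Sum>i<Suc (Suc n). \<bar>f (w (Suc i)) - f (w i)\<bar>) \<in> S t"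
        unfolding S_def by blast
      then have "(\<Sum>i<Suc (Suc n). \<bar>f (w (Suc i)) - f (w i)\<bar>) \<le> v t"
        unfolding v_def by (rule cSup_upper) (use bdd st in auto)
      moreover have "(\<Sum>i<Suc (Suc n). \<bar>f (w (Suc i)) - f (w i)\<bar>)
          = (\<Sum>i<n. \<bar>f (u (Suc i)) - f (u i)\<bar>) + \<bar>f s - f (u n)\<bar> + \<bar>f t - f s\<bar>"
        by (simp add: w_def)
      ultimately show ?thesis using u(1) by linarith
    qed
    moreover have "S s \<noteq> {}"
    proof -
      have "mono (\<lambda>i::nat. s)" "range (\<lambda>i::nat. s) \<subseteq> {0..s}" using st by (auto intro: monoI)
      then show ?thesis unfolding S_def by blast
    qed
    ultimately have "v s \<le> v t - \<bar>f t - f s\<bar>" unfolding v_def[of s] by (intro cSup_least) auto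
    then show ?thesis by simp
  qed
  then show ?thesis using that by blast
qed

text \<open>The Stieltjes measure of the right-continuous modification of g, extended by constants
  outside [0,1]. The jump from \<open>g 0\<close> to the right limit becomes an atom at 0, and the
  constant extension beyond 1 makes the total mass \<open>g 1 - g 0\<close>.\<close>

lemma mono_measure_01:
  fixes g :: "real \<Rightarrow> real"
  assumes g: "\<And>s t. 0 \<le> s \<Longrightarrow> s \<le> t \<Longrightarrow> t \<le> 1 \<Longrightarrow> g s \<le> g t"
  obtains P where "sets P = sets borel" "finite_measure P" "emeasure P (- {0..1}) = 0"
    "\<And>t. t \<in> {0..<1} \<Longrightarrow> (g \<longlongrightarrow> g 0 + measure P {0..t}) (at_right t)"
    "g 1 = g 0 + measure P {0..1}"
proof -
  define k where "k x = g (max 0 (min 1 x))" for x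
  have k: "mono k" unfolding k_def by (intro monoI g) auto
  define G where "G x = (INF y\<in>{x<..}. k y)" for x
  note G = mono_right_limit[OF k, folded G_def]
  have G0: "G x = g 0" if "x < 0" for x
    using G(4)[of x 0] G(5)[of x] that by (simp add: k_def)
  have G1: "G x = g 1" if "x \<ge> 1" for x
    using G(4)[of x "x + 1"] G(5)[of x] that by (simp add: k_def)
  have G_le: "G x \<le> G y" if "x \<le> y" for x y using G(1) that by (rule monoD)
  let ?P = "interval_measure G"
  have Ioc: "emeasure ?P {a<..b} = G b - G a" if "a \<le> b" for a b
    by (rule emeasure_interval_measure_Ioc[OF that G_le G(3)])
  have neg: "emeasure ?P {..<0} = 0"
  proof -
    \<comment> \<open>The half-open intervals end strictly below 0, so as not to catch the atom at
      0.\<close>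
    have "{..<0::real} = (\<Union>n. {- real n<..- 1 / real (Suc n)})"
    proof (intro set_eqI iffI)
      fix x :: real assume x: "x \<in> {..<0}"
      obtain m where m: "- x < real m" using reals_Archimedean2 by blast
      obtain p where p: "inverse (real (Suc p)) < - x" using reals_Archimedean[of "- x"] x by auto
      let ?n = "max m p"
      have "inverse (real (Suc ?n)) \<le> inverse (real (Suc p))" by (intro le_imp_inverse_le) auto
      with p have "x \<le> - inverse (real (Suc ?n))" by linarith
      with m have "x \<in> {- real ?n<..- 1 / real (Suc ?n)}" by (auto simp: divide_inverse)
      then show "x \<in> (\<Union>n. {- real n<..- 1 / real (Suc n)})" by blast
    next
      fix x :: real assume "x \<in> (\<Union>n. {- real n<..- 1 / real (Suc n)})"
      then obtain n where "x \<le> - 1 / real (Suc n)" by auto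
      also have "\<dots> < 0" by simp
      finally show "x \<in> {..<0}" by simp
    qed
    moreover have "{- real n<..- 1 / real (Suc n)} \<in> null_sets ?P" for n
      by (cases "n = 0"; cases "- real n \<le> - 1 / real (Suc n)") (auto simp: null_sets_def Ioc G0)
    then have "(\<Union>n. {- real n<..- 1 / real (Suc n)}) \<in> null_sets ?P" by (intro null_sets_UN)
    ultimately show ?thesis by auto
  qed
  have pos: "emeasure ?P {1<..} = 0"
  proof -
    have "{1<..} = (\<Union>n. {1<..real n})"
      using real_arch_simple by (auto simp: order.strict_trans1)
    moreover have "{1<..real n} \<in> null_sets ?P" for n
      by (cases "1 \<le> real n") (auto simp: null_sets_def Ioc G1)
    then have "(\<Union>n. {1<..real n}) \<in> null_sets ?P" by (intro null_sets_UN)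
    ultimately show ?thesis by auto
  qed
  have null: "{..<0} \<in> null_sets ?P" "{1<..} \<in> null_sets ?P" using neg pos by (auto simp: null_sets_def)
  have "- {0..1} = {..<0} \<union> {1::real<..}" by (auto simp: not_le)
  then have out: "- {0..1} \<in> null_sets ?P" using null_sets.Un[OF null] by simp
  have Icc: "emeasure ?P {0..t} = ennreal (G t - g 0)" if "t \<ge> 0" for t
  proof -
    have "AE x in ?P. x \<notin> {..<0}" using null(1) by (rule AE_not_in)
    \<comment> \<open>A half-open interval that contains the atom at 0 is needed; G equals
      \<open>g 0\<close> at -1.\<close>
    then have "emeasure ?P {0..t} = emeasure ?P {-1<..t}"
      by (intro emeasure_eq_AE) (auto elim!: eventually_mono)
    then show ?thesis using that by (simp add: Ioc G0)
  qed
  have fin: "finite_measure ?P"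
  proof (rule finite_measureI)
    have "AE x in ?P. x \<notin> - {0..1}" using out by (rule AE_not_in)
    then have "emeasure ?P (space ?P) = emeasure ?P {0..1}"
      by (intro emeasure_eq_AE) (auto elim!: eventually_mono)
    then show "emeasure ?P (space ?P) \<noteq> \<infinity>" by (simp add: Icc)
  qed
  have G_ge: "g 0 \<le> G t" if "t \<ge> 0" for t using G_le[of "-1" t] G0[of "-1"] that by simp
  have m: "measure ?P {0..t} = G t - g 0" if "t \<ge> 0" for t
    using Icc[OF that] G_ge[OF that] by (simp add: measure_def)
  show thesis
  proof (rule that[of ?P])
    show "emeasure ?P (- {0..1}) = 0" using out by auto
    show "g 1 = g 0 + measure ?P {0..1}" by (simp add: m G1)
    fix t :: real assume t: "t \<in> {0..<1}"
    have "(k \<longlongrightarrow> G t) (at_right t)" by (rule G(2))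
    moreover have "\<forall>\<^sub>F x in at_right t. k x = g x"
      unfolding eventually_at_right_field using t by (intro exI[of _ 1]) (auto simp: k_def)
    ultimately have "(g \<longlongrightarrow> G t) (at_right t)" by (rule Lim_transform_eventually)
    then show "(g \<longlongrightarrow> g 0 + measure ?P {0..t}) (at_right t)" using t by (simp add: m)
  qed (simp_all add: fin)
qed

text \<open>Let a and b be the densities of P' and N' with respect to their sum. Subtraction in
  ennreal truncates at 0, so \<open>a - b\<close> and \<open>b - a\<close> are the positive and the
  negative part of the density of the difference, and \<open>b < a\<close> describes a Hahn
  set.\<close>

lemma hahn_jordan_of_difference:
  fixes P' N' :: "real measure"
  assumes s': "sets P' = sets borel" "sets N' = sets borel"
    and fin: "finite_measure P'" "finite_measure N'"
  obtains P N H where "sets P = sets borel" "sets N = sets borel" "H \<in> sets borel"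
    "emeasure P (- H) = 0" "emeasure N H = 0"
    "\<And>B. B \<in> sets borel \<Longrightarrow> emeasure P B \<le> emeasure P' B"
    "\<And>B. B \<in> sets borel \<Longrightarrow> emeasure N B \<le> emeasure N' B"
    "\<And>B. B \<in> sets borel \<Longrightarrow> emeasure P B + emeasure N' B = emeasure N B + emeasure P' B"
proof -
  obtain Q where Q: "sets Q = sets borel" "\<And>B. B \<in> sets borel \<Longrightarrow> emeasure Q B = emeasure P' B + emeasure N' B"
    using ex_sum_measure[OF s'] by blast
  have [measurable_cong]: "sets Q = sets borel" by (rule Q)
  have sp: "space Q = UNIV" "space P' = UNIV" "space N' = UNIV"
    using sets_eq_imp_space_eq[OF Q(1)] sets_eq_imp_space_eq[OF s'(1)] sets_eq_imp_space_eq[OF s'(2)] by auto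
  interpret Q: finite_measure Q
    by (rule finite_measureI) (use fin in \<open>simp add: Q(2) sp finite_measure.emeasure_finite\<close>)
  have "absolutely_continuous Q P'" "absolutely_continuous Q N'"
    by (auto simp: absolutely_continuous_def null_sets_def Q(1) s' Q(2))
  then obtain a b where a[measurable]: "a \<in> borel_measurable Q" and ad: "density Q a = P'"
    and b[measurable]: "b \<in> borel_measurable Q" and bd: "density Q b = N'"
    using Q.Radon_Nikodym s' Q(1) by metis
  have "(\<integral>\<^sup>+x. a x \<partial>Q) \<noteq> \<infinity>" "(\<integral>\<^sup>+x. b x \<partial>Q) \<noteq> \<infinity>"
    using finite_measure.emeasure_finite[OF fin(1), of UNIV] finite_measure.emeasure_finite[OF fin(2), of UNIV]
    by (simp_all add: ad[symmetric] bd[symmetric] emeasure_density sp)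
  then have "AE x in Q. a x \<noteq> \<infinity>" "AE x in Q. b x \<noteq> \<infinity>"
    using nn_integral_PInf_AE a b by blast+
  \<comment> \<open>Subtraction in ennreal cancels only at finite values.\<close>
  then have f: "AE x in Q. a x < top \<and> b x < top"
    by eventually_elim (auto simp: less_top)
  let ?P = "density Q (\<lambda>x. a x - b x)" and ?N = "density Q (\<lambda>x. b x - a x)"
  define H where "H = {x. b x < a x}"
  have H [measurable]: "H \<in> sets borel"
  proof -
    have "{x\<in>space Q. b x < a x} \<in> sets Q" by measurable
    then show ?thesis by (simp add: sp Q(1) H_def)
  qed
  have sets: "sets ?P = sets borel" "sets ?N = sets borel" by (simp_all add: Q(1))
  show thesis
  proof (rule that[OF sets H])
    show "emeasure ?P (- H) = 0"
    proof -
      have "emeasure ?P (- H) = (\<integral>\<^sup>+x. (a x - b x) * indicator (- H) x \<partial>Q)"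
        by (rule emeasure_density) (auto simp: Q(1))
      also have "\<dots> = (\<integral>\<^sup>+x. 0 \<partial>Q)"
        by (rule nn_integral_cong_AE, use f in eventually_elim)
          (auto simp: indicator_def H_def not_less diff_eq_0_ennreal)
      finally show ?thesis by simp
    qed
    show "emeasure ?N H = 0"
    proof -
      have "emeasure ?N H = (\<integral>\<^sup>+x. (b x - a x) * indicator H x \<partial>Q)"
        by (rule emeasure_density) (auto simp: Q(1))
      also have "\<dots> = (\<integral>\<^sup>+x. 0 \<partial>Q)"
        by (rule nn_integral_cong_AE, use f in eventually_elim)
          (auto simp: indicator_def H_def not_less diff_eq_0_ennreal)
      finally show ?thesis by simp
    qed
    fix B :: "real set" assume B[measurable]: "B \<in> sets borel"
    have e: "emeasure ?P B = (\<integral>\<^sup>+x. (a x - b x) * indicator B x \<partial>Q)"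
      "emeasure ?N B = (\<integral>\<^sup>+x. (b x - a x) * indicator B x \<partial>Q)"
      "emeasure P' B = (\<integral>\<^sup>+x. a x * indicator B x \<partial>Q)"
      "emeasure N' B = (\<integral>\<^sup>+x. b x * indicator B x \<partial>Q)"
      by (simp_all add: ad[symmetric] bd[symmetric] emeasure_density Q(1))
    show "emeasure ?P B \<le> emeasure P' B"
      unfolding e by (intro nn_integral_mono_AE, use f in eventually_elim) (auto simp: indicator_def diff_le_self_ennreal)
    show "emeasure ?N B \<le> emeasure N' B"
      unfolding e by (intro nn_integral_mono_AE, use f in eventually_elim) (auto simp: indicator_def diff_le_self_ennreal)
    have "emeasure ?P B + emeasure N' B = (\<integral>\<^sup>+x. (a x - b x) * indicator B x + b x * indicator B x \<partial>Q)"
      unfolding e by (rule nn_integral_add[symmetric]) auto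
    also have "\<dots> = (\<integral>\<^sup>+x. (b x - a x) * indicator B x + a x * indicator B x \<partial>Q)"
    proof (rule nn_integral_cong_AE, use f in eventually_elim)
      fix x assume x: "a x < top \<and> b x < top"
      have "(a x - b x) + b x = (b x - a x) + a x"
      proof (cases "a x \<le> b x")
        case True
        then show ?thesis using x by (simp add: diff_eq_0_ennreal diff_add_cancel_ennreal)
      next
        case False
        then have "b x \<le> a x" by simp
        then show ?thesis using x by (simp add: diff_eq_0_ennreal diff_add_cancel_ennreal)
      qed
      then show "(a x - b x) * indicator B x + b x * indicator B x = (b x - a x) * indicator B x + a x * indicator B x"
        by (simp add: indicator_def)
    qed
    also have "\<dots> = emeasure ?N B + emeasure P' B"
      unfolding e by (rule nn_integral_add) auto
    finally show "emeasure ?P B + emeasure N' B = emeasure ?N B + emeasure P' B" .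
  qed
qed

text \<open>f is the difference of the nondecreasing functions v and \<open>v - f\<close>. Their
  Stieltjes measures may share mass, which \<open>hahn_jordan_of_difference\<close> removes.\<close>

lemma jordan_pair_exists:
  assumes f: "f \<in> BV0"
  obtains P N where "jordan_pair f P N"
proof -
  have bv: "bounded_variation01 f" and f0: "f 0 = 0" using f by (auto simp: BV0_def)
  obtain v where v: "\<And>s t. 0 \<le> s \<Longrightarrow> s \<le> t \<Longrightarrow> t \<le> 1 \<Longrightarrow> v s + \<bar>f t - f s\<bar> \<le> v t"
    using bounded_variation01_split[OF bv] by blast
  have v1: "v s \<le> v t" if "0 \<le> s" "s \<le> t" "t \<le> 1" for s t using v[OF that] by linarith
  obtain P' where P': "sets P' = sets borel" "finite_measure P'" "emeasure P' (- {0..1}) = 0"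
    "\<And>t. t \<in> {0..<1} \<Longrightarrow> (v \<longlongrightarrow> v 0 + measure P' {0..t}) (at_right t)"
    "v 1 = v 0 + measure P' {0..1}"
    using mono_measure_01[of v, OF v1] by blast
  have v2: "v s - f s \<le> v t - f t" if "0 \<le> s" "s \<le> t" "t \<le> 1" for s t using v[OF that] by linarith
  obtain N' where N': "sets N' = sets borel" "finite_measure N'" "emeasure N' (- {0..1}) = 0"
    "\<And>t. t \<in> {0..<1} \<Longrightarrow> ((\<lambda>t. v t - f t) \<longlongrightarrow> v 0 - f 0 + measure N' {0..t}) (at_right t)"
    "v 1 - f 1 = v 0 - f 0 + measure N' {0..1}"
    using mono_measure_01[of "\<lambda>t. v t - f t", OF v2] by blast
  obtain P N H where J: "sets P = sets borel" "sets N = sets borel" "H \<in> sets borel"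
    "emeasure P (- H) = 0" "emeasure N H = 0"
    and le: "\<And>B. B \<in> sets borel \<Longrightarrow> emeasure P B \<le> emeasure P' B"
    "\<And>B. B \<in> sets borel \<Longrightarrow> emeasure N B \<le> emeasure N' B"
    and eq: "\<And>B. B \<in> sets borel \<Longrightarrow> emeasure P B + emeasure N' B = emeasure N B + emeasure P' B"
    using hahn_jordan_of_difference[OF P'(1) N'(1) P'(2) N'(2)] by metis
  have out: "emeasure P (- {0..1}) = 0" "emeasure N (- {0..1}) = 0"
    using le(1)[of "- {0..1}"] le(2)[of "- {0..1}"] P'(3) N'(3) by auto
  have sp: "space P = UNIV" "space N = UNIV"
    using sets_eq_imp_space_eq[OF J(1)] sets_eq_imp_space_eq[OF J(2)] by auto
  have fin: "finite_measure P" "finite_measure N"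
    using le[of UNIV] finite_measure.emeasure_finite[OF P'(2), of UNIV] finite_measure.emeasure_finite[OF N'(2), of UNIV]
    by (auto intro!: finite_measureI simp: sp top_unique)
  have diff: "measure P B - measure N B = measure P' B - measure N' B" if "B \<in> sets borel" for B
  proof -
    have "measure P B + measure N' B = measure N B + measure P' B"
      using eq[OF that] fin P'(2) N'(2)
      by (simp add: finite_measure.emeasure_eq_measure flip: ennreal_plus)
    then show ?thesis by simp
  qed
  have "jordan_pair f P N"
    unfolding jordan_pair_def
  proof (intro conjI ballI bexI[of _ H])
    fix t :: real assume t: "t \<in> {0..<1}"
    have "((\<lambda>t. v t - (v t - f t)) \<longlongrightarrow> (v 0 + measure P' {0..t}) - (v 0 - f 0 + measure N' {0..t})) (at_right t)"
      by (intro tendsto_diff P' N' t)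
    then show "(f \<longlongrightarrow> measure P {0..t} - measure N {0..t}) (at_right t)"
      by (simp add: diff f0)
  next
    show "f 1 = measure P {0..1} - measure N {0..1}"
      using diff[of "{0..1}"] P'(5) N'(5) f0 by simp
  qed (fact J fin out)+
  then show thesis by (rule that)
qed

text \<open>The Radon-Nikodym derivative of a finite measure is finite almost everywhere, so the
  density can be taken real-valued.\<close>

lemma lebesgue_decomposition_density:
  fixes m :: "real measure"
  assumes m: "finite_measure m" "sets m = sets borel"
  obtains p :: "real \<Rightarrow> real" and S where
    "p \<in> borel_measurable borel" "\<And>x. 0 \<le> p x" "integrable lborel p"
    "sets S = sets borel" "finite_measure S"
    "lebesgue_decomposition m = (density lborel (\<lambda>x. ennreal (p x)), S)"
    "\<And>B. B \<in> sets borel \<Longrightarrow> emeasure m B = (\<integral>\<^sup>+x\<in>B. ennreal (p x) \<partial>lborel) + emeasure S B"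
    "\<exists>H\<in>null_sets lborel. emeasure S (- H) = 0"
proof -
  obtain H where H: "H \<in> null_sets lborel" "\<And>B. B \<in> null_sets lborel \<Longrightarrow> emeasure m (B - H) = 0"
    using lebesgue_decomposition_exists[OF m] by blast
  note eq = lebesgue_decomposition_eq[OF m H]
  let ?A = "density m (indicator (- H))" and ?S = "density m (indicator H)"
  have [measurable_cong, simp]: "sets m = sets borel" by fact
  have sp [simp]: "space m = UNIV" using sets_eq_imp_space_eq[OF m(2)] by simp
  have [measurable]: "H \<in> sets borel" using H(1) by auto
  have e: "emeasure ?A B = emeasure m (B - H)"
    "emeasure ?S B = emeasure m (B \<inter> H)" if [measurable]: "B \<in> sets borel" for B
    by (simp_all add: emeasure_density Diff_eq Int_commute flip: indicator_inter_arith)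
  have finA: "finite_measure ?A" and finS: "finite_measure ?S"
    by (rule finite_measureI, simp add: e finite_measure.emeasure_finite[OF m(1)])+
  have ac: "absolutely_continuous lborel ?A"
    unfolding absolutely_continuous_def
  proof
    fix B :: "real set" assume B: "B \<in> null_sets lborel"
    then show "B \<in> null_sets (density m (indicator (- H)))"
      using H(2)[OF B] by (intro null_setsI) (auto simp: e)
  qed
  have sA: "sets ?A = sets lborel" by simp
  obtain p where p: "p \<in> borel_measurable lborel" "AE x in lborel. RN_deriv lborel ?A x = ennreal (p x)"
    "\<And>x. 0 \<le> p x"
    using sigma_finite_measure.real_RN_deriv[OF lborel.sigma_finite_measure_axioms finA ac sA] by metis
  have d: "density lborel (\<lambda>x. ennreal (p x)) = ?A"
  proof -
    have "density lborel (RN_deriv lborel ?A) = ?A"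
      by (rule sigma_finite_measure.density_RN_deriv[OF lborel.sigma_finite_measure_axioms ac sA])
    moreover have "density lborel (RN_deriv lborel ?A) = density lborel (\<lambda>x. ennreal (p x))"
      by (rule density_cong) (use p in simp_all)
    ultimately show ?thesis by simp
  qed
  have [measurable]: "p \<in> borel_measurable borel" using p(1) by simp
  have A: "emeasure ?A B = (\<integral>\<^sup>+x\<in>B. ennreal (p x) \<partial>lborel)" if [measurable]: "B \<in> sets borel" for B
    unfolding d[symmetric] by (simp add: emeasure_density)
  have "(\<integral>\<^sup>+x. ennreal (p x) \<partial>lborel) < \<infinity>"
    using A[of UNIV] finite_measure.emeasure_finite[OF finA, of UNIV] by (simp add: less_top)
  then have "integrable lborel p"
    by (intro integrableI_nonneg) (use p(3) in auto)
  moreover have "emeasure m B = (\<integral>\<^sup>+x\<in>B. ennreal (p x) \<partial>lborel) + emeasure ?S B"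
    if B: "B \<in> sets borel" for B
    unfolding A[OF B, symmetric] e[OF B] using emeasure_Int_Diff[of B m H] B by (simp add: add.commute)
  moreover have "\<exists>H\<in>null_sets lborel. emeasure ?S (- H) = 0"
    using H(1) by (intro bexI[of _ H]) (simp_all add: e)
  ultimately show ?thesis
    using that[of p ?S] p(3) finS by (simp add: d eq)
qed

lemma measure_eq_integral_plus:
  fixes p :: "real \<Rightarrow> real"
  assumes p: "p \<in> borel_measurable borel" "\<And>x. 0 \<le> p x" "integrable lborel p"
    and S: "finite_measure S" and B: "B \<in> sets borel"
    and eq: "emeasure m B = (\<integral>\<^sup>+x\<in>B. ennreal (p x) \<partial>lborel) + emeasure S B"
  shows "measure m B = (LBINT x:B. p x) + measure S B"
proof -
  have "(\<integral>\<^sup>+x\<in>B. ennreal (p x) \<partial>lborel) = (\<integral>\<^sup>+x. ennreal (indicator B x * p x) \<partial>lborel)"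
    by (intro nn_integral_cong) (auto simp: indicator_def)
  also have "\<dots> = ennreal (LBINT x:B. p x)"
    unfolding set_lebesgue_integral_def using p B
    by (subst nn_integral_eq_integral) (auto intro!: integrable_mult_indicator[where f=p, simplified])
  finally have "emeasure m B = ennreal (LBINT x:B. p x) + ennreal (measure S B)"
    using eq S by (simp add: finite_measure.emeasure_eq_measure)
  moreover have "0 \<le> (LBINT x:B. p x)"
    unfolding set_lebesgue_integral_def using p by (intro integral_nonneg_AE) (auto simp: indicator_def)
  ultimately show ?thesis
    by (simp add: measure_def[of m] flip: ennreal_plus)
qed

lemma BV0_structure:
  assumes f: "f \<in> BV0"
  obtains P N p n SP SN where "jordan_pair f P N"
    "p \<in> borel_measurable borel" "\<And>x. 0 \<le> p x" "integrable lborel p"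
    "n \<in> borel_measurable borel" "\<And>x. 0 \<le> n x" "integrable lborel n"
    "sets SP = sets borel" "finite_measure SP" "sets SN = sets borel" "finite_measure SN"
    "\<And>B. B \<in> sets borel \<Longrightarrow> measure P B = (LBINT x:B. p x) + measure SP B"
    "\<And>B. B \<in> sets borel \<Longrightarrow> measure N B = (LBINT x:B. n x) + measure SN B"
    "\<exists>H\<in>null_sets lborel. emeasure SP (- H) = 0"
    "\<exists>H\<in>null_sets lborel. emeasure SN (- H) = 0"
    "\<And>t. ac_part f t = (LBINT u:{0..t}. p u - n u)"
    "sing_pos_mass f = emeasure SP {0..1}" "sing_neg_mass f = emeasure SN {0..1}"
proof -
  obtain P N where J: "jordan_pair f P N" using jordan_pair_exists[OF f] by blast
  then have P: "finite_measure P" "sets P = sets borel" and N: "finite_measure N" "sets N = sets borel"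
    by (simp_all add: jordan_pair_def)
  note Jeq = jordan_measures_eq[OF J]
  obtain p SP where p: "p \<in> borel_measurable borel" "\<And>x. 0 \<le> p x" "integrable lborel p"
    and SP: "sets SP = sets borel" "finite_measure SP"
    and lp: "lebesgue_decomposition P = (density lborel (\<lambda>x. ennreal (p x)), SP)"
    and Pe: "\<And>B. B \<in> sets borel \<Longrightarrow> emeasure P B = (\<integral>\<^sup>+x\<in>B. ennreal (p x) \<partial>lborel) + emeasure SP B"
    and SPH: "\<exists>H\<in>null_sets lborel. emeasure SP (- H) = 0"
    using lebesgue_decomposition_density[OF P] by blast
  obtain n SN where n: "n \<in> borel_measurable borel" "\<And>x. 0 \<le> n x" "integrable lborel n"
    and SN: "sets SN = sets borel" "finite_measure SN"
    and ln: "lebesgue_decomposition N = (density lborel (\<lambda>x. ennreal (n x)), SN)"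
    and Ne: "\<And>B. B \<in> sets borel \<Longrightarrow> emeasure N B = (\<integral>\<^sup>+x\<in>B. ennreal (n x) \<partial>lborel) + emeasure SN B"
    and SNH: "\<exists>H\<in>null_sets lborel. emeasure SN (- H) = 0"
    using lebesgue_decomposition_density[OF N] by blast
  have dens: "measure (density lborel (\<lambda>x. ennreal (q x))) B = (LBINT x:B. q x)"
    if q: "q \<in> borel_measurable borel" "\<And>x. 0 \<le> q x" "integrable lborel q" and B: "B \<in> sets borel" for q :: "real \<Rightarrow> real" and B
  proof -
    have "measure (density lborel (\<lambda>x. ennreal (q x))) B = (LBINT x:B. q x) + measure (null_measure borel) B"
      by (rule measure_eq_integral_plus[OF q _ B])
        (use q(1) B in \<open>auto simp: emeasure_density intro!: finite_measureI\<close>)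
    then show ?thesis by (simp add: measure_def)
  qed
  have si: "set_integrable lborel B q" if "integrable lborel q" "B \<in> sets borel" for B and q :: "real \<Rightarrow> real"
    unfolding set_integrable_def using that by (intro integrable_mult_indicator) auto
  have ac: "ac_part f t = (LBINT u:{0..t}. p u - n u)" for t
    unfolding ac_part_def Jeq by (simp add: lp ln dens[OF p] dens[OF n] si[OF p(3)] si[OF n(3)] set_integral_diff)
  show ?thesis
    by (rule that[OF J p n SP SN measure_eq_integral_plus[OF p SP(2) _ Pe] measure_eq_integral_plus[OF n SN(2) _ Ne] SPH SNH ac])
      (simp_all add: sing_pos_mass_def sing_neg_mass_def Jeq lp ln)
qed

text \<open>By Lebesgue's theorem \<open>deriv (ac_part f)\<close> may be replaced by the density h
  almost everywhere, so no derivative occurs in the later estimates of the rate.\<close>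

lemma rate_J_eq:
  assumes f: "f \<in> BV0"
  obtains h :: "real \<Rightarrow> real" and SP SN where "h \<in> borel_measurable borel" "integrable lborel h"
    "sets SP = sets borel" "finite_measure SP" "sets SN = sets borel" "finite_measure SN"
    "\<And>t. t \<in> {0..<1} \<Longrightarrow>
      (f \<longlongrightarrow> (LBINT u:{0..t}. h u) + measure SP {0..t} - measure SN {0..t}) (at_right t)"
    "f 1 = (LBINT u:{0..1}. h u) + measure SP {0..1} - measure SN {0..1}"
    "\<And>\<Phi>. rate_J \<Phi> f = (\<integral>\<^sup>+s\<in>{0..1}. e2ennreal (\<Psi> \<Phi> (h s)) \<partial>lborel)
       + e2ennreal (\<theta>\<^sub>0 \<Phi>) * emeasure SP {0..1} + e2ennreal (- \<theta>\<^sub>1 \<Phi>) * emeasure SN {0..1}"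
proof -
  obtain P N p n SP SN where J: "jordan_pair f P N"
    and p: "p \<in> borel_measurable borel" "\<And>x. 0 \<le> p x" "integrable lborel p"
    and n: "n \<in> borel_measurable borel" "\<And>x. 0 \<le> n x" "integrable lborel n"
    and S: "sets SP = sets borel" "finite_measure SP" "sets SN = sets borel" "finite_measure SN"
    and P: "\<And>B. B \<in> sets borel \<Longrightarrow> measure P B = (LBINT x:B. p x) + measure SP B"
    and N: "\<And>B. B \<in> sets borel \<Longrightarrow> measure N B = (LBINT x:B. n x) + measure SN B"
    and "\<exists>H\<in>null_sets lborel. emeasure SP (- H) = 0"
    "\<exists>H\<in>null_sets lborel. emeasure SN (- H) = 0"
    and ac: "\<And>t. ac_part f t = (LBINT u:{0..t}. p u - n u)"
    and sing: "sing_pos_mass f = emeasure SP {0..1}" "sing_neg_mass f = emeasure SN {0..1}"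
    using BV0_structure[OF f] by blast
  define h where "h x = p x - n x" for x
  have h: "h \<in> borel_measurable borel" "integrable lborel h"
    unfolding h_def using p n by auto
  have si: "set_integrable lborel B q" if "integrable lborel q" "B \<in> sets borel" for B and q :: "real \<Rightarrow> real"
    unfolding set_integrable_def using that by (intro integrable_mult_indicator) auto
  have eq: "measure P {0..t} - measure N {0..t} = (LBINT u:{0..t}. h u) + measure SP {0..t} - measure SN {0..t}" for t
    unfolding h_def by (simp add: P N set_integral_diff si[OF p(3)] si[OF n(3)])
  have ac': "ac_part f = (\<lambda>t. LBINT u:{0..t}. h u)"
    by (rule ext) (simp add: ac h_def)
  \<comment> \<open>The differentiation theorem with lower limit 0 speaks of positive s
    only.\<close>
  have "AE s in lborel. s \<noteq> 0" by (rule AE_lborel_singleton)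
  with lebesgue_differentiation[OF h(2)]
  have "AE s in lborel. s \<in> {0..1} \<longrightarrow> deriv (ac_part f) s = h s"
    unfolding ac'
  proof eventually_elim
    case (elim s)
    show ?case using elim DERIV_imp_deriv by force
  qed
  then have "(\<integral>\<^sup>+s\<in>{0..1}. e2ennreal (\<Psi> \<Phi> (deriv (ac_part f) s)) \<partial>lborel)
      = (\<integral>\<^sup>+s\<in>{0..1}. e2ennreal (\<Psi> \<Phi> (h s)) \<partial>lborel)" for \<Phi>
    by (intro nn_integral_cong_AE) (auto elim!: eventually_mono simp: indicator_def)
  then have "rate_J \<Phi> f = (\<integral>\<^sup>+s\<in>{0..1}. e2ennreal (\<Psi> \<Phi> (h s)) \<partial>lborel)
       + e2ennreal (\<theta>\<^sub>0 \<Phi>) * emeasure SP {0..1} + e2ennreal (- \<theta>\<^sub>1 \<Phi>) * emeasure SN {0..1}" for \<Phi>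
    by (simp add: rate_J_def sing)
  moreover have "(f \<longlongrightarrow> (LBINT u:{0..t}. h u) + measure SP {0..t} - measure SN {0..t}) (at_right t)"
    if "t \<in> {0..<1}" for t
    using J that unfolding jordan_pair_def eq[symmetric] by blast
  moreover have "f 1 = (LBINT u:{0..1}. h u) + measure SP {0..1} - measure SN {0..1}"
    using J unfolding jordan_pair_def eq[symmetric] by blast
  ultimately show ?thesis using that[OF h S] by blast
qed

subsection \<open>Absolutely continuous functions\<close>

lemma abs_continuous01_continuous_on:
  assumes "abs_continuous01 f"
  shows "continuous_on {0..1} f"
proof (rule continuous_onI)
  fix x e :: real assume x: "x \<in> {0..1}" and e: "0 < e"
  then obtain d where d: "d > 0" "\<And>n (a :: nat \<Rightarrow> real) b.
        (\<forall>i<n. 0 \<le> a i \<and> a i \<le> b i \<and> b i \<le> 1) \<and>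
        disjoint_family_on (\<lambda>i. {a i<..<b i}) {..<n} \<and>
        (\<Sum>i<n. b i - a i) < d \<longrightarrow>
        (\<Sum>i<n. \<bar>f (b i) - f (a i)\<bar>) < e"
    using assms unfolding abs_continuous01_def by blast
  show "\<exists>d>0. \<forall>x'\<in>{0..1}. dist x' x < d \<longrightarrow> dist (f x') (f x) \<le> e"
  proof (intro exI[of _ d] conjI ballI impI)
    fix y assume y: "y \<in> {0..1}" "dist y x < d"
    have "(\<Sum>i<(1::nat). \<bar>f (max x y) - f (min x y)\<bar>) < e"
      by (rule d(2)[of 1 "\<lambda>_. min x y" "\<lambda>_. max x y", rule_format])
        (use x y in \<open>auto simp: disjoint_family_on_def dist_real_def\<close>)
    then show "dist (f y) (f x) \<le> e"
      by (cases "x \<le> y") (auto simp: dist_real_def max_def min_def)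
  qed (use d in auto)
qed

text \<open>[0,1] is cut into m cells shorter than the d that absolute continuity assigns to 1. The
  variation within a cell is then at most 1, and the whole variation at most m.\<close>

lemma abs_continuous01_imp_bounded_variation01:
  assumes "abs_continuous01 f"
  shows "bounded_variation01 f"
proof -
  obtain d where d: "d > 0" "\<And>n (a :: nat \<Rightarrow> real) b.
        (\<forall>i<n. 0 \<le> a i \<and> a i \<le> b i \<and> b i \<le> 1) \<and>
        disjoint_family_on (\<lambda>i. {a i<..<b i}) {..<n} \<and>
        (\<Sum>i<n. b i - a i) < d \<longrightarrow>
        (\<Sum>i<n. \<bar>f (b i) - f (a i)\<bar>) < 1"
    using assms zero_less_one unfolding abs_continuous01_def by blast
  obtain m0 where m0: "inverse (real (Suc m0)) < d" using reals_Archimedean[OF d(1)] by blast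
  define m where "m = Suc m0"
  have m: "m > 0" "1 / real m < d" using m0 by (auto simp: m_def divide_inverse)
  \<comment> \<open>\<open>C k\<close> is the projection onto the k-th cell; an increment of f is
    the sum of the increments between the projections of its end points.\<close>
  define C where "C k x = max (real k / m) (min (real (Suc k) / m) x)" for k :: nat and x :: real
  have C_mono: "C k x \<le> C k y" if "x \<le> y" for k x y using that by (auto simp: C_def)
  have C_bds: "real k / m \<le> C k x" "C k x \<le> real (Suc k) / m" for k x
    using m by (auto simp: C_def field_simps)
  have decomp: "f y - f x = (\<Sum>k<m. f (C k y) - f (C k x))" if xy: "x \<in> {0..1}" "y \<in> {0..1}" for x y
  proof -
    define T where "T z k = f (min z (real k / m))" for z k
    have T: "f z - f 0 = (\<Sum>k<m. T z (Suc k) - T z k)" if "z \<in> {0..1}" for z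
      using that m by (simp add: sum_lessThan_telescope) (simp add: T_def)
    have "T y (Suc k) - T y k - (T x (Suc k) - T x k) = f (C k y) - f (C k x)" for k
    proof -
      have "T z (Suc k) - T z k = f (C k z) - f (real k / m)" for z
      proof -
        have kk: "real k / m < real (Suc k) / m" using m by (simp add: divide_strict_right_mono)
        consider "z \<le> real k / m" | "real k / m \<le> z" "z \<le> real (Suc k) / m" | "real (Suc k) / m \<le> z"
          by linarith
        then show ?thesis
          unfolding T_def C_def by cases (use kk in \<open>simp_all add: min_def max_def del: of_nat_Suc\<close>)
      qed
      then show ?thesis by simp
    qed
    then have "(\<Sum>k<m. f (C k y) - f (C k x)) = (\<Sum>k<m. T y (Suc k) - T y k - (T x (Suc k) - T x k))"
      by simp
    also have "\<dots> = (f y - f 0) - (f x - f 0)"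
      unfolding T[OF xy(1)] T[OF xy(2)] by (rule sum_subtractf)
    finally have "(\<Sum>k<m. f (C k y) - f (C k x)) = (f y - f 0) - (f x - f 0)" .
    then show ?thesis by simp
  qed
  have "(\<Sum>i<n. \<bar>f (u (Suc i)) - f (u i)\<bar>) \<le> real m"
    if u: "mono u" "range u \<subseteq> {0..1}" for n and u :: "nat \<Rightarrow> real"
  proof -
    have ui: "u i \<in> {0..1}" for i using range_subsetD[OF u(2)] .
    have "(\<Sum>i<n. \<bar>f (u (Suc i)) - f (u i)\<bar>) \<le> (\<Sum>i<n. \<Sum>k<m. \<bar>f (C k (u (Suc i))) - f (C k (u i))\<bar>)"
      by (intro sum_mono) (subst decomp[OF ui ui], rule sum_abs)
    also have "\<dots> = (\<Sum>k<m. \<Sum>i<n. \<bar>f (C k (u (Suc i))) - f (C k (u i))\<bar>)"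
      by (rule sum.swap)
    also have "\<dots> \<le> (\<Sum>k<m. 1)"
    proof (rule sum_mono)
      fix k assume k: "k \<in> {..<m}"
      have kk: "real (Suc k) / m \<le> 1" using k m by (simp add: field_simps del: of_nat_Suc)
      have cu: "C k (u i) \<le> C k (u j)" if "i \<le> j" for i j
        by (rule C_mono) (rule monoD[OF u(1) that])
      have "(\<Sum>i<n. C k (u (Suc i)) - C k (u i)) = C k (u n) - C k (u 0)"
        by (rule sum_lessThan_telescope)
      also have "\<dots> \<le> 1 / m"
        using C_bds[of k "u 0"] C_bds[of k "u n"] by (simp add: add_divide_distrib)
      also have "\<dots> < d" by (rule m)
      finally have len: "(\<Sum>i<n. C k (u (Suc i)) - C k (u i)) < d" .
      have "0 \<le> C k x" "C k x \<le> 1" for x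
        using C_bds[of k x] kk order_trans[of 0 "real k / m"] by auto
      moreover have "disjoint_family_on (\<lambda>i. {C k (u i)<..<C k (u (Suc i))}) {..<n}"
        unfolding disjoint_family_on_def
      proof (intro ballI impI)
        fix i j :: nat assume "i \<noteq> j"
        then consider "Suc i \<le> j" | "Suc j \<le> i" by linarith
        then show "{C k (u i)<..<C k (u (Suc i))} \<inter> {C k (u j)<..<C k (u (Suc j))} = {}"
        proof cases
          case 1 then show ?thesis using cu[OF 1] by auto
        next
          case 2 then show ?thesis using cu[OF 2] by auto
        qed
      qed
      ultimately show "(\<Sum>i<n. \<bar>f (C k (u (Suc i))) - f (C k (u i))\<bar>) \<le> 1"
        using d(2)[of n "\<lambda>i. C k (u i)" "\<lambda>i. C k (u (Suc i))"] len cu by (simp add: less_imp_le)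
    qed
    finally show ?thesis by simp
  qed
  then show ?thesis unfolding bounded_variation01_def by blast
qed

text \<open>The intervals of a division overlap in boundary points only, and these are null for a
  measure without atoms.\<close>

lemma emeasure_division:
  fixes m :: "real measure"
  assumes s: "sets m = sets borel" and at: "\<And>t. emeasure m {t} = 0" and D: "D division_of S"
  shows "(\<Sum>I\<in>D. emeasure m I) = emeasure m S"
proof -
  have fin: "finite D" using D by auto
  have I: "\<exists>a b. I = {a..b} \<and> a \<le> b" if "I \<in> D" for I
    using division_ofD(3,4)[OF D that] by (metis atLeastatMost_empty_iff2 cbox_interval)
  have m: "I \<in> sets m" "interior I \<in> sets m" if ID: "I \<in> D" for I
  proof -
    obtain a b where "I = {a..b}" using I[OF ID] by blast
    then show "I \<in> sets m" "interior I \<in> sets m" by (simp_all add: s)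
  qed
  have fr: "I - interior I \<in> null_sets m" if "I \<in> D" for I
  proof -
    obtain a b where ab: "I = {a..b}" "a \<le> b" using I[OF \<open>I \<in> D\<close>] by blast
    have "{a} \<in> null_sets m" "{b} \<in> null_sets m" using at s by (auto simp: null_sets_def)
    then have "{a} \<union> {b} \<in> null_sets m" by (rule null_sets.Un)
    moreover have "I - interior I \<subseteq> {a} \<union> {b}" using ab by (auto simp: interior_atLeastAtMost_real)
    ultimately show ?thesis using m that by (meson null_sets_subset sets.Diff)
  qed
  define E where "E = (\<Union>I\<in>D. I - interior I)"
  have "E \<in> null_sets m" unfolding E_def using fin fr by (intro null_sets_UN') (auto simp: countable_finite)
  then have ae: "AE x in m. x \<notin> E" by (rule AE_not_in)
  have "(\<Sum>I\<in>D. emeasure m I) = (\<Sum>I\<in>D. emeasure m (interior I))"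
    by (intro sum.cong refl emeasure_eq_AE)
      (use ae m interior_subset in \<open>auto elim!: eventually_mono simp: E_def\<close>)
  also have "\<dots> = emeasure m (\<Union>I\<in>D. interior I)"
  proof (rule sum_emeasure)
    show "disjoint_family_on interior D"
      using division_ofD(5)[OF D] unfolding disjoint_family_on_def by blast
  qed (use m fin in auto)
  also have "\<dots> = emeasure m S"
  proof (rule emeasure_eq_AE)
    have S: "S = \<Union>D" using division_ofD(6)[OF D] by simp
    show "AE x in m. (x \<in> (\<Union>I\<in>D. interior I)) = (x \<in> S)"
      using ae unfolding S E_def by eventually_elim (use interior_subset in blast)
    show "S \<in> sets m" unfolding S using fin m by (intro sets.finite_Union) auto
    show "(\<Union>I\<in>D. interior I) \<in> sets m" using fin m by (intro sets.finite_UN) auto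
  qed
  finally show ?thesis .
qed

lemma abs_continuous01_uminus:
  "abs_continuous01 f \<Longrightarrow> abs_continuous01 (\<lambda>x. - f x)"
  unfolding abs_continuous01_def by (simp add: abs_minus_commute)

text \<open>The part C of B inside the Hahn set is null for Lebesgue measure and for N, so some open
  set around C is small for both. Finitely many intervals in it, of total length below d, cover a
  compact subset of C with almost all of the mass of P. On each of them P exceeds N by at most the
  absolute value of an increment of f, and these sum to less than e.\<close>

lemma abs_continuous01_null_set:
  fixes P N :: "real measure"
  assumes ac: "abs_continuous01 f"
    and s: "sets P = sets borel" "sets N = sets borel"
    and fin: "finite_measure P" "finite_measure N"
    and out: "emeasure P (- {0..1}) = 0" "emeasure N (- {0..1}) = 0"
    and D: "D \<in> sets borel" "emeasure P (- D) = 0" "emeasure N D = 0"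
    and at: "\<And>t. emeasure P {t} = 0" "\<And>t. emeasure N {t} = 0"
    and eq: "\<And>x y. 0 \<le> x \<Longrightarrow> x \<le> y \<Longrightarrow> y \<le> 1 \<Longrightarrow> measure P {x..y} - measure N {x..y} = f y - f x"
    and B: "B \<in> null_sets lborel"
  shows "emeasure P B = 0"
proof -
  interpret P: finite_measure P by fact
  interpret N: finite_measure N by fact
  define C where "C = B \<inter> D"
  have Bb: "B \<in> sets borel" using B by auto
  have C: "C \<in> sets borel" "C \<in> null_sets lborel"
    using B D(1) Bb unfolding C_def by (auto intro: null_set_Int2)
  have "- D \<in> null_sets P" using D s by (auto simp: null_sets_def)
  then have "AE x in P. x \<notin> - D" by (rule AE_not_in)
  then have PB: "emeasure P B = emeasure P C"
    unfolding C_def by (intro emeasure_eq_AE) (use Bb D s in \<open>auto elim!: eventually_mono\<close>)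
  have NC: "emeasure N C = 0"
    using emeasure_mono[of C D N] D s by (simp add: C_def)
  \<comment> \<open>One e each for the inner approximation, for the increments of f and for the mass
    of N on the open set.\<close>
  have bound: "measure P C \<le> 3 * e" if e: "e > 0" for e
  proof (cases "measure P C \<le> e")
    case True
    then show ?thesis using e by simp
  next
    case False
    obtain d where d: "d > 0" "\<And>n (a :: nat \<Rightarrow> real) b.
        (\<forall>i<n. 0 \<le> a i \<and> a i \<le> b i \<and> b i \<le> 1) \<and>
        disjoint_family_on (\<lambda>i. {a i<..<b i}) {..<n} \<and>
        (\<Sum>i<n. b i - a i) < d \<longrightarrow>
        (\<Sum>i<n. \<bar>f (b i) - f (a i)\<bar>) < e"
      using ac e unfolding abs_continuous01_def by blast
    have "(INF U\<in>{U. C \<subseteq> U \<and> open U}. emeasure N U) < ennreal e"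
      using outer_regular[OF s(2) _ C(1)] NC e by simp
    then obtain U1 where U1: "C \<subseteq> U1" "open U1" "emeasure N U1 < ennreal e"
      by (auto simp: INF_less_iff)
    obtain U2 where U2: "open U2" "C \<subseteq> U2" "emeasure lborel (U2 - C) < ennreal d"
      using outer_regular_lborel[OF C(1) d(1)] by blast
    have U2': "emeasure lborel U2 < ennreal d"
      using U2(1,3) C(2) emeasure_Diff_null_set[OF C(2), of U2] by simp
    define U where "U = U1 \<inter> U2"
    have U: "open U" "C \<subseteq> U" using U1 U2 by (auto simp: U_def)
    have "ennreal (measure P C - e) < (SUP K\<in>{K. K \<subseteq> C \<and> compact K}. emeasure P K)"
    proof -
      have "ennreal (measure P C - e) < emeasure P C"
        using False e by (simp add: P.emeasure_eq_measure ennreal_less_iff)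
      then show ?thesis using inner_regular[OF s(1) _ C(1)] by simp
    qed
    then obtain K where K: "K \<subseteq> C" "compact K" "ennreal (measure P C - e) < emeasure P K"
      by (auto simp: less_SUP_iff)
    have K3: "measure P C - e < measure P K"
      using K(3) False by (simp add: P.emeasure_eq_measure ennreal_less_iff)
    have "\<forall>x\<in>K. \<exists>r>0. cball x r \<subseteq> U"
      using U K(1) open_contains_cball by blast
    then obtain r where r: "\<And>x. x \<in> K \<Longrightarrow> r x > 0" "\<And>x. x \<in> K \<Longrightarrow> cball x (r x) \<subseteq> U"
      by metis
    obtain X where X: "X \<subseteq> K" "finite X" "K \<subseteq> (\<Union>x\<in>X. ball x (r x))"
    proof (rule compactE_image[OF K(2), of K "\<lambda>x. ball x (r x)"])
      show "K \<subseteq> (\<Union>x\<in>K. ball x (r x))" using r(1) by force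
    qed auto
    define F where "F = (\<lambda>x. cbox (x - r x) (x + r x)) ` X"
    \<comment> \<open>The covering intervals may overlap; a division of their union has disjoint
      interiors, as absolute continuity requires.\<close>
    obtain Q where Q: "Q division_of \<Union>F"
      by (rule elementary_unions_intervals[of F]) (use X(2) in \<open>auto simp: F_def\<close>)
    define S where "S = \<Union>F"
    have SU: "S \<subseteq> U" using r(2) X(1) unfolding S_def F_def by (force simp: cball_eq_atLeastAtMost)
    have KS: "K \<subseteq> S"
    proof
      fix y assume "y \<in> K"
      then obtain x where "x \<in> X" "y \<in> ball x (r x)" using X(3) by blast
      then show "y \<in> S" unfolding S_def F_def by (intro UnionI[of "cbox (x - r x) (x + r x)"]) (auto simp: dist_real_def)
    qed
    have Sb: "S \<in> sets borel" unfolding S_def F_def using X(2) by (intro sets.finite_Union) auto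
    note Q' = Q[folded S_def]
    have finQ: "finite Q" using Q by auto
    have I: "I = {Inf I..Sup I} \<and> Inf I \<le> Sup I" if IQ: "I \<in> Q" for I
    proof -
      obtain a b where "I = {a..b}" "a \<le> b"
        using division_ofD(3,4)[OF Q IQ] by (metis atLeastatMost_empty_iff2 cbox_interval)
      then show ?thesis by simp
    qed
    have Ib: "I \<in> sets borel" if "I \<in> Q" for I using I[OF that] by (metis atLeastAtMost_borel)
    \<comment> \<open>The covering intervals may leave [0,1], where f is not controlled; clipping
      them loses no mass.\<close>
    define lo hi where "lo I = max 0 (min 1 (Inf I))" and "hi I = max 0 (min 1 (Sup I))" for I :: "real set"
    have lohi: "0 \<le> lo I" "lo I \<le> hi I" "hi I \<le> 1" if "I \<in> Q" for I
      using I[OF that] by (auto simp: lo_def hi_def)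
    have clip: "measure m I = measure m {lo I..hi I}"
      if IQ: "I \<in> Q" and m: "sets m = sets borel" "emeasure m (- {0..1}) = 0" "\<And>t. emeasure m {t} = 0"
      for m :: "real measure" and I
    proof -
      have "- {0..1} \<in> null_sets m" "{0} \<in> null_sets m" "{1} \<in> null_sets m"
        using m by (simp_all add: null_sets_def)
      note ae = this[THEN AE_not_in]
      from ae have "AE x in m. (x \<in> {Inf I..Sup I}) = (x \<in> {lo I..hi I})"
        by eventually_elim (auto simp: lo_def hi_def max_def min_def)
      then show ?thesis
        by (intro measure_eq_AE) (use I[OF IQ] m Ib[OF IQ] in simp_all)
    qed
    obtain e' where e': "bij_betw e' {..<card Q} Q"
      using ex_bij_betw_nat_finite[OF finQ] by (auto simp: atLeast0LessThan)
    have eQ: "e' i \<in> Q" if "i < card Q" for i using bij_betwE[OF e'] that by auto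
    have sumQ: "(\<Sum>i<card Q. g (e' i)) = (\<Sum>I\<in>Q. g I)" for g :: "real set \<Rightarrow> real"
      by (rule sum.reindex_bij_betw[OF e'])
    have "(\<Sum>i<card Q. \<bar>f (hi (e' i)) - f (lo (e' i))\<bar>) < e"
    proof (rule d(2)[rule_format], intro conjI allI impI)
      show "disjoint_family_on (\<lambda>i. {lo (e' i)<..<hi (e' i)}) {..<card Q}"
        unfolding disjoint_family_on_def
      proof (intro ballI impI)
        fix i j assume ij: "i \<in> {..<card Q}" "j \<in> {..<card Q}" "i \<noteq> j"
        then have "e' i \<noteq> e' j" using e' by (auto simp: bij_betw_def inj_on_def)
        then have "interior (e' i) \<inter> interior (e' j) = {}"
          using division_ofD(5)[OF Q] eQ ij by auto
        moreover have "{lo (e' k)<..<hi (e' k)} \<subseteq> interior (e' k)" if "k < card Q" for k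
        proof -
          have "{lo (e' k)<..<hi (e' k)} \<subseteq> {Inf (e' k)<..<Sup (e' k)}"
            using I[OF eQ[OF that]] by (auto simp: lo_def hi_def)
          also have "\<dots> = interior {Inf (e' k)..Sup (e' k)}" by (simp add: interior_atLeastAtMost_real)
          also have "\<dots> = interior (e' k)" using I[OF eQ[OF that]] by simp
          finally show ?thesis .
        qed
        ultimately show "{lo (e' i)<..<hi (e' i)} \<inter> {lo (e' j)<..<hi (e' j)} = {}" using ij by blast
      qed
      have "ennreal (\<Sum>I\<in>Q. Sup I - Inf I) = (\<Sum>I\<in>Q. ennreal (Sup I - Inf I))"
        using I by (intro sum_ennreal[symmetric]) auto
      also have "\<dots> = (\<Sum>I\<in>Q. emeasure lborel I)"
      proof (rule sum.cong[OF refl])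
        fix J assume "J \<in> Q"
        then have "emeasure lborel J = emeasure lborel {Inf J..Sup J}" "Inf J \<le> Sup J" using I by auto
        then show "ennreal (Sup J - Inf J) = emeasure lborel J" by simp
      qed
      also have "\<dots> = emeasure lborel S" by (rule emeasure_division[OF _ _ Q']) auto
      also have "\<dots> \<le> emeasure lborel U2" using SU U2(1) by (intro emeasure_mono) (auto simp: U_def)
      also have "\<dots> < ennreal d" by (rule U2')
      finally have "(\<Sum>I\<in>Q. Sup I - Inf I) < d" using d(1)
        by (subst (asm) ennreal_less_iff) (use I in \<open>auto intro!: sum_nonneg\<close>)
      moreover have "(\<Sum>I\<in>Q. hi I - lo I) \<le> (\<Sum>I\<in>Q. Sup I - Inf I)"
      proof (rule sum_mono)
        fix J assume "J \<in> Q"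
        then have "Inf J \<le> Sup J" using I by blast
        then show "hi J - lo J \<le> Sup J - Inf J" by (simp add: lo_def hi_def max_def min_def)
      qed
      ultimately show "(\<Sum>i<card Q. hi (e' i) - lo (e' i)) < d"
        unfolding sumQ[of "\<lambda>I. hi I - lo I"] by linarith
    qed (use lohi eQ in auto)
    then have fs: "(\<Sum>I\<in>Q. \<bar>f (hi I) - f (lo I)\<bar>) < e" by (simp add: sumQ[of "\<lambda>I. \<bar>f (hi I) - f (lo I)\<bar>"])
    have PI: "measure P I \<le> measure N I + \<bar>f (hi I) - f (lo I)\<bar>" if "I \<in> Q" for I
      using eq[OF lohi[OF that]] clip[OF that s(1) out(1) at(1)] clip[OF that s(2) out(2) at(2)] by linarith
    have "measure P C - e < measure P K" by (rule K3)
    also have "\<dots> \<le> measure P S" using KS Sb s by (intro P.finite_measure_mono) auto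
    also have "\<dots> = (\<Sum>I\<in>Q. measure P I)"
      using emeasure_division[OF s(1) at(1) Q'] by (simp add: P.emeasure_eq_measure sum_nonneg)
    also have "\<dots> \<le> (\<Sum>I\<in>Q. measure N I) + (\<Sum>I\<in>Q. \<bar>f (hi I) - f (lo I)\<bar>)"
      unfolding sum.distrib[symmetric] by (intro sum_mono PI)
    also have "(\<Sum>I\<in>Q. measure N I) = measure N S"
      using emeasure_division[OF s(2) at(2) Q'] by (simp add: N.emeasure_eq_measure sum_nonneg)
    also have "measure N S \<le> measure N U1"
      using SU U1(2) s by (intro N.finite_measure_mono) (auto simp: U_def)
    also have "measure N U1 < e" using U1(3) e by (simp add: N.emeasure_eq_measure ennreal_less_iff)
    finally show ?thesis using fs by linarith
  qed
  have "measure P C \<le> 0"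
    by (rule field_le_epsilon) (use bound[of "_ / 3"] in simp)
  then have "measure P C = 0" by (simp add: measure_le_0_iff)
  then show ?thesis unfolding PB by (simp add: P.emeasure_eq_measure)
qed

text \<open>Continuity of f makes P and N agree on points, and mutual singularity then makes both
  atomless. By \<open>abs_continuous01_null_set\<close> neither charges Lebesgue-null sets, so the
  singular parts vanish and I and J coincide at f.\<close>

lemma abs_continuous01_integral:
  assumes ac: "abs_continuous01 f" and f0: "f 0 = 0"
  obtains h where "h \<in> borel_measurable borel" "integrable lborel h"
    "\<And>t. t \<in> {0..1} \<Longrightarrow> f t = (LBINT u:{0..t}. h u)"
    "AE s in lborel. s \<in> {0..1} \<longrightarrow> deriv f s = h s" "\<And>\<Phi>. rate_J \<Phi> f = rate_I \<Phi> f"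
proof -
  have f: "f \<in> BV0" using abs_continuous01_imp_bounded_variation01[OF ac] f0 by (simp add: BV0_def)
  have cont: "continuous_on {0..1} f" by (rule abs_continuous01_continuous_on[OF ac])
  obtain P N p n SP SN where J: "jordan_pair f P N"
    and p: "p \<in> borel_measurable borel" "\<And>x. 0 \<le> p x" "integrable lborel p"
    and n: "n \<in> borel_measurable borel" "\<And>x. 0 \<le> n x" "integrable lborel n"
    and S: "sets SP = sets borel" "finite_measure SP" "sets SN = sets borel" "finite_measure SN"
    and P: "\<And>B. B \<in> sets borel \<Longrightarrow> measure P B = (LBINT x:B. p x) + measure SP B"
    and N: "\<And>B. B \<in> sets borel \<Longrightarrow> measure N B = (LBINT x:B. n x) + measure SN B"
    and H: "\<exists>H\<in>null_sets lborel. emeasure SP (- H) = 0"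
      "\<exists>H\<in>null_sets lborel. emeasure SN (- H) = 0"
    and ac_part: "\<And>t. ac_part f t = (LBINT u:{0..t}. p u - n u)"
    and sing: "sing_pos_mass f = emeasure SP {0..1}" "sing_neg_mass f = emeasure SN {0..1}"
    using BV0_structure[OF f] by blast
  have s: "sets P = sets borel" "sets N = sets borel" and fin: "finite_measure P" "finite_measure N"
    and out: "emeasure P (- {0..1}) = 0" "emeasure N (- {0..1}) = 0"
    and R: "\<forall>t\<in>{0..<1}. (f \<longlongrightarrow> measure P {0..t} - measure N {0..t}) (at_right t)"
    and f1: "f 1 = measure P {0..1} - measure N {0..1}"
    using J unfolding jordan_pair_def by blast+
  obtain D where D: "D \<in> sets borel" "emeasure P (- D) = 0" "emeasure N D = 0"
    using J unfolding jordan_pair_def by blast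
  interpret P: finite_borel_measure P
    using s fin by (simp add: finite_borel_measure_def finite_borel_measure_axioms_def)
  interpret N: finite_borel_measure N
    using s fin by (simp add: finite_borel_measure_def finite_borel_measure_axioms_def)
  have F: "measure P {0..t} - measure N {0..t} = f t" if t: "t \<in> {0..1}" for t
  proof (cases "t = 1")
    case False
    have "(f \<longlongrightarrow> f t) (at t within {0..1})" using cont t by (auto simp: continuous_on_def)
    then have "(f \<longlongrightarrow> f t) (at t within {t..1})" by (rule tendsto_within_subset) (use t in auto)
    then have "(f \<longlongrightarrow> f t) (at_right t)" using t False by (simp add: at_within_Icc_at_right)
    moreover have "(f \<longlongrightarrow> measure P {0..t} - measure N {0..t}) (at_right t)"
      using R t False by auto
    ultimately show ?thesis by (intro tendsto_unique[of "at_right t"]) auto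
  qed (use f1 in simp)
  have cdf: "cdf P t - cdf N t = f t" if t: "t \<in> {0..1}" for t
    using F[OF t] measure_atMost_01[OF s(1) out(1), of t] measure_atMost_01[OF s(2) out(2), of t] t
    by (simp add: cdf_def measure_def)
  have atom: "measure P {t} = measure N {t}" for t
  proof -
    consider "t \<notin> {0..1}" | "t = 0" | "0 < t" "t \<le> 1" by fastforce
    then show ?thesis
    proof cases
      case 1
      then have "measure P {t} \<le> measure P (- {0..1})" "measure N {t} \<le> measure N (- {0..1})"
        by (intro P.finite_measure_mono N.finite_measure_mono; simp add: s)+
      then show ?thesis using out by (simp add: measure_def[of _ "- {0..1}"] measure_le_0_iff)
    next
      case 2
      then show ?thesis using F[of 0] f0 by simp
    next
      case 3
      have "((\<lambda>x. cdf P x - cdf N x) \<longlongrightarrow> measure P {..<t} - measure N {..<t}) (at_left t)"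
        by (intro tendsto_diff P.cdf_at_left N.cdf_at_left)
      moreover have "\<forall>\<^sub>F x in at_left t. cdf P x - cdf N x = f x"
        unfolding eventually_at_left_field using 3 by (intro exI[of _ 0]) (auto intro!: cdf)
      ultimately have "(f \<longlongrightarrow> measure P {..<t} - measure N {..<t}) (at_left t)"
        by (rule Lim_transform_eventually)
      moreover have "(f \<longlongrightarrow> f t) (at_left t)"
      proof -
        have "(f \<longlongrightarrow> f t) (at t within {0..1})" using cont 3 by (auto simp: continuous_on_def)
        then have "(f \<longlongrightarrow> f t) (at t within {0..t})" by (rule tendsto_within_subset) (use 3 in auto)
        then show ?thesis using 3 by (simp add: at_within_Icc_at_left)
      qed
      ultimately have "f t = measure P {..<t} - measure N {..<t}"
        by (intro tendsto_unique[of "at_left t"]) auto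
      moreover have "measure m {..t} = measure m {..<t} + measure m {t}"
        if "finite_measure m" "sets m = sets borel" for m :: "real measure"
        using finite_measure.finite_measure_Union[OF that(1), of "{..<t}" "{t}"] that(2)
        by (simp add: ivl_disj_un_singleton(2)[symmetric])
      ultimately show ?thesis using cdf[of t] 3 s fin by (simp add: cdf_def)
    qed
  qed
  \<comment> \<open>Whether or not t lies in the Hahn set D, one of the two equal atoms is
    0.\<close>
  have at: "emeasure P {t} = 0" "emeasure N {t} = 0" for t
  proof -
    have "measure P {t} = 0"
    proof (cases "t \<in> D")
      case True
      then have "emeasure N {t} \<le> emeasure N D" using D s by (intro emeasure_mono) auto
      then show ?thesis using atom[of t] D by (simp add: measure_def)
    next
      case False
      then have "emeasure P {t} \<le> emeasure P (- D)" using D s by (intro emeasure_mono) auto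
      then show ?thesis using D by (simp add: measure_def)
    qed
    then show "emeasure P {t} = 0" "emeasure N {t} = 0"
      using atom[of t] by (simp_all add: P.emeasure_eq_measure N.emeasure_eq_measure)
  qed
  have Icc: "measure P {x..y} - measure N {x..y} = f y - f x" if xy: "0 \<le> x" "x \<le> y" "y \<le> 1" for x y
  proof -
    have "measure m {0..y} = measure m {0..x} + measure m {x..y}"
      if m: "finite_measure m" "sets m = sets borel" "emeasure m {x} = 0" for m :: "real measure"
    proof -
      have "{x} \<in> null_sets m" using m by (auto simp: null_sets_def)
      then have ae: "AE z in m. z \<notin> {x}" by (rule AE_not_in)
      have "measure m {0..y} = measure m {0..x} + measure m {x<..y}"
        using finite_measure.finite_measure_Union[OF m(1), of "{0..x}" "{x<..y}"] m(2) xy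
        by (simp add: ivl_disj_un_two_touch ivl_disj_un_two disjoint_iff)
      also have "measure m {x<..y} = measure m {x..y}"
        by (rule measure_eq_AE) (use ae m in \<open>auto elim!: eventually_mono\<close>)
      finally show ?thesis .
    qed
    from this[OF fin(1) s(1) at(1)] this[OF fin(2) s(2) at(2)] F[of x] F[of y] xy
    show ?thesis by simp
  qed
  have nullP: "emeasure P B = 0" if "B \<in> null_sets lborel" for B
    by (rule abs_continuous01_null_set[OF ac s fin out D at Icc that])
  have Icc': "measure N {x..y} - measure P {x..y} = - f y - - f x" if "0 \<le> x" "x \<le> y" "y \<le> 1" for x y
    using Icc[OF that] by simp
  \<comment> \<open>The negative part of f is the positive part of -f, with the complementary Hahn
    set.\<close>
  have nullN: "emeasure N B = 0" if "B \<in> null_sets lborel" for B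
    by (rule abs_continuous01_null_set[OF abs_continuous01_uminus[OF ac] s(2,1) fin(2,1) out(2,1) _ _ _ at(2,1) Icc' that, of "- D"])
      (use D in auto)
  have zero: "measure S' B = 0"
    if S': "sets S' = sets borel" "finite_measure S'" "\<exists>H\<in>null_sets lborel. emeasure S' (- H) = 0"
      and le: "\<And>B. B \<in> null_sets lborel \<Longrightarrow> measure S' B = 0" and B: "B \<in> sets borel" for S' :: "real measure" and B
  proof -
    obtain H where H: "H \<in> null_sets lborel" "emeasure S' (- H) = 0" using S'(3) by blast
    have "measure S' B \<le> measure S' (H \<union> - H)"
      using S' B H by (intro finite_measure.finite_measure_mono) auto
    also have "\<dots> \<le> measure S' H + measure S' (- H)"
      using null_setsD2[OF H(1)] by (intro measure_Un_le) (simp_all add: S'(1) borel_comp)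
    also have "\<dots> = 0" using le[OF H(1)] H(2) by (simp add: measure_def)
    finally show ?thesis by (simp add: measure_le_0_iff)
  qed
  have q0: "0 \<le> (LBINT x:B. q x)" if "\<And>x. 0 \<le> q x" for q :: "real \<Rightarrow> real" and B
    unfolding set_lebesgue_integral_def using that by (intro integral_nonneg_AE) (auto simp: indicator_def)
  have leP: "measure SP B = 0" if "B \<in> null_sets lborel" for B
    using P[of B] nullP[OF that] q0[of p B] p(2) null_setsD2[OF that]
    by (simp add: measure_def[of P] add_nonneg_eq_0_iff)
  have leN: "measure SN B = 0" if "B \<in> null_sets lborel" for B
    using N[of B] nullN[OF that] q0[of n B] n(2) null_setsD2[OF that]
    by (simp add: measure_def[of N] add_nonneg_eq_0_iff)
  define h where "h x = p x - n x" for x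
  have h: "h \<in> borel_measurable borel" "integrable lborel h"
    unfolding h_def using p n by auto
  have si: "set_integrable lborel B q" if "integrable lborel q" "B \<in> sets borel" for B and q :: "real \<Rightarrow> real"
    unfolding set_integrable_def using that by (intro integrable_mult_indicator) auto
  have ft: "f t = (LBINT u:{0..t}. h u)" if t: "t \<in> {0..1}" for t
    using F[OF t] P[of "{0..t}"] N[of "{0..t}"] zero[OF S(1,2) H(1) leP, of "{0..t}"] zero[OF S(3,4) H(2) leN, of "{0..t}"]
    by (simp add: h_def set_integral_diff si[OF p(3)] si[OF n(3)])
  have ac': "ac_part f = (\<lambda>t. LBINT u:{0..t}. h u)"
    by (rule ext) (simp add: ac_part h_def)
  have "AE s in lborel. s \<noteq> (0::real)" "AE s in lborel. s \<noteq> (1::real)" by (rule AE_lborel_singleton)+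
  with lebesgue_differentiation[OF h(2)]
  have ae: "AE s in lborel. s \<in> {0..1} \<longrightarrow> deriv f s = h s \<and> deriv (ac_part f) s = h s"
  proof eventually_elim
    case (elim s)
    show ?case
    proof
      assume s: "s \<in> {0..1}"
      with elim have D: "((\<lambda>t. LBINT u:{0..t}. h u) has_real_derivative h s) (at s)" "0 < s" "s < 1" by auto
      have "(f has_real_derivative h s) (at s)"
        by (rule has_field_derivative_transform_within_open[OF D(1), of "{0<..<1}"]) (use D ft in auto)
      then show "deriv f s = h s \<and> deriv (ac_part f) s = h s"
        unfolding ac' using D(1) by (simp add: DERIV_imp_deriv)
    qed
  qed
  have "(\<integral>\<^sup>+s\<in>{0..1}. e2ennreal (\<Psi> \<Phi> (deriv (ac_part f) s)) \<partial>lborel)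
      = (\<integral>\<^sup>+s\<in>{0..1}. e2ennreal (\<Psi> \<Phi> (deriv f s)) \<partial>lborel)" for \<Phi>
    by (intro nn_integral_cong_AE, use ae in eventually_elim) (auto simp: indicator_def)
  moreover have "emeasure SP {0..1} = 0" "emeasure SN {0..1} = 0"
    using zero[OF S(1,2) H(1) leP, of "{0..1}"] zero[OF S(3,4) H(2) leN, of "{0..1}"] S
    by (simp_all add: finite_measure.emeasure_eq_measure)
  ultimately have "rate_J \<Phi> f = rate_I \<Phi> f" for \<Phi>
    using ac f0 by (simp add: rate_J_def rate_I_def sing)
  moreover have "AE s in lborel. s \<in> {0..1} \<longrightarrow> deriv f s = h s"
    using ae by eventually_elim blast
  ultimately show ?thesis using h ft that by blast
qed

subsection \<open>The Legendre transform and discretised rates\<close>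

definition logmgf :: "(real \<Rightarrow> ennreal) \<Rightarrow> real \<Rightarrow> real" where
  "logmgf \<Phi> \<theta> = ln (enn2real (\<Phi> \<theta>))"

definition psi :: "(real \<Rightarrow> ennreal) \<Rightarrow> real \<Rightarrow> ennreal" where
  "psi \<Phi> a = e2ennreal (\<Psi> \<Phi> a)"

lemma psi_ge: "\<Phi> \<theta> < \<infinity> \<Longrightarrow> ennreal (a * \<theta> - logmgf \<Phi> \<theta>) \<le> psi \<Phi> a"
proof -
  assume "\<Phi> \<theta> < \<infinity>"
  then have "ereal (a * \<theta> - logmgf \<Phi> \<theta>) \<le> \<Psi> \<Phi> a"
    unfolding \<Psi>_def logmgf_def by (intro SUP_upper) auto
  then have "e2ennreal (ereal (a * \<theta> - logmgf \<Phi> \<theta>)) \<le> psi \<Phi> a"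
    unfolding psi_def by (rule e2ennreal_mono)
  then show ?thesis by (simp add: e2ennreal_ereal)
qed

lemma psi_least:
  assumes "\<And>\<theta>. \<Phi> \<theta> < \<infinity> \<Longrightarrow> ennreal (a * \<theta> - logmgf \<Phi> \<theta>) \<le> c"
  shows "psi \<Phi> a \<le> c"
proof -
  have "\<Psi> \<Phi> a \<le> enn2ereal c"
    unfolding \<Psi>_def
  proof (rule SUP_least)
    fix \<theta> assume "\<theta> \<in> {\<theta>. \<Phi> \<theta> < \<infinity>}"
    then have "ennreal (a * \<theta> - logmgf \<Phi> \<theta>) \<le> c" by (intro assms) simp
    then have "enn2ereal (ennreal (a * \<theta> - logmgf \<Phi> \<theta>)) \<le> enn2ereal c" by (simp add: less_eq_ennreal.rep_eq)
    moreover have "ereal (a * \<theta> - logmgf \<Phi> \<theta>) \<le> enn2ereal (ennreal (a * \<theta> - logmgf \<Phi> \<theta>))"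
      by (cases "0 \<le> a * \<theta> - logmgf \<Phi> \<theta>") (simp_all add: enn2ereal_ennreal ennreal_neg zero_ennreal.rep_eq)
    ultimately show "ereal (a * \<theta> - ln (enn2real (\<Phi> \<theta>))) \<le> enn2ereal c"
      unfolding logmgf_def by (rule order_trans[rotated])
  qed
  then have "psi \<Phi> a \<le> e2ennreal (enn2ereal c)"
    unfolding psi_def by (rule e2ennreal_mono)
  then show ?thesis by simp
qed

text \<open>Truncating each term at 0 commutes with the supremum, so \<open>psi\<close> is a
  supremum within ennreal and can be estimated exponent by exponent.\<close>

lemma psi_eq: "psi \<Phi> a = (SUP \<theta>\<in>{\<theta>. \<Phi> \<theta> < \<infinity>}. ennreal (a * \<theta> - logmgf \<Phi> \<theta>))"
  by (intro antisym psi_least SUP_least SUP_upper psi_ge) auto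

text \<open>As a supremum of continuous functions \<open>psi\<close> is lower
  semicontinuous.\<close>

lemma borel_measurable_psi [measurable]: "psi \<Phi> \<in> borel_measurable borel"
proof (rule borel_measurableI_greater)
  fix y
  have "{x \<in> space borel. y < psi \<Phi> x} = (\<Union>\<theta>\<in>{\<theta>. \<Phi> \<theta> < \<infinity>}. {x. y < ennreal (x * \<theta> - logmgf \<Phi> \<theta>)})"
    by (auto simp: psi_eq less_SUP_iff)
  also have "open \<dots>"
    by (intro open_UN ballI open_Collect_less continuous_on_ennreal continuous_intros)
  finally show "{x \<in> space borel. y < psi \<Phi> x} \<in> sets borel" by simp
qed

text \<open>The value of \<open>rate_I\<close> at the polygon with increments d over m equal cells
  (\<open>rate_I_pl\<close>): its slope in cell i is \<open>m * d i\<close>.\<close>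

definition rate :: "(real \<Rightarrow> ennreal) \<Rightarrow> nat \<Rightarrow> (nat \<Rightarrow> real) \<Rightarrow> ennreal" where
  "rate \<Phi> m d = (\<Sum>i<m. ennreal (1 / real m) * psi \<Phi> (real m * d i))"

text \<open>The clamp is the fraction of cell i to the left of s, so this is the polygon through the
  partial sums of d. Written as a sum over all cells, it can be estimated term by term.\<close>

definition pl :: "nat \<Rightarrow> (nat \<Rightarrow> real) \<Rightarrow> real \<Rightarrow> real" where
  "pl m d s = (\<Sum>i<m. d i * max 0 (min 1 (real m * s - real i)))"

lemma pl_cell:
  assumes "k < m" "real k \<le> real m * s" "real m * s \<le> real (Suc k)"
  shows "pl m d s = (\<Sum>i<k. d i) + d k * (real m * s - real k)"
proof -
  have "pl m d s = (\<Sum>i<m. if i < k then d i else if i = k then d k * (real m * s - real k) else 0)"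
    unfolding pl_def
  proof (rule sum.cong[OF refl])
    fix i assume "i \<in> {..<m}"
    consider "i < k" | "i = k" | "k < i" by linarith
    then show "d i * max 0 (min 1 (real m * s - real i)) =
      (if i < k then d i else if i = k then d k * (real m * s - real k) else 0)"
    proof cases
      case 1
      then have "real i + 1 \<le> real k" by linarith
      then show ?thesis using 1 assms by (simp add: min_def max_def)
    next
      case 2
      then show ?thesis using assms by (simp add: min_def max_def)
    next
      case 3
      then have "real k + 1 \<le> real i" by linarith
      then have "real m * s - real i \<le> 0" using assms by linarith
      then show ?thesis using 3 by (simp add: min_def max_def)
    qed
  qed
  also have "\<dots> = (\<Sum>i\<in>{..<k}. if i < k then d i else if i = k then d k * (real m * s - real k) else 0)
      + (\<Sum>i\<in>{k..<m}. if i < k then d i else if i = k then d k * (real m * s - real k) else 0)"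
    using assms(1) by (subst sum.union_disjoint[symmetric]) (auto simp: ivl_disj_un_one)
  also have "(\<Sum>i\<in>{k..<m}. if i < k then d i else if i = k then d k * (real m * s - real k) else 0)
      = (\<Sum>i\<in>{k..<m}. if i = k then d k * (real m * s - real k) else 0)"
    by (intro sum.cong) auto
  finally show ?thesis using assms(1) by simp
qed

lemma pl_0 [simp]: "pl m d 0 = 0"
  unfolding pl_def by (intro sum.neutral) (auto simp: max_def min_def)

lemma pl_1: "pl m d 1 = (\<Sum>i<m. d i)"
  unfolding pl_def by (intro sum.cong) (auto simp: max_def min_def)

lemma pl_diff_le: "\<bar>pl m d s - pl m d' s\<bar> \<le> (\<Sum>i<m. \<bar>d i - d' i\<bar>)"
proof -
  have eq: "pl m d s - pl m d' s = (\<Sum>i<m. (d i - d' i) * max 0 (min 1 (real m * s - real i)))"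
    unfolding pl_def sum_subtractf[symmetric] by (simp only: left_diff_distrib right_diff_distrib)
  have "\<bar>pl m d s - pl m d' s\<bar> \<le> (\<Sum>i<m. \<bar>(d i - d' i) * max 0 (min 1 (real m * s - real i))\<bar>)"
    unfolding eq by (rule sum_abs)
  also have "\<dots> \<le> (\<Sum>i<m. \<bar>d i - d' i\<bar>)"
    by (intro sum_mono) (auto simp: abs_mult intro!: mult_left_le)
  finally show ?thesis .
qed

lemma clamp_lipschitz: "\<bar>max 0 (min 1 x) - max 0 (min 1 y)\<bar> \<le> \<bar>x - y\<bar>" for x y :: real
  by linarith

lemma pl_lipschitz: "\<bar>pl m d s - pl m d t\<bar> \<le> (\<Sum>i<m. \<bar>d i\<bar>) * real m * \<bar>s - t\<bar>"
proof -
  have eq: "pl m d s - pl m d t = (\<Sum>i<m. d i * (max 0 (min 1 (real m * s - real i)) - max 0 (min 1 (real m * t - real i))))"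
    unfolding pl_def sum_subtractf[symmetric] by (simp only: left_diff_distrib right_diff_distrib)
  have "\<bar>pl m d s - pl m d t\<bar> \<le> (\<Sum>i<m. \<bar>d i * (max 0 (min 1 (real m * s - real i)) - max 0 (min 1 (real m * t - real i)))\<bar>)"
    unfolding eq by (rule sum_abs)
  also have "\<dots> \<le> (\<Sum>i<m. \<bar>d i\<bar> * (real m * \<bar>s - t\<bar>))"
  proof (rule sum_mono)
    fix i
    have "\<bar>max 0 (min 1 (real m * s - real i)) - max 0 (min 1 (real m * t - real i))\<bar> \<le> \<bar>(real m * s - real i) - (real m * t - real i)\<bar>"
      by (rule clamp_lipschitz)
    also have "\<dots> = real m * \<bar>s - t\<bar>"
      by (simp add: abs_mult flip: right_diff_distrib)
    finally show "\<bar>d i * (max 0 (min 1 (real m * s - real i)) - max 0 (min 1 (real m * t - real i)))\<bar> \<le> \<bar>d i\<bar> * (real m * \<bar>s - t\<bar>)"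
      by (simp add: abs_mult mult_left_mono)
  qed
  finally show ?thesis by (simp add: sum_distrib_right mult.assoc)
qed

lemma pl_abs_continuous: "abs_continuous01 (pl m d)"
  unfolding abs_continuous01_def
proof (intro allI impI)
  fix \<epsilon> :: real assume e: "\<epsilon> > 0"
  define L where "L = (\<Sum>i<m. \<bar>d i\<bar>) * real m"
  have L: "L \<ge> 0" by (simp add: L_def sum_nonneg)
  show "\<exists>\<delta>>0. \<forall>n (a :: nat \<Rightarrow> real) b.
        (\<forall>i<n. 0 \<le> a i \<and> a i \<le> b i \<and> b i \<le> 1) \<and>
        disjoint_family_on (\<lambda>i. {a i<..<b i}) {..<n} \<and>
        (\<Sum>i<n. b i - a i) < \<delta> \<longrightarrow>
        (\<Sum>i<n. \<bar>pl m d (b i) - pl m d (a i)\<bar>) < \<epsilon>"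
  proof (intro exI[of _ "\<epsilon> / (L + 1)"] conjI allI impI)
    fix n and a b :: "nat \<Rightarrow> real"
    assume A: "(\<forall>i<n. 0 \<le> a i \<and> a i \<le> b i \<and> b i \<le> 1) \<and>
        disjoint_family_on (\<lambda>i. {a i<..<b i}) {..<n} \<and> (\<Sum>i<n. b i - a i) < \<epsilon> / (L + 1)"
    have "(\<Sum>i<n. \<bar>pl m d (b i) - pl m d (a i)\<bar>) \<le> (\<Sum>i<n. L * (b i - a i))"
    proof (rule sum_mono)
      fix i assume "i \<in> {..<n}"
      then have "a i \<le> b i" using A by auto
      then show "\<bar>pl m d (b i) - pl m d (a i)\<bar> \<le> L * (b i - a i)"
        using pl_lipschitz[of m d "b i" "a i"] by (simp add: L_def)
    qed
    also have "\<dots> = L * (\<Sum>i<n. b i - a i)" by (simp add: sum_distrib_left)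
    also have "\<dots> \<le> L * (\<epsilon> / (L + 1))" using A L by (intro mult_left_mono) auto
    also have "\<dots> < \<epsilon>" using L e by (simp add: field_simps)
    finally show "(\<Sum>i<n. \<bar>pl m d (b i) - pl m d (a i)\<bar>) < \<epsilon>" .
  qed (use L e in simp)
qed

lemma AE_not_grid:
  assumes "m > 0"
  shows "AE s in lborel. \<forall>k::nat. real m * s \<noteq> real k"
proof -
  have "countable (range (\<lambda>k::nat. real k / real m))" by simp
  then have "range (\<lambda>k::nat. real k / real m) \<in> null_sets lborel" by (rule countable_imp_null_set_lborel)
  then have "AE s in lborel. s \<notin> range (\<lambda>k::nat. real k / real m)" by (rule AE_not_in)
  then show ?thesis
    by eventually_elim (use assms in \<open>auto simp: field_simps image_iff\<close>)
qed

lemma ex_cell: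
  assumes "m > 0" "0 \<le> s" "s < 1"
  obtains k where "k < m" "real k \<le> real m * s" "real m * s < real (Suc k)"
proof -
  define k where "k = nat \<lfloor>real m * s\<rfloor>"
  have ms: "0 \<le> real m * s" "real m * s < real m" using assms by auto
  have k: "real k = of_int \<lfloor>real m * s\<rfloor>" using ms by (simp add: k_def)
  have "real k \<le> real m * s" "real m * s < real (Suc k)" unfolding of_nat_Suc k by linarith+
  moreover from this have "k < m" using ms by linarith
  ultimately show ?thesis using that by blast
qed

lemma rate_I_pl:
  assumes m: "m > 0"
  shows "rate_I \<Phi> (pl m d) = rate \<Phi> m d"
proof -
  have ae: "AE s in lborel. psi \<Phi> (deriv (pl m d) s) * indicator {0..1} s =
      (\<Sum>i<m. psi \<Phi> (real m * d i) * indicator {real i / m<..<real (Suc i) / m} s)"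
    using AE_not_grid[OF m]
  proof eventually_elim
    case (elim s)
    show ?case
    proof (cases "s \<in> {0..1}")
      case True
      have "s \<noteq> 1" using elim by auto
      then obtain k where k: "k < m" "real k \<le> real m * s" "real m * s < real (Suc k)"
        using ex_cell[OF m, of s] True by auto
      have k': "real k < real m * s" using k(2) elim by (metis less_le)
      have "((\<lambda>s. (\<Sum>i<k. d i) + d k * (real m * s - real k)) has_real_derivative (real m * d k)) (at s)"
        by (auto intro!: derivative_eq_intros)
      then have "(pl m d has_real_derivative (real m * d k)) (at s)"
      proof (rule has_field_derivative_transform_within_open[where S="{real k / m<..<real (Suc k) / m}"])
        show "s \<in> {real k / m<..<real (Suc k) / m}" using k k' m by (simp add: field_simps)
        fix x assume "x \<in> {real k / m<..<real (Suc k) / m}"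
        then show "(\<Sum>i<k. d i) + d k * (real m * x - real k) = pl m d x"
          using k m by (subst pl_cell[of k]) (auto simp: field_simps)
      qed auto
      then have D: "deriv (pl m d) s = real m * d k" by (rule DERIV_imp_deriv)
      have "indicator {real i / m<..<real (Suc i) / m} s = (if i = k then 1 else 0 :: ennreal)" for i
      proof (cases "i = k")
        case True
        then show ?thesis using k k' m by (simp add: field_simps)
      next
        case False
        then consider "Suc i \<le> k" | "Suc k \<le> i" by linarith
        then show ?thesis
        proof cases
          case 1
          then have "real (Suc i) \<le> real k" by linarith
          then have "real (Suc i) / m \<le> s" using k m by (simp add: field_simps)
          then show ?thesis using False by (simp add: indicator_def)
        next
          case 2
          then have "real (Suc k) \<le> real i" by linarith
          then have "s \<le> real i / m" using k m by (simp add: field_simps)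
          then show ?thesis using False by (simp add: indicator_def)
        qed
      qed
      then show ?thesis using True k(1) by (simp add: D if_distrib[of "(*) _"] cong: if_cong)
    next
      case False
      have "indicator {real i / m<..<real (Suc i) / m} s = (0 :: ennreal)" if "i < m" for i
      proof -
        have "0 \<le> real i / m" "real (Suc i) / m \<le> 1" using m that by (auto simp: field_simps)
        then have "\<not> (real i / m < s \<and> s < real (Suc i) / m)" using False
          by (metis atLeastAtMost_iff less_imp_le order_trans)
        then show ?thesis by (simp add: indicator_def del: of_nat_Suc)
      qed
      then show ?thesis using False by simp
    qed
  qed
  have "rate_I \<Phi> (pl m d) = (\<integral>\<^sup>+s. psi \<Phi> (deriv (pl m d) s) * indicator {0..1} s \<partial>lborel)"
    by (simp add: rate_I_def pl_abs_continuous psi_def)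
  also have "\<dots> = (\<integral>\<^sup>+s. (\<Sum>i<m. psi \<Phi> (real m * d i) * indicator {real i / m<..<real (Suc i) / m} s) \<partial>lborel)"
    by (rule nn_integral_cong_AE[OF ae])
  also have "\<dots> = (\<Sum>i<m. \<integral>\<^sup>+s. psi \<Phi> (real m * d i) * indicator {real i / m<..<real (Suc i) / m} s \<partial>lborel)"
    by (rule nn_integral_sum) auto
  also have "\<dots> = rate \<Phi> m d"
    unfolding rate_def
  proof (rule sum.cong[OF refl])
    fix i
    have "real (Suc i) / m - real i / m = 1 / m" by (simp add: add_divide_distrib)
    moreover have "real i / m \<le> real (Suc i) / m" by (simp add: divide_right_mono)
    ultimately show "(\<integral>\<^sup>+s. psi \<Phi> (real m * d i) * indicator {real i / m<..<real (Suc i) / m} s \<partial>lborel)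
      = ennreal (1 / real m) * psi \<Phi> (real m * d i)"
      by (subst nn_integral_cmult_indicator) (auto simp: mult.commute)
  qed
  finally show ?thesis .
qed

lemma pl_in_BV0: "pl m d \<in> BV0"
  by (simp add: BV0_def abs_continuous01_imp_bounded_variation01 pl_abs_continuous)

lemma continuous_pl: "continuous_on UNIV (pl m d)"
  unfolding pl_def by (intro continuous_intros)

lemma pl_in_D01: "pl m d \<in> D01"
proof -
  have "isCont (pl m d) s" for s using continuous_pl by (simp add: continuous_on_eq_continuous_at)
  then show ?thesis
    unfolding D01_def isCont_def continuous_within by (auto intro: filterlim_at_split[THEN iffD1, THEN conjunct1] filterlim_at_split[THEN iffD1, THEN conjunct2])
qed

lemma pl_in_K_set: "m > 0 \<Longrightarrow> rate \<Phi> m d \<le> ennreal \<alpha> \<Longrightarrow> pl m d \<in> K_set \<Phi> \<alpha>"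
  by (simp add: K_set_def rate_I_pl pl_in_D01)

lemma pl_in_L_set:
  assumes "m > 0" "rate \<Phi> m d \<le> ennreal \<alpha>"
  shows "pl m d \<in> L_set \<Phi> \<alpha>"
proof -
  have "rate_J \<Phi> (pl m d) = rate_I \<Phi> (pl m d)"
    using abs_continuous01_integral[OF pl_abs_continuous pl_0] by blast
  then show ?thesis using assms by (simp add: L_set_def rate_I_pl pl_in_BV0)
qed

subsection \<open>Approximation of the sublevel sets by polygons\<close>

lemma ennreal_integral_le:
  fixes g :: "'b \<Rightarrow> real"
  assumes g: "integrable M g"
  shows "ennreal (\<integral>x. g x \<partial>M) \<le> (\<integral>\<^sup>+x. ennreal (g x) \<partial>M)"
proof -
  have i: "integrable M (\<lambda>x. max 0 (g x))" using g by auto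
  have "(\<integral>x. g x \<partial>M) \<le> (\<integral>x. max 0 (g x) \<partial>M)"
    by (rule integral_mono[OF g i]) simp
  then have "ennreal (\<integral>x. g x \<partial>M) \<le> ennreal (\<integral>x. max 0 (g x) \<partial>M)" by (rule ennreal_leI)
  also have "\<dots> = (\<integral>\<^sup>+x. ennreal (max 0 (g x)) \<partial>M)"
    by (rule nn_integral_eq_integral[OF i, symmetric]) simp
  also have "\<dots> = (\<integral>\<^sup>+x. ennreal (g x) \<partial>M)"
    by (intro nn_integral_cong) (auto simp: max_def ennreal_neg)
  finally show ?thesis .
qed

text \<open>The first cell is closed on the left, so that the cells partition [0,1] and an atom of
  the singular part at 0 is counted.\<close>

definition cell :: "nat \<Rightarrow> nat \<Rightarrow> real set" where
  "cell m i = (if i = 0 then {0..1 / real m} else {real i / real m<..real (Suc i) / real m})"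

lemma cell_borel [measurable, simp]: "cell m i \<in> sets borel"
  by (simp add: cell_def)

lemma cell_Suc [simp]: "cell m (Suc i) = {real (Suc i) / real m<..real (Suc (Suc i)) / real m}"
  by (simp add: cell_def)

text \<open>Stated for an arbitrary additive g because it serves the signed increments, the total
  variation and the local rates in ennreal.\<close>

lemma cells_sum:
  fixes g :: "real set \<Rightarrow> 'b :: comm_monoid_add"
  assumes add: "\<And>a b. 0 \<le> a \<Longrightarrow> a \<le> b \<Longrightarrow> g {0..b} = g {0..a} + g {a<..b}"
  shows "(\<Sum>i<Suc k. g (cell m i)) = g {0..real (Suc k) / real m}"
proof (induction k)
  case 0
  then show ?case by (simp add: cell_def)
next
  case (Suc k)
  have "(\<Sum>i<Suc (Suc k). g (cell m i)) = g {0..real (Suc k) / real m} + g (cell m (Suc k))"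
    using Suc.IH by simp
  also have "\<dots> = g {0..real (Suc (Suc k)) / real m}"
    unfolding cell_Suc by (rule add[symmetric]) (auto intro: divide_right_mono)
  finally show ?case .
qed

lemma ex_in_cell: "0 \<le> s \<Longrightarrow> s \<le> real (Suc k) / real m \<Longrightarrow> \<exists>i<Suc k. s \<in> cell m i"
proof (induction k)
  case 0
  then show ?case by (auto simp: cell_def)
next
  case (Suc k)
  show ?case
  proof (cases "s \<le> real (Suc k) / real m")
    case True
    then show ?thesis using Suc.IH Suc.prems less_SucI by blast
  next
    case False
    then have "s \<in> cell m (Suc k)" using Suc.prems by simp
    then show ?thesis by blast
  qed
qed

lemma measure_cell: "m > 0 \<Longrightarrow> measure lborel (cell m i) = 1 / real m"
  by (simp add: cell_def divide_right_mono add_divide_distrib)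

lemma emeasure_cell: "m > 0 \<Longrightarrow> emeasure lborel (cell m i) = ennreal (1 / real m)"
  by (simp add: cell_def divide_right_mono add_divide_distrib)

lemma cell_subset: "i < m \<Longrightarrow> cell m i \<subseteq> {0..1}"
proof
  fix x assume i: "i < m" and x: "x \<in> cell m i"
  have "x \<le> real (Suc i) / real m" using x by (auto simp: cell_def split: if_splits)
  also have "\<dots> \<le> 1" using i by (simp add: field_simps)
  finally have "x \<le> 1" .
  moreover have "0 \<le> x"
  proof (cases "i = 0")
    case False
    have "0 \<le> real i / real m" by simp
    also have "\<dots> \<le> x" using x False by (simp add: cell_def)
    finally show ?thesis .
  qed (use x in \<open>simp add: cell_def\<close>)
  ultimately show "x \<in> {0..1}" by simp
qed

lemma ennreal_plus_le: "ennreal (x + y) \<le> ennreal x + ennreal y"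
proof -
  have "ennreal (x + y) \<le> ennreal (max 0 x + max 0 y)" by (intro ennreal_leI) linarith
  also have "\<dots> = ennreal (max 0 x) + ennreal (max 0 y)" by (rule ennreal_plus) auto
  finally show ?thesis by (simp add: ennreal_max_0)
qed

lemma e2ennreal_ge: "ereal x \<le> y \<Longrightarrow> ennreal x \<le> e2ennreal y"
  using e2ennreal_mono[of "ereal x" y] by (simp add: e2ennreal_ereal)

text \<open>Common ground of the two sublevel sets: h is the density of the absolutely continuous
  part of the path, SP and SN are its singular parts. For \<open>K_set\<close> both are null
  measures.\<close>

locale path_density =
  fixes h :: "real \<Rightarrow> real" and SP SN :: "real measure" and \<Phi> :: "real \<Rightarrow> ennreal" and \<alpha> :: real
  assumes h [measurable]: "h \<in> borel_measurable borel" and hi: "integrable lborel h"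
    and S: "sets SP = sets borel" "finite_measure SP" "sets SN = sets borel" "finite_measure SN"
    and \<alpha>: "\<alpha> \<ge> 0"
    and R: "(\<integral>\<^sup>+s\<in>{0..1}. psi \<Phi> (h s) \<partial>lborel)
       + e2ennreal (\<theta>\<^sub>0 \<Phi>) * emeasure SP {0..1} + e2ennreal (- \<theta>\<^sub>1 \<Phi>) * emeasure SN {0..1} \<le> ennreal \<alpha>"
begin

definition inc :: "real set \<Rightarrow> real" where
  "inc B = (LBINT u:B. h u) + measure SP B - measure SN B"

definition tv :: "real set \<Rightarrow> real" where
  "tv B = (LBINT u:B. \<bar>h u\<bar>) + measure SP B + measure SN B"

lemma set_int: "integrable lborel (q :: real \<Rightarrow> real) \<Longrightarrow> B \<in> sets borel \<Longrightarrow> set_integrable lborel B q"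
  unfolding set_integrable_def by (intro integrable_mult_indicator) auto

lemma abs_inc_le: "B \<in> sets borel \<Longrightarrow> \<bar>inc B\<bar> \<le> tv B"
proof -
  assume B: "B \<in> sets borel"
  have "\<bar>LBINT u:B. h u\<bar> \<le> (LBINT u:B. \<bar>h u\<bar>)"
    using set_integral_norm_bound[OF set_int[OF hi B]] by simp
  then show ?thesis unfolding inc_def tv_def
    by (smt (verit) measure_nonneg)
qed

lemma measure_Ioc_split:
  assumes "sets m = sets borel" "finite_measure m" "(0::real) \<le> a" "a \<le> b"
  shows "measure m {0..b} = measure m {0..a} + measure m {a<..b}"
proof -
  have "{0..b} = {0..a} \<union> {a<..b}" using assms by auto
  moreover have "measure m ({0..a} \<union> {a<..b}) = measure m {0..a} + measure m {a<..b}"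
    by (rule finite_measure.finite_measure_Union) (use assms in auto)
  ultimately show ?thesis by simp
qed

lemma integral_Ioc_split:
  assumes "integrable lborel q" "(0::real) \<le> a" "a \<le> b"
  shows "(LBINT u:{0..b}. q u) = (LBINT u:{0..a}. q u) + (LBINT u:{a<..b}. (q u :: real))"
proof -
  have "{0..b} = {0..a} \<union> {a<..b}" using assms by auto
  moreover have "(LBINT u:{0..a} \<union> {a<..b}. q u) = (LBINT u:{0..a}. q u) + (LBINT u:{a<..b}. q u)"
    by (rule set_integral_Un) (use assms in \<open>auto intro!: set_int\<close>)
  ultimately show ?thesis by simp
qed

lemma inc_split:
  assumes ab: "0 \<le> a" "a \<le> b"
  shows "inc {0..b} = inc {0..a} + inc {a<..b}"
  unfolding inc_def measure_Ioc_split[OF S(1,2) ab] measure_Ioc_split[OF S(3,4) ab] integral_Ioc_split[OF hi ab]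
  by simp

lemma tv_split:
  assumes ab: "0 \<le> a" "a \<le> b"
  shows "tv {0..b} = tv {0..a} + tv {a<..b}"
  unfolding tv_def measure_Ioc_split[OF S(1,2) ab] measure_Ioc_split[OF S(3,4) ab] integral_Ioc_split[OF integrable_abs[OF hi] ab]
  by simp

lemma tv_mono:
  assumes "A \<subseteq> B" "A \<in> sets borel" "B \<in> sets borel"
  shows "tv A \<le> tv B"
proof -
  have "(LBINT u:A. \<bar>h u\<bar>) \<le> (LBINT u:B. \<bar>h u\<bar>)"
    unfolding set_lebesgue_integral_def
    using set_int[OF integrable_abs[OF hi], unfolded set_integrable_def] assms
    by (intro integral_mono) (auto simp: indicator_def)
  moreover have "measure SP A \<le> measure SP B" "measure SN A \<le> measure SN B"
    using S assms by (auto intro!: finite_measure.finite_measure_mono)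
  ultimately show ?thesis by (simp add: tv_def)
qed

text \<open>The graph of \<open>psi\<close> lies above \<open>\<theta> * \<bar>x\<bar> - L\<close>,
  and singular mass of either sign costs at least \<theta> per unit, because \<Phi> is finite at
  \<theta> and at -\<theta>. So a bound on the rate controls the variation, and a large \<theta>
  makes it small on short sets.\<close>

lemma tv_bound:
  assumes B: "B \<in> sets borel" "B \<subseteq> {0..1}"
    and \<theta>: "\<theta> > 0" "\<Phi> \<theta> < \<infinity>" "\<Phi> (- \<theta>) < \<infinity>"
    and L: "logmgf \<Phi> \<theta> \<le> L" "logmgf \<Phi> (- \<theta>) \<le> L"
  shows "\<theta> * tv B \<le> \<alpha> + L * measure lborel B"
proof -
  have fB: "emeasure lborel B < \<infinity>"
    using emeasure_mono[OF B(2), of lborel] by (simp add: le_less_trans)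
  have iB: "set_integrable lborel B (\<lambda>_. L)" using B fB by (simp add: set_integrable_def)
  have ih: "set_integrable lborel B (\<lambda>u. \<theta> * \<bar>h u\<bar>)" by (rule set_int) (use hi B in auto)
  have i: "set_integrable lborel B (\<lambda>u. \<theta> * \<bar>h u\<bar> - L)" using set_integral_diff(1)[OF ih iB] .
  have e: "(LBINT u:B. \<theta> * \<bar>h u\<bar> - L) = \<theta> * (LBINT u:B. \<bar>h u\<bar>) - L * measure lborel B"
    using set_integral_diff(2)[OF ih iB] B fB by (simp add: set_lebesgue_integral_def mult.commute)
  have psi: "ennreal (\<theta> * \<bar>x\<bar> - L) \<le> psi \<Phi> x" for x
  proof -
    have "ennreal (\<theta> * \<bar>x\<bar> - L) \<le> ennreal (x * \<theta> - logmgf \<Phi> \<theta>) \<or> ennreal (\<theta> * \<bar>x\<bar> - L) \<le> ennreal (x * - \<theta> - logmgf \<Phi> (- \<theta>))"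
      using L \<theta>(1) by (cases "x \<ge> 0") (auto simp: mult.commute intro: ennreal_leI)
    then show ?thesis using psi_ge[where \<Phi>=\<Phi> and a=x, OF \<theta>(2)] psi_ge[where \<Phi>=\<Phi> and a=x, OF \<theta>(3)]
      by (meson order_trans)
  qed
  have "ennreal (LBINT u:B. \<theta> * \<bar>h u\<bar> - L) \<le> (\<integral>\<^sup>+u. ennreal (indicator B u * (\<theta> * \<bar>h u\<bar> - L)) \<partial>lborel)"
    unfolding set_lebesgue_integral_def using ennreal_integral_le[OF i[unfolded set_integrable_def]] by simp
  also have "\<dots> \<le> (\<integral>\<^sup>+s\<in>{0..1}. psi \<Phi> (h s) \<partial>lborel)"
    using B psi by (intro nn_integral_mono) (auto simp: indicator_def)
  finally have 1: "ennreal (LBINT u:B. \<theta> * \<bar>h u\<bar> - L) \<le> (\<integral>\<^sup>+s\<in>{0..1}. psi \<Phi> (h s) \<partial>lborel)" .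
  have m: "ennreal (\<theta> * measure m B) \<le> c * emeasure m {0..1}"
    if "sets m = sets borel" "finite_measure m" "ennreal \<theta> \<le> c" for m :: "real measure" and c
  proof -
    have "ennreal (\<theta> * measure m B) = ennreal \<theta> * emeasure m B"
      using that \<theta>(1) by (simp add: finite_measure.emeasure_eq_measure ennreal_mult)
    also have "\<dots> \<le> c * emeasure m {0..1}"
      using that B by (intro mult_mono emeasure_mono) auto
    finally show ?thesis .
  qed
  have 2: "ennreal (\<theta> * measure SP B) \<le> e2ennreal (\<theta>\<^sub>0 \<Phi>) * emeasure SP {0..1}"
    by (rule m[OF S(1,2)], rule e2ennreal_ge) (use \<theta> in \<open>auto simp: \<theta>\<^sub>0_def intro!: SUP_upper\<close>)
  have "\<theta>\<^sub>1 \<Phi> \<le> ereal (- \<theta>)" using \<theta> unfolding \<theta>\<^sub>1_def by (intro INF_lower) auto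
  then have "ereal \<theta> \<le> - \<theta>\<^sub>1 \<Phi>" using ereal_minus_le_minus[of "- \<theta>\<^sub>1 \<Phi>" "ereal \<theta>"] by simp
  then have 3: "ennreal (\<theta> * measure SN B) \<le> e2ennreal (- \<theta>\<^sub>1 \<Phi>) * emeasure SN {0..1}"
    by (intro m[OF S(3,4)] e2ennreal_ge)
  have "ennreal (\<theta> * tv B - L * measure lborel B)
      = ennreal ((LBINT u:B. \<theta> * \<bar>h u\<bar> - L) + \<theta> * measure SP B + \<theta> * measure SN B)"
    by (simp add: e tv_def algebra_simps)
  also have "\<dots> \<le> ennreal (LBINT u:B. \<theta> * \<bar>h u\<bar> - L) + ennreal (\<theta> * measure SP B) + ennreal (\<theta> * measure SN B)"
    by (rule order_trans[OF ennreal_plus_le add_right_mono[OF ennreal_plus_le]])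
  also have "\<dots> \<le> ennreal \<alpha>"
    by (rule order_trans[OF add_mono[OF add_mono[OF 1 2] 3] R])
  finally show ?thesis using \<alpha> by (simp add: ennreal_le_iff)
qed

text \<open>Jensen's inequality before the supremum over the exponent is taken: for a fixed \<theta>
  the bound is linear in the increment. The singular parts fit in because \<theta> lies between
  \<open>\<theta>\<^sub>1 \<Phi>\<close> and \<open>\<theta>\<^sub>0 \<Phi>\<close>.\<close>

lemma inc_bound:
  assumes B: "B \<in> sets borel" "B \<subseteq> {0..1}" and \<theta>: "\<Phi> \<theta> < \<infinity>"
  shows "ennreal (inc B * \<theta> - logmgf \<Phi> \<theta> * measure lborel B)
    \<le> (\<integral>\<^sup>+s\<in>B. psi \<Phi> (h s) \<partial>lborel) + e2ennreal (\<theta>\<^sub>0 \<Phi>) * emeasure SP B + e2ennreal (- \<theta>\<^sub>1 \<Phi>) * emeasure SN B"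
proof -
  let ?L = "logmgf \<Phi> \<theta>"
  have fB: "emeasure lborel B < \<infinity>"
    using emeasure_mono[OF B(2), of lborel] by (simp add: le_less_trans)
  have iB: "set_integrable lborel B (\<lambda>_. ?L)" using B fB by (simp add: set_integrable_def)
  have ih: "set_integrable lborel B (\<lambda>u. h u * \<theta>)" by (rule set_int) (use hi B in auto)
  have i: "set_integrable lborel B (\<lambda>u. h u * \<theta> - ?L)" using set_integral_diff(1)[OF ih iB] .
  have e: "(LBINT u:B. h u * \<theta> - ?L) = (LBINT u:B. h u) * \<theta> - ?L * measure lborel B"
    using set_integral_diff(2)[OF ih iB] B fB by (simp add: set_lebesgue_integral_def mult.commute mult.assoc[symmetric])
  have "ennreal (LBINT u:B. h u * \<theta> - ?L) \<le> (\<integral>\<^sup>+u. ennreal (indicator B u * (h u * \<theta> - ?L)) \<partial>lborel)"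
    unfolding set_lebesgue_integral_def using ennreal_integral_le[OF i[unfolded set_integrable_def]] by simp
  also have "\<dots> \<le> (\<integral>\<^sup>+s\<in>B. psi \<Phi> (h s) \<partial>lborel)"
    using B psi_ge[where \<Phi>=\<Phi>, OF \<theta>] by (intro nn_integral_mono) (auto simp: indicator_def)
  finally have 1: "ennreal (LBINT u:B. h u * \<theta> - ?L) \<le> (\<integral>\<^sup>+s\<in>B. psi \<Phi> (h s) \<partial>lborel)" .
  have m: "ennreal (x * measure m B) \<le> c * emeasure m B"
    if "sets m = sets borel" "finite_measure m" "ennreal x \<le> c" for m :: "real measure" and c x
  proof (cases "x \<ge> 0")
    case True
    have "ennreal (x * measure m B) = ennreal x * emeasure m B"
      using that True by (simp add: finite_measure.emeasure_eq_measure ennreal_mult)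
    also have "\<dots> \<le> c * emeasure m B"
      using that by (intro mult_mono) auto
    finally show ?thesis .
  next
    case False
    then have "x * measure m B \<le> 0" by (simp add: mult_nonpos_nonneg)
    then show ?thesis by (simp add: ennreal_neg)
  qed
  have 2: "ennreal (\<theta> * measure SP B) \<le> e2ennreal (\<theta>\<^sub>0 \<Phi>) * emeasure SP B"
    by (rule m[OF S(1,2)], rule e2ennreal_ge) (use \<theta> in \<open>auto simp: \<theta>\<^sub>0_def intro!: SUP_upper\<close>)
  have "\<theta>\<^sub>1 \<Phi> \<le> ereal \<theta>" using \<theta> unfolding \<theta>\<^sub>1_def by (intro INF_lower) auto
  then have "ereal (- \<theta>) \<le> - \<theta>\<^sub>1 \<Phi>" using ereal_minus_le_minus[of "- \<theta>\<^sub>1 \<Phi>" "ereal (- \<theta>)"] by simp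
  then have 3: "ennreal (- \<theta> * measure SN B) \<le> e2ennreal (- \<theta>\<^sub>1 \<Phi>) * emeasure SN B"
    by (intro m[OF S(3,4)] e2ennreal_ge)
  have "ennreal (inc B * \<theta> - ?L * measure lborel B)
      = ennreal ((LBINT u:B. h u * \<theta> - ?L) + \<theta> * measure SP B + - \<theta> * measure SN B)"
    unfolding e inc_def by (simp add: algebra_simps)
  also have "\<dots> \<le> ennreal (LBINT u:B. h u * \<theta> - ?L) + ennreal (\<theta> * measure SP B) + ennreal (- \<theta> * measure SN B)"
    by (rule order_trans[OF ennreal_plus_le add_right_mono[OF ennreal_plus_le]])
  also have "\<dots> \<le> (\<integral>\<^sup>+s\<in>B. psi \<Phi> (h s) \<partial>lborel) + e2ennreal (\<theta>\<^sub>0 \<Phi>) * emeasure SP B + e2ennreal (- \<theta>\<^sub>1 \<Phi>) * emeasure SN B"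
    by (rule add_mono[OF add_mono[OF 1 2] 3])
  finally show ?thesis .
qed

text \<open>The supremum over \<theta> in \<open>inc_bound\<close> shows that replacing the path by
  a chord over a cell does not raise the local rate, singular mass included. The local rates add up
  to the rate of the path.\<close>

lemma rate_cells:
  assumes m: "m > 0"
  shows "rate \<Phi> m (\<lambda>i. inc (cell m i)) \<le> ennreal \<alpha>"
proof -
  let ?T = "\<lambda>B. (\<integral>\<^sup>+s\<in>B. psi \<Phi> (h s) \<partial>lborel) + e2ennreal (\<theta>\<^sub>0 \<Phi>) * emeasure SP B + e2ennreal (- \<theta>\<^sub>1 \<Phi>) * emeasure SN B"
  have em: "emeasure m {0..b} = emeasure m {0..a} + emeasure m {a<..b}"
    if "sets m = sets borel" "(0::real) \<le> a" "a \<le> b" for m a b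
  proof -
    have "{0..b} = {0..a} \<union> {a<..b}" using that by auto
    moreover have "emeasure m {0..a} + emeasure m {a<..b} = emeasure m ({0..a} \<union> {a<..b})"
      by (rule plus_emeasure) (use that in auto)
    ultimately show ?thesis by simp
  qed
  have dens: "(\<integral>\<^sup>+s\<in>B. psi \<Phi> (h s) \<partial>lborel) = emeasure (density lborel (\<lambda>s. psi \<Phi> (h s))) B"
    if "B \<in> sets borel" for B
    using that by (simp add: emeasure_density)
  have add: "?T {0..b} = ?T {0..a} + ?T {a<..b}" if "0 \<le> a" "a \<le> b" for a b
  proof -
    have "emeasure (density lborel (\<lambda>s. psi \<Phi> (h s))) {0..b} = emeasure (density lborel (\<lambda>s. psi \<Phi> (h s))) {0..a}
        + emeasure (density lborel (\<lambda>s. psi \<Phi> (h s))) {a<..b}"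
      by (rule em[OF _ that]) simp
    then show ?thesis
      unfolding em[OF S(1) that] em[OF S(3) that] by (simp add: dens distrib_left ac_simps)
  qed
  obtain k where k: "m = Suc k" using m by (cases m) auto
  have "ennreal (1 / real m) * psi \<Phi> (real m * inc (cell m i)) \<le> ?T (cell m i)" if i: "i < m" for i
  proof -
    have "psi \<Phi> (real m * inc (cell m i)) \<le> ennreal (real m) * ?T (cell m i)"
    proof (rule psi_least)
      fix \<theta> assume \<theta>: "\<Phi> \<theta> < \<infinity>"
      have "ennreal (real m * inc (cell m i) * \<theta> - logmgf \<Phi> \<theta>)
        = ennreal (real m * (inc (cell m i) * \<theta> - logmgf \<Phi> \<theta> * measure lborel (cell m i)))"
        unfolding measure_cell[OF m] using m by (simp add: right_diff_distrib mult.assoc)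
      also have "\<dots> = ennreal (real m) * ennreal (inc (cell m i) * \<theta> - logmgf \<Phi> \<theta> * measure lborel (cell m i))"
        by (rule ennreal_mult') simp
      also have "\<dots> \<le> ennreal (real m) * ?T (cell m i)"
        by (intro mult_left_mono inc_bound cell_subset i \<theta>) auto
      finally show "ennreal (real m * inc (cell m i) * \<theta> - logmgf \<Phi> \<theta>) \<le> ennreal (real m) * ?T (cell m i)" .
    qed
    then have "ennreal (1 / real m) * psi \<Phi> (real m * inc (cell m i)) \<le> ennreal (1 / real m) * (ennreal (real m) * ?T (cell m i))"
      by (rule mult_left_mono) simp
    also have "\<dots> = ennreal (1 / real m * real m) * ?T (cell m i)"
      by (subst ennreal_mult) (simp_all add: mult.assoc)
    finally show ?thesis using m by simp
  qed
  then have "rate \<Phi> m (\<lambda>i. inc (cell m i)) \<le> (\<Sum>i<m. ?T (cell m i))"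
    unfolding rate_def by (intro sum_mono) auto
  also have "\<dots> = ?T {0..real m / real m}"
    unfolding k by (rule cells_sum[of ?T, OF add])
  also have "\<dots> \<le> ennreal \<alpha>" using R m by simp
  finally show ?thesis .
qed

text \<open>Path and polygon are compared with the sum of the earlier increments, from which each
  differs by at most the variation over the current cell.\<close>

lemma inc_pl_close:
  assumes m: "m > 0" and k: "k < m" and s: "s \<in> cell m k"
  shows "\<bar>inc {0..s} - pl m (\<lambda>i. inc (cell m i)) s\<bar> \<le> 2 * tv (cell m k)"
proof -
  let ?d = "\<lambda>i. inc (cell m i)"
  have s': "real k \<le> real m * s" "real m * s \<le> real (Suc k)"
    using s m by (auto simp: cell_def field_simps split: if_splits)
  have pl: "pl m ?d s = (\<Sum>i<k. ?d i) + ?d k * (real m * s - real k)"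
    by (rule pl_cell[OF k s'])
  have "\<bar>?d k * (real m * s - real k)\<bar> \<le> \<bar>?d k\<bar>"
    unfolding abs_mult using s' by (intro mult_left_le) auto
  then have 1: "\<bar>?d k * (real m * s - real k)\<bar> \<le> tv (cell m k)"
    using abs_inc_le[of "cell m k"] by simp
  have "\<bar>inc {0..s} - (\<Sum>i<k. ?d i)\<bar> \<le> tv (cell m k)"
  proof (cases k)
    case 0
    then have "\<bar>inc {0..s} - (\<Sum>i<k. ?d i)\<bar> \<le> tv {0..s}" using abs_inc_le[of "{0..s}"] by simp
    also have "\<dots> \<le> tv (cell m k)" using s 0 by (intro tv_mono) (auto simp: cell_def)
    finally show ?thesis .
  next
    case (Suc j)
    have "(\<Sum>i<k. ?d i) = inc {0..real k / real m}"
      unfolding Suc by (rule cells_sum[of inc, OF inc_split])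
    moreover have "inc {0..s} = inc {0..real k / real m} + inc {real k / real m<..s}"
      using s Suc by (intro inc_split) auto
    ultimately have "\<bar>inc {0..s} - (\<Sum>i<k. ?d i)\<bar> \<le> tv {real k / real m<..s}"
      using abs_inc_le[of "{real k / real m<..s}"] by simp
    also have "\<dots> \<le> tv (cell m k)" using s Suc by (intro tv_mono) auto
    finally show ?thesis .
  qed
  with 1 show ?thesis unfolding pl by linarith
qed

lemma inc_cells_1: "m > 0 \<Longrightarrow> (\<Sum>i<m. inc (cell m i)) = inc {0..1}"
  using cells_sum[where g=inc and k="m - 1" and m=m, OF inc_split] by simp

lemma tv_cells_1: "m > 0 \<Longrightarrow> (\<Sum>i<m. tv (cell m i)) = tv {0..1}"
  using cells_sum[where g=tv and k="m - 1" and m=m, OF tv_split] by simp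

end

text \<open>Since the exponent is arbitrary here, \<open>tv_bound\<close> makes the variation over
  short cells small, uniformly on the sublevel set.\<close>

lemma K_set_approx:
  assumes fin: "\<And>\<theta>. \<Phi> \<theta> < \<infinity>" and \<alpha>: "\<alpha> \<ge> 0" and e: "\<epsilon> > 0"
  shows "\<forall>\<^sub>F m in sequentially. \<forall>f\<in>K_set \<Phi> \<alpha>. \<exists>d. rate \<Phi> m d \<le> ennreal \<alpha> \<and> d_unif f (pl m d) \<le> \<epsilon>"
proof -
  \<comment> \<open>This makes \<open>\<alpha> / \<theta>\<close> at most
    \<open>\<epsilon> / 4\<close>; the choice of m makes \<open>L / (m * \<theta>)\<close> at most
    \<open>\<epsilon> / 4\<close>. So twice the variation over a cell is at most \<epsilon>.\<close>
  define \<theta> where "\<theta> = 4 * \<alpha> / \<epsilon> + 1"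
  have \<theta>: "\<theta> > 0" "4 * \<alpha> \<le> \<epsilon> * \<theta>" using \<alpha> e by (auto simp: \<theta>_def field_simps add_pos_nonneg)
  define L where "L = max 0 (max (logmgf \<Phi> \<theta>) (logmgf \<Phi> (- \<theta>)))"
  have L: "L \<ge> 0" "logmgf \<Phi> \<theta> \<le> L" "logmgf \<Phi> (- \<theta>) \<le> L" by (auto simp: L_def)
  have "\<forall>\<^sub>F m in sequentially. 4 * L / (\<epsilon> * \<theta>) < real m"
    by (intro filterlim_real_sequentially[THEN filterlim_at_top_dense[THEN iffD1], rule_format])
  moreover have "\<forall>\<^sub>F m::nat in sequentially. m > 0" by (rule eventually_gt_at_top)
  ultimately show ?thesis
  proof eventually_elim
    case (elim m)
    show ?case
    proof
      fix f assume "f \<in> K_set \<Phi> \<alpha>"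
      then have r: "rate_I \<Phi> f \<le> ennreal \<alpha>" by (simp add: K_set_def)
      then have ac: "abs_continuous01 f" and f0: "f 0 = 0"
        by (auto simp: rate_I_def top_unique split: if_splits)
      obtain h where h: "h \<in> borel_measurable borel" "integrable lborel h"
        and f: "\<And>t. t \<in> {0..1} \<Longrightarrow> f t = (LBINT u:{0..t}. h u)"
        and ae: "AE s in lborel. s \<in> {0..1} \<longrightarrow> deriv f s = h s"
        and "\<And>\<Phi>. rate_J \<Phi> f = rate_I \<Phi> f"
        using abs_continuous01_integral[OF ac f0] by blast
      have "rate_I \<Phi> f = (\<integral>\<^sup>+s\<in>{0..1}. psi \<Phi> (deriv f s) \<partial>lborel)"
        using ac f0 by (simp add: rate_I_def psi_def)
      also have "\<dots> = (\<integral>\<^sup>+s\<in>{0..1}. psi \<Phi> (h s) \<partial>lborel)"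
        by (intro nn_integral_cong_AE, use ae in eventually_elim) (auto simp: indicator_def)
      finally have "(\<integral>\<^sup>+s\<in>{0..1}. psi \<Phi> (h s) \<partial>lborel) \<le> ennreal \<alpha>" using r by simp
      moreover have "finite_measure (null_measure (borel :: real measure))" by (rule finite_measureI) simp
      ultimately interpret path_density h "null_measure borel" "null_measure borel" \<Phi> \<alpha>
        by (intro path_density.intro) (simp_all add: h \<alpha>)
      have fi: "f t = inc {0..t}" if "t \<in> {0..1}" for t
        using f[OF that] by (simp add: inc_def measure_def)
      define d where "d i = inc (cell m i)" for i
      have "rate \<Phi> m d \<le> ennreal \<alpha>" unfolding d_def by (rule rate_cells) (use elim in simp)
      moreover have "d_unif f (pl m d) \<le> \<epsilon>"
        unfolding d_unif_def
      proof (rule cSUP_least)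
        fix s :: real assume s: "s \<in> {0..1}"
        obtain k where k: "k < m" "s \<in> cell m k"
          using ex_in_cell[of s "m - 1" m] s elim by auto
        have "\<theta> * tv (cell m k) \<le> \<alpha> + L * measure lborel (cell m k)"
          by (rule tv_bound) (use fin L \<theta> cell_subset[OF k(1)] in auto)
        also have "\<dots> = \<alpha> + L / real m" using elim by (simp add: measure_cell)
        finally have "4 * \<theta> * tv (cell m k) \<le> \<epsilon> * \<theta> + 4 * L / real m" using \<theta>(2) by simp
        also have "4 * L / real m \<le> \<epsilon> * \<theta>" using elim e \<theta> by (simp add: field_simps)
        finally have "\<theta> * (4 * tv (cell m k)) \<le> \<theta> * (2 * \<epsilon>)" by simp
        then have "2 * tv (cell m k) \<le> \<epsilon>" using \<theta>(1) by (simp add: mult_le_cancel_left)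
        then show "\<bar>f s - pl m d s\<bar> \<le> \<epsilon>"
          using inc_pl_close[OF _ k] elim fi[OF s] unfolding d_def by fastforce
      qed simp
      ultimately show "\<exists>d. rate \<Phi> m d \<le> ennreal \<alpha> \<and> d_unif f (pl m d) \<le> \<epsilon>" by blast
    qed
  qed
qed

text \<open>f need not be right-continuous, but it differs from its right limits at countably many
  points only, which the integral in \<open>d_hyb\<close> does not see.\<close>

lemma BV0_AE_isCont:
  assumes "f \<in> BV0"
  shows "AE s in lborel. s \<in> {0<..<1} \<longrightarrow> isCont f s"
proof -
  have bv: "bounded_variation01 f" using assms by (simp add: BV0_def)
  obtain v where v: "\<And>s t. 0 \<le> s \<Longrightarrow> s \<le> t \<Longrightarrow> t \<le> 1 \<Longrightarrow> v s + \<bar>f t - f s\<bar> \<le> v t"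
    using bounded_variation01_split[OF bv] by blast
  have v1: "v s \<le> v t" and v2: "v s - f s \<le> v t - f t" if "0 \<le> s" "s \<le> t" "t \<le> 1" for s t
    using v[OF that] by linarith+
  have m1: "mono_on {0<..<1} v" and m2: "mono_on {0<..<1} (\<lambda>t. v t - f t)"
    by (intro mono_onI v1 v2; simp)+
  have "countable ({a \<in> {0<..<1}. \<not> isCont v a} \<union> {a \<in> {0<..<1}. \<not> isCont (\<lambda>t. v t - f t) a})"
    by (intro countable_Un mono_on_ctble_discont_open m1 m2) auto
  then have "{a \<in> {0<..<1}. \<not> isCont v a} \<union> {a \<in> {0<..<1}. \<not> isCont (\<lambda>t. v t - f t) a} \<in> null_sets lborel"
    by (rule countable_imp_null_set_lborel)
  then have "AE s in lborel. s \<notin> {a \<in> {0<..<1}. \<not> isCont v a} \<union> {a \<in> {0<..<1}. \<not> isCont (\<lambda>t. v t - f t) a}"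
    by (rule AE_not_in)
  then show ?thesis
  proof eventually_elim
    case (elim s)
    show ?case
    proof
      assume "s \<in> {0<..<1}"
      then have "isCont v s" "isCont (\<lambda>t. v t - f t) s" using elim by auto
      then have "isCont (\<lambda>t. v t - (v t - f t)) s" by (rule isCont_diff)
      then show "isCont f s" by simp
    qed
  qed
qed

text \<open>The variation over a single cell may stay large here. But the integral weights it by
  \<open>1 / m\<close>, so the total variation, which is bounded on the sublevel set, gets divided
  by m; and path and polygon agree at 1.\<close>

lemma L_set_approx:
  assumes \<theta>: "\<theta> > 0" "\<Phi> \<theta> < \<infinity>" "\<Phi> (- \<theta>) < \<infinity>" and \<alpha>: "\<alpha> \<ge> 0" and e: "\<epsilon> > 0"
  shows "\<forall>\<^sub>F m in sequentially. \<forall>f\<in>L_set \<Phi> \<alpha>. \<exists>d. rate \<Phi> m d \<le> ennreal \<alpha> \<and> d_hyb f (pl m d) \<le> \<epsilon>"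
proof -
  define L where "L = max 0 (max (logmgf \<Phi> \<theta>) (logmgf \<Phi> (- \<theta>)))"
  have L: "L \<ge> 0" "logmgf \<Phi> \<theta> \<le> L" "logmgf \<Phi> (- \<theta>) \<le> L" by (auto simp: L_def)
  have "\<forall>\<^sub>F m in sequentially. 2 * (\<alpha> + L) / (\<epsilon> * \<theta>) < real m"
    by (intro filterlim_real_sequentially[THEN filterlim_at_top_dense[THEN iffD1], rule_format])
  moreover have "\<forall>\<^sub>F m::nat in sequentially. m > 0" by (rule eventually_gt_at_top)
  ultimately show ?thesis
  proof eventually_elim
    case (elim m)
    show ?case
    proof
      fix f assume "f \<in> L_set \<Phi> \<alpha>"
      then have r: "rate_J \<Phi> f \<le> ennreal \<alpha>" and f: "f \<in> BV0" by (auto simp: L_set_def)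
      obtain h :: "real \<Rightarrow> real" and SP SN where h: "h \<in> borel_measurable borel" "integrable lborel h"
        and S: "sets SP = sets borel" "finite_measure SP" "sets SN = sets borel" "finite_measure SN"
        and lim: "\<And>t. t \<in> {0..<1} \<Longrightarrow>
          (f \<longlongrightarrow> (LBINT u:{0..t}. h u) + measure SP {0..t} - measure SN {0..t}) (at_right t)"
        and f1: "f 1 = (LBINT u:{0..1}. h u) + measure SP {0..1} - measure SN {0..1}"
        and J: "\<And>\<Phi>. rate_J \<Phi> f = (\<integral>\<^sup>+s\<in>{0..1}. e2ennreal (\<Psi> \<Phi> (h s)) \<partial>lborel)
           + e2ennreal (\<theta>\<^sub>0 \<Phi>) * emeasure SP {0..1} + e2ennreal (- \<theta>\<^sub>1 \<Phi>) * emeasure SN {0..1}"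
        using rate_J_eq[OF f] by blast
      interpret path_density h SP SN \<Phi> \<alpha>
        using r by (intro path_density.intro) (simp_all add: h S \<alpha> J psi_def)
      define d where "d i = inc (cell m i)" for i
      have rd: "rate \<Phi> m d \<le> ennreal \<alpha>" unfolding d_def by (rule rate_cells) (use elim in simp)
      have "AE s in lborel. s \<noteq> (0::real)" "AE s in lborel. s \<noteq> (1::real)" by (rule AE_lborel_singleton)+
      with BV0_AE_isCont[OF f]
      have ae: "AE s in lborel. s \<in> {0..1} \<longrightarrow> f s = inc {0..s}"
      proof eventually_elim
        case (elim s)
        show ?case
        proof
          assume "s \<in> {0..1}"
          with elim have s: "0 < s" "s < 1" "isCont f s" by auto
          have "(f \<longlongrightarrow> f s) (at_right s)" using s(3) unfolding isCont_def by (rule filterlim_at_split[THEN iffD1, THEN conjunct2])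
          moreover have "(f \<longlongrightarrow> inc {0..s}) (at_right s)" unfolding inc_def by (rule lim) (use s in auto)
          ultimately show "f s = inc {0..s}" by (intro tendsto_unique[of "at_right s"]) auto
        qed
      qed
      \<comment> \<open>A step function above the distance to the polygon, with integral
        \<open>2 * tv {0..1} / m\<close>.\<close>
      let ?g = "\<lambda>s. \<Sum>k<m. 2 * tv (cell m k) * indicator (cell m k) s"
      have tv0: "0 \<le> tv B" if "B \<in> sets borel" for B using abs_inc_le[OF that] by linarith
      have ig: "integrable lborel ?g"
        using elim by (intro Bochner_Integration.integrable_sum integrable_mult_right integrable_real_indicator)
           (auto simp: emeasure_cell)
      have "(LBINT u:{0..1}. \<bar>f u - pl m d u\<bar>) \<le> (\<integral>u. ?g u \<partial>lborel)"
        unfolding set_lebesgue_integral_def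
      proof (rule integral_mono_AE'[OF ig])
        show "AE u in lborel. indicat_real {0..1} u *\<^sub>R \<bar>f u - pl m d u\<bar> \<le> ?g u"
          using ae
        proof eventually_elim
          case (elim u)
          show ?case
          proof (cases "u \<in> {0..1}")
            case True
            obtain k where k: "k < m" "u \<in> cell m k"
              using ex_in_cell[of u "m - 1" m] True \<open>m > 0\<close> by auto
            have "\<bar>f u - pl m d u\<bar> \<le> 2 * tv (cell m k) * indicator (cell m k) u"
              using inc_pl_close[OF \<open>m > 0\<close> k] elim True k(2) unfolding d_def by simp
            also have "\<dots> \<le> ?g u"
              by (rule member_le_sum) (use k tv0 in auto)
            finally show ?thesis using True by simp
          qed (use tv0 in \<open>auto intro!: sum_nonneg\<close>)
        qed
        show "AE u in lborel. 0 \<le> ?g u" using tv0 by (auto intro!: sum_nonneg)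
      qed
      also have "(\<integral>u. ?g u \<partial>lborel) = (\<Sum>k<m. \<integral>u. 2 * tv (cell m k) * indicator (cell m k) u \<partial>lborel)"
        using elim by (intro Bochner_Integration.integral_sum integrable_mult_right integrable_real_indicator)
           (auto simp: emeasure_cell)
      also have "\<dots> = (\<Sum>k<m. 2 * tv (cell m k) / real m)"
        using elim by (simp add: measure_cell)
      also have "\<dots> = 2 * tv {0..1} / real m"
        using elim by (simp add: tv_cells_1[symmetric] sum_divide_distrib sum_distrib_left)
      also have "\<dots> \<le> \<epsilon>"
      proof -
        have "\<theta> * tv {0..1} \<le> \<alpha> + L * measure lborel {0..1::real}"
          by (rule tv_bound) (use \<theta> L in auto)
        moreover have "2 * (\<alpha> + L) \<le> \<epsilon> * \<theta> * real m" using elim e \<theta>(1) by (simp add: field_simps)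
        ultimately have "2 * (\<theta> * tv {0..1}) \<le> \<epsilon> * \<theta> * real m" by simp
        then have "\<theta> * (2 * tv {0..1}) \<le> \<theta> * (\<epsilon> * real m)" by (simp add: ac_simps)
        then have "2 * tv {0..1} \<le> \<epsilon> * real m" using \<theta>(1) by (simp add: mult_le_cancel_left)
        then show ?thesis using elim by (simp add: field_simps)
      qed
      finally have "(LBINT u:{0..1}. \<bar>f u - pl m d u\<bar>) \<le> \<epsilon>" .
      moreover have "f 1 = pl m d 1"
        using f1 inc_cells_1[of m] elim by (simp add: pl_1 d_def inc_def)
      ultimately have "d_hyb f (pl m d) \<le> \<epsilon>" by (simp add: d_hyb_def)
      with rd show "\<exists>d. rate \<Phi> m d \<le> ennreal \<alpha> \<and> d_hyb f (pl m d) \<le> \<epsilon>" by blast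
    qed
  qed
qed

subsection \<open>Exponential tilting of truncated variables\<close>

lemma exp_le_quadratic:
  fixes u :: real assumes "\<bar>u\<bar> \<le> 1" shows "exp u \<le> 1 + u + u\<^sup>2"
proof (cases "u \<ge> 0")
  case True
  then show ?thesis using exp_bound[of u] assms by simp
next
  case False
  have "1 - u \<le> exp (- u)" using exp_ge_add_one_self[of "- u"] by simp
  then have "exp u \<le> 1 / (1 - u)" using False by (simp add: exp_minus field_simps)
  also have "\<dots> \<le> 1 + u + u\<^sup>2"
  proof -
    have "u * u\<^sup>2 \<le> 0" using False by (intro mult_nonpos_nonneg) auto
    then have "1 \<le> (1 + u + u\<^sup>2) * (1 - u)" by (simp add: algebra_simps power2_eq_square)
    then show ?thesis using False by (simp add: field_simps)
  qed
  finally show ?thesis .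
qed

context prob_space
begin

text \<open>Truncation keeps this finite and continuous in l even where the moment generating
  function of Y is infinite.\<close>

definition trunc_mgf :: "('a \<Rightarrow> real) \<Rightarrow> real \<Rightarrow> real \<Rightarrow> real" where
  "trunc_mgf Y R l = (\<integral>\<omega>. indicator {-R..R} (Y \<omega>) * exp (l * Y \<omega>) \<partial>M)"

lemma trunc_exp_bound: "\<bar>indicator {-R..R} y * exp (l * y)\<bar> \<le> exp (\<bar>l\<bar> * R)" for y l R :: real
proof (cases "\<bar>y\<bar> \<le> R")
  case True
  then have "\<bar>l * y\<bar> \<le> \<bar>l\<bar> * R" by (simp add: abs_mult mult_left_mono)
  then have "l * y \<le> \<bar>l\<bar> * R" by simp
  then show ?thesis by (simp add: indicator_def)
qed (auto simp: indicator_def)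

lemma trunc_integrable:
  assumes [measurable]: "Y \<in> borel_measurable M"
  shows "integrable M (\<lambda>\<omega>. indicator {-R..R} (Y \<omega>) * exp (l * Y \<omega>) :: real)"
  by (rule integrable_const_bound[where B="exp (\<bar>l\<bar> * R)"]) (use trunc_exp_bound in auto)

lemma trunc_mgf_tendsto:
  assumes [measurable]: "Y \<in> borel_measurable M" and l: "(f \<longlongrightarrow> l) sequentially"
  shows "(\<lambda>n. trunc_mgf Y R (f n)) \<longlonglongrightarrow> trunc_mgf Y R l"
proof -
  obtain B where B: "\<And>n. \<bar>f n\<bar> \<le> B"
    using convergent_imp_Bseq[OF convergentI[OF l]] by (auto simp: Bseq_def)
  have *: "\<bar>f n\<bar> * R \<le> B * \<bar>R\<bar>" for n
  proof -
    have "\<bar>f n\<bar> * R \<le> \<bar>f n\<bar> * \<bar>R\<bar>" by (rule mult_left_mono) auto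
    also have "\<dots> \<le> B * \<bar>R\<bar>" by (rule mult_right_mono[OF B]) simp
    finally show ?thesis .
  qed
  show ?thesis
    unfolding trunc_mgf_def
  proof (rule integral_dominated_convergence[where w="\<lambda>_. exp (B * \<bar>R\<bar>)"])
    show "AE \<omega> in M. (\<lambda>n. indicator {-R..R} (Y \<omega>) * exp (f n * Y \<omega>)) \<longlonglongrightarrow> indicator {-R..R} (Y \<omega>) * exp (l * Y \<omega>)"
      by (intro AE_I2 tendsto_intros l)
    show "AE \<omega> in M. norm (indicator {-R..R} (Y \<omega>) * exp (f n * Y \<omega>)) \<le> exp (B * \<bar>R\<bar>)" for n
      using trunc_exp_bound[of R _ "f n"] * by (auto intro: order_trans)
  qed auto
qed

text \<open>The stationarity condition at a minimum, without differentiation: by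
  \<open>exp_le_quadratic\<close> a small step t in l changes the value by at most
  \<open>t * a + t\<^sup>2 * b\<close>, and this is nonnegative for all small t only if a is
  0.\<close>

lemma tilting_min:
  assumes Y[measurable]: "Y \<in> borel_measurable M" and R: "R \<ge> 0"
    and min: "\<And>l'. trunc_mgf Y R l \<le> trunc_mgf Y R l'"
  shows "(\<integral>\<omega>. Y \<omega> * (indicator {-R..R} (Y \<omega>) * exp (l * Y \<omega>)) \<partial>M) = 0"
proof -
  define w where "w \<omega> = indicator {-R..R} (Y \<omega>) * exp (l * Y \<omega>)" for \<omega>
  have w0: "0 \<le> w \<omega>" for \<omega> by (simp add: w_def)
  have [measurable]: "w \<in> borel_measurable M" unfolding w_def by measurable
  have wb: "\<bar>w \<omega>\<bar> \<le> exp (\<bar>l\<bar> * R)" for \<omega> using trunc_exp_bound[of R "Y \<omega>" l] by (simp add: w_def)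
  have wi: "integrable M w" unfolding w_def by (rule trunc_integrable[OF Y])
  have wz: "w \<omega> = 0" if "\<bar>Y \<omega>\<bar> > R" for \<omega> using that by (auto simp: w_def indicator_def)
  have yb: "\<bar>Y \<omega> ^ k * w \<omega>\<bar> \<le> R ^ k * exp (\<bar>l\<bar> * R)" for \<omega> k
  proof (cases "\<bar>Y \<omega>\<bar> \<le> R")
    case True
    then show ?thesis using wb[of \<omega>] R by (auto simp: abs_mult power_abs intro!: mult_mono power_mono)
  qed (use wz[of \<omega>] R in auto)
  have yi: "integrable M (\<lambda>\<omega>. Y \<omega> ^ k * w \<omega>)" for k
    by (rule integrable_const_bound[where B="R ^ k * exp (\<bar>l\<bar> * R)"]) (use yb in auto)
  define a where "a = (\<integral>\<omega>. Y \<omega> * w \<omega> \<partial>M)"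
  define b where "b = (\<integral>\<omega>. Y \<omega> ^ 2 * w \<omega> \<partial>M)"
  have b0: "0 \<le> b" unfolding b_def by (intro integral_nonneg_AE) (auto simp: w0)
  have yi1: "integrable M (\<lambda>\<omega>. Y \<omega> * w \<omega>)" using yi[of 1] by simp
  have key: "0 \<le> t * a + t\<^sup>2 * b" if t: "\<bar>t\<bar> * R \<le> 1" for t
  proof -
    have "trunc_mgf Y R (l + t) \<le> (\<integral>\<omega>. w \<omega> + (t * (Y \<omega> * w \<omega>) + t\<^sup>2 * (Y \<omega> ^ 2 * w \<omega>)) \<partial>M)"
      unfolding trunc_mgf_def
    proof (rule integral_mono)
      show "integrable M (\<lambda>\<omega>. indicator {-R..R} (Y \<omega>) * exp ((l + t) * Y \<omega>))" by (rule trunc_integrable[OF Y])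
      show "integrable M (\<lambda>\<omega>. w \<omega> + (t * (Y \<omega> * w \<omega>) + t\<^sup>2 * (Y \<omega> ^ 2 * w \<omega>)))"
        using wi yi1 yi by auto
      fix \<omega>
      show "indicator {-R..R} (Y \<omega>) * exp ((l + t) * Y \<omega>) \<le> w \<omega> + (t * (Y \<omega> * w \<omega>) + t\<^sup>2 * (Y \<omega> ^ 2 * w \<omega>))"
      proof (cases "\<bar>Y \<omega>\<bar> \<le> R")
        case True
        have "\<bar>t * Y \<omega>\<bar> \<le> \<bar>t\<bar> * R" using True by (simp add: abs_mult mult_left_mono)
        then have "exp (t * Y \<omega>) \<le> 1 + t * Y \<omega> + (t * Y \<omega>)\<^sup>2" using t by (intro exp_le_quadratic) simp
        then have "w \<omega> * exp (t * Y \<omega>) \<le> w \<omega> * (1 + t * Y \<omega> + (t * Y \<omega>)\<^sup>2)" by (rule mult_left_mono) (rule w0)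
        then show ?thesis
          by (simp add: w_def distrib_right exp_add mult.assoc) (simp add: algebra_simps power_mult_distrib)
      qed (auto simp: w_def indicator_def)
    qed
    also have "\<dots> = trunc_mgf Y R l + (t * a + t\<^sup>2 * b)"
      using wi yi1 yi by (simp add: a_def b_def trunc_mgf_def w_def[symmetric])
    finally show ?thesis using min[of "l + t"] by simp
  qed
  have "a = 0"
  proof (rule ccontr)
    assume a: "a \<noteq> 0"
    \<comment> \<open>s keeps the step within the range of the quadratic bound,
      \<open>s * R \<le> 1\<close>; the second entry of the minimum in q makes \<open>q * b\<close>
      smaller than the absolute value of a.\<close>
    define s where "s = 1 / (1 + R + 2 * b + \<bar>a\<bar>)"
    define q where "q = min s (\<bar>a\<bar> / (2 * (b + 1)))"
    have s: "0 < s" "s * R \<le> 1" using R b0 by (auto simp: s_def field_simps)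
    have q: "0 < q" using s a b0 by (simp add: q_def add_nonneg_pos)
    have "q * R \<le> s * R" by (rule mult_right_mono) (use R in \<open>simp_all add: q_def\<close>)
    then have qR: "q * R \<le> 1" using s by simp
    have "0 \<le> (- sgn a * q) * a + (- sgn a * q)\<^sup>2 * b"
      by (rule key) (use q qR a in \<open>simp add: abs_mult abs_sgn_eq\<close>)
    also have "\<dots> = - q * \<bar>a\<bar> + q\<^sup>2 * b" using a by (simp add: sgn_if power_mult_distrib)
    finally have "q * \<bar>a\<bar> \<le> q * (q * b)" by (simp add: power2_eq_square mult.assoc)
    then have "\<bar>a\<bar> \<le> q * b" using q by (simp add: mult_le_cancel_left)
    also have "\<dots> \<le> \<bar>a\<bar> / (2 * (b + 1)) * b" unfolding q_def using b0 by (intro mult_right_mono) auto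
    also have "\<dots> < \<bar>a\<bar>" using a mult_nonneg_nonneg[OF b0 abs_ge_zero[of a]] b0 by (simp add: field_simps add_nonneg_pos)
    finally show False by simp
  qed
  then show ?thesis by (simp add: a_def w_def)
qed

text \<open>p bounds the moment generating function of Y from below at every exponent. If Y has mass
  on both sides of 0, the truncated functions are coercive uniformly in R, so their minimisers stay
  in a compact set. Were all minima below p', monotone convergence at a cluster point of minimisers
  would bring the full function down to p' there. At a minimiser the tilted mean is 0 by
  \<open>tilting_min\<close>.\<close>

lemma tilting:
  assumes Y[measurable]: "Y \<in> borel_measurable M"
    and p: "\<And>l. ennreal p \<le> (\<integral>\<^sup>+\<omega>. ennreal (exp (l * Y \<omega>)) \<partial>M)" and p': "0 < p'" "p' < p"
  obtains R l where "R \<ge> 0" "p' \<le> trunc_mgf Y R l"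
    "(\<integral>\<omega>. Y \<omega> * (indicator {-R..R} (Y \<omega>) * exp (l * Y \<omega>)) \<partial>M) = 0"
proof -
  note result = that
  \<comment> \<open>If Y keeps to one side of 0, its moment generating function decreases to the
    probability of \<open>Y = 0\<close> as the exponent grows in the right direction, so that R = 0
    and l = 0 do.\<close>
  have one_sided: ?thesis if s: "s = 1 \<or> s = -1" and Y0: "AE \<omega> in M. s * Y \<omega> \<le> 0" for s :: real
  proof -
    have lim: "(\<lambda>n. \<integral>\<omega>. exp (real n * (s * Y \<omega>)) \<partial>M) \<longlonglongrightarrow> (\<integral>\<omega>. indicator {0..0} (Y \<omega>) \<partial>M)"
    proof (rule integral_dominated_convergence[where w="\<lambda>_. 1"])
      show "AE \<omega> in M. (\<lambda>n. exp (real n * (s * Y \<omega>))) \<longlonglongrightarrow> indicat_real {0..0} (Y \<omega>)"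
        using Y0
      proof eventually_elim
        case (elim \<omega>)
        show ?case
        proof (cases "Y \<omega> = 0")
          case False
          then have sY: "s * Y \<omega> < 0" using elim s by auto
          have "(\<lambda>n. exp (s * Y \<omega>) ^ n) \<longlonglongrightarrow> 0" by (rule LIMSEQ_power_zero) (use sY in simp)
          then show ?thesis using False by (simp add: exp_of_nat_mult)
        qed simp
      qed
      show "AE \<omega> in M. norm (exp (real n * (s * Y \<omega>))) \<le> 1" for n
        using Y0 by eventually_elim (simp add: mult_nonneg_nonpos)
    qed auto
    have ge: "p \<le> (\<integral>\<omega>. exp (real n * (s * Y \<omega>)) \<partial>M)" for n
    proof -
      have i: "integrable M (\<lambda>\<omega>. exp (real n * (s * Y \<omega>)))"
        by (rule integrable_const_bound[where B=1], use Y0 in eventually_elim) (auto simp: mult_nonneg_nonpos)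
      have "ennreal p \<le> (\<integral>\<^sup>+\<omega>. ennreal (exp (real n * s * Y \<omega>)) \<partial>M)" by (rule p)
      also have "\<dots> = ennreal (\<integral>\<omega>. exp (real n * (s * Y \<omega>)) \<partial>M)"
        by (subst nn_integral_eq_integral[OF i, symmetric]) (auto simp: mult.assoc)
      finally show ?thesis by (simp add: ennreal_le_iff integral_nonneg_AE)
    qed
    have "p \<le> (\<integral>\<omega>. indicator {0..0} (Y \<omega>) \<partial>M)"
      by (rule LIMSEQ_le_const[OF lim]) (use ge in auto)
    also have "(\<integral>\<omega>. indicator {0..0} (Y \<omega>) \<partial>M) = trunc_mgf Y 0 0" by (simp add: trunc_mgf_def)
    finally have "p' \<le> trunc_mgf Y 0 0" using p' by simp
    moreover have "(\<integral>\<omega>. Y \<omega> * (indicator {-0..0} (Y \<omega>) * exp (0 * Y \<omega>)) \<partial>M) = 0"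
      by (rule integral_eq_zero_AE) (auto simp: indicator_def)
    ultimately show ?thesis using result[of 0 0] by simp
  qed
  show ?thesis
  proof (cases "(AE \<omega> in M. Y \<omega> \<le> 0) \<or> (AE \<omega> in M. - Y \<omega> \<le> 0)")
    case True
    then show ?thesis using one_sided[of 1] one_sided[of "-1"] by auto
  next
    case False
    \<comment> \<open>Quantitative form of having mass on one side: the events \<open>A n\<close>
      exhaust \<open>0 < s * Y\<close>, so their probabilities cannot all be tiny.\<close>
    have pos: "\<exists>k>0. k \<le> prob {\<omega>\<in>space M. k \<le> s * Y \<omega> \<and> s * Y \<omega> \<le> 1 / k}"
      if nz: "\<not> (AE \<omega> in M. s * Y \<omega> \<le> 0)" for s :: real
    proof (rule ccontr)
      assume neg: "\<not> ?thesis"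
      define A where "A n = {\<omega>\<in>space M. 1 / real (Suc n) \<le> s * Y \<omega> \<and> s * Y \<omega> \<le> real (Suc n)}" for n
      have A[measurable]: "A n \<in> events" for n unfolding A_def by measurable
      have inc: "incseq A"
      proof (rule incseq_SucI)
        fix n
        have "1 / real (Suc (Suc n)) \<le> 1 / real (Suc n)" by (intro divide_left_mono) auto
        then show "A n \<le> A (Suc n)" unfolding A_def by auto
      qed
      have A_lt: "prob (A n) < 1 / real (Suc n)" for n
      proof -
        have "\<not> (1 / real (Suc n) \<le> prob (A n))" using neg[simplified, rule_format, of "1 / real (Suc n)"]
          by (simp add: A_def)
        then show ?thesis by simp
      qed
      have "(\<lambda>n. prob (A n)) \<longlonglongrightarrow> prob (\<Union>n. A n)"
        by (rule finite_Lim_measure_incseq) (use inc in auto)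
      moreover have "(\<lambda>n. prob (A n)) \<longlonglongrightarrow> 0"
      proof (rule tendsto_sandwich[of "\<lambda>_. 0" _ _ "\<lambda>n. 1 / real (Suc n)"])
        show "(\<lambda>n. 1 / real (Suc n)) \<longlonglongrightarrow> 0" using LIMSEQ_inverse_real_of_nat by (simp add: divide_inverse)
      qed (use A_lt in \<open>auto intro!: always_eventually less_imp_le\<close>)
      ultimately have "prob (\<Union>n. A n) = 0" by (rule LIMSEQ_unique)
      moreover have "(\<Union>n. A n) = {\<omega>\<in>space M. 0 < s * Y \<omega>}"
      proof (intro set_eqI iffI)
        fix \<omega> assume "\<omega> \<in> (\<Union>n. A n)"
        then obtain n where "\<omega> \<in> space M" "1 / real (Suc n) \<le> s * Y \<omega>" by (auto simp: A_def)
        moreover have "0 < 1 / real (Suc n)" by simp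
        ultimately show "\<omega> \<in> {\<omega>\<in>space M. 0 < s * Y \<omega>}" by (metis (mono_tags, lifting) less_le_trans mem_Collect_eq)
      next
        fix \<omega> assume \<omega>: "\<omega> \<in> {\<omega>\<in>space M. 0 < s * Y \<omega>}"
        then obtain n1 where n1: "inverse (real (Suc n1)) < s * Y \<omega>" using reals_Archimedean by blast
        obtain n2 where n2: "s * Y \<omega> \<le> real n2" using real_arch_simple by blast
        have "1 / real (Suc (max n1 n2)) \<le> 1 / real (Suc n1)" by (intro divide_left_mono) auto
        also have "1 / real (Suc n1) \<le> s * Y \<omega>" using n1 by (simp add: divide_inverse)
        finally have "1 / real (Suc (max n1 n2)) \<le> s * Y \<omega>" .
        moreover have "s * Y \<omega> \<le> real (Suc (max n1 n2))" using n2 by simp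
        ultimately have "\<omega> \<in> A (max n1 n2)" using \<omega> by (simp add: A_def)
        then show "\<omega> \<in> (\<Union>n. A n)" by blast
      qed
      ultimately have "prob {\<omega>\<in>space M. 0 < s * Y \<omega>} = 0" by simp
      then have "AE \<omega> in M. \<not> 0 < s * Y \<omega>"
        by (subst AE_iff_measurable[OF _ refl]) (auto simp: emeasure_eq_measure)
      then show False using nz by (simp add: not_less)
    qed
    obtain k1 where k1: "k1 > 0" "k1 \<le> prob {\<omega>\<in>space M. k1 \<le> Y \<omega> \<and> Y \<omega> \<le> 1 / k1}"
      using pos[of 1] False by auto
    obtain k2 where k2: "k2 > 0" "k2 \<le> prob {\<omega>\<in>space M. k2 \<le> - Y \<omega> \<and> - Y \<omega> \<le> 1 / k2}"
      using pos[of "-1"] False by auto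
    define k where "k = min k1 k2"
    have k: "k > 0" using k1 k2 by (simp add: k_def)
    obtain M0 :: nat where M0: "real M0 \<ge> 1 / k1" "real M0 \<ge> 1 / k2"
      using real_arch_simple[of "max (1 / k1) (1 / k2)"] by auto
    \<comment> \<open>Chosen so that \<open>k * exp (k * B)\<close> exceeds 1, whereas the value at
      exponent 0 is at most 1: no minimiser lies outside [-B, B].\<close>
    define B where "B = \<bar>ln k\<bar> / k + 1"
    have B: "B > 0" using k by (simp add: B_def add_nonneg_pos)
    have coercive: "trunc_mgf Y R l > 1" if R: "R \<ge> real M0" and l: "\<bar>l\<bar> \<ge> B" for R l
    proof -
      have kB: "k * exp (k * \<bar>l\<bar>) > 1"
      proof -
        have "k * B = \<bar>ln k\<bar> + k" using k by (simp add: B_def distrib_left)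
        then have "k * B \<ge> - ln k + k" by linarith
        moreover have "k * B \<le> k * \<bar>l\<bar>" using k l by (intro mult_left_mono) auto
        ultimately have "ln k + k * \<bar>l\<bar> > 0" using k by linarith
        then have "exp (ln k + k * \<bar>l\<bar>) > 1" by simp
        then show ?thesis using k by (simp add: exp_add)
      qed
      define s where "s = (if l \<ge> 0 then 1 else -1 :: real)"
      have sl: "l = s * \<bar>l\<bar>" by (simp add: s_def)
      define S where "S = {\<omega>\<in>space M. k \<le> s * Y \<omega> \<and> \<bar>Y \<omega>\<bar> \<le> R}"
      have [measurable]: "S \<in> events" unfolding S_def by measurable
      have "k \<le> prob S"
      proof (cases "l \<ge> 0")
        case True
        have "k \<le> k1" by (simp add: k_def)
        also have "\<dots> \<le> prob {\<omega>\<in>space M. k1 \<le> Y \<omega> \<and> Y \<omega> \<le> 1 / k1}" by (rule k1)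
        also have "\<dots> \<le> prob S"
          by (intro finite_measure_mono) (use True k1 M0 R in \<open>auto simp: S_def s_def k_def\<close>)
        finally show ?thesis .
      next
        case False
        have "k \<le> k2" by (simp add: k_def)
        also have "\<dots> \<le> prob {\<omega>\<in>space M. k2 \<le> - Y \<omega> \<and> - Y \<omega> \<le> 1 / k2}" by (rule k2)
        also have "\<dots> \<le> prob S"
          by (intro finite_measure_mono) (use False k2 M0 R in \<open>auto simp: S_def s_def k_def\<close>)
        finally show ?thesis .
      qed
      then have "k * exp (k * \<bar>l\<bar>) \<le> exp (k * \<bar>l\<bar>) * prob S" by (simp add: mult.commute)
      also have "\<dots> = (\<integral>\<omega>. exp (k * \<bar>l\<bar>) * indicator S \<omega> \<partial>M)" by simp
      also have "\<dots> \<le> trunc_mgf Y R l"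
        unfolding trunc_mgf_def
      proof (rule integral_mono[OF _ trunc_integrable[OF Y]])
        fix \<omega>
        show "exp (k * \<bar>l\<bar>) * indicator S \<omega> \<le> indicator {-R..R} (Y \<omega>) * exp (l * Y \<omega>)"
        proof (cases "\<omega> \<in> S")
          case True
          then have "k * \<bar>l\<bar> \<le> (s * Y \<omega>) * \<bar>l\<bar>" by (intro mult_right_mono) (auto simp: S_def)
          also have "\<dots> = l * Y \<omega>" by (subst (2) sl) simp
          finally show ?thesis using True by (auto simp: S_def indicator_def)
        qed simp
      qed (intro integrable_mult_right integrable_real_indicator; simp add: less_top[symmetric])
      finally show ?thesis using kB by simp
    qed
    have t0: "trunc_mgf Y R 0 \<le> 1" for R
    proof -
      have "trunc_mgf Y R 0 \<le> (\<integral>\<omega>. 1 \<partial>M)"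
        unfolding trunc_mgf_def by (rule integral_mono[OF trunc_integrable[OF Y]]) (auto simp: indicator_def)
      then show ?thesis by (simp add: prob_space)
    qed
    have ex_min: "\<exists>l. \<bar>l\<bar> \<le> B \<and> (\<forall>l'. trunc_mgf Y R l \<le> trunc_mgf Y R l')" if R: "R \<ge> real M0" for R
    proof -
      have "continuous_on {-B..B} (trunc_mgf Y R)"
        unfolding continuous_on_sequentially comp_def using trunc_mgf_tendsto[OF Y] by blast
      then obtain l where l: "l \<in> {-B..B}" "\<forall>l'\<in>{-B..B}. trunc_mgf Y R l \<le> trunc_mgf Y R l'"
        using continuous_attains_inf[of "{-B..B}" "trunc_mgf Y R"] B by auto
      have "trunc_mgf Y R l \<le> trunc_mgf Y R l'" for l'
      proof (cases "\<bar>l'\<bar> \<le> B")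
        case True
        then show ?thesis using l(2) by (simp add: abs_le_iff)
      next
        case False
        then have "trunc_mgf Y R l' > 1" using coercive[OF R] by simp
        moreover have "trunc_mgf Y R l \<le> trunc_mgf Y R 0" using l(2) B by simp
        ultimately show ?thesis using t0[of R] by linarith
      qed
      then show ?thesis using l(1) by (intro exI[of _ l]) auto
    qed
    then obtain l where l: "\<And>R. R \<ge> real M0 \<Longrightarrow> \<bar>l R\<bar> \<le> B"
      "\<And>R l'. R \<ge> real M0 \<Longrightarrow> trunc_mgf Y R (l R) \<le> trunc_mgf Y R l'"
      by metis
    have "\<exists>R\<ge>real M0. p' \<le> trunc_mgf Y R (l R)"
    proof (rule ccontr)
      assume "\<not> ?thesis"
      then have lt: "trunc_mgf Y R (l R) < p'" if "R \<ge> real M0" for R using that by force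
      define f where "f n = l (real (M0 + n))" for n
      have "bounded (range f)" by (rule boundedI[of _ B]) (auto simp: f_def intro!: l(1))
      then obtain l0 r where r: "strict_mono r" "(f \<circ> r) \<longlonglongrightarrow> l0"
        using bounded_imp_convergent_subsequence[of f] by blast
      \<comment> \<open>The truncated function increases with R, so the minima at later truncation
        levels bound it at a fixed level along the subsequence.\<close>
      have bd: "trunc_mgf Y (real (M0 + n)) l0 \<le> p'" for n
      proof (rule LIMSEQ_le_const2[OF trunc_mgf_tendsto[OF Y r(2)]], intro exI[of _ n] allI impI)
        fix i assume "n \<le> i"
        also have "i \<le> r i" using r(1) by (rule seq_suble)
        finally have ni: "n \<le> r i" .
        have "trunc_mgf Y (real (M0 + n)) ((f \<circ> r) i) \<le> trunc_mgf Y (real (M0 + r i)) ((f \<circ> r) i)"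
          unfolding trunc_mgf_def
          by (rule integral_mono[OF trunc_integrable[OF Y] trunc_integrable[OF Y]]) (use ni in \<open>auto simp: indicator_def\<close>)
        also have "\<dots> < p'" unfolding f_def comp_def by (rule lt) simp
        finally show "trunc_mgf Y (real (M0 + n)) ((f \<circ> r) i) \<le> p'" by simp
      qed
      let ?g = "\<lambda>n \<omega>. ennreal (indicator {-real (M0 + n)..real (M0 + n)} (Y \<omega>) * exp (l0 * Y \<omega>))"
      have "(\<integral>\<^sup>+\<omega>. ennreal (exp (l0 * Y \<omega>)) \<partial>M) = (\<integral>\<^sup>+\<omega>. (SUP n. ?g n \<omega>) \<partial>M)"
      proof (rule nn_integral_cong)
        fix \<omega>
        obtain n :: nat where "\<bar>Y \<omega>\<bar> \<le> real n" using real_arch_simple by blast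
        then have "ennreal (exp (l0 * Y \<omega>)) = ?g n \<omega>" by (auto simp: indicator_def)
        moreover have "?g n \<omega> \<le> (SUP n. ?g n \<omega>)" by (rule SUP_upper) simp
        ultimately have "ennreal (exp (l0 * Y \<omega>)) \<le> (SUP n. ?g n \<omega>)" by (rule ord_eq_le_trans)
        moreover have "(SUP n. ?g n \<omega>) \<le> ennreal (exp (l0 * Y \<omega>))"
          by (intro SUP_least ennreal_leI) (auto simp: indicator_def)
        ultimately show "ennreal (exp (l0 * Y \<omega>)) = (SUP n. ?g n \<omega>)" by simp
      qed
      also have "\<dots> = (SUP n. \<integral>\<^sup>+\<omega>. ?g n \<omega> \<partial>M)"
      proof (rule nn_integral_monotone_convergence_SUP)
        show "incseq ?g" by (intro incseq_SucI le_funI ennreal_leI) (auto simp: indicator_def)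
      qed measurable
      also have "\<dots> \<le> ennreal p'"
      proof (rule SUP_least)
        fix n
        have "(\<integral>\<^sup>+\<omega>. ?g n \<omega> \<partial>M) = ennreal (trunc_mgf Y (real (M0 + n)) l0)"
          unfolding trunc_mgf_def by (rule nn_integral_eq_integral[OF trunc_integrable[OF Y]]) auto
        then show "(\<integral>\<^sup>+\<omega>. ?g n \<omega> \<partial>M) \<le> ennreal p'" using bd[of n] by (simp add: ennreal_leI)
      qed
      finally have "ennreal p \<le> ennreal p'" using p[of l0] by (rule order_trans[rotated])
      then show False using p' by (simp add: ennreal_le_iff)
    qed
    then obtain R where R: "R \<ge> real M0" "p' \<le> trunc_mgf Y R (l R)" by blast
    moreover have "R \<ge> 0" using R(1) by (rule order_trans[rotated]) simp
    ultimately show ?thesis using result[of R "l R"] tilting_min[OF Y _ l(2)[OF R(1)]] by blast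
  qed
qed

end

section \<open>Random walks with exponential moments\<close>

text \<open>The assumption \<open>Phi_ge1\<close> is the form in which mean zero enters: it makes
  the logarithm of \<Phi> nonnegative, on which the monotonicity of \<open>psi\<close>
  rests.\<close>

locale walk = prob_space M for M :: "'a measure" +
  fixes X :: "nat \<Rightarrow> 'a \<Rightarrow> real" and \<Phi> :: "real \<Rightarrow> ennreal"
  assumes indep: "indep_vars (\<lambda>_. borel) X UNIV"
    and dist: "\<And>j. distr M borel (X j) = distr M borel (X 0)"
    and Phi: "\<And>\<theta>. \<Phi> \<theta> = (\<integral>\<^sup>+\<omega>. ennreal (exp (\<theta> * X 0 \<omega>)) \<partial>M)"
    and Phi_ge1: "\<And>\<theta>. 1 \<le> \<Phi> \<theta>"
begin

lemma X_measurable [measurable]: "X j \<in> borel_measurable M"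
  using indep unfolding indep_vars_def2 by blast

lemma Phi_0: "\<Phi> 0 = 1"
  by (simp add: Phi emeasure_space_1)

lemma logmgf_0: "logmgf \<Phi> 0 = 0"
  by (simp add: logmgf_def Phi_0)

lemma logmgf_nonneg: "\<Phi> \<theta> < \<infinity> \<Longrightarrow> 0 \<le> logmgf \<Phi> \<theta>"
  using Phi_ge1[of \<theta>] unfolding logmgf_def
  by (cases "\<Phi> \<theta>") (auto simp: ennreal_1[symmetric] ennreal_le_iff simp del: ennreal_1)

lemma Phi_exp: "\<Phi> \<theta> < \<infinity> \<Longrightarrow> \<Phi> \<theta> = ennreal (exp (logmgf \<Phi> \<theta>))"
  using Phi_ge1[of \<theta>] unfolding logmgf_def
  by (cases "\<Phi> \<theta>") (auto simp: ennreal_1[symmetric] ennreal_le_iff simp del: ennreal_1)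

lemma nn_integral_X:
  assumes [measurable]: "f \<in> borel_measurable borel"
  shows "(\<integral>\<^sup>+\<omega>. f (X j \<omega>) \<partial>M) = (\<integral>\<^sup>+\<omega>. f (X 0 \<omega>) \<partial>M)"
  using nn_integral_distr[of "X j" M borel f] nn_integral_distr[of "X 0" M borel f] dist[of j] by simp

lemma integral_X:
  fixes f :: "real \<Rightarrow> real"
  assumes [measurable]: "f \<in> borel_measurable borel"
  shows "(\<integral>\<omega>. f (X j \<omega>) \<partial>M) = (\<integral>\<omega>. f (X 0 \<omega>) \<partial>M)"
    "integrable M (\<lambda>\<omega>. f (X j \<omega>)) = integrable M (\<lambda>\<omega>. f (X 0 \<omega>))"
  using integral_distr[of "X j" M borel f] integral_distr[of "X 0" M borel f]
    integrable_distr_eq[of "X j" M borel f] integrable_distr_eq[of "X 0" M borel f] dist[of j] by simp_all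

lemma nn_integral_prod_X:
  assumes J: "finite J" and f: "\<And>j. f j \<in> borel_measurable borel"
  shows "(\<integral>\<^sup>+\<omega>. (\<Prod>j\<in>J. f j (X j \<omega>)) \<partial>M) = (\<Prod>j\<in>J. \<integral>\<^sup>+\<omega>. f j (X 0 \<omega>) \<partial>M)"
proof -
  have "indep_vars (\<lambda>_. borel) (\<lambda>j \<omega>. f j (X j \<omega>)) J"
    by (rule indep_vars_compose2[OF indep_vars_subset[OF indep]]) (use f in auto)
  then have "(\<integral>\<^sup>+\<omega>. (\<Prod>j\<in>J. f j (X j \<omega>)) \<partial>M) = (\<Prod>j\<in>J. \<integral>\<^sup>+\<omega>. f j (X j \<omega>) \<partial>M)"
    by (intro indep_vars_nn_integral[OF J]) auto
  also have "\<dots> = (\<Prod>j\<in>J. \<integral>\<^sup>+\<omega>. f j (X 0 \<omega>) \<partial>M)"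
    by (intro prod.cong refl nn_integral_X f)
  finally show ?thesis .
qed

lemma integral_prod_X:
  fixes f :: "nat \<Rightarrow> real \<Rightarrow> real"
  assumes J: "finite J" and f: "\<And>j. f j \<in> borel_measurable borel"
    and i: "\<And>j. j \<in> J \<Longrightarrow> integrable M (\<lambda>\<omega>. f j (X 0 \<omega>))"
  shows "(\<integral>\<omega>. (\<Prod>j\<in>J. f j (X j \<omega>)) \<partial>M) = (\<Prod>j\<in>J. \<integral>\<omega>. f j (X 0 \<omega>) \<partial>M)"
    "integrable M (\<lambda>\<omega>. \<Prod>j\<in>J. f j (X j \<omega>))"
proof -
  have ind: "indep_vars (\<lambda>_. borel) (\<lambda>j \<omega>. f j (X j \<omega>)) J"
    by (rule indep_vars_compose2[OF indep_vars_subset[OF indep]]) (use f in auto)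
  have i': "integrable M (\<lambda>\<omega>. f j (X j \<omega>))" if "j \<in> J" for j
    by (subst integral_X(2)[OF f]) (rule i[OF that])
  have "(\<integral>\<omega>. (\<Prod>j\<in>J. f j (X j \<omega>)) \<partial>M) = (\<Prod>j\<in>J. \<integral>\<omega>. f j (X j \<omega>) \<partial>M)"
    by (rule indep_vars_lebesgue_integral[OF J ind i'])
  also have "\<dots> = (\<Prod>j\<in>J. \<integral>\<omega>. f j (X 0 \<omega>) \<partial>M)"
    by (intro prod.cong refl integral_X(1) f)
  finally show "(\<integral>\<omega>. (\<Prod>j\<in>J. f j (X j \<omega>)) \<partial>M) = (\<Prod>j\<in>J. \<integral>\<omega>. f j (X 0 \<omega>) \<partial>M)" .
  show "integrable M (\<lambda>\<omega>. \<Prod>j\<in>J. f j (X j \<omega>))"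
    by (rule indep_vars_integrable[OF J ind i'])
qed

text \<open>Instead of changing the measure, the tilted density T is kept as a weight: Chebyshev's
  inequality for the weighted block sums leaves half of the mass of T on the event.\<close>

lemma block_lower_bound:
  fixes a l R :: "nat \<Rightarrow> real" and b :: "nat \<Rightarrow> nat"
  assumes J: "finite J" and b: "\<And>j. j \<in> J \<Longrightarrow> b j < m"
    and R: "\<And>i. i < m \<Longrightarrow> 0 \<le> R i" "\<And>i. i < m \<Longrightarrow> (R i)\<^sup>2 \<le> V"
    and pos: "\<And>i. i < m \<Longrightarrow> 0 < trunc_mgf (\<lambda>\<omega>. X 0 \<omega> - a i) (R i) (l i)"
    and mean: "\<And>i. i < m \<Longrightarrow> (\<integral>\<omega>. (X 0 \<omega> - a i) * (indicator {-R i..R i} (X 0 \<omega> - a i) * exp (l i * (X 0 \<omega> - a i))) \<partial>M) = 0"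
    and \<eta>: "\<eta> > 0" "real (card J) * V \<le> \<eta>\<^sup>2 / 2"
  shows "exp (- (\<Sum>i<m. \<bar>l i\<bar> * \<eta>)) * (\<Prod>j\<in>J. trunc_mgf (\<lambda>\<omega>. X 0 \<omega> - a (b j)) (R (b j)) (l (b j))) / 2
    \<le> prob {\<omega>\<in>space M. \<forall>i<m. \<bar>\<Sum>j\<in>{j\<in>J. b j = i}. X j \<omega> - a i\<bar> \<le> \<eta>}"
proof -
  define \<phi> where "\<phi> i = trunc_mgf (\<lambda>\<omega>. X 0 \<omega> - a i) (R i) (l i)" for i
  \<comment> \<open>The density of the tilted truncated law for block i; under it the increment has
    mean \<open>a i\<close>.\<close>
  define w where "w i x = indicator {-R i..R i} (x - a i) * exp (l i * (x - a i)) / \<phi> i" for i x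
  have [measurable]: "w i \<in> borel_measurable borel" for i unfolding w_def by measurable
  have \<phi>: "\<phi> i > 0" if "i < m" for i using pos[OF that] by (simp add: \<phi>_def)
  have w0: "0 \<le> w i x" if "i < m" for i x using \<phi>[OF that] by (simp add: w_def)
  have wz: "w i x = 0" if "\<bar>x - a i\<bar> > R i" for i x using that by (auto simp: w_def indicator_def)
  have wi: "integrable M (\<lambda>\<omega>. w i (X 0 \<omega>))" for i
    unfolding w_def by (intro integrable_divide trunc_integrable) measurable
  have w1: "(\<integral>\<omega>. w i (X 0 \<omega>) \<partial>M) = 1" if "i < m" for i
  proof -
    have "(\<integral>\<omega>. w i (X 0 \<omega>) \<partial>M) = \<phi> i / \<phi> i"
      unfolding w_def by (simp add: trunc_mgf_def[symmetric] \<phi>_def)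
    then show ?thesis using \<phi>[OF that] by simp
  qed
  have yi: "integrable M (\<lambda>\<omega>. (X 0 \<omega> - a i) ^ k * w i (X 0 \<omega>))" if i: "i < m" for i k
  proof (rule Bochner_Integration.integrable_bound[OF integrable_mult_right[OF wi[of i], of "R i ^ k"]])
    show "AE \<omega> in M. norm ((X 0 \<omega> - a i) ^ k * w i (X 0 \<omega>)) \<le> norm (R i ^ k * w i (X 0 \<omega>))"
    proof (rule AE_I2)
      fix \<omega>
      show "norm ((X 0 \<omega> - a i) ^ k * w i (X 0 \<omega>)) \<le> norm (R i ^ k * w i (X 0 \<omega>))"
      proof (cases "\<bar>X 0 \<omega> - a i\<bar> \<le> R i")
        case True
        then have "\<bar>X 0 \<omega> - a i\<bar> ^ k \<le> R i ^ k" by (rule power_mono) simp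
        then show ?thesis using R(1)[OF i] by (simp add: abs_mult power_abs mult_right_mono)
      qed (use wz[of i] in simp)
    qed
  qed measurable
  have wy: "(\<integral>\<omega>. (X 0 \<omega> - a i) * w i (X 0 \<omega>) \<partial>M) = 0" if "i < m" for i
    using mean[OF that] by (simp add: w_def)
  define y where "y j \<omega> = X j \<omega> - a (b j)" for j \<omega>
  have [measurable]: "y j \<in> borel_measurable M" for j unfolding y_def by measurable
  define T where "T \<omega> = (\<Prod>j\<in>J. w (b j) (X j \<omega>))" for \<omega>
  have [measurable]: "T \<in> borel_measurable M" unfolding T_def by measurable
  have T0: "0 \<le> T \<omega>" for \<omega> unfolding T_def using w0 b by (intro prod_nonneg) auto
  have Ti: "integrable M T" unfolding T_def by (rule integral_prod_X(2)[OF J]) (use wi in auto)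
  have T1: "(\<integral>\<omega>. T \<omega> \<partial>M) = 1"
    unfolding T_def using integral_prod_X(1)[OF J, of "\<lambda>j. w (b j)"] wi w1 b by simp
  have Ty: "T \<omega> * (y k \<omega>)\<^sup>2 \<le> V * T \<omega>" if k: "k \<in> J" for k \<omega>
  proof (cases "\<bar>y k \<omega>\<bar> \<le> R (b k)")
    case True
    then have "(y k \<omega>)\<^sup>2 \<le> (R (b k))\<^sup>2" using abs_le_square_iff by fastforce
    also have "\<dots> \<le> V" by (rule R(2)[OF b[OF k]])
    finally have "T \<omega> * (y k \<omega>)\<^sup>2 \<le> T \<omega> * V" by (rule mult_left_mono[OF _ T0])
    then show ?thesis by (simp add: mult.commute)
  next
    case False
    then have "w (b k) (X k \<omega>) = 0" by (intro wz) (simp add: y_def)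
    then have "T \<omega> = 0" unfolding T_def by (intro prod_zero J bexI[of _ k] k)
    then show ?thesis by simp
  qed
  have cross: "integrable M (\<lambda>\<omega>. T \<omega> * (y k \<omega> * y n \<omega>)) \<and> (k \<noteq> n \<longrightarrow> (\<integral>\<omega>. T \<omega> * (y k \<omega> * y n \<omega>) \<partial>M) = 0)"
    if k: "k \<in> J" and n: "n \<in> J" for k n
  proof -
    \<comment> \<open>The exponents with which \<open>y k * y n\<close> is written as a product over
      J. If k and n differ, the factor of k has exponent 1 and integral 0.\<close>
    define e :: "nat \<Rightarrow> nat" where "e j = (if j = k then 1 else 0) + (if j = n then 1 else 0)" for j
    have i: "integrable M (\<lambda>\<omega>. (X 0 \<omega> - a (b j)) ^ e j * w (b j) (X 0 \<omega>))" if "j \<in> J" for j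
      by (rule yi[OF b[OF that]])
    have eq: "T \<omega> * (y k \<omega> * y n \<omega>) = (\<Prod>j\<in>J. (X j \<omega> - a (b j)) ^ e j * w (b j) (X j \<omega>))" for \<omega>
    proof -
      have "(\<Prod>j\<in>J. (X j \<omega> - a (b j)) ^ e j) = (\<Prod>j\<in>J. (if j = k then y k \<omega> else 1) * (if j = n then y n \<omega> else 1))"
        by (intro prod.cong) (auto simp: e_def y_def power_add)
      also have "\<dots> = y k \<omega> * y n \<omega>" using J k n by (simp add: prod.distrib)
      finally show ?thesis by (simp add: prod.distrib T_def mult.commute)
    qed
    have "(\<integral>\<omega>. T \<omega> * (y k \<omega> * y n \<omega>) \<partial>M) = 0" if "k \<noteq> n"
    proof -
      have "(\<integral>\<omega>. T \<omega> * (y k \<omega> * y n \<omega>) \<partial>M) = (\<Prod>j\<in>J. \<integral>\<omega>. (X 0 \<omega> - a (b j)) ^ e j * w (b j) (X 0 \<omega>) \<partial>M)"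
        unfolding eq by (rule integral_prod_X(1)[OF J]) (use i in auto)
      also have "\<dots> = 0"
      proof -
        have "(\<integral>\<omega>. (X 0 \<omega> - a (b k)) ^ e k * w (b k) (X 0 \<omega>) \<partial>M) = 0"
          using wy[OF b[OF k]] that by (simp add: e_def)
        then show ?thesis by (intro prod_zero J bexI[of _ k] k)
      qed
      finally show ?thesis .
    qed
    moreover have "integrable M (\<lambda>\<omega>. T \<omega> * (y k \<omega> * y n \<omega>))"
      unfolding eq by (rule integral_prod_X(2)[OF J]) (use i in auto)
    ultimately show ?thesis by blast
  qed
  define B where "B i = {j\<in>J. b j = i}" for i
  have B: "finite (B i)" "B i \<subseteq> J" for i using J by (auto simp: B_def)
  have cross_i: "integrable M (\<lambda>\<omega>. T \<omega> * (y k \<omega> * y n \<omega>))" if "k \<in> B i" "n \<in> B i" for i k n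
    using cross[OF subsetD[OF B(2) that(1)] subsetD[OF B(2) that(2)]] by simp
  have cross_0: "(\<integral>\<omega>. T \<omega> * (y k \<omega> * y n \<omega>) \<partial>M) = 0" if "k \<in> B i" "n \<in> B i" "n \<noteq> k" for i k n
    using cross[OF subsetD[OF B(2) that(1)] subsetD[OF B(2) that(2)]] that(3) by simp
  define S where "S i \<omega> = (\<Sum>j\<in>B i. y j \<omega>)" for i \<omega>
  have [measurable]: "S i \<in> borel_measurable M" for i unfolding S_def by measurable
  have sq: "T \<omega> * (S i \<omega>)\<^sup>2 = (\<Sum>k\<in>B i. \<Sum>n\<in>B i. T \<omega> * (y k \<omega> * y n \<omega>))" for i \<omega>
  proof -
    have "(S i \<omega>)\<^sup>2 = (\<Sum>k\<in>B i. \<Sum>n\<in>B i. y k \<omega> * y n \<omega>)"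
      by (simp add: S_def power2_eq_square sum_product)
    then show ?thesis by (simp only: sum_distrib_left)
  qed
  have TSi: "integrable M (\<lambda>\<omega>. T \<omega> * (S i \<omega>)\<^sup>2)" for i
    unfolding sq by (intro Bochner_Integration.integrable_sum cross_i)
  have TS: "(\<integral>\<omega>. T \<omega> * (S i \<omega>)\<^sup>2 \<partial>M) \<le> real (card (B i)) * V" for i
  proof -
    have "(\<integral>\<omega>. T \<omega> * (S i \<omega>)\<^sup>2 \<partial>M) = (\<Sum>k\<in>B i. \<integral>\<omega>. (\<Sum>n\<in>B i. T \<omega> * (y k \<omega> * y n \<omega>)) \<partial>M)"
      unfolding sq by (intro Bochner_Integration.integral_sum Bochner_Integration.integrable_sum cross_i)
    also have "\<dots> = (\<Sum>k\<in>B i. \<Sum>n\<in>B i. \<integral>\<omega>. T \<omega> * (y k \<omega> * y n \<omega>) \<partial>M)"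
      by (intro sum.cong refl Bochner_Integration.integral_sum cross_i)
    also have "\<dots> \<le> (\<Sum>k\<in>B i. V)"
    proof (rule sum_mono)
      fix k assume k: "k \<in> B i"
      have "(\<Sum>n\<in>B i. \<integral>\<omega>. T \<omega> * (y k \<omega> * y n \<omega>) \<partial>M) = (\<Sum>n\<in>B i. if n = k then \<integral>\<omega>. T \<omega> * (y k \<omega> * y k \<omega>) \<partial>M else 0)"
        by (intro sum.cong refl) (simp add: cross_0[OF k])
      also have "\<dots> = (\<integral>\<omega>. T \<omega> * (y k \<omega> * y k \<omega>) \<partial>M)" using k B by simp
      also have "\<dots> \<le> (\<integral>\<omega>. V * T \<omega> \<partial>M)"
      proof (rule integral_mono)
        show "integrable M (\<lambda>\<omega>. T \<omega> * (y k \<omega> * y k \<omega>))" by (rule cross_i[OF k k])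
        show "integrable M (\<lambda>\<omega>. V * T \<omega>)" using Ti by simp
        show "T \<omega> * (y k \<omega> * y k \<omega>) \<le> V * T \<omega>" for \<omega>
          using Ty[OF subsetD[OF B(2) k], of \<omega>] by (simp add: power2_eq_square)
      qed
      also have "\<dots> = V" by (simp add: T1)
      finally show "(\<Sum>n\<in>B i. \<integral>\<omega>. T \<omega> * (y k \<omega> * y n \<omega>) \<partial>M) \<le> V" .
    qed
    finally show ?thesis by simp
  qed
  define G where "G = {\<omega>\<in>space M. \<forall>i<m. \<bar>S i \<omega>\<bar> \<le> \<eta>}"
  have G[measurable]: "G \<in> events" unfolding G_def by measurable
  \<comment> \<open>A bound for the weight T on G. Since at least half of the mass of T lies on G,
    the probability of G is at least \<open>1 / (2 * C)\<close>.\<close>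
  define C where "C = exp (\<Sum>i<m. \<bar>l i\<bar> * \<eta>) / (\<Prod>j\<in>J. \<phi> (b j))"
  have P0: "0 < (\<Prod>j\<in>J. \<phi> (b j))" using \<phi> b by (intro prod_pos) auto
  have TG: "T \<omega> \<le> C" if \<omega>: "\<omega> \<in> G" for \<omega>
  proof -
    have "T \<omega> \<le> (\<Prod>j\<in>J. exp (l (b j) * y j \<omega>) / \<phi> (b j))"
      unfolding T_def using w0 b \<phi>
      by (intro prod_mono conjI) (auto simp: w_def y_def indicator_def intro!: divide_nonneg_pos)
    also have "\<dots> = exp (\<Sum>j\<in>J. l (b j) * y j \<omega>) / (\<Prod>j\<in>J. \<phi> (b j))"
      by (simp add: prod_dividef exp_sum[OF J])
    also have "(\<Sum>j\<in>J. l (b j) * y j \<omega>) = (\<Sum>i<m. \<Sum>j\<in>B i. l (b j) * y j \<omega>)"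
      unfolding B_def by (rule sum.group[symmetric]) (use J b in auto)
    also have "\<dots> = (\<Sum>i<m. l i * S i \<omega>)"
      unfolding S_def sum_distrib_left by (intro sum.cong refl) (auto simp: B_def)
    also have "exp (\<Sum>i<m. l i * S i \<omega>) / (\<Prod>j\<in>J. \<phi> (b j)) \<le> C"
    proof -
      have "l i * S i \<omega> \<le> \<bar>l i\<bar> * \<eta>" if "i < m" for i
      proof -
        have "l i * S i \<omega> \<le> \<bar>l i\<bar> * \<bar>S i \<omega>\<bar>" by (metis abs_ge_self abs_mult)
        also have "\<dots> \<le> \<bar>l i\<bar> * \<eta>" using \<omega> that by (intro mult_left_mono) (auto simp: G_def)
        finally show ?thesis .
      qed
      then have "(\<Sum>i<m. l i * S i \<omega>) \<le> (\<Sum>i<m. \<bar>l i\<bar> * \<eta>)" by (intro sum_mono) auto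
      then show ?thesis unfolding C_def using P0 by (intro divide_right_mono) auto
    qed
    finally show ?thesis .
  qed
  \<comment> \<open>Off G, one of the quotients
    \<open>(S i \<omega>)\<^sup>2 / \<eta>\<^sup>2\<close> is at least 1.\<close>
  have ineq: "T \<omega> \<le> C * indicator G \<omega> + (\<Sum>i<m. T \<omega> * (S i \<omega>)\<^sup>2 / \<eta>\<^sup>2)" if \<omega>: "\<omega> \<in> space M" for \<omega>
  proof (cases "\<omega> \<in> G")
    case True
    then show ?thesis using TG[OF True] T0[of \<omega>] by (simp add: add_increasing2 sum_nonneg)
  next
    case False
    then obtain i where i: "i < m" "\<bar>S i \<omega>\<bar> > \<eta>" using \<omega> by (auto simp: G_def not_le)
    then have "\<eta>\<^sup>2 \<le> (S i \<omega>)\<^sup>2" using \<eta>(1) abs_le_square_iff[of \<eta> "S i \<omega>"] by simp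
    then have "T \<omega> * 1 \<le> T \<omega> * ((S i \<omega>)\<^sup>2 / \<eta>\<^sup>2)"
      using T0[of \<omega>] \<eta>(1) by (intro mult_left_mono) auto
    also have "\<dots> = T \<omega> * (S i \<omega>)\<^sup>2 / \<eta>\<^sup>2" by simp
    also have "\<dots> \<le> (\<Sum>i<m. T \<omega> * (S i \<omega>)\<^sup>2 / \<eta>\<^sup>2)"
      by (rule member_le_sum) (use i T0 in auto)
    finally show ?thesis using False by simp
  qed
  have "1 \<le> (\<integral>\<omega>. C * indicator G \<omega> + (\<Sum>i<m. T \<omega> * (S i \<omega>)\<^sup>2 / \<eta>\<^sup>2) \<partial>M)"
    unfolding T1[symmetric]
  proof (rule integral_mono[OF Ti _ ineq])
    show "integrable M (\<lambda>\<omega>. C * indicator G \<omega> + (\<Sum>i<m. T \<omega> * (S i \<omega>)\<^sup>2 / \<eta>\<^sup>2))"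
      by (intro Bochner_Integration.integrable_add integrable_mult_right integrable_real_indicator
          Bochner_Integration.integrable_sum integrable_divide TSi) (auto simp: less_top[symmetric])
  qed
  also have "\<dots> = C * prob G + (\<Sum>i<m. (\<integral>\<omega>. T \<omega> * (S i \<omega>)\<^sup>2 \<partial>M) / \<eta>\<^sup>2)"
  proof -
    have "integrable M (\<lambda>\<omega>. C * indicator G \<omega>)" "integrable M (\<lambda>\<omega>. T \<omega> * (S i \<omega>)\<^sup>2 / \<eta>\<^sup>2)" for i
      by (intro integrable_mult_right integrable_real_indicator integrable_divide TSi; simp add: less_top[symmetric])+
    then show ?thesis by (simp add: Bochner_Integration.integral_add Bochner_Integration.integral_sum)
  qed
  also have "(\<Sum>i<m. (\<integral>\<omega>. T \<omega> * (S i \<omega>)\<^sup>2 \<partial>M) / \<eta>\<^sup>2) \<le> (\<Sum>i<m. real (card (B i)) * V / \<eta>\<^sup>2)"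
    using TS by (intro sum_mono divide_right_mono) auto
  also have "\<dots> = real (card J) * V / \<eta>\<^sup>2"
  proof -
    have "(\<Sum>i<m. card (B i)) = card J"
      using sum.group[OF J finite_lessThan[of m], of b "\<lambda>_. 1::nat"] b by (auto simp: B_def)
    then have "(\<Sum>i<m. real (card (B i))) = real (card J)" by (metis of_nat_sum)
    then show ?thesis by (simp add: sum_distrib_right[symmetric] sum_divide_distrib[symmetric])
  qed
  also have "\<dots> \<le> 1 / 2" using \<eta> by (simp add: field_simps)
  finally have half: "1 / 2 \<le> C * prob G" by simp
  have "exp (- (\<Sum>i<m. \<bar>l i\<bar> * \<eta>)) * (\<Prod>j\<in>J. \<phi> (b j)) * C = 1"
    using P0 by (simp add: C_def exp_minus field_simps)
  then have "exp (- (\<Sum>i<m. \<bar>l i\<bar> * \<eta>)) * (\<Prod>j\<in>J. \<phi> (b j)) / 2 \<le> prob G"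
    using mult_left_mono[OF half, of "exp (- (\<Sum>i<m. \<bar>l i\<bar> * \<eta>)) * (\<Prod>j\<in>J. \<phi> (b j))"] P0
    by (simp add: mult.assoc[symmetric])
  moreover have "S i \<omega> = (\<Sum>j\<in>{j\<in>J. b j = i}. X j \<omega> - a i)" for i \<omega>
    unfolding S_def B_def by (intro sum.cong) (auto simp: y_def)
  ultimately show ?thesis by (simp add: G_def \<phi>_def)
qed

end

subsection \<open>Large deviations of block increments\<close>

text \<open>Here \<open>i * A div m\<close> reads \<open>(i * A) div m\<close>. Rounding the cut
  points \<open>i * A / m\<close> down keeps the block lengths within 1 of
  \<open>A / m\<close>.\<close>

definition blk :: "nat \<Rightarrow> nat \<Rightarrow> nat \<Rightarrow> nat \<Rightarrow> nat set" where
  "blk m A x i = {x + i * A div m..<x + Suc i * A div m}"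

lemma blk_mono: "i \<le> k \<Longrightarrow> i * A div m \<le> k * A div m" for i k A m :: nat
  by (intro div_le_mono mult_le_mono1)

lemma ex_blk:
  assumes "x \<le> j" "j < x + k * A div m"
  shows "\<exists>i<k. j \<in> blk m A x i"
  using assms
proof (induction k)
  case (Suc k)
  show ?case
  proof (cases "j < x + k * A div m")
    case True
    then show ?thesis using Suc.IH Suc.prems less_SucI by blast
  next
    case False
    then have "j \<in> blk m A x k" using Suc.prems by (simp add: blk_def)
    then show ?thesis by blast
  qed
qed simp

lemma blk_unique: "j \<in> blk m A x i \<Longrightarrow> j \<in> blk m A x k \<Longrightarrow> i = k"
proof (rule ccontr)
  assume j: "j \<in> blk m A x i" "j \<in> blk m A x k" and "i \<noteq> k"
  then consider "Suc i \<le> k" | "Suc k \<le> i" by linarith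
  then show False
    using j blk_mono[of "Suc i" k A m] blk_mono[of "Suc k" i A m] by cases (auto simp: blk_def)
qed

lemma blk_index:
  assumes "m > 0"
  obtains b where "\<And>j. j \<in> {x..<x + A} \<Longrightarrow> b j < m"
    "\<And>i. i < m \<Longrightarrow> {j\<in>{x..<x + A}. b j = i} = blk m A x i"
proof -
  have "\<exists>i<m. j \<in> blk m A x i" if "j \<in> {x..<x + A}" for j
    using ex_blk[of x j m A m] that assms by simp
  then obtain b where b: "\<And>j. j \<in> {x..<x + A} \<Longrightarrow> b j < m \<and> j \<in> blk m A x (b j)" by metis
  have sub: "blk m A x i \<subseteq> {x..<x + A}" if "i < m" for i
    using blk_mono[of "Suc i" m A m] that assms by (auto simp: blk_def)
  have "{j\<in>{x..<x + A}. b j = i} = blk m A x i" if i: "i < m" for i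
  proof (intro set_eqI iffI)
    fix j assume "j \<in> {j\<in>{x..<x + A}. b j = i}"
    then show "j \<in> blk m A x i" using b[of j] by auto
  next
    fix j assume j: "j \<in> blk m A x i"
    then have "j \<in> {x..<x + A}" using sub[OF i] by blast
    then show "j \<in> {j\<in>{x..<x + A}. b j = i}" using b[of j] blk_unique[OF j, of "b j"] by simp
  qed
  then show ?thesis using that b by blast
qed

lemma card_blk:
  assumes "m > 0"
  shows "\<bar>real (card (blk m A x i)) - real A / real m\<bar> \<le> 1"
proof -
  have "i * A div m \<le> Suc i * A div m" by (rule blk_mono) simp
  then have c: "real (card (blk m A x i)) = real (Suc i * A div m) - real (i * A div m)"
    by (simp add: blk_def)
  have q: "real (k * A div m) \<le> real k * real A / real m" "real k * real A / real m - 1 \<le> real (k * A div m)" for k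
  proof -
    have "real (k * A) = real m * real (k * A div m) + real (k * A mod m)"
      by (simp only: of_nat_mult[symmetric] of_nat_add[symmetric] mult_div_mod_eq)
    moreover have "real (k * A mod m) < real m" using assms by simp
    ultimately show "real (k * A div m) \<le> real k * real A / real m" "real k * real A / real m - 1 \<le> real (k * A div m)"
      using assms by (simp_all add: field_simps)
  qed
  have "real (Suc i) * real A / real m - real i * real A / real m = real A / real m"
    by (simp add: distrib_right add_divide_distrib)
  then show ?thesis unfolding c using q[of i] q[of "Suc i"] by linarith
qed

text \<open>The summand a is an accumulator for the induction: it collects the terms whose argument
  is already chosen.\<close>

lemma SUP_sum_choice:
  fixes g :: "nat \<Rightarrow> 'b \<Rightarrow> ennreal"
  assumes "I \<noteq> {}" "c < a + (\<Sum>i<m. SUP t\<in>I. g i t)"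
  shows "\<exists>t. (\<forall>i. t i \<in> I) \<and> c < a + (\<Sum>i<m. g i (t i))"
  using assms(2)
proof (induction m arbitrary: a)
  case 0
  then show ?case using assms(1) by auto
next
  case (Suc m)
  have "a + (\<Sum>i<Suc m. SUP t\<in>I. g i t) = (a + (\<Sum>i<m. SUP t\<in>I. g i t)) + (SUP t\<in>I. g m t)"
    by (simp add: add.assoc)
  also have "\<dots> = (SUP t\<in>I. (a + (\<Sum>i<m. SUP t\<in>I. g i t)) + g m t)"
    by (rule ennreal_SUP_add_right[OF assms(1)])
  finally obtain s where s: "s \<in> I" "c < (a + (\<Sum>i<m. SUP t\<in>I. g i t)) + g m s"
    using Suc.prems by (auto simp: less_SUP_iff)
  then have "c < (a + g m s) + (\<Sum>i<m. SUP t\<in>I. g i t)" by (simp add: ac_simps)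
  from Suc.IH[OF this] obtain t where t: "\<forall>i. t i \<in> I" "c < (a + g m s) + (\<Sum>i<m. g i (t i))" by blast
  have "c < a + (\<Sum>i<Suc m. g i ((t(m := s)) i))"
    using t(2) by (simp add: ac_simps)
  moreover have "\<forall>i. (t(m := s)) i \<in> I" using t(1) s(1) by simp
  ultimately show ?case by blast
qed

context walk
begin

definition D :: "nat \<Rightarrow> nat \<Rightarrow> nat \<Rightarrow> 'a \<Rightarrow> nat \<Rightarrow> real" where
  "D m A x \<omega> i = (\<Sum>j\<in>blk m A x i. X j \<omega>) / real A"

lemma D_measurable [measurable]: "(\<lambda>\<omega>. D m A x \<omega> i) \<in> borel_measurable M"
  unfolding D_def by measurable

text \<open>Cramer's lower bound. Of the exponent \<delta>, a quarter pays for the levels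
  \<open>exp (- g i - \<delta> / 4)\<close> of the tilting, a quarter for undoing the tilt within
  distance e, and half for the factor 2 and for blocks longer than \<open>A / m\<close>. The
  estimates do not depend on x, as the increments are identically distributed.\<close>

lemma prob_D_near_ge:
  assumes m: "m > 0" and g: "\<And>i. i < m \<Longrightarrow> psi \<Phi> (real m * w i) \<le> ennreal (g i)" "\<And>i. 0 \<le> g i"
    and \<beta>: "(\<Sum>i<m. g i / real m) \<le> \<beta>" and \<epsilon>: "\<epsilon> > 0" and \<delta>: "\<delta> > 0"
  shows "\<forall>\<^sub>F A in sequentially. \<forall>x. exp (- real A * (\<beta> + \<delta>)) \<le>
    prob {\<omega>\<in>space M. \<forall>i<m. \<bar>D m A x \<omega> i - w i\<bar> < \<epsilon>}"
proof -
  define a where "a i = real m * w i" for i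
  define Q where "Q i R l \<longleftrightarrow> R \<ge> 0 \<and> exp (- g i - \<delta> / 4) \<le> trunc_mgf (\<lambda>\<omega>. X 0 \<omega> - a i) R l \<and>
    (\<integral>\<omega>. (X 0 \<omega> - a i) * (indicator {-R..R} (X 0 \<omega> - a i) * exp (l * (X 0 \<omega> - a i))) \<partial>M) = 0" for i R l
  have "\<exists>R l. Q i R l" if i: "i < m" for i
  proof -
    \<comment> \<open>This is \<open>psi \<Phi> (a i) \<le> g i\<close> with the supremum spelled
      out.\<close>
    have p: "ennreal (exp (- g i)) \<le> (\<integral>\<^sup>+\<omega>. ennreal (exp (l * (X 0 \<omega> - a i))) \<partial>M)" for l
    proof -
      have "(\<integral>\<^sup>+\<omega>. ennreal (exp (l * (X 0 \<omega> - a i))) \<partial>M) = (\<integral>\<^sup>+\<omega>. ennreal (exp (- l * a i)) * ennreal (exp (l * X 0 \<omega>)) \<partial>M)"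
        by (intro nn_integral_cong) (simp add: ennreal_mult[symmetric] exp_add[symmetric] algebra_simps)
      also have "\<dots> = ennreal (exp (- l * a i)) * \<Phi> l"
        by (subst nn_integral_cmult) (auto simp: Phi)
      finally have e: "(\<integral>\<^sup>+\<omega>. ennreal (exp (l * (X 0 \<omega> - a i))) \<partial>M) = ennreal (exp (- l * a i)) * \<Phi> l" .
      show ?thesis
      proof (cases "\<Phi> l < \<infinity>")
        case True
        have "ennreal (a i * l - logmgf \<Phi> l) \<le> ennreal (g i)"
          using psi_ge[where \<Phi>=\<Phi> and a="a i", OF True] g(1)[OF i] unfolding a_def by (rule order_trans)
        then have "a i * l - logmgf \<Phi> l \<le> g i" using g(2)[of i] by (simp add: ennreal_le_iff)
        then have "exp (- g i) \<le> exp (- l * a i) * exp (logmgf \<Phi> l)" by (simp add: exp_add[symmetric] mult.commute)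
        then show ?thesis unfolding e Phi_exp[OF True] by (simp add: ennreal_mult[symmetric] ennreal_leI)
      next
        case False
        then have "\<Phi> l = top" using less_top[of "\<Phi> l"] by auto
        then show ?thesis unfolding e by (simp add: ennreal_mult_top)
      qed
    qed
    have lt: "exp (- g i - \<delta> / 4) < exp (- g i)" using \<delta> by simp
    have Ym: "(\<lambda>\<omega>. X 0 \<omega> - a i) \<in> borel_measurable M" by measurable
    show ?thesis
      unfolding Q_def using tilting[OF Ym p exp_gt_zero lt] by blast
  qed
  then have "\<forall>i\<in>{..<m}. \<exists>q. Q i (fst q) (snd q)" by simp
  from bchoice[OF this] obtain f where f: "\<forall>i\<in>{..<m}. Q i (fst (f i)) (snd (f i))" by blast
  define R l where "R i = fst (f i)" and "l i = snd (f i)" for i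
  have Q: "Q i (R i) (l i)" if "i < m" for i using f that by (simp add: R_def l_def)
  have R: "0 \<le> R i"
    and tr: "exp (- g i - \<delta> / 4) \<le> trunc_mgf (\<lambda>\<omega>. X 0 \<omega> - a i) (R i) (l i)"
    and mean: "(\<integral>\<omega>. (X 0 \<omega> - a i) * (indicator {-R i..R i} (X 0 \<omega> - a i) * exp (l i * (X 0 \<omega> - a i))) \<partial>M) = 0"
    if "i < m" for i
    using Q[OF that] unfolding Q_def by blast+
  define V where "V = (\<Sum>i<m. (R i)\<^sup>2)"
  have V: "(R i)\<^sup>2 \<le> V" if "i < m" for i unfolding V_def by (rule member_le_sum) (use that in auto)
  define L where "L = (\<Sum>i<m. \<bar>l i\<bar>)"
  have L0: "0 \<le> L" unfolding L_def by (simp add: sum_nonneg)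
  \<comment> \<open>Half of \<epsilon> is for the block sums, half for the rounding of the block
    lengths; the second entry keeps the cost \<open>L * e\<close> of the tilt below
    \<open>\<delta> / 4\<close>.\<close>
  define e where "e = min (\<epsilon> / 2) (\<delta> / (4 * (1 + L)))"
  have e: "e > 0" using \<epsilon> \<delta> L0 by (simp add: e_def add_pos_nonneg)
  have e2: "e \<le> \<epsilon> / 2" unfolding e_def by (rule min.cobounded1)
  have eL: "L * e \<le> \<delta> / 4"
  proof -
    have "L * e \<le> L * (\<delta> / (4 * (1 + L)))" unfolding e_def using L0 by (intro mult_left_mono) auto
    also have "\<dots> \<le> \<delta> / 4" using L0 \<delta> by (simp add: field_simps)
    finally show ?thesis .
  qed
  define C where "C = (\<Sum>i<m. g i + \<delta> / 4)"
  define W where "W = 1 + (\<Sum>i<m. \<bar>a i\<bar>)"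
  have W: "\<bar>a i\<bar> \<le> W" if "i < m" for i
    using member_le_sum[of i "{..<m}" "\<lambda>i. \<bar>a i\<bar>"] that by (simp add: W_def)
  have "\<forall>\<^sub>F A::nat in sequentially. 2 * V / e\<^sup>2 < real A" "\<forall>\<^sub>F A::nat in sequentially. 2 * W / \<epsilon> < real A"
    "\<forall>\<^sub>F A::nat in sequentially. 2 * (ln 2 + C) / \<delta> < real A"
    by (intro filterlim_real_sequentially[THEN filterlim_at_top_dense[THEN iffD1], rule_format])+
  moreover have "\<forall>\<^sub>F A::nat in sequentially. A > 0" by (rule eventually_gt_at_top)
  ultimately show ?thesis
  proof eventually_elim
    case (elim A)
    show ?case
    proof
      fix x
      obtain b where b: "\<And>j. j \<in> {x..<x + A} \<Longrightarrow> b j < m"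
        "\<And>i. i < m \<Longrightarrow> {j\<in>{x..<x + A}. b j = i} = blk m A x i"
        using blk_index[OF m] by blast
      let ?J = "{x..<x + A}" and ?\<phi> = "\<lambda>i. trunc_mgf (\<lambda>\<omega>. X 0 \<omega> - a i) (R i) (l i)"
      have "exp (- (\<Sum>i<m. \<bar>l i\<bar> * (e * real A))) * (\<Prod>j\<in>?J. ?\<phi> (b j)) / 2
        \<le> prob {\<omega>\<in>space M. \<forall>i<m. \<bar>\<Sum>j\<in>{j\<in>?J. b j = i}. X j \<omega> - a i\<bar> \<le> e * real A}"
      proof (rule block_lower_bound[OF _ b(1) R V _ mean])
        show "0 < ?\<phi> i" if "i < m" for i using tr[OF that] exp_gt_zero less_le_trans by blast
        show "real (card ?J) * V \<le> (e * real A)\<^sup>2 / 2"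
        proof -
          have "2 * V \<le> e\<^sup>2 * real A" using elim(1) e by (simp add: field_simps)
          then have "real A * (2 * V) \<le> real A * (e\<^sup>2 * real A)" by (intro mult_left_mono) auto
          then show ?thesis by (simp add: power2_eq_square algebra_simps)
        qed
      qed (use e elim in auto)
      also have "\<dots> \<le> prob {\<omega>\<in>space M. \<forall>i<m. \<bar>D m A x \<omega> i - w i\<bar> < \<epsilon>}"
      proof (rule finite_measure_mono)
        show "{\<omega>\<in>space M. \<forall>i<m. \<bar>\<Sum>j\<in>{j\<in>?J. b j = i}. X j \<omega> - a i\<bar> \<le> e * real A}
          \<subseteq> {\<omega>\<in>space M. \<forall>i<m. \<bar>D m A x \<omega> i - w i\<bar> < \<epsilon>}"
        proof (intro subsetI CollectI conjI allI impI)
          fix \<omega> i assume \<omega>: "\<omega> \<in> {\<omega>\<in>space M. \<forall>i<m. \<bar>\<Sum>j\<in>{j\<in>?J. b j = i}. X j \<omega> - a i\<bar> \<le> e * real A}"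
            and i: "i < m"
          have A0: "real A > 0" using elim by simp
          let ?c = "real (card (blk m A x i))"
          have "\<bar>\<Sum>j\<in>blk m A x i. X j \<omega> - a i\<bar> \<le> e * real A" using \<omega> i b(2)[OF i] by auto
          moreover have "(\<Sum>j\<in>blk m A x i. X j \<omega> - a i) = real A * D m A x \<omega> i - ?c * a i"
            using A0 by (simp add: D_def sum_subtractf)
          ultimately have 1: "\<bar>real A * D m A x \<omega> i - ?c * a i\<bar> \<le> e * real A" by simp
          have "\<bar>(?c - real A / real m) * a i\<bar> \<le> 1 * W"
            unfolding abs_mult using card_blk[OF m, of A x i] W[OF i] by (intro mult_mono) auto
          moreover have "(?c - real A / real m) * a i = ?c * a i - real A * w i"
            using m by (simp add: a_def field_simps)
          ultimately have 2: "\<bar>?c * a i - real A * w i\<bar> \<le> W" by simp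
          have "W < \<epsilon> / 2 * real A" using elim(2) \<epsilon> by (simp add: field_simps)
          moreover have "e * real A \<le> \<epsilon> / 2 * real A" using e2 A0 by (intro mult_right_mono) auto
          ultimately have "\<bar>real A * D m A x \<omega> i - real A * w i\<bar> < real A * \<epsilon>" using 1 2 by (simp add: mult.commute)
          moreover have "\<bar>real A * D m A x \<omega> i - real A * w i\<bar> = real A * \<bar>D m A x \<omega> i - w i\<bar>"
            using A0 by (simp add: abs_mult flip: right_diff_distrib)
          ultimately show "\<bar>D m A x \<omega> i - w i\<bar> < \<epsilon>" using A0 by (simp add: mult_less_cancel_left)
        qed simp
      qed measurable
      finally have lb: "exp (- (\<Sum>i<m. \<bar>l i\<bar> * (e * real A))) * (\<Prod>j\<in>?J. ?\<phi> (b j)) / 2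
        \<le> prob {\<omega>\<in>space M. \<forall>i<m. \<bar>D m A x \<omega> i - w i\<bar> < \<epsilon>}" .
      have "exp (- (\<Sum>j\<in>?J. g (b j) + \<delta> / 4)) = (\<Prod>j\<in>?J. exp (- g (b j) - \<delta> / 4))"
        by (simp add: exp_sum[symmetric] sum_negf[symmetric])
      also have "\<dots> \<le> (\<Prod>j\<in>?J. ?\<phi> (b j))"
        by (intro prod_mono conjI tr b(1)) auto
      finally have 1: "exp (- (\<Sum>j\<in>?J. g (b j) + \<delta> / 4)) \<le> (\<Prod>j\<in>?J. ?\<phi> (b j))" .
      have "(\<Sum>j\<in>?J. g (b j) + \<delta> / 4) = (\<Sum>i<m. \<Sum>j\<in>{j\<in>?J. b j = i}. g (b j) + \<delta> / 4)"
        by (rule sum.group[symmetric]) (use b(1) in auto)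
      also have "\<dots> = (\<Sum>i<m. real (card (blk m A x i)) * (g i + \<delta> / 4))"
      proof (rule sum.cong[OF refl])
        fix i assume "i \<in> {..<m}"
        then have "{j\<in>?J. b j = i} = blk m A x i" using b(2) by simp
        moreover have "(\<Sum>j\<in>{j\<in>?J. b j = i}. g (b j) + \<delta> / 4) = (\<Sum>j\<in>{j\<in>?J. b j = i}. g i + \<delta> / 4)"
          by (intro sum.cong) auto
        ultimately show "(\<Sum>j\<in>{j\<in>?J. b j = i}. g (b j) + \<delta> / 4) = real (card (blk m A x i)) * (g i + \<delta> / 4)" by simp
      qed
      also have "\<dots> \<le> (\<Sum>i<m. (real A / real m + 1) * (g i + \<delta> / 4))"
      proof (intro sum_mono mult_right_mono)
        fix i show "real (card (blk m A x i)) \<le> real A / real m + 1" using card_blk[OF m, of A x i] by linarith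
        show "0 \<le> g i + \<delta> / 4" using g(2)[of i] \<delta> by simp
      qed
      also have "\<dots> = real A * (\<Sum>i<m. (g i + \<delta> / 4) / real m) + C"
        by (simp add: C_def distrib_right sum.distrib sum_distrib_left)
      also have "(\<Sum>i<m. (g i + \<delta> / 4) / real m) = (\<Sum>i<m. g i / real m) + \<delta> / 4"
        using m by (simp add: add_divide_distrib sum.distrib)
      also have "real A * ((\<Sum>i<m. g i / real m) + \<delta> / 4) + C \<le> real A * (\<beta> + \<delta> / 4) + C"
        using \<beta> by (intro add_right_mono mult_left_mono) auto
      finally have 2: "(\<Sum>j\<in>?J. g (b j) + \<delta> / 4) \<le> real A * (\<beta> + \<delta> / 4) + C" .
      have "(\<Sum>i<m. \<bar>l i\<bar> * (e * real A)) = L * e * real A" by (simp add: L_def sum_distrib_right mult.assoc)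
      also have "\<dots> \<le> \<delta> / 4 * real A" using eL by (intro mult_right_mono) auto
      finally have 3: "(\<Sum>i<m. \<bar>l i\<bar> * (e * real A)) \<le> \<delta> / 4 * real A" .
      have 4: "ln 2 + C \<le> \<delta> / 2 * real A" using elim(3) \<delta> by (simp add: field_simps)
      have "- real A * (\<beta> + \<delta>) \<le> - (\<Sum>i<m. \<bar>l i\<bar> * (e * real A)) + - (\<Sum>j\<in>?J. g (b j) + \<delta> / 4) - ln 2"
        using 2 3 4 by (simp add: algebra_simps)
      then have "exp (- real A * (\<beta> + \<delta>)) \<le> exp (- (\<Sum>i<m. \<bar>l i\<bar> * (e * real A)) + - (\<Sum>j\<in>?J. g (b j) + \<delta> / 4) - ln 2)" by simp
      also have "\<dots> = exp (- (\<Sum>i<m. \<bar>l i\<bar> * (e * real A))) * exp (- (\<Sum>j\<in>?J. g (b j) + \<delta> / 4)) / 2"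
        by (simp only: exp_diff exp_add exp_ln)
      also have "\<dots> \<le> exp (- (\<Sum>i<m. \<bar>l i\<bar> * (e * real A))) * (\<Prod>j\<in>?J. ?\<phi> (b j)) / 2"
        using 1 by (intro divide_right_mono mult_left_mono) auto
      finally show "exp (- real A * (\<beta> + \<delta>)) \<le> prob {\<omega>\<in>space M. \<forall>i<m. \<bar>D m A x \<omega> i - w i\<bar> < \<epsilon>}"
        using lb by (rule order_trans)
    qed
  qed
qed

text \<open>The region treated by one Chernoff bound: exponents that have the signs of v give u a
  scalar product at least as large as v.\<close>

definition dominates :: "nat \<Rightarrow> (nat \<Rightarrow> real) \<Rightarrow> (nat \<Rightarrow> real) \<Rightarrow> bool" where
  "dominates m u v \<longleftrightarrow> (\<forall>i<m. (0 < v i \<longrightarrow> v i \<le> u i) \<and> (v i < 0 \<longrightarrow> u i \<le> v i))"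

lemma dominates_measurable [measurable]: "{\<omega>\<in>space M. dominates m (D m A x \<omega>) v} \<in> events"
  unfolding dominates_def by measurable

text \<open>As the rate of v exceeds \<alpha> strictly, one exponent for each block can be chosen
  such that the resulting sum \<tau> is still above \<alpha>; the surplus is \<delta>. The constant
  C absorbs blocks that are longer than \<open>A / m\<close>.\<close>

lemma prob_dominates_le:
  assumes m: "m > 0" and \<alpha>: "\<alpha> \<ge> 0" and v: "ennreal \<alpha> < rate \<Phi> m v"
  obtains \<delta> C where "\<delta> > 0" "\<And>A x. prob {\<omega>\<in>space M. dominates m (D m A x \<omega>) v} \<le> exp (C - real A * (\<alpha> + \<delta>))"
proof -
  define I where "I = {\<theta>. \<Phi> \<theta> < \<infinity>}"
  have I0: "0 \<in> I" by (simp add: I_def Phi_0)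
  define t where "t i \<theta> = v i * \<theta> - logmgf \<Phi> \<theta> / real m" for i \<theta>
  have "rate \<Phi> m v = (\<Sum>i<m. SUP \<theta>\<in>I. ennreal (t i \<theta>))"
    unfolding rate_def
  proof (rule sum.cong[OF refl])
    fix i
    have "ennreal (1 / real m) * psi \<Phi> (real m * v i) = (SUP \<theta>\<in>I. ennreal (1 / real m) * ennreal (real m * v i * \<theta> - logmgf \<Phi> \<theta>))"
      unfolding psi_eq I_def by (rule SUP_mult_left_ennreal)
    also have "\<dots> = (SUP \<theta>\<in>I. ennreal (t i \<theta>))"
      using m by (intro SUP_cong refl) (simp add: ennreal_mult'[symmetric] t_def field_simps)
    finally show "ennreal (1 / real m) * psi \<Phi> (real m * v i) = (SUP \<theta>\<in>I. ennreal (t i \<theta>))" .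
  qed
  then have "ennreal \<alpha> < 0 + (\<Sum>i<m. SUP \<theta>\<in>I. ennreal (t i \<theta>))" using v by simp
  then obtain s where s: "\<And>i. s i \<in> I" "ennreal \<alpha> < 0 + (\<Sum>i<m. ennreal (t i (s i)))"
    using SUP_sum_choice[of I "ennreal \<alpha>" 0 "\<lambda>i \<theta>. ennreal (t i \<theta>)" m] I0 by blast
  \<comment> \<open>Terms that do not contribute get exponent 0. Any other exponent has the sign of
    its \<open>v i\<close>, because the logarithm of \<Phi> is nonnegative.\<close>
  define \<theta> where "\<theta> i = (if t i (s i) > 0 then s i else 0)" for i
  have \<theta>: "\<Phi> (\<theta> i) < \<infinity>" for i using s(1)[of i] I0 by (auto simp: \<theta>_def I_def)
  have t\<theta>: "t i (\<theta> i) = max 0 (t i (s i))" for i by (auto simp: \<theta>_def t_def logmgf_0 max_def)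
  define \<tau> where "\<tau> = (\<Sum>i<m. t i (\<theta> i))"
  have "(\<Sum>i<m. ennreal (t i (s i))) = (\<Sum>i<m. ennreal (t i (\<theta> i)))"
    by (intro sum.cong refl) (simp add: t\<theta> ennreal_max_0)
  also have "\<dots> = ennreal \<tau>" unfolding \<tau>_def by (rule sum_ennreal) (simp add: t\<theta>)
  finally have \<tau>: "\<alpha> < \<tau>" using s(2) \<alpha> by (simp add: ennreal_less_iff)
  have sign: "\<theta> i = 0 \<or> 0 < v i * \<theta> i" for i
  proof (cases "t i (s i) > 0")
    case True
    have "0 \<le> logmgf \<Phi> (s i) / real m" using logmgf_nonneg s(1)[of i] by (simp add: I_def)
    then show ?thesis using True by (simp add: \<theta>_def t_def)
  qed (simp add: \<theta>_def)
  define C where "C = (\<Sum>i<m. logmgf \<Phi> (\<theta> i))"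
  have "prob {\<omega>\<in>space M. dominates m (D m A x \<omega>) v} \<le> exp (C - real A * (\<alpha> + (\<tau> - \<alpha>)))" for A x
  proof (cases "A = 0")
    case True
    have "0 \<le> C" unfolding C_def using logmgf_nonneg \<theta> by (intro sum_nonneg) auto
    then show ?thesis using True prob_le_1 order_trans[of _ 1 "exp C"] by simp
  next
    case False
    let ?J = "{x..<x + A}" and ?E = "{\<omega>\<in>space M. dominates m (D m A x \<omega>) v}"
    obtain b where b: "\<And>j. j \<in> ?J \<Longrightarrow> b j < m" "\<And>i. i < m \<Longrightarrow> {j\<in>?J. b j = i} = blk m A x i"
      using blk_index[OF m] by blast
    define K where "K = (\<Sum>i<m. \<theta> i * v i)"
    have grp: "(\<Sum>j\<in>?J. h (b j) j) = (\<Sum>i<m. \<Sum>j\<in>blk m A x i. h i j)" for h :: "nat \<Rightarrow> nat \<Rightarrow> real"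
    proof -
      have "(\<Sum>j\<in>?J. h (b j) j) = (\<Sum>i<m. \<Sum>j\<in>{j\<in>?J. b j = i}. h (b j) j)"
        by (rule sum.group[symmetric]) (use b(1) in auto)
      also have "\<dots> = (\<Sum>i<m. \<Sum>j\<in>blk m A x i. h i j)"
      proof (rule sum.cong[OF refl])
        fix i assume "i \<in> {..<m}"
        then have "{j\<in>?J. b j = i} = blk m A x i" using b(2) by simp
        moreover have "(\<Sum>j\<in>{j\<in>?J. b j = i}. h (b j) j) = (\<Sum>j\<in>{j\<in>?J. b j = i}. h i j)"
          by (intro sum.cong) auto
        ultimately show "(\<Sum>j\<in>{j\<in>?J. b j = i}. h (b j) j) = (\<Sum>j\<in>blk m A x i. h i j)" by simp
      qed
      finally show ?thesis .
    qed
    have E_le: "indicator ?E \<omega> \<le> ennreal (exp (- real A * K)) * (\<Prod>j\<in>?J. ennreal (exp (\<theta> (b j) * X j \<omega>)))" for \<omega>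
    proof (cases "\<omega> \<in> ?E")
      case True
      have "\<theta> i * v i \<le> \<theta> i * D m A x \<omega> i" if "i < m" for i
      proof -
        consider "\<theta> i = 0" | "0 < v i" "0 < \<theta> i" | "v i < 0" "\<theta> i < 0" using sign[of i] by (auto simp: zero_less_mult_iff)
        then show ?thesis
          using True that by cases (auto simp: dominates_def intro: mult_left_mono mult_left_mono_neg)
      qed
      then have "K \<le> (\<Sum>i<m. \<theta> i * D m A x \<omega> i)" unfolding K_def by (intro sum_mono) auto
      then have "real A * K \<le> real A * (\<Sum>i<m. \<theta> i * D m A x \<omega> i)" by (rule mult_left_mono) simp
      also have "\<dots> = (\<Sum>i<m. \<Sum>j\<in>blk m A x i. \<theta> i * X j \<omega>)"
        using False by (simp add: D_def sum_distrib_left sum_divide_distrib)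
      also have "\<dots> = (\<Sum>j\<in>?J. \<theta> (b j) * X j \<omega>)" by (rule grp[symmetric])
      finally have "1 \<le> exp (- real A * K) * exp (\<Sum>j\<in>?J. \<theta> (b j) * X j \<omega>)" by (simp flip: exp_add)
      then have "1 \<le> ennreal (exp (- real A * K) * exp (\<Sum>j\<in>?J. \<theta> (b j) * X j \<omega>))" by (simp add: ennreal_1[symmetric] del: ennreal_1)
      also have "\<dots> = ennreal (exp (- real A * K)) * (\<Prod>j\<in>?J. ennreal (exp (\<theta> (b j) * X j \<omega>)))"
        by (subst ennreal_mult) (simp_all add: exp_sum prod_ennreal prod_nonneg)
      finally show ?thesis using True by simp
    qed simp
    have "emeasure M ?E = (\<integral>\<^sup>+\<omega>. indicator ?E \<omega> \<partial>M)" by (rule nn_integral_indicator[symmetric]) measurable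
    also have "\<dots> \<le> (\<integral>\<^sup>+\<omega>. ennreal (exp (- real A * K)) * (\<Prod>j\<in>?J. ennreal (exp (\<theta> (b j) * X j \<omega>))) \<partial>M)"
      by (intro nn_integral_mono E_le)
    also have "\<dots> = ennreal (exp (- real A * K)) * (\<integral>\<^sup>+\<omega>. (\<Prod>j\<in>?J. ennreal (exp (\<theta> (b j) * X j \<omega>))) \<partial>M)"
      by (rule nn_integral_cmult) measurable
    also have "(\<integral>\<^sup>+\<omega>. (\<Prod>j\<in>?J. ennreal (exp (\<theta> (b j) * X j \<omega>))) \<partial>M) = (\<Prod>j\<in>?J. \<Phi> (\<theta> (b j)))"
      unfolding Phi by (rule nn_integral_prod_X[where f="\<lambda>j x. ennreal (exp (\<theta> (b j) * x))"]) auto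
    also have "\<dots> = (\<Prod>j\<in>?J. ennreal (exp (logmgf \<Phi> (\<theta> (b j)))))"
      by (intro prod.cong refl Phi_exp \<theta>)
    also have "\<dots> = ennreal (exp (\<Sum>j\<in>?J. logmgf \<Phi> (\<theta> (b j))))"
      by (simp add: prod_ennreal exp_sum)
    finally have 1: "emeasure M ?E \<le> ennreal (exp (- real A * K + (\<Sum>j\<in>?J. logmgf \<Phi> (\<theta> (b j)))))"
      unfolding exp_add by (simp add: ennreal_mult)
    have "(\<Sum>j\<in>?J. logmgf \<Phi> (\<theta> (b j))) = (\<Sum>i<m. real (card (blk m A x i)) * logmgf \<Phi> (\<theta> i))"
      using grp[of "\<lambda>i j. logmgf \<Phi> (\<theta> i)"] by simp
    also have "\<dots> \<le> (\<Sum>i<m. (real A / real m + 1) * logmgf \<Phi> (\<theta> i))"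
    proof (intro sum_mono mult_right_mono)
      fix i show "real (card (blk m A x i)) \<le> real A / real m + 1" using card_blk[OF m, of A x i] by linarith
      show "0 \<le> logmgf \<Phi> (\<theta> i)" by (rule logmgf_nonneg[OF \<theta>])
    qed
    also have "\<dots> = real A * (\<Sum>i<m. logmgf \<Phi> (\<theta> i) / real m) + C"
      by (simp add: C_def distrib_right sum.distrib sum_distrib_left)
    finally have "- real A * K + (\<Sum>j\<in>?J. logmgf \<Phi> (\<theta> (b j))) \<le> - real A * (K - (\<Sum>i<m. logmgf \<Phi> (\<theta> i) / real m)) + C"
      by (simp add: algebra_simps)
    also have "K - (\<Sum>i<m. logmgf \<Phi> (\<theta> i) / real m) = \<tau>"
      by (simp add: K_def \<tau>_def t_def sum_subtractf mult.commute)
    finally have "ennreal (exp (- real A * K + (\<Sum>j\<in>?J. logmgf \<Phi> (\<theta> (b j))))) \<le> ennreal (exp (C - real A * (\<alpha> + (\<tau> - \<alpha>))))"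
      by (intro ennreal_leI) simp
    with 1 have "ennreal (prob ?E) \<le> ennreal (exp (C - real A * (\<alpha> + (\<tau> - \<alpha>))))"
      unfolding emeasure_eq_measure by (rule order_trans)
    then show ?thesis by (simp add: ennreal_le_iff)
  qed
  then show ?thesis using that[of "\<tau> - \<alpha>" C] \<tau> by simp
qed

end

section \<open>Borel--Cantelli and rounding to a grid\<close>

text \<open>The first few \<open>B n\<close> need not be events; they are replaced by the empty
  set.\<close>

lemma (in prob_space) borel_cantelli_eventually:
  fixes f :: "nat \<Rightarrow> real"
  assumes B: "\<forall>\<^sub>F n in sequentially. B n \<in> events \<and> prob (B n) \<le> f n" and f: "summable f"
  shows "AE \<omega> in M. \<forall>\<^sub>F n in sequentially. \<omega> \<notin> B n"
proof -
  define B' where "B' n = (if B n \<in> events \<and> prob (B n) \<le> f n then B n else {})" for n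
  have ev: "B' n \<in> events" for n by (simp add: B'_def)
  have "summable (\<lambda>n. prob (B' n))"
  proof (rule summable_comparison_test_ev[OF _ f])
    show "\<forall>\<^sub>F n in sequentially. norm (prob (B' n)) \<le> f n"
      using B by eventually_elim (simp add: B'_def)
  qed
  then have "AE \<omega> in M. \<forall>\<^sub>F n in sequentially. \<omega> \<in> space M - B' n"
    by (intro borel_cantelli_AE1 ev) (auto simp: less_top[symmetric])
  then show ?thesis
  proof eventually_elim
    case (elim \<omega>)
    from elim B show ?case by eventually_elim (simp add: B'_def)
  qed
qed

text \<open>Rounding towards 0, so that it neither increases psi nor leaves the half spaces of \<open>dominates\<close>.\<close>

definition rd :: "real \<Rightarrow> real \<Rightarrow> real" where
  "rd h y = (if 0 \<le> y then h * of_int \<lfloor>y / h\<rfloor> else h * of_int \<lceil>y / h\<rceil>)"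

lemma rd_pos:
  assumes "h > 0" "0 \<le> y"
  shows "0 \<le> rd h y" "rd h y \<le> y" "y \<le> rd h y + h"
proof -
  have "h * of_int \<lfloor>y / h\<rfloor> \<le> h * (y / h)" "h * (y / h) \<le> h * (of_int \<lfloor>y / h\<rfloor> + 1)"
    using assms by (intro mult_left_mono; simp)+
  moreover have "0 \<le> \<lfloor>y / h\<rfloor>" using assms by simp
  ultimately show "0 \<le> rd h y" "rd h y \<le> y" "y \<le> rd h y + h"
    using assms by (auto simp: rd_def distrib_left)
qed

lemma rd_neg:
  assumes "h > 0" "y \<le> 0"
  shows "rd h y \<le> 0" "y \<le> rd h y" "rd h y \<le> y + h"
proof -
  have 1: "h * (y / h) \<le> h * of_int \<lceil>y / h\<rceil>" "h * of_int \<lceil>y / h\<rceil> \<le> h * (y / h + 1)"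
    using assms by (intro mult_left_mono; simp)+
  have "\<lceil>y / h\<rceil> \<le> 0" using assms by (simp add: ceiling_le_iff divide_nonpos_pos)
  then have "h * of_int \<lceil>y / h\<rceil> \<le> 0" using assms by (intro mult_nonneg_nonpos) auto
  moreover have "y \<le> h * of_int \<lceil>y / h\<rceil>" "h * of_int \<lceil>y / h\<rceil> \<le> y + h"
    using 1 assms by (simp_all add: distrib_left)
  moreover have "rd h y = h * of_int \<lceil>y / h\<rceil>" using assms by (cases "y = 0") (auto simp: rd_def)
  ultimately show "rd h y \<le> 0" "y \<le> rd h y" "rd h y \<le> y + h" by simp_all
qed

lemma rd_close: "h > 0 \<Longrightarrow> \<bar>y - rd h y\<bar> \<le> h"
  using rd_pos[of h y] rd_neg[of h y] by (cases "0 \<le> y") auto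

lemma rd_abs: "h > 0 \<Longrightarrow> \<bar>rd h y\<bar> \<le> \<bar>y\<bar>"
  using rd_pos[of h y] rd_neg[of h y] by (cases "0 \<le> y") auto

lemma rd_grid:
  assumes h: "h > 0" and N: "C \<le> h * real N" and y: "\<bar>y\<bar> \<le> C"
  shows "rd h y \<in> (\<lambda>z. h * of_int z) ` {- int N..int N}"
proof -
  obtain z where z: "rd h y = h * of_int z" unfolding rd_def by (cases "0 \<le> y") auto
  have "h * \<bar>of_int z\<bar> = \<bar>rd h y\<bar>" using h by (simp add: z abs_mult)
  also have "\<dots> \<le> h * real N" using rd_abs[OF h, of y] y N by linarith
  finally have "h * \<bar>of_int z\<bar> \<le> h * real N" .
  then have "\<bar>of_int z\<bar> \<le> real N" using h by (simp add: mult_le_cancel_left)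
  then have "z \<in> {- int N..int N}" by (simp add: abs_le_iff)
  then show ?thesis unfolding z by (rule imageI)
qed

lemma rate_cong: "(\<And>i. i < m \<Longrightarrow> v i = w i) \<Longrightarrow> rate \<Phi> m v = rate \<Phi> m w"
  unfolding rate_def by (intro sum.cong) auto

lemma disjoint_consecutive_blocks: "disjoint_family_on (\<lambda>r. {r * A..<r * A + A}) I" for A :: nat
  unfolding disjoint_family_on_def
proof (intro ballI impI)
  fix r s :: nat assume "r \<noteq> s"
  then consider "Suc r * A \<le> s * A" | "Suc s * A \<le> r * A"
    by (metis linorder_neqE_nat Suc_leI mult_le_mono1)
  then show "{r * A..<r * A + A} \<inter> {s * A..<s * A + A} = {}" by cases auto
qed

context walk
begin

text \<open>An exponent that favours r over y has \<open>r * \<theta> \<le> 0\<close> and then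
  contributes nothing, as the logarithm of \<Phi> is nonnegative.\<close>

lemma psi_mono_abs:
  assumes "(0 \<le> r \<and> r \<le> y) \<or> (y \<le> r \<and> r \<le> 0)"
  shows "psi \<Phi> r \<le> psi \<Phi> y"
proof (rule psi_least)
  fix \<theta> assume \<theta>: "\<Phi> \<theta> < \<infinity>"
  show "ennreal (r * \<theta> - logmgf \<Phi> \<theta>) \<le> psi \<Phi> y"
  proof (cases "r * \<theta> \<le> y * \<theta>")
    case True
    then have "ennreal (r * \<theta> - logmgf \<Phi> \<theta>) \<le> ennreal (y * \<theta> - logmgf \<Phi> \<theta>)" by (intro ennreal_leI) simp
    also have "\<dots> \<le> psi \<Phi> y" by (rule psi_ge[where \<Phi>=\<Phi>, OF \<theta>])
    finally show ?thesis .
  next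
    case False
    then have "r * \<theta> \<le> 0"
      using assms by (cases "\<theta> \<ge> 0") (auto simp: mult_right_mono mult_right_mono_neg mult_nonneg_nonpos mult_nonpos_nonneg)
    then show ?thesis using logmgf_nonneg[OF \<theta>] by (simp add: ennreal_neg)
  qed
qed

text \<open>Convexity of \<open>psi\<close> between 0, where it vanishes, and a.\<close>

lemma psi_mult_le:
  assumes "0 \<le> k" "k \<le> 1"
  shows "psi \<Phi> (k * a) \<le> ennreal k * psi \<Phi> a"
proof (rule psi_least)
  fix \<theta> assume \<theta>: "\<Phi> \<theta> < \<infinity>"
  have "k * logmgf \<Phi> \<theta> \<le> logmgf \<Phi> \<theta>" using logmgf_nonneg[OF \<theta>] assms by (simp add: mult_left_le_one_le)
  then have "k * a * \<theta> - logmgf \<Phi> \<theta> \<le> k * (a * \<theta> - logmgf \<Phi> \<theta>)" by (simp add: algebra_simps)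
  then have "ennreal (k * a * \<theta> - logmgf \<Phi> \<theta>) \<le> ennreal (k * (a * \<theta> - logmgf \<Phi> \<theta>))" by (rule ennreal_leI)
  also have "\<dots> = ennreal k * ennreal (a * \<theta> - logmgf \<Phi> \<theta>)" using assms by (simp add: ennreal_mult')
  also have "\<dots> \<le> ennreal k * psi \<Phi> a" by (intro mult_left_mono psi_ge[where \<Phi>=\<Phi>, OF \<theta>]) simp
  finally show "ennreal (k * a * \<theta> - logmgf \<Phi> \<theta>) \<le> ennreal k * psi \<Phi> a" .
qed

lemma psi_coercive:
  assumes \<theta>: "\<theta> > 0" "\<Phi> \<theta> < \<infinity>" "\<Phi> (- \<theta>) < \<infinity>"
  shows "ennreal (\<theta> * \<bar>a\<bar> - (logmgf \<Phi> \<theta> + logmgf \<Phi> (- \<theta>))) \<le> psi \<Phi> a"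
proof -
  have "ennreal (\<theta> * \<bar>a\<bar> - (logmgf \<Phi> \<theta> + logmgf \<Phi> (- \<theta>))) \<le> ennreal (a * \<theta> - logmgf \<Phi> \<theta>)
    \<or> ennreal (\<theta> * \<bar>a\<bar> - (logmgf \<Phi> \<theta> + logmgf \<Phi> (- \<theta>))) \<le> ennreal (a * - \<theta> - logmgf \<Phi> (- \<theta>))"
    using logmgf_nonneg[OF \<theta>(2)] logmgf_nonneg[OF \<theta>(3)]
    by (cases "0 \<le> a") (auto simp: mult.commute intro!: ennreal_leI)
  then show ?thesis
    using psi_ge[where \<Phi>=\<Phi> and a=a, OF \<theta>(2)] psi_ge[where \<Phi>=\<Phi> and a=a, OF \<theta>(3)] by (meson order_trans)
qed

lemma rate_rd_le:
  assumes "h > 0" shows "rate \<Phi> m (\<lambda>i. rd h (d i)) \<le> rate \<Phi> m d"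
  unfolding rate_def
proof (intro sum_mono mult_left_mono psi_mono_abs)
  fix i
  show "0 \<le> real m * rd h (d i) \<and> real m * rd h (d i) \<le> real m * d i \<or> real m * d i \<le> real m * rd h (d i) \<and> real m * rd h (d i) \<le> 0"
    using rd_pos[OF assms, of "d i"] rd_neg[OF assms, of "d i"]
    by (cases "0 \<le> d i") (auto intro: mult_left_mono mult_nonneg_nonpos)
qed simp

lemma rate_term_le: "i < m \<Longrightarrow> ennreal (1 / real m) * psi \<Phi> (real m * d i) \<le> rate \<Phi> m d"
  unfolding rate_def by (rule member_le_sum) auto

text \<open>Vectors of bounded rate lie in a cube that does not depend on m.\<close>

lemma rate_bounded:
  assumes \<theta>: "\<theta> > 0" "\<Phi> \<theta> < \<infinity>" "\<Phi> (- \<theta>) < \<infinity>" and i: "i < m"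
  shows "ennreal (\<theta> * \<bar>d i\<bar> - (logmgf \<Phi> \<theta> + logmgf \<Phi> (- \<theta>))) \<le> rate \<Phi> m d"
proof -
  define L where "L = logmgf \<Phi> \<theta> + logmgf \<Phi> (- \<theta>)"
  have L: "0 \<le> L" using logmgf_nonneg[OF \<theta>(2)] logmgf_nonneg[OF \<theta>(3)] by (simp add: L_def)
  have m: "real m \<ge> 1" "m > 0" using i by auto
  have "L / real m \<le> L" using L m by (simp add: field_simps mult_le_cancel_left1)
  then have "ennreal (\<theta> * \<bar>d i\<bar> - L) \<le> ennreal (1 / real m * (\<theta> * \<bar>real m * d i\<bar> - L))"
    using m by (intro ennreal_leI) (simp add: abs_mult field_simps)
  also have "\<dots> = ennreal (1 / real m) * ennreal (\<theta> * \<bar>real m * d i\<bar> - L)" by (rule ennreal_mult') simp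
  also have "\<dots> \<le> ennreal (1 / real m) * psi \<Phi> (real m * d i)"
    unfolding L_def by (intro mult_left_mono psi_coercive \<theta>) simp
  also have "\<dots> \<le> rate \<Phi> m d" by (rule rate_term_le[OF i])
  finally show ?thesis unfolding L_def .
qed

lemma dominates_rd: "h > 0 \<Longrightarrow> dominates m u (\<lambda>i. rd h (u i))"
  unfolding dominates_def
proof (intro allI impI conjI)
  fix i assume h: "h > 0"
  show "0 < rd h (u i) \<Longrightarrow> rd h (u i) \<le> u i" "rd h (u i) < 0 \<Longrightarrow> u i \<le> rd h (u i)"
    using rd_pos[OF h, of "u i"] rd_neg[OF h, of "u i"] by (cases "0 \<le> u i"; force)+
qed

text \<open>If the rounded vector has rate above \<alpha>, it is one of finitely many grid vectors,
  and D dominates it because rounding is towards 0. The spikes exclude large coordinates, which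
  keeps the grid finite.\<close>

lemma rate_rounded_D_le:
  assumes m: "m > 0" and h: "h > 0" and \<alpha>: "\<alpha> \<ge> 0"
    and \<theta>: "\<theta> > 0" "\<Phi> \<theta> < \<infinity>" "\<Phi> (- \<theta>) < \<infinity>"
  shows "\<exists>\<delta> C Bad. \<delta> > 0 \<and> (\<forall>A x. Bad A x \<in> events \<and> prob (Bad A x) \<le> exp (C - real A * (\<alpha> + \<delta>)) \<and>
    (\<forall>\<omega>\<in>space M - Bad A x. rate \<Phi> m (\<lambda>i. rd h (D m A x \<omega> i)) \<le> ennreal \<alpha>))"
proof -
  define L where "L = logmgf \<Phi> \<theta> + logmgf \<Phi> (- \<theta>)"
  have L: "0 \<le> L" using logmgf_nonneg[OF \<theta>(2)] logmgf_nonneg[OF \<theta>(3)] by (simp add: L_def)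
  \<comment> \<open>A spike of height c has rate at least
    \<open>\<theta> * c - L = \<alpha> + 1\<close>.\<close>
  define c where "c = (\<alpha> + L + 1) / \<theta>"
  have c: "c > 0" using \<alpha> L \<theta> by (simp add: c_def)
  obtain N :: nat where "c / h \<le> real N" using real_arch_simple by blast
  then have N: "c \<le> h * real N" using h by (simp add: field_simps)
  define G where "G = (\<lambda>z. h * of_int z) ` {- int N..int N}"
  define spike where "spike i s = (\<lambda>k. if k = i then s * c else 0)" for i :: nat and s :: real
  define V where "V = {v \<in> {..<m} \<rightarrow>\<^sub>E G. ennreal \<alpha> < rate \<Phi> m v} \<union> (\<lambda>(i, s). spike i s) ` ({..<m} \<times> {1, -1})"
  have "finite ({..<m} \<rightarrow>\<^sub>E G)" by (intro finite_PiE) (auto simp: G_def)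
  then have finV: "finite V" unfolding V_def by auto
  have "spike 0 1 \<in> V" unfolding V_def using m by (intro UnI2 image_eqI[of _ _ "(0, 1)"]) auto
  then have V0: "V \<noteq> {}" by blast
  have Vrate: "ennreal \<alpha> < rate \<Phi> m v" if "v \<in> V" for v
  proof -
    have "ennreal \<alpha> < rate \<Phi> m (spike i s)" if i: "i < m" and s: "\<bar>s\<bar> = 1" for i s
    proof -
      have "\<theta> * \<bar>spike i s i\<bar> = \<theta> * c" using s c by (simp add: spike_def abs_mult)
      also have "\<dots> = \<alpha> + L + 1" using \<theta>(1) by (simp add: c_def)
      finally have "\<theta> * \<bar>spike i s i\<bar> = \<alpha> + L + 1" .
      then have "ennreal (\<theta> * \<bar>spike i s i\<bar> - L) = ennreal (\<alpha> + 1)" by simp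
      moreover have "ennreal (\<theta> * \<bar>spike i s i\<bar> - L) \<le> rate \<Phi> m (spike i s)"
        unfolding L_def by (rule rate_bounded[OF \<theta> i])
      moreover have "ennreal \<alpha> < ennreal (\<alpha> + 1)" using \<alpha> by (simp add: ennreal_less_iff)
      ultimately show ?thesis by simp
    qed
    then show ?thesis using that unfolding V_def by auto
  qed
  have "\<exists>q. fst q > 0 \<and> (\<forall>A x. prob {\<omega>\<in>space M. dominates m (D m A x \<omega>) v} \<le> exp (snd q - real A * (\<alpha> + fst q)))"
    if v: "v \<in> V" for v
  proof -
    obtain \<delta> C where "\<delta> > 0" "\<And>A x. prob {\<omega>\<in>space M. dominates m (D m A x \<omega>) v} \<le> exp (C - real A * (\<alpha> + \<delta>))"
      using prob_dominates_le[OF m \<alpha> Vrate[OF v]] by blast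
    then show ?thesis by (intro exI[of _ "(\<delta>, C)"]) simp
  qed
  then have "\<forall>v\<in>V. \<exists>q. fst q > 0 \<and> (\<forall>A x. prob {\<omega>\<in>space M. dominates m (D m A x \<omega>) v} \<le> exp (snd q - real A * (\<alpha> + fst q)))"
    by simp
  from bchoice[OF this] obtain q where q: "\<And>v. v \<in> V \<Longrightarrow> fst (q v) > 0"
    "\<And>v A x. v \<in> V \<Longrightarrow> prob {\<omega>\<in>space M. dominates m (D m A x \<omega>) v} \<le> exp (snd (q v) - real A * (\<alpha> + fst (q v)))"
    by blast
  \<comment> \<open>The finitely many bounds are merged by taking the least surplus and adding up
    the constant factors.\<close>
  define \<delta> where "\<delta> = Min ((\<lambda>v. fst (q v)) ` V)"
  have \<delta>: "\<delta> > 0" unfolding \<delta>_def using finV V0 q(1) by (subst Min_gr_iff) auto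
  have \<delta>_le: "\<delta> \<le> fst (q v)" if "v \<in> V" for v unfolding \<delta>_def using finV that by (intro Min_le) auto
  define S where "S = (\<Sum>v\<in>V. exp (snd (q v)))"
  have S: "S > 0" unfolding S_def using finV V0 by (intro sum_pos) auto
  define Bad where "Bad A x = (\<Union>v\<in>V. {\<omega>\<in>space M. dominates m (D m A x \<omega>) v})" for A x
  show ?thesis
  proof (rule exI[of _ \<delta>], rule exI[of _ "ln S"], rule exI[of _ Bad], intro conjI allI ballI)
    show "Bad A x \<in> events" for A x unfolding Bad_def using finV by (intro sets.finite_UN) auto
    show "prob (Bad A x) \<le> exp (ln S - real A * (\<alpha> + \<delta>))" for A x
    proof -
      have "prob (Bad A x) \<le> (\<Sum>v\<in>V. prob {\<omega>\<in>space M. dominates m (D m A x \<omega>) v})"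
        unfolding Bad_def by (rule measure_UNION_le[OF finV]) auto
      also have "\<dots> \<le> (\<Sum>v\<in>V. exp (snd (q v)) * exp (- real A * (\<alpha> + \<delta>)))"
      proof (rule sum_mono)
        fix v assume v: "v \<in> V"
        have "prob {\<omega>\<in>space M. dominates m (D m A x \<omega>) v} \<le> exp (snd (q v) - real A * (\<alpha> + fst (q v)))" by (rule q(2)[OF v])
        also have "\<dots> \<le> exp (snd (q v) - real A * (\<alpha> + \<delta>))" using \<delta>_le[OF v] by (simp add: mult_left_mono)
        also have "\<dots> = exp (snd (q v)) * exp (- real A * (\<alpha> + \<delta>))" by (simp flip: exp_add)
        finally show "prob {\<omega>\<in>space M. dominates m (D m A x \<omega>) v} \<le> exp (snd (q v)) * exp (- real A * (\<alpha> + \<delta>))" .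
      qed
      also have "\<dots> = S * exp (- real A * (\<alpha> + \<delta>))" by (simp add: S_def sum_distrib_right)
      also have "\<dots> = exp (ln S - real A * (\<alpha> + \<delta>))" using S by (simp only: exp_diff exp_ln mult_minus_left exp_minus divide_inverse)
      finally show ?thesis .
    qed
    fix A x \<omega> assume \<omega>: "\<omega> \<in> space M - Bad A x"
    let ?u = "D m A x \<omega>"
    have nd: "\<not> dominates m ?u v" if "v \<in> V" for v using \<omega> that by (auto simp: Bad_def)
    have bd: "\<bar>?u i\<bar> \<le> c" if i: "i < m" for i
    proof (rule ccontr)
      assume neg: "\<not> \<bar>?u i\<bar> \<le> c"
      define s where "s = (if 0 \<le> ?u i then 1 else -1 :: real)"
      have "spike i s \<in> V" unfolding V_def using i by (intro UnI2 image_eqI[of _ _ "(i, s)"]) (auto simp: s_def)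
      moreover have "dominates m ?u (spike i s)"
        unfolding dominates_def spike_def s_def using neg c by auto
      ultimately show False using nd by blast
    qed
    show "rate \<Phi> m (\<lambda>i. rd h (?u i)) \<le> ennreal \<alpha>"
    proof (rule ccontr)
      assume neg: "\<not> ?thesis"
      define v where "v = restrict (\<lambda>i. rd h (?u i)) {..<m}"
      have "rate \<Phi> m v = rate \<Phi> m (\<lambda>i. rd h (?u i))" by (rule rate_cong) (simp add: v_def)
      then have "ennreal \<alpha> < rate \<Phi> m v" using neg by simp
      moreover have "v \<in> {..<m} \<rightarrow>\<^sub>E G"
        unfolding v_def G_def using rd_grid[OF h N bd] by (intro restrict_PiE_iff[THEN iffD2] ballI) simp
      ultimately have "v \<in> V" unfolding V_def by blast
      moreover have "dominates m ?u v"
        using dominates_rd[OF h, of m ?u] by (simp add: dominates_def v_def)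
      ultimately show False using nd by blast
    qed
  qed (rule \<delta>)
qed

text \<open>The windows that start at multiples of A are disjoint, hence independent, and
  \<open>(1 - p)^N \<le> exp (- p * N)\<close>.\<close>

lemma no_hit_bound:
  assumes m: "m > 0" and A: "A > 0"
    and p: "\<And>x. p \<le> prob {\<omega>\<in>space M. \<forall>i<m. \<bar>D m A x \<omega> i - w i\<bar> < \<epsilon>}"
  shows "prob {\<omega>\<in>space M. \<forall>r<N. \<not> (\<forall>i<m. \<bar>D m A (r * A) \<omega> i - w i\<bar> < \<epsilon>)} \<le> exp (- p * real N)"
proof -
  let ?G = "\<lambda>r. {\<omega>\<in>space M. \<forall>i<m. \<bar>D m A (r * A) \<omega> i - w i\<bar> < \<epsilon>}"
  let ?F = "{\<omega>\<in>space M. \<forall>r<N. \<not> (\<forall>i<m. \<bar>D m A (r * A) \<omega> i - w i\<bar> < \<epsilon>)}"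
  define K where "K r = {r * A..<r * A + A}" for r
  have sub: "blk m A (r * A) i \<subseteq> K r" if "i < m" for r i
    using blk_mono[of "Suc i" m A m] that m by (auto simp: blk_def K_def)
  have disj: "disjoint_family_on K {..<N}"
    unfolding K_def by (rule disjoint_consecutive_blocks)
  \<comment> \<open>The indicator of a miss, as a function of the increments in window r alone, so
    that the independence of disjoint groups applies.\<close>
  define f :: "nat \<Rightarrow> (nat \<Rightarrow> real) \<Rightarrow> ennreal" where
    "f r z = (if \<forall>i<m. \<bar>(\<Sum>j\<in>blk m A (r * A) i. z j) / real A - w i\<bar> < \<epsilon> then 0 else 1)" for r z
  have fm: "f r \<in> borel_measurable (PiM (K r) (\<lambda>_. borel))" for r
  proof -
    have [measurable]: "(\<lambda>z :: nat \<Rightarrow> real. \<Sum>j\<in>blk m A (r * A) i. z j) \<in> borel_measurable (PiM (K r) (\<lambda>_. borel))" if "i < m" for i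
    proof -
      have c: "(\<lambda>z::nat \<Rightarrow> real. z j) \<in> borel_measurable (PiM (K r) (\<lambda>_. borel))" if "j \<in> blk m A (r * A) i" for j
        by (rule measurable_component_singleton) (use sub[OF \<open>i < m\<close>] that in blast)
      show ?thesis using borel_measurable_sum[of "blk m A (r * A) i" "\<lambda>j z. z j", OF c] by simp
    qed
    have "Measurable.pred (PiM (K r) (\<lambda>_. borel)) (\<lambda>z. \<forall>i\<in>{..<m}. \<bar>(\<Sum>j\<in>blk m A (r * A) i. z j) / real A - w i\<bar> < \<epsilon>)"
      by (intro pred_intros_finite) (auto intro!: borel_measurable_pred_less borel_measurable_abs borel_measurable_diff borel_measurable_divide)
    then show ?thesis unfolding f_def by (intro measurable_If) (simp_all add: lessThan_def pred_def)
  qed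
  have ind: "indep_vars (\<lambda>_. borel) (\<lambda>r \<omega>. f r (restrict (\<lambda>i. X i \<omega>) (K r))) {..<N}"
    by (rule indep_vars_compose2[OF indep_vars_restrict[OF indep _ disj]]) (use fm in auto)
  have eq: "f r (restrict (\<lambda>i. X i \<omega>) (K r)) = indicator (space M - ?G r) \<omega>" if "\<omega> \<in> space M" for r \<omega>
  proof -
    have "(\<Sum>j\<in>blk m A (r * A) i. restrict (\<lambda>i. X i \<omega>) (K r) j) / real A = D m A (r * A) \<omega> i" if "i < m" for i
      unfolding D_def using sub[OF that] by (intro arg_cong2[where f="(/)"] sum.cong refl) auto
    then show ?thesis using that by (auto simp: f_def indicator_def)
  qed
  have G[measurable]: "?G r \<in> events" for r by measurable
  have "emeasure M ?F = (\<integral>\<^sup>+\<omega>. indicator ?F \<omega> \<partial>M)" by (rule nn_integral_indicator[symmetric]) measurable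
  also have "\<dots> = (\<integral>\<^sup>+\<omega>. (\<Prod>r<N. f r (restrict (\<lambda>i. X i \<omega>) (K r))) \<partial>M)"
  proof (rule nn_integral_cong)
    fix \<omega> assume \<omega>: "\<omega> \<in> space M"
    show "indicator ?F \<omega> = (\<Prod>r<N. f r (restrict (\<lambda>i. X i \<omega>) (K r)))"
    proof (cases "\<omega> \<in> ?F")
      case True
      then have "(\<Prod>r<N. f r (restrict (\<lambda>i. X i \<omega>) (K r))) = (\<Prod>r<N. 1)"
        unfolding eq[OF \<omega>] by (intro prod.cong) auto
      then show ?thesis using True by simp
    next
      case False
      then obtain r where r: "r < N" "\<omega> \<in> ?G r" using \<omega> by auto
      then have "(\<Prod>r<N. f r (restrict (\<lambda>i. X i \<omega>) (K r))) = 0"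
        unfolding eq[OF \<omega>] by (intro prod_zero bexI[of _ r]) auto
      then show ?thesis using False by simp
    qed
  qed
  also have "\<dots> = (\<Prod>r<N. \<integral>\<^sup>+\<omega>. f r (restrict (\<lambda>i. X i \<omega>) (K r)) \<partial>M)"
    by (rule indep_vars_nn_integral[OF _ ind]) auto
  also have "\<dots> = (\<Prod>r<N. ennreal (1 - prob (?G r)))"
  proof (rule prod.cong[OF refl])
    fix r
    have "(\<integral>\<^sup>+\<omega>. f r (restrict (\<lambda>i. X i \<omega>) (K r)) \<partial>M) = (\<integral>\<^sup>+\<omega>. indicator (space M - ?G r) \<omega> \<partial>M)"
      by (intro nn_integral_cong eq)
    also have "\<dots> = emeasure M (space M - ?G r)" by (rule nn_integral_indicator) measurable
    also have "\<dots> = ennreal (1 - prob (?G r))" using prob_compl[OF G] by (simp add: emeasure_eq_measure)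
    finally show "(\<integral>\<^sup>+\<omega>. f r (restrict (\<lambda>i. X i \<omega>) (K r)) \<partial>M) = ennreal (1 - prob (?G r))" .
  qed
  also have "\<dots> = ennreal (\<Prod>r<N. 1 - prob (?G r))"
    by (rule prod_ennreal) simp
  finally have eqF: "emeasure M ?F = ennreal (\<Prod>r<N. 1 - prob (?G r))" .
  have "(\<Prod>r<N. 1 - prob (?G r)) \<le> (\<Prod>r<N. exp (- p))"
  proof (intro prod_mono conjI)
    fix r
    have "1 - prob (?G r) \<le> 1 + - p" using p by simp
    also have "\<dots> \<le> exp (- p)" by (rule exp_ge_add_one_self)
    finally show "1 - prob (?G r) \<le> exp (- p)" .
  qed simp
  also have "(\<Prod>r<N. exp (- p)) = exp (- p * real N)"
    by (simp add: exp_of_nat2_mult[symmetric])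
  finally have "ennreal (prob ?F) \<le> ennreal (exp (- p * real N))"
    using eqF by (simp add: emeasure_eq_measure ennreal_leI del: ennreal_le_iff)
  then show ?thesis by (simp add: ennreal_le_iff)
qed

end

subsection \<open>An abstract functional law\<close>

lemma summable_exp_decay:
  fixes c :: real assumes "c > 0" shows "summable (\<lambda>n. exp (- real n * c))"
proof -
  have "summable (\<lambda>n. exp (- c) ^ n)" using assms by (intro summable_geometric) simp
  then show ?thesis by (simp add: exp_of_nat_mult[symmetric])
qed

lemma summable_doubly_exp:
  fixes c :: real assumes c: "c > 0" shows "summable (\<lambda>n. exp (1 - exp (real n * c) / real n))"
proof (rule summable_comparison_test_ev[OF _ summable_exp_decay[of 1]])
  have "\<forall>\<^sub>F n in sequentially. exp (real n * c) / real n \<ge> real n + 1"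
    using c by real_asymp
  then show "\<forall>\<^sub>F n in sequentially. norm (exp (1 - exp (real n * c) / real n)) \<le> exp (- real n * 1)"
    by eventually_elim simp
qed simp

text \<open>\<open>H A x \<omega>\<close> is the centred increment function over \<open>[x, x + A]\<close>, and \<open>\<alpha> = 1 / c\<close>.
  Assumption \<open>close\<close> replaces it by the polygon through its block increments.\<close>

locale ferl = walk +
  fixes H :: "nat \<Rightarrow> nat \<Rightarrow> 'a \<Rightarrow> real \<Rightarrow> real"
    and E K :: "(real \<Rightarrow> real) set" and d :: "(real \<Rightarrow> real) \<Rightarrow> (real \<Rightarrow> real) \<Rightarrow> real" and \<alpha> \<theta> :: real
  assumes \<alpha>: "\<alpha> > 0" and \<theta>: "\<theta> > 0" "\<Phi> \<theta> < \<infinity>" "\<Phi> (- \<theta>) < \<infinity>"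
    and tri: "\<And>f g k. f \<in> E \<Longrightarrow> g \<in> E \<Longrightarrow> k \<in> E \<Longrightarrow> d f k \<le> d f g + d g k"
    and sym: "\<And>f g. d f g = d g f"
    and plE: "\<And>m v. pl m v \<in> E"
    and dpl: "\<And>m v w. d (pl m v) (pl m w) \<le> 2 * (\<Sum>i<m. \<bar>v i - w i\<bar>)"
    and plK: "\<And>m v. m > 0 \<Longrightarrow> rate \<Phi> m v \<le> ennreal \<alpha> \<Longrightarrow> pl m v \<in> K"
    and KE: "K \<subseteq> E"
    and approx: "\<And>\<epsilon>. \<epsilon> > 0 \<Longrightarrow> \<forall>\<^sub>F m in sequentially. \<forall>f\<in>K. \<exists>v. rate \<Phi> m v \<le> ennreal \<alpha> \<and> d f (pl m v) \<le> \<epsilon>"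
    and HE: "AE \<omega> in M. \<forall>A>0. \<forall>x. H A x \<omega> \<in> E"
    and close: "\<And>\<epsilon>. \<epsilon> > 0 \<Longrightarrow> \<forall>\<^sub>F m in sequentially. \<forall>\<^sub>F A in sequentially. \<forall>x. \<exists>F\<in>events.
      prob F \<le> exp (- real A * (\<alpha> + 1)) \<and> (\<forall>\<omega>\<in>space M - F. d (H A x \<omega>) (pl m (D m A x \<omega>)) \<le> \<epsilon>)"
begin

lemma d_pl_le:
  assumes "\<And>i. i < m \<Longrightarrow> \<bar>v i - w i\<bar> \<le> e" "2 * real m * e \<le> \<epsilon>"
  shows "d (pl m v) (pl m w) \<le> \<epsilon>"
proof -
  have "(\<Sum>i<m. \<bar>v i - w i\<bar>) \<le> (\<Sum>i<m. e)" using assms(1) by (intro sum_mono) auto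
  then have "2 * (\<Sum>i<m. \<bar>v i - w i\<bar>) \<le> 2 * real m * e" by simp
  with dpl[of m v w] assms(2) show ?thesis by linarith
qed

text \<open>Makes the exceptional sets of \<open>close\<close> a function of A and x, so that they
  can be united over x. Where \<open>close\<close> does not yet apply, its values are
  arbitrary.\<close>

lemma close_choice:
  assumes "\<epsilon> > 0"
  shows "\<forall>\<^sub>F m in sequentially. \<exists>F. \<forall>\<^sub>F A in sequentially. \<forall>x. F A x \<in> events \<and>
      prob (F A x) \<le> exp (- real A * (\<alpha> + 1)) \<and> (\<forall>\<omega>\<in>space M - F A x. d (H A x \<omega>) (pl m (D m A x \<omega>)) \<le> \<epsilon>)"
  using close[OF assms]
proof eventually_elim
  case (elim m)
  define Q where "Q A x F \<longleftrightarrow> F \<in> events \<and> prob F \<le> exp (- real A * (\<alpha> + 1)) \<and>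
    (\<forall>\<omega>\<in>space M - F. d (H A x \<omega>) (pl m (D m A x \<omega>)) \<le> \<epsilon>)" for A x F
  have "\<forall>\<^sub>F A in sequentially. \<forall>x. Q A x (SOME F. Q A x F)"
    using elim
  proof eventually_elim
    case (elim A)
    show ?case
    proof
      fix x
      have "\<exists>F. Q A x F" using elim unfolding Q_def by blast
      then show "Q A x (SOME F. Q A x F)" by (rule someI_ex)
    qed
  qed
  then show ?case unfolding Q_def by (intro exI[of _ "\<lambda>A x. SOME F. Q A x F"]) (simp add: Q_def)
qed

lemma union_bound:
  assumes F: "\<And>x. F x \<in> events" "\<And>x. prob (F x) \<le> p" and y: "y \<ge> 0"
  shows "(\<Union>x\<in>{x. real x \<le> y}. F x) \<in> events" "prob (\<Union>x\<in>{x. real x \<le> y}. F x) \<le> (y + 1) * p"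
proof -
  have eq: "{x. real x \<le> y} = {..nat \<lfloor>y\<rfloor>}" using y by (auto simp: le_nat_iff le_floor_iff)
  then have fin: "finite {x. real x \<le> y}" by simp
  show "(\<Union>x\<in>{x. real x \<le> y}. F x) \<in> events" using fin F by (intro sets.finite_UN) auto
  have p: "0 \<le> p" using F(2)[of 0] measure_nonneg[of M "F 0"] by linarith
  have "prob (\<Union>x\<in>{x. real x \<le> y}. F x) \<le> (\<Sum>x\<in>{x. real x \<le> y}. prob (F x))"
    using fin F by (intro measure_UNION_le) auto
  also have "\<dots> \<le> (\<Sum>x\<in>{x. real x \<le> y}. p)" using F(2) by (intro sum_mono)
  also have "\<dots> = real (Suc (nat \<lfloor>y\<rfloor>)) * p" unfolding eq by simp
  also have "\<dots> \<le> (y + 1) * p"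
    using y p by (intro mult_right_mono) auto
  finally show "prob (\<Union>x\<in>{x. real x \<le> y}. F x) \<le> (y + 1) * p" .
qed

lemma upper_inclusion:
  assumes \<epsilon>: "\<epsilon> > 0"
  shows "AE \<omega> in M. \<forall>\<^sub>F A in sequentially. \<forall>x. real x \<le> exp ((real A + 1) * \<alpha>) \<longrightarrow> (\<exists>g\<in>K. d (H A x \<omega>) g < \<epsilon>)"
proof -
  have e4: "\<epsilon> / 4 > 0" using \<epsilon> by simp
  have "\<forall>\<^sub>F m::nat in sequentially. m > 0" by (rule eventually_gt_at_top)
  with close_choice[OF e4] have "\<exists>m. m > 0 \<and> (\<exists>F. \<forall>\<^sub>F A in sequentially. \<forall>x. F A x \<in> events \<and>
      prob (F A x) \<le> exp (- real A * (\<alpha> + 1)) \<and> (\<forall>\<omega>\<in>space M - F A x. d (H A x \<omega>) (pl m (D m A x \<omega>)) \<le> \<epsilon> / 4))"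
    by (intro eventually_happens'[OF sequentially_bot] eventually_conj)
  then obtain m F where m: "m > 0" and F: "\<forall>\<^sub>F A in sequentially. \<forall>x. F A x \<in> events \<and>
      prob (F A x) \<le> exp (- real A * (\<alpha> + 1)) \<and> (\<forall>\<omega>\<in>space M - F A x. d (H A x \<omega>) (pl m (D m A x \<omega>)) \<le> \<epsilon> / 4)"
    by blast
  \<comment> \<open>By \<open>dpl\<close>, a coordinate error h moves the polygon by at most
    \<open>2 * m * h\<close>.\<close>
  define h where "h = \<epsilon> / (8 * real m)"
  have h: "h > 0" "2 * real m * h \<le> \<epsilon> / 4" using m \<epsilon> by (auto simp: h_def)
  have \<alpha>0: "\<alpha> \<ge> 0" using \<alpha> by simp
  obtain \<delta> C Bad where \<delta>: "\<delta> > 0" and Bad': "\<forall>A x. Bad A x \<in> events \<and> prob (Bad A x) \<le> exp (C - real A * (\<alpha> + \<delta>)) \<and>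
    (\<forall>\<omega>\<in>space M - Bad A x. rate \<Phi> m (\<lambda>i. rd h (D m A x \<omega> i)) \<le> ennreal \<alpha>)"
    using rate_rounded_D_le[OF m h(1) \<alpha>0 \<theta>] by blast
  have Bad: "Bad A x \<in> events" "prob (Bad A x) \<le> exp (C - real A * (\<alpha> + \<delta>))"
    "\<omega> \<in> space M \<Longrightarrow> \<omega> \<notin> Bad A x \<Longrightarrow> rate \<Phi> m (\<lambda>i. rd h (D m A x \<omega> i)) \<le> ennreal \<alpha>" for A x \<omega>
    using Bad' by blast+
  define B where "B A = (\<Union>x\<in>{x. real x \<le> exp ((real A + 1) * \<alpha>)}. F A x \<union> Bad A x)" for A
  \<comment> \<open>There are at most \<open>exp ((A + 1) * \<alpha>) + 1\<close> positions x, which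
    is at most \<open>2 * exp \<alpha> * exp (A * \<alpha>)\<close>; this cancels the \<alpha> in
    both exponents.\<close>
  define f where "f A = 2 * exp \<alpha> * (exp (- real A * 1) + exp C * exp (- real A * \<delta>))" for A
  have "\<forall>\<^sub>F A in sequentially. B A \<in> events \<and> prob (B A) \<le> f A"
    using F
  proof eventually_elim
    case (elim A)
    let ?y = "exp ((real A + 1) * \<alpha>)" and ?p = "exp (- real A * (\<alpha> + 1)) + exp (C - real A * (\<alpha> + \<delta>))"
    have ev: "F A x \<union> Bad A x \<in> events" for x using elim Bad(1) by blast
    have pr: "prob (F A x \<union> Bad A x) \<le> ?p" for x
    proof -
      have "prob (F A x \<union> Bad A x) \<le> prob (F A x) + prob (Bad A x)"
        by (rule measure_Un_le) (use elim Bad(1) in blast)+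
      also have "\<dots> \<le> ?p" using elim Bad(2)[of A x] by (intro add_mono) blast+
      finally show ?thesis .
    qed
    have "prob (B A) \<le> (?y + 1) * ?p" unfolding B_def by (rule union_bound(2)[OF ev pr]) simp
    also have "\<dots> \<le> (2 * ?y) * ?p" using \<alpha> by (intro mult_right_mono add_nonneg_nonneg) auto
    also have "\<dots> = f A"
    proof -
      have "?y * exp (- real A * (\<alpha> + 1)) = exp \<alpha> * exp (- real A * 1)"
        by (simp flip: exp_add) (simp add: algebra_simps)
      moreover have "?y * exp (C - real A * (\<alpha> + \<delta>)) = exp \<alpha> * (exp C * exp (- real A * \<delta>))"
        by (simp flip: exp_add) (simp add: algebra_simps)
      ultimately show ?thesis by (simp only: f_def distrib_left mult.assoc)
    qed
    finally have "prob (B A) \<le> f A" .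
    moreover have "B A \<in> events" unfolding B_def by (rule union_bound(1)[OF ev pr]) simp
    ultimately show ?case by simp
  qed
  moreover have "summable f"
    unfolding f_def by (intro summable_mult summable_add summable_exp_decay \<delta>) simp
  ultimately have "AE \<omega> in M. \<forall>\<^sub>F A in sequentially. \<omega> \<notin> B A" by (rule borel_cantelli_eventually)
  with HE AE_space show ?thesis
  proof eventually_elim
    case (elim \<omega>)
    have "\<forall>\<^sub>F A::nat in sequentially. A > 0" by (rule eventually_gt_at_top)
    with elim(3) F show ?case
    proof eventually_elim
      case (elim A)
      show ?case
      proof (intro allI impI)
        fix x :: nat assume x: "real x \<le> exp ((real A + 1) * \<alpha>)"
        then have nB: "\<omega> \<notin> F A x" "\<omega> \<notin> Bad A x" using elim(1) by (auto simp: B_def)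
        let ?D = "D m A x \<omega>"
        have K: "pl m (\<lambda>i. rd h (?D i)) \<in> K" by (rule plK[OF m Bad(3)[OF \<open>\<omega> \<in> space M\<close> nB(2)]])
        have "H A x \<omega> \<in> E" using \<open>\<forall>A>0. \<forall>x. H A x \<omega> \<in> E\<close> elim by blast
        then have "d (H A x \<omega>) (pl m (\<lambda>i. rd h (?D i))) \<le> d (H A x \<omega>) (pl m ?D) + d (pl m ?D) (pl m (\<lambda>i. rd h (?D i)))"
          by (intro tri plE)
        also have "d (H A x \<omega>) (pl m ?D) \<le> \<epsilon> / 4" using elim(2) nB(1) \<open>\<omega> \<in> space M\<close> by blast
        also have "d (pl m ?D) (pl m (\<lambda>i. rd h (?D i))) \<le> \<epsilon> / 4"
          by (rule d_pl_le[OF rd_close[OF h(1)] h(2)])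
        also have "\<epsilon> / 4 + \<epsilon> / 4 < \<epsilon>" using \<epsilon> by simp
        finally show "\<exists>g\<in>K. d (H A x \<omega>) g < \<epsilon>" using K by fastforce
      qed
    qed
  qed
qed

text \<open>Shrinking v by \<open>1 - k\<close> lowers its rate to
  \<open>(1 - k) * \<alpha>\<close>. So about \<open>exp (A * \<alpha>) / A\<close> independent
  windows meet a hitting probability of at least \<open>exp (- A * (\<alpha> - \<delta>))\<close>,
  and the probability of no hit is doubly exponentially small.\<close>

lemma D_hits:
  assumes m: "m > 0" and v: "rate \<Phi> m v \<le> ennreal \<alpha>" and k: "0 < k" "k < 1" and \<epsilon>: "\<epsilon> > 0"
  shows "AE \<omega> in M. \<forall>\<^sub>F A in sequentially. \<exists>x. real x + real A \<le> exp (real A * \<alpha>) \<and>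
    (\<forall>i<m. \<bar>D m A x \<omega> i - (1 - k) * v i\<bar> < \<epsilon>)"
proof -
  define g where "g i = (1 - k) * enn2real (psi \<Phi> (real m * v i))" for i
  have fin: "psi \<Phi> (real m * v i) < top" if "i < m" for i
  proof (rule ccontr)
    assume "\<not> psi \<Phi> (real m * v i) < top"
    then have "psi \<Phi> (real m * v i) = top" using less_top by blast
    moreover have "0 < ennreal (1 / real m)" using m by simp
    ultimately have "ennreal (1 / real m) * psi \<Phi> (real m * v i) = top" by (simp add: ennreal_mult_top)
    then show False using rate_term_le[OF that, of v] v by (simp add: top_unique)
  qed
  have g1: "psi \<Phi> (real m * ((1 - k) * v i)) \<le> ennreal (g i)" if "i < m" for i
  proof -
    have "psi \<Phi> ((1 - k) * (real m * v i)) \<le> ennreal (1 - k) * psi \<Phi> (real m * v i)"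
      by (rule psi_mult_le) (use k in auto)
    also have "psi \<Phi> (real m * v i) = ennreal (enn2real (psi \<Phi> (real m * v i)))" using fin[OF that] by simp
    also have "ennreal (1 - k) * \<dots> = ennreal (g i)" unfolding g_def using k by (simp add: ennreal_mult')
    finally show ?thesis by (simp add: mult.left_commute)
  qed
  have g2: "(\<Sum>i<m. g i / real m) \<le> (1 - k) * \<alpha>"
  proof -
    have "ennreal (\<Sum>i<m. 1 / real m * enn2real (psi \<Phi> (real m * v i))) = (\<Sum>i<m. ennreal (1 / real m * enn2real (psi \<Phi> (real m * v i))))"
      by (rule sum_ennreal[symmetric]) simp
    also have "\<dots> = rate \<Phi> m v"
      unfolding rate_def
    proof (rule sum.cong[OF refl])
      fix i assume "i \<in> {..<m}"
      then have e: "ennreal (enn2real (psi \<Phi> (real m * v i))) = psi \<Phi> (real m * v i)"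
        using fin by (intro ennreal_enn2real) simp
      have "ennreal (1 / real m * enn2real (psi \<Phi> (real m * v i))) = ennreal (1 / real m) * ennreal (enn2real (psi \<Phi> (real m * v i)))"
        by (rule ennreal_mult') simp
      then show "ennreal (1 / real m * enn2real (psi \<Phi> (real m * v i))) = ennreal (1 / real m) * psi \<Phi> (real m * v i)"
        unfolding e .
    qed
    finally have "ennreal (\<Sum>i<m. 1 / real m * enn2real (psi \<Phi> (real m * v i))) \<le> ennreal \<alpha>" using v by (simp only:)
    then have "(\<Sum>i<m. 1 / real m * enn2real (psi \<Phi> (real m * v i))) \<le> \<alpha>" using \<alpha> by (subst (asm) ennreal_le_iff) auto
    then have "(1 - k) * (\<Sum>i<m. 1 / real m * enn2real (psi \<Phi> (real m * v i))) \<le> (1 - k) * \<alpha>" using k by (intro mult_left_mono) auto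
    then show ?thesis by (simp add: g_def sum_distrib_left mult_ac)
  qed
  \<comment> \<open>Half of the margin \<open>k * \<alpha>\<close> pays for the lower bound, half
    remains as growth of the expected number of hits.\<close>
  define \<delta> where "\<delta> = k * \<alpha> / 2"
  have \<delta>: "\<delta> > 0" using k \<alpha> by (simp add: \<delta>_def)
  have low: "\<forall>\<^sub>F A in sequentially. \<forall>x. exp (- real A * ((1 - k) * \<alpha> + \<delta>)) \<le>
    prob {\<omega>\<in>space M. \<forall>i<m. \<bar>D m A x \<omega> i - (1 - k) * v i\<bar> < \<epsilon>}"
    by (rule prob_D_near_ge[OF m g1 _ g2 \<epsilon> \<delta>]) (use k in \<open>simp_all add: g_def\<close>)
  define N where "N A = nat \<lfloor>exp (real A * \<alpha>) / real A\<rfloor>" for A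
  define B where "B A = {\<omega>\<in>space M. \<forall>r<N A. \<not> (\<forall>i<m. \<bar>D m A (r * A) \<omega> i - (1 - k) * v i\<bar> < \<epsilon>)}" for A
  have "\<forall>\<^sub>F A::nat in sequentially. A > 0" by (rule eventually_gt_at_top)
  with low have "\<forall>\<^sub>F A in sequentially. B A \<in> events \<and> prob (B A) \<le> exp (1 - exp (real A * \<delta>) / real A)"
  proof eventually_elim
    case (elim A)
    let ?p = "exp (- real A * ((1 - k) * \<alpha> + \<delta>))"
    have "prob (B A) \<le> exp (- ?p * real (N A))"
      unfolding B_def by (rule no_hit_bound[OF m]) (use elim in auto)
    also have "\<dots> \<le> exp (1 - exp (real A * \<delta>) / real A)"
    proof -
      \<comment> \<open>Rounding the number of windows down costs at most \<open>?p \<le> 1\<close>,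
        which is the 1 in the exponent.\<close>
      have N: "exp (real A * \<alpha>) / real A - 1 \<le> real (N A)" unfolding N_def by linarith
      have p1: "?p \<le> 1" using \<alpha> k \<delta> by (simp add: mult_nonneg_nonneg)
      have "?p * exp (real A * \<alpha>) = exp (real A * \<delta>)"
        by (simp flip: exp_add) (simp add: \<delta>_def algebra_simps)
      then have "exp (real A * \<delta>) / real A - 1 = ?p * (exp (real A * \<alpha>) / real A) - 1" by simp
      also have "\<dots> \<le> ?p * (exp (real A * \<alpha>) / real A) - ?p" using p1 by simp
      also have "\<dots> = ?p * (exp (real A * \<alpha>) / real A - 1)" by (simp only: right_diff_distrib mult_1_right)
      also have "\<dots> \<le> ?p * real (N A)" by (rule mult_left_mono[OF N]) simp
      finally show ?thesis by simp
    qed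
    finally have "prob (B A) \<le> exp (1 - exp (real A * \<delta>) / real A)" .
    moreover have "B A \<in> events" unfolding B_def by measurable
    ultimately show ?case by simp
  qed
  then have "AE \<omega> in M. \<forall>\<^sub>F A in sequentially. \<omega> \<notin> B A"
    by (rule borel_cantelli_eventually) (rule summable_doubly_exp[OF \<delta>])
  with AE_space show ?thesis
  proof eventually_elim
    case (elim \<omega>)
    have "\<forall>\<^sub>F A::nat in sequentially. A > 0" by (rule eventually_gt_at_top)
    with elim(2) show ?case
    proof eventually_elim
      case (elim A)
      then obtain r where r: "r < N A" "\<forall>i<m. \<bar>D m A (r * A) \<omega> i - (1 - k) * v i\<bar> < \<epsilon>"
        using \<open>\<omega> \<in> space M\<close> by (auto simp: B_def)
      have "real (Suc r) \<le> real (N A)" using r(1) by linarith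
      also have "\<dots> \<le> exp (real A * \<alpha>) / real A" unfolding N_def using elim by (simp add: of_nat_floor)
      finally have "real (Suc r) * real A \<le> exp (real A * \<alpha>)" using elim by (simp add: field_simps)
      then have "real (r * A) + real A \<le> exp (real A * \<alpha>)" by (simp add: distrib_right)
      with r(2) show ?case by blast
    qed
  qed
qed

text \<open>K may be uncountable, so the hits are arranged for the finitely many grid vectors. Five
  errors of \<open>\<epsilon> / 8\<close> lead from g through its polygon, the rounded, the shrunk
  and the hit increments to the path.\<close>

lemma lower_inclusion:
  assumes \<epsilon>: "\<epsilon> > 0"
  shows "AE \<omega> in M. \<forall>\<^sub>F A in sequentially. \<forall>g\<in>K. \<exists>x. real x + real A \<le> exp (real A * \<alpha>) \<and> d g (H A x \<omega>) < \<epsilon>"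
proof -
  have e8: "\<epsilon> / 8 > 0" using \<epsilon> by simp
  have "\<forall>\<^sub>F m::nat in sequentially. m > 0" by (rule eventually_gt_at_top)
  with close_choice[OF e8] approx[OF e8] have "\<exists>m. m > 0 \<and> (\<exists>F. \<forall>\<^sub>F A in sequentially. \<forall>x. F A x \<in> events \<and>
      prob (F A x) \<le> exp (- real A * (\<alpha> + 1)) \<and> (\<forall>\<omega>\<in>space M - F A x. d (H A x \<omega>) (pl m (D m A x \<omega>)) \<le> \<epsilon> / 8))
      \<and> (\<forall>f\<in>K. \<exists>v. rate \<Phi> m v \<le> ennreal \<alpha> \<and> d f (pl m v) \<le> \<epsilon> / 8)"
    by (intro eventually_happens'[OF sequentially_bot] eventually_conj)
  then obtain m F where m: "m > 0" and F: "\<forall>\<^sub>F A in sequentially. \<forall>x. F A x \<in> events \<and>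
      prob (F A x) \<le> exp (- real A * (\<alpha> + 1)) \<and> (\<forall>\<omega>\<in>space M - F A x. d (H A x \<omega>) (pl m (D m A x \<omega>)) \<le> \<epsilon> / 8)"
    and ap: "\<forall>f\<in>K. \<exists>v. rate \<Phi> m v \<le> ennreal \<alpha> \<and> d f (pl m v) \<le> \<epsilon> / 8"
    by blast
  define h where "h = \<epsilon> / (16 * real m)"
  have h: "h > 0" "2 * real m * h \<le> \<epsilon> / 8" using m \<epsilon> by (auto simp: h_def)
  define L where "L = logmgf \<Phi> \<theta> + logmgf \<Phi> (- \<theta>)"
  have L: "0 \<le> L" using logmgf_nonneg[OF \<theta>(2)] logmgf_nonneg[OF \<theta>(3)] by (simp add: L_def)
  define c where "c = (\<alpha> + L) / \<theta>"
  have c: "c > 0" using \<alpha> L \<theta> by (simp add: c_def add_pos_nonneg)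
  have bd: "\<bar>v i\<bar> \<le> c" if v: "rate \<Phi> m v \<le> ennreal \<alpha>" and i: "i < m" for v i
  proof -
    have "ennreal (\<theta> * \<bar>v i\<bar> - L) \<le> ennreal \<alpha>"
      using rate_bounded[OF \<theta> i, of v] v unfolding L_def by (rule order_trans)
    then have "\<theta> * \<bar>v i\<bar> - L \<le> \<alpha>" using \<alpha> by (simp add: ennreal_le_iff)
    then show ?thesis using \<theta>(1) by (simp add: c_def field_simps)
  qed
  obtain N :: nat where "c / h \<le> real N" using real_arch_simple by blast
  then have N: "c \<le> h * real N" using h(1) by (simp add: field_simps)
  define V where "V = {v \<in> {..<m} \<rightarrow>\<^sub>E (\<lambda>z. h * of_int z) ` {- int N..int N}. rate \<Phi> m v \<le> ennreal \<alpha>}"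
  have "finite ({..<m} \<rightarrow>\<^sub>E (\<lambda>z. h * of_int z) ` {- int N..int N})" by (intro finite_PiE) auto
  then have finV: "finite V" unfolding V_def by auto
  \<comment> \<open>c bounds the coordinates of vectors of rate at most \<alpha>, so shrinking by
    \<open>1 - k\<close> moves each coordinate by at most h.\<close>
  define k where "k = min (1 / 2) (h / c)"
  have k: "0 < k" "k < 1" using h(1) c by (auto simp: k_def)
  have kc: "k * c \<le> h"
  proof -
    have "k * c \<le> h / c * c" unfolding k_def using c by (intro mult_right_mono) auto
    then show ?thesis using c by simp
  qed
  have "AE \<omega> in M. \<forall>v\<in>V. \<forall>\<^sub>F A in sequentially. \<exists>x. real x + real A \<le> exp (real A * \<alpha>) \<and>
    (\<forall>i<m. \<bar>D m A x \<omega> i - (1 - k) * v i\<bar> < h)"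
    by (intro AE_finite_allI[OF finV] D_hits m k h(1)) (simp add: V_def)
  moreover have "AE \<omega> in M. \<forall>\<^sub>F A in sequentially. \<omega> \<notin> (\<Union>x\<in>{x. real x \<le> exp (real A * \<alpha>)}. F A x)"
  proof (rule borel_cantelli_eventually)
    show "\<forall>\<^sub>F A in sequentially. (\<Union>x\<in>{x. real x \<le> exp (real A * \<alpha>)}. F A x) \<in> events \<and>
      prob (\<Union>x\<in>{x. real x \<le> exp (real A * \<alpha>)}. F A x) \<le> 2 * exp (- real A * 1)"
      using F
    proof eventually_elim
      case (elim A)
      have F1: "F A x \<in> events" and F2: "prob (F A x) \<le> exp (- real A * (\<alpha> + 1))" for x using elim by blast+
      have "prob (\<Union>x\<in>{x. real x \<le> exp (real A * \<alpha>)}. F A x) \<le> (exp (real A * \<alpha>) + 1) * exp (- real A * (\<alpha> + 1))"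
        by (rule union_bound(2)[OF F1 F2]) simp
      also have "\<dots> \<le> (2 * exp (real A * \<alpha>)) * exp (- real A * (\<alpha> + 1))"
        using \<alpha> by (intro mult_right_mono) auto
      also have "\<dots> = 2 * exp (- real A * 1)"
        by (simp add: mult.assoc flip: exp_add) (simp add: algebra_simps)
      finally show ?case using union_bound(1)[OF F1 F2] by simp
    qed
    show "summable (\<lambda>A. 2 * exp (- real A * 1))" by (intro summable_mult summable_exp_decay) simp
  qed
  ultimately show ?thesis using HE AE_space
  proof eventually_elim
    case (elim \<omega>)
    have ev: "\<forall>\<^sub>F A in sequentially. \<forall>v\<in>V. \<exists>x. real x + real A \<le> exp (real A * \<alpha>) \<and>
      (\<forall>i<m. \<bar>D m A x \<omega> i - (1 - k) * v i\<bar> < h)"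
      by (intro eventually_ball_finite finV elim(1))
    have "\<forall>\<^sub>F A::nat in sequentially. A > 0" by (rule eventually_gt_at_top)
    with ev elim(2) F show ?case
    proof eventually_elim
      case (elim A)
      show ?case
      proof
        fix g assume g: "g \<in> K"
        obtain u where u: "rate \<Phi> m u \<le> ennreal \<alpha>" "d g (pl m u) \<le> \<epsilon> / 8" using ap g by blast
        define v where "v = restrict (\<lambda>i. rd h (u i)) {..<m}"
        have "rate \<Phi> m v = rate \<Phi> m (\<lambda>i. rd h (u i))" by (rule rate_cong) (simp add: v_def)
        then have vr: "rate \<Phi> m v \<le> ennreal \<alpha>" using rate_rd_le[OF h(1), of m u] u(1) by (simp add: order_trans)
        have vG: "v \<in> {..<m} \<rightarrow>\<^sub>E (\<lambda>z. h * of_int z) ` {- int N..int N}"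
          unfolding v_def using rd_grid[OF h(1) N bd[OF u(1)]] by (intro restrict_PiE_iff[THEN iffD2] ballI) simp
        have "v \<in> V" using vr vG by (simp add: V_def)
        then obtain x where x: "real x + real A \<le> exp (real A * \<alpha>)"
          "\<forall>i<m. \<bar>D m A x \<omega> i - (1 - k) * v i\<bar> < h" using elim(1) by blast
        let ?D = "D m A x \<omega>" and ?w = "\<lambda>i. (1 - k) * v i"
        have "\<omega> \<notin> F A x" using elim(2) x(1) by auto
        then have 5: "d (H A x \<omega>) (pl m ?D) \<le> \<epsilon> / 8" using elim(3) \<open>\<omega> \<in> space M\<close> by blast
        have 2: "d (pl m u) (pl m v) \<le> \<epsilon> / 8"
          by (rule d_pl_le[OF _ h(2)]) (simp add: v_def rd_close[OF h(1)])
        have 3: "d (pl m v) (pl m ?w) \<le> \<epsilon> / 8"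
        proof (rule d_pl_le[OF _ h(2)])
          fix i assume i: "i < m"
          have "\<bar>v i - ?w i\<bar> = k * \<bar>v i\<bar>" using k by (simp add: left_diff_distrib abs_mult)
          also have "\<dots> \<le> k * c" using bd[OF vr i] k by (intro mult_left_mono) auto
          finally show "\<bar>v i - ?w i\<bar> \<le> h" using kc by simp
        qed
        have 4: "d (pl m ?w) (pl m ?D) \<le> \<epsilon> / 8"
          by (rule d_pl_le[OF _ h(2)]) (use x(2) in \<open>auto simp: abs_minus_commute less_imp_le\<close>)
        have HE': "H A x \<omega> \<in> E" using \<open>\<forall>A>0. \<forall>x. H A x \<omega> \<in> E\<close> elim by blast
        have gE: "g \<in> E" using g KE by blast
        have "d g (H A x \<omega>) \<le> d g (pl m u) + d (pl m u) (H A x \<omega>)" by (rule tri[OF gE plE HE'])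
        moreover have "d (pl m u) (H A x \<omega>) \<le> d (pl m u) (pl m v) + d (pl m v) (H A x \<omega>)" by (rule tri[OF plE plE HE'])
        moreover have "d (pl m v) (H A x \<omega>) \<le> d (pl m v) (pl m ?w) + d (pl m ?w) (H A x \<omega>)" by (rule tri[OF plE plE HE'])
        moreover have "d (pl m ?w) (H A x \<omega>) \<le> d (pl m ?w) (pl m ?D) + d (pl m ?D) (H A x \<omega>)" by (rule tri[OF plE plE HE'])
        moreover have "d (pl m ?D) (H A x \<omega>) \<le> \<epsilon> / 8" using 5 by (simp add: sym)
        ultimately have "d g (H A x \<omega>) < \<epsilon>" using u(2) 2 3 4 \<epsilon> by linarith
        with x(1) show "\<exists>x. real x + real A \<le> exp (real A * \<alpha>) \<and> d g (H A x \<omega>) < \<epsilon>" by blast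
      qed
    qed
  qed
qed

end

subsection \<open>Paths and maximal increments\<close>

definition cadlag :: "(real \<Rightarrow> real) \<Rightarrow> bool" where
  "cadlag z \<longleftrightarrow> (\<forall>t\<ge>0. continuous (at_right t) z) \<and> (\<forall>t>0. \<exists>l. (z \<longlongrightarrow> l) (at_left t))"

text \<open>On each side of t the path stays within 1/2 of its limit. The point t itself belongs to
  the right side, as the path is right-continuous.\<close>

lemma cadlag_local:
  assumes z: "cadlag z" and t: "t \<ge> 0"
  shows "\<exists>r>0. \<forall>x y. 0 \<le> x \<longrightarrow> 0 \<le> y \<longrightarrow> \<bar>x - t\<bar> < r \<longrightarrow> \<bar>y - t\<bar> < r \<longrightarrow> (x < t \<longleftrightarrow> y < t) \<longrightarrow> \<bar>z x - z y\<bar> \<le> 1"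
proof -
  have "(z \<longlongrightarrow> z t) (at_right t)" using z t by (simp add: cadlag_def continuous_within)
  then have "\<forall>\<^sub>F x in at_right t. dist (z x) (z t) < 1 / 2" by (rule tendstoD) simp
  then obtain b where b: "b > t" "\<And>x. t < x \<Longrightarrow> x < b \<Longrightarrow> \<bar>z x - z t\<bar> < 1 / 2"
    by (auto simp: eventually_at_right_field dist_real_def)
  have right: "\<bar>z x - z t\<bar> \<le> 1 / 2" if "t \<le> x" "x < b" for x
    using b(2)[of x] that by (cases "x = t") auto
  obtain a l where a: "a < t" "\<And>x. 0 \<le> x \<Longrightarrow> a < x \<Longrightarrow> x < t \<Longrightarrow> \<bar>z x - l\<bar> < 1 / 2"
  proof (cases "t = 0")
    case True
    \<comment> \<open>At 0 there is no left side, so any number serves as the limit.\<close>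
    show ?thesis by (rule that[of "-1" 0]) (use True in auto)
  next
    case False
    then have "t > 0" using t by simp
    then obtain l where "(z \<longlongrightarrow> l) (at_left t)" using z unfolding cadlag_def by blast
    then have "\<forall>\<^sub>F x in at_left t. dist (z x) l < 1 / 2" by (rule tendstoD) simp
    then obtain a where "a < t" "\<And>x. a < x \<Longrightarrow> x < t \<Longrightarrow> \<bar>z x - l\<bar> < 1 / 2"
      by (auto simp: eventually_at_left_field dist_real_def)
    then show ?thesis using that[of a l] by blast
  qed
  show ?thesis
  proof (intro exI[of _ "min (b - t) (t - a)"] conjI allI impI)
    show "0 < min (b - t) (t - a)" using a b by simp
    fix x y assume xy: "0 \<le> x" "0 \<le> y" "\<bar>x - t\<bar> < min (b - t) (t - a)" "\<bar>y - t\<bar> < min (b - t) (t - a)"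
      and eq: "(x < t) = (y < t)"
    show "\<bar>z x - z y\<bar> \<le> 1"
    proof (cases "x < t")
      case True
      then have "y < t" using eq by simp
      have "\<bar>z x - l\<bar> < 1 / 2" by (rule a(2)) (use xy True in linarith)+
      moreover have "\<bar>z y - l\<bar> < 1 / 2" by (rule a(2)) (use xy \<open>y < t\<close> in linarith)+
      ultimately show ?thesis by linarith
    next
      case False
      then have "\<bar>z x - z t\<bar> \<le> 1 / 2" "\<bar>z y - z t\<bar> \<le> 1 / 2"
        using right[of x] right[of y] xy eq by linarith+
      then show ?thesis by linarith
    qed
  qed
qed

text \<open>C consists of the centres and the right ends of a finite cover by the neighbourhoods of
  \<open>cadlag_local\<close>. If \<open>{u<..v}\<close> misses C, then u and v lie in one ball of
  the cover and on the same side of its centre.\<close>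

lemma cadlag_critical_points:
  assumes z: "cadlag z"
  obtains C :: "real set" where "finite C"
    "\<And>u v. 0 \<le> u \<Longrightarrow> u \<le> v \<Longrightarrow> v \<le> b \<Longrightarrow> {u<..v} \<inter> C = {} \<Longrightarrow> \<bar>z u - z v\<bar> \<le> 1"
proof -
  have "\<forall>t\<in>{0..b}. \<exists>r>0. \<forall>x y. 0 \<le> x \<longrightarrow> 0 \<le> y \<longrightarrow> \<bar>x - t\<bar> < r \<longrightarrow> \<bar>y - t\<bar> < r \<longrightarrow> (x < t \<longleftrightarrow> y < t) \<longrightarrow> \<bar>z x - z y\<bar> \<le> 1"
    using cadlag_local[OF z] by simp
  from bchoice[OF this] obtain r where r: "\<And>t. t \<in> {0..b} \<Longrightarrow> r t > 0"
    "\<And>t x y. t \<in> {0..b} \<Longrightarrow> 0 \<le> x \<Longrightarrow> 0 \<le> y \<Longrightarrow> \<bar>x - t\<bar> < r t \<Longrightarrow> \<bar>y - t\<bar> < r t \<Longrightarrow> (x < t \<longleftrightarrow> y < t) \<Longrightarrow> \<bar>z x - z y\<bar> \<le> 1"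
    by blast
  obtain T where T: "T \<subseteq> {0..b}" "finite T" "{0..b} \<subseteq> (\<Union>t\<in>T. ball t (r t))"
  proof (rule compactE_image[of "{0..b}" "{0..b}" "\<lambda>t. ball t (r t)"])
    show "{0..b} \<subseteq> (\<Union>t\<in>{0..b}. ball t (r t))" using r(1) by force
  qed auto
  show thesis
  proof (rule that[of "T \<union> (\<lambda>t. t + r t) ` T"])
    fix u v assume uv: "0 \<le> u" "u \<le> v" "v \<le> b" and C: "{u<..v} \<inter> (T \<union> (\<lambda>t. t + r t) ` T) = {}"
    then obtain t where t: "t \<in> T" "u \<in> ball t (r t)" using T(3) by fastforce
    have n: "\<not> (u < t \<and> t \<le> v)" "\<not> (u < t + r t \<and> t + r t \<le> v)" using C t(1) by auto
    show "\<bar>z u - z v\<bar> \<le> 1"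
    proof (rule r(2)[of t])
      show "t \<in> {0..b}" using t T by blast
    qed (use uv t n in \<open>auto simp: dist_real_def\<close>)
  qed (use T in auto)
qed

text \<open>The set of critical points up to u takes finitely many values, and z varies by at most 1
  among the points with the same value.\<close>

lemma cadlag_bounded:
  assumes z: "cadlag z"
  obtains B where "\<And>u. 0 \<le> u \<Longrightarrow> u \<le> b \<Longrightarrow> \<bar>z u\<bar> \<le> B"
proof -
  obtain C where C: "finite C" "\<And>u v. 0 \<le> u \<Longrightarrow> u \<le> v \<Longrightarrow> v \<le> b \<Longrightarrow> {u<..v} \<inter> C = {} \<Longrightarrow> \<bar>z u - z v\<bar> \<le> 1"
    using cadlag_critical_points[OF z, of b] by blast
  define k where "k u = {c\<in>C. c \<le> u}" for u
  define rep where "rep q = (SOME u. 0 \<le> u \<and> u \<le> b \<and> k u = q)" for q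
  have fin: "finite (Pow C)" using C(1) by simp
  show thesis
  proof (rule that[of "(\<Sum>q\<in>Pow C. \<bar>z (rep q)\<bar>) + 1"])
    fix u assume u: "0 \<le> u" "u \<le> b"
    have "\<exists>v. 0 \<le> v \<and> v \<le> b \<and> k v = k u" using u by blast
    then have rep: "0 \<le> rep (k u) \<and> rep (k u) \<le> b \<and> k (rep (k u)) = k u" unfolding rep_def by (rule someI_ex)
    have gen: "\<bar>z v - z w\<bar> \<le> 1" if "0 \<le> v" "v \<le> w" "w \<le> b" "k v = k w" for v w
    proof (rule C(2)[OF that(1-3)])
      show "{v<..w} \<inter> C = {}"
      proof (rule ccontr)
        assume "{v<..w} \<inter> C \<noteq> {}"
        then obtain c where "c \<in> C" "v < c" "c \<le> w" by auto
        then have "c \<in> k w" "c \<notin> k v" by (auto simp: k_def)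
        then show False using that(4) by simp
      qed
    qed
    have "\<bar>z u - z (rep (k u))\<bar> \<le> 1"
    proof (cases "u \<le> rep (k u)")
      case True
      then show ?thesis using gen[of u "rep (k u)"] u rep by simp
    next
      case False
      then show ?thesis using gen[of "rep (k u)" u] u rep by (simp add: abs_minus_commute)
    qed
    moreover have "\<bar>z (rep (k u))\<bar> \<le> (\<Sum>q\<in>Pow C. \<bar>z (rep q)\<bar>)"
      by (rule member_le_sum[of "k u" "Pow C" "\<lambda>q. \<bar>z (rep q)\<bar>"]) (use fin in \<open>auto simp: k_def\<close>)
    ultimately show "\<bar>z u\<bar> \<le> (\<Sum>q\<in>Pow C. \<bar>z (rep q)\<bar>) + 1" by linarith
  qed
qed

section \<open>Maximal inequality and exponential moments\<close>

text \<open>On the event \<open>P l\<close> that l is the first exceedance of \<open>u + a\<close>,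
  the remainder \<open>R l\<close> is independent of the past and at most a in absolute value with
  probability at least 1/2; then the full sum still exceeds u.\<close>

lemma (in prob_space) ottaviani:
  fixes I :: "nat \<Rightarrow> 'a \<Rightarrow> real" and a u :: real
  assumes ind: "indep_vars (\<lambda>_. borel) I {..<L}"
    and half: "\<And>l. l \<le> L \<Longrightarrow> prob {\<omega>\<in>space M. \<bar>\<Sum>i\<in>{l..<L}. I i \<omega>\<bar> > a} \<le> 1 / 2"
  shows "prob {\<omega>\<in>space M. \<exists>l\<le>L. \<bar>\<Sum>i<l. I i \<omega>\<bar> > u + a} \<le> 2 * prob {\<omega>\<in>space M. \<bar>\<Sum>i<L. I i \<omega>\<bar> > u}"
proof -
  have Im [measurable]: "i < L \<Longrightarrow> I i \<in> borel_measurable M" for i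
    using ind unfolding indep_vars_def2 by auto
  define S where "S l z = (\<Sum>i<l. z i)" for l and z :: "nat \<Rightarrow> real"
  define P where "P l z \<longleftrightarrow> \<bar>S l z\<bar> > u + a \<and> (\<forall>k\<in>{..<l}. \<bar>S k z\<bar> \<le> u + a)" for l z
  define R where "R l z = (\<Sum>i\<in>{l..<L}. z i)" for l and z :: "nat \<Rightarrow> real"
  let ?z = "\<lambda>\<omega> i. I i \<omega>"
  have meas: "(\<lambda>z::nat \<Rightarrow> real. \<Sum>i\<in>J. z i) \<in> borel_measurable (PiM A (\<lambda>_. borel))" if "J \<subseteq> A" for J A
  proof -
    have c: "(\<lambda>z::nat \<Rightarrow> real. z j) \<in> borel_measurable (PiM A (\<lambda>_. borel))" if "j \<in> J" for j
      by (rule measurable_component_singleton) (use \<open>J \<subseteq> A\<close> that in blast)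
    show ?thesis using borel_measurable_sum[of J "\<lambda>j z. z j", OF c] by simp
  qed
  have Sm: "(\<lambda>\<omega>. S l (?z \<omega>)) \<in> borel_measurable M" if "l \<le> L" for l
    unfolding S_def by (intro borel_measurable_sum Im) (use that in auto)
  have Rm: "(\<lambda>\<omega>. R l (?z \<omega>)) \<in> borel_measurable M" for l
    unfolding R_def by (intro borel_measurable_sum Im) auto
  have Pm: "{\<omega>\<in>space M. P l (?z \<omega>)} \<in> events" if l: "l \<le> L" for l
  proof -
    note [measurable] = Sm[OF l]
    have [measurable]: "(\<lambda>\<omega>. S k (?z \<omega>)) \<in> borel_measurable M" if "k \<in> {..<l}" for k
      by (rule Sm) (use that l in auto)
    have "Measurable.pred M (\<lambda>\<omega>. \<forall>k\<in>{..<l}. \<bar>S k (?z \<omega>)\<bar> \<le> u + a)"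
      by (rule pred_intros_finite) (auto intro!: borel_measurable_pred_less Measurable.pred_def[THEN iffD2] borel_measurable_le borel_measurable_abs Sm simp: l order.strict_implies_order[OF order.strict_trans2[OF _ l]])
    then have [measurable]: "Measurable.pred M (\<lambda>\<omega>. \<forall>k\<in>{..<l}. \<bar>S k (?z \<omega>)\<bar> \<le> u + a)" .
    show ?thesis unfolding P_def by measurable
  qed
  have prod: "prob {\<omega>\<in>space M. P l (?z \<omega>) \<and> \<bar>R l (?z \<omega>)\<bar> \<le> a}
    = prob {\<omega>\<in>space M. P l (?z \<omega>)} * prob {\<omega>\<in>space M. \<bar>R l (?z \<omega>)\<bar> \<le> a}" if l: "l \<le> L" for l
  proof -
    let ?A = "{..<l}" and ?B = "{l..<L}"
    have iv: "indep_var (PiM ?A (\<lambda>_. borel)) (\<lambda>\<omega>. restrict (?z \<omega>) ?A) (PiM ?B (\<lambda>_. borel)) (\<lambda>\<omega>. restrict (?z \<omega>) ?B)"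
      by (rule indep_var_restrict[OF ind]) (use l in auto)
    have Sm': "(\<lambda>z. S k z) \<in> borel_measurable (PiM ?A (\<lambda>_. borel))" if "k \<le> l" for k
      unfolding S_def by (rule meas) (use that in auto)
    have "Measurable.pred (PiM ?A (\<lambda>_. borel)) (\<lambda>z. \<forall>k\<in>{..<l}. \<bar>S k z\<bar> \<le> u + a)"
    proof (rule pred_intros_finite)
      fix k assume "k \<in> {..<l}"
      then have [measurable]: "(\<lambda>z. S k z) \<in> borel_measurable (PiM ?A (\<lambda>_. borel))" by (intro Sm') simp
      show "Measurable.pred (PiM ?A (\<lambda>_. borel)) (\<lambda>z. \<bar>S k z\<bar> \<le> u + a)" by measurable
    qed simp
    moreover have [measurable]: "(\<lambda>z. S l z) \<in> borel_measurable (PiM ?A (\<lambda>_. borel))" by (rule Sm') simp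
    ultimately have PA: "{z\<in>space (PiM ?A (\<lambda>_. borel)). P l z} \<in> sets (PiM ?A (\<lambda>_. borel))"
      unfolding P_def by measurable
    have [measurable]: "R l \<in> borel_measurable (PiM ?B (\<lambda>_. borel))"
      unfolding R_def by (rule meas) simp
    have RB: "{z\<in>space (PiM ?B (\<lambda>_. borel)). \<bar>R l z\<bar> \<le> a} \<in> sets (PiM ?B (\<lambda>_. borel))" by measurable
    have Peq: "P l (restrict z ?A) \<longleftrightarrow> P l z" for z
    proof -
      have "S k (restrict z ?A) = S k z" if "k \<le> l" for k
        unfolding S_def using that by (intro sum.cong) auto
      then show ?thesis unfolding P_def by auto
    qed
    have Req: "R l (restrict z ?B) = R l z" for z unfolding R_def by (intro sum.cong) auto
    have sp: "restrict z J \<in> space (PiM J (\<lambda>_. borel :: real measure))" for z J by (simp add: space_PiM)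
    show ?thesis
      using indep_varD[OF iv PA RB]
      by (simp add: vimage_def Int_def Peq Req sp conj_commute cong: conj_cong)
  qed
  let ?Q = "{\<omega>\<in>space M. \<bar>S L (?z \<omega>)\<bar> > u}"
  have disj: "disjoint_family_on (\<lambda>l. {\<omega>\<in>space M. P l (?z \<omega>)}) {..L}"
    unfolding disjoint_family_on_def
  proof (intro ballI impI)
    fix l k :: nat assume "l \<noteq> k"
    then consider "l < k" | "k < l" by linarith
    then show "{\<omega>\<in>space M. P l (?z \<omega>)} \<inter> {\<omega>\<in>space M. P k (?z \<omega>)} = {}"
      by cases (auto simp: P_def not_le[symmetric])
  qed
  have P_half: "prob {\<omega>\<in>space M. P l (?z \<omega>)} \<le> 2 * prob {\<omega>\<in>space M. P l (?z \<omega>) \<and> \<bar>R l (?z \<omega>)\<bar> \<le> a}" if l: "l \<le> L" for l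
  proof -
    note [measurable] = Rm[of l]
    have "prob {\<omega>\<in>space M. \<bar>R l (?z \<omega>)\<bar> \<le> a} = 1 - prob {\<omega>\<in>space M. \<bar>R l (?z \<omega>)\<bar> > a}"
      using prob_neg[of "\<lambda>\<omega>. \<bar>R l (?z \<omega>)\<bar> > a"] by (simp add: not_less)
    also have "\<dots> \<ge> 1 / 2" using half[OF l] by (simp add: R_def)
    finally have "1 \<le> 2 * prob {\<omega>\<in>space M. \<bar>R l (?z \<omega>)\<bar> \<le> a}" by simp
    from mult_left_mono[OF this, of "prob {\<omega>\<in>space M. P l (?z \<omega>)}"]
    show ?thesis unfolding prod[OF l] by (simp add: mult_ac)
  qed
  have "{\<omega>\<in>space M. \<exists>l\<le>L. \<bar>\<Sum>i<l. I i \<omega>\<bar> > u + a} = (\<Union>l\<in>{..L}. {\<omega>\<in>space M. P l (?z \<omega>)})"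
  proof (intro set_eqI iffI)
    fix \<omega> assume \<omega>: "\<omega> \<in> {\<omega>\<in>space M. \<exists>l\<le>L. \<bar>\<Sum>i<l. I i \<omega>\<bar> > u + a}"
    define l where "l = (LEAST l. \<bar>S l (?z \<omega>)\<bar> > u + a)"
    from \<omega> obtain l' where l': "l' \<le> L" "\<bar>S l' (?z \<omega>)\<bar> > u + a" by (auto simp: S_def)
    have "\<bar>S l (?z \<omega>)\<bar> > u + a" unfolding l_def by (rule LeastI[of _ l']) (rule l')
    moreover have "l \<le> l'" unfolding l_def by (rule Least_le) (rule l')
    moreover have "\<bar>S k (?z \<omega>)\<bar> \<le> u + a" if "k < l" for k
      using not_less_Least[of k "\<lambda>l. \<bar>S l (?z \<omega>)\<bar> > u + a"] that by (simp add: l_def)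
    ultimately have "P l (?z \<omega>)" "l \<le> L" using l' by (auto simp: P_def)
    then show "\<omega> \<in> (\<Union>l\<in>{..L}. {\<omega>\<in>space M. P l (?z \<omega>)})" using \<omega> by auto
  next
    fix \<omega> assume "\<omega> \<in> (\<Union>l\<in>{..L}. {\<omega>\<in>space M. P l (?z \<omega>)})"
    then obtain l where "\<omega> \<in> space M" "l \<le> L" "P l (?z \<omega>)" by auto
    then show "\<omega> \<in> {\<omega>\<in>space M. \<exists>l\<le>L. \<bar>\<Sum>i<l. I i \<omega>\<bar> > u + a}" by (auto simp: P_def S_def)
  qed
  then have "prob {\<omega>\<in>space M. \<exists>l\<le>L. \<bar>\<Sum>i<l. I i \<omega>\<bar> > u + a} \<le> (\<Sum>l\<in>{..L}. prob {\<omega>\<in>space M. P l (?z \<omega>)})"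
    by (simp only:) (rule measure_UNION_le; simp add: Pm)
  also have "\<dots> \<le> (\<Sum>l\<in>{..L}. 2 * prob {\<omega>\<in>space M. P l (?z \<omega>) \<and> \<bar>R l (?z \<omega>)\<bar> \<le> a})"
    using P_half by (intro sum_mono) auto
  also have "\<dots> = 2 * (\<Sum>l\<in>{..L}. prob {\<omega>\<in>space M. P l (?z \<omega>) \<and> \<bar>R l (?z \<omega>)\<bar> \<le> a})"
    by (simp add: sum_distrib_left)
  also have "(\<Sum>l\<in>{..L}. prob {\<omega>\<in>space M. P l (?z \<omega>) \<and> \<bar>R l (?z \<omega>)\<bar> \<le> a})
      = prob (\<Union>l\<in>{..L}. {\<omega>\<in>space M. P l (?z \<omega>) \<and> \<bar>R l (?z \<omega>)\<bar> \<le> a})"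
  proof (rule finite_measure_finite_Union[symmetric])
    show "disjoint_family_on (\<lambda>l. {\<omega>\<in>space M. P l (?z \<omega>) \<and> \<bar>R l (?z \<omega>)\<bar> \<le> a}) {..L}"
      using disj unfolding disjoint_family_on_def by blast
    have "{\<omega>\<in>space M. P l (?z \<omega>) \<and> \<bar>R l (?z \<omega>)\<bar> \<le> a} \<in> events" if "l \<le> L" for l
    proof -
      note [measurable] = Pm[OF that] Rm[of l]
      have "{\<omega>\<in>space M. P l (?z \<omega>) \<and> \<bar>R l (?z \<omega>)\<bar> \<le> a} = {\<omega>\<in>space M. P l (?z \<omega>)} \<inter> {\<omega>\<in>space M. \<bar>R l (?z \<omega>)\<bar> \<le> a}" by auto
      also have "\<dots> \<in> events" by measurable
      finally show ?thesis .
    qed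
    then show "(\<lambda>l. {\<omega>\<in>space M. P l (?z \<omega>) \<and> \<bar>R l (?z \<omega>)\<bar> \<le> a}) ` {..L} \<subseteq> events" by auto
  qed simp
  also have "\<dots> \<le> prob ?Q"
  proof (rule finite_measure_mono)
    show "(\<Union>l\<in>{..L}. {\<omega>\<in>space M. P l (?z \<omega>) \<and> \<bar>R l (?z \<omega>)\<bar> \<le> a}) \<subseteq> ?Q"
    proof
      fix \<omega> assume "\<omega> \<in> (\<Union>l\<in>{..L}. {\<omega>\<in>space M. P l (?z \<omega>) \<and> \<bar>R l (?z \<omega>)\<bar> \<le> a})"
      then obtain l where l: "\<omega> \<in> space M" "l \<le> L" "P l (?z \<omega>)" "\<bar>R l (?z \<omega>)\<bar> \<le> a" by auto
      have "S L (?z \<omega>) = S l (?z \<omega>) + R l (?z \<omega>)"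
        unfolding S_def R_def using l(2) by (simp add: lessThan_atLeast0 sum.atLeastLessThan_concat)
      moreover have "\<bar>S l (?z \<omega>)\<bar> > u + a" using l(3) by (simp add: P_def)
      ultimately show "\<omega> \<in> ?Q" using l by simp
    qed
    note [measurable] = Sm[of L]
    show "?Q \<in> events" by measurable
  qed
  finally show ?thesis by (simp add: S_def)
qed

text \<open>The values of V above a are sorted into layers of height 1. The tail decays at the rate
  \<open>\<theta>'\<close>, larger than \<theta>, so the layers contribute a geometric
  series.\<close>

lemma (in prob_space) exp_moment_of_tail:
  fixes V :: "'a \<Rightarrow> real"
  assumes V[measurable]: "V \<in> borel_measurable M" and a: "a \<ge> 0" and B: "B \<ge> 0"
    and \<theta>: "0 \<le> \<theta>" "\<theta> < \<theta>'"
    and tail: "\<And>n::nat. prob {\<omega>\<in>space M. V \<omega> > real n + a} \<le> B * exp (- \<theta>' * real n)"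
  shows "(\<integral>\<^sup>+\<omega>. ennreal (exp (\<theta> * V \<omega>)) \<partial>M) \<le> ennreal (exp (\<theta> * a) * (1 + exp \<theta> * B / (1 - exp (\<theta> - \<theta>'))))"
proof -
  have pw: "ennreal (exp (\<theta> * v)) \<le> ennreal (exp (\<theta> * a)) * (1 + (\<Sum>n. ennreal (exp (\<theta> * real (Suc n))) * indicator {real n + a<..} v))" for v
  proof (cases "v \<le> a")
    case True
    then have "exp (\<theta> * v) \<le> exp (\<theta> * a)" using \<theta>(1) by (simp add: mult_left_mono)
    then have "ennreal (exp (\<theta> * v)) \<le> ennreal (exp (\<theta> * a)) * 1" by (simp add: ennreal_leI)
    also have "\<dots> \<le> ennreal (exp (\<theta> * a)) * (1 + (\<Sum>n. ennreal (exp (\<theta> * real (Suc n))) * indicator {real n + a<..} v))"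
      by (intro mult_left_mono) auto
    finally show ?thesis .
  next
    case False
    define n where "n = nat (\<lceil>v - a\<rceil> - 1)"
    have n: "real n + a < v" "v \<le> real (Suc n) + a" using False unfolding n_def by linarith+
    have "\<theta> * v \<le> \<theta> * a + \<theta> * real (Suc n)" using n(2) \<theta>(1) by (simp add: mult_left_mono flip: distrib_left)
    then have "exp (\<theta> * v) \<le> exp (\<theta> * a) * exp (\<theta> * real (Suc n))" by (simp flip: exp_add)
    then have "ennreal (exp (\<theta> * v)) \<le> ennreal (exp (\<theta> * a)) * ennreal (exp (\<theta> * real (Suc n)))"
      by (simp add: ennreal_mult[symmetric] ennreal_leI)
    also have "ennreal (exp (\<theta> * real (Suc n))) = ennreal (exp (\<theta> * real (Suc n))) * indicator {real n + a<..} v"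
      using n(1) by simp
    also have "\<dots> \<le> (\<Sum>n. ennreal (exp (\<theta> * real (Suc n))) * indicator {real n + a<..} v)"
    proof -
      define g :: "nat \<Rightarrow> ennreal" where "g n = ennreal (exp (\<theta> * real (Suc n))) * indicator {real n + a<..} v" for n
      have "sum g {n} \<le> suminf g" by (rule sum_le_suminf[OF summableI]) auto
      then have "g n \<le> suminf g" by simp
      then show ?thesis unfolding g_def .
    qed
    also have "\<dots> \<le> 1 + \<dots>" by (simp add: add_increasing)
    finally show ?thesis by (simp add: mult_left_mono)
  qed
  have "(\<integral>\<^sup>+\<omega>. ennreal (exp (\<theta> * V \<omega>)) \<partial>M)
    \<le> (\<integral>\<^sup>+\<omega>. ennreal (exp (\<theta> * a)) * (1 + (\<Sum>n. ennreal (exp (\<theta> * real (Suc n))) * indicator {real n + a<..} (V \<omega>))) \<partial>M)"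
    by (intro nn_integral_mono pw)
  also have "\<dots> = ennreal (exp (\<theta> * a)) * (1 + (\<Sum>n. \<integral>\<^sup>+\<omega>. ennreal (exp (\<theta> * real (Suc n))) * indicator {real n + a<..} (V \<omega>) \<partial>M))"
    by (simp add: nn_integral_cmult nn_integral_add nn_integral_suminf emeasure_space_1)
  also have "\<dots> \<le> ennreal (exp (\<theta> * a)) * (1 + (\<Sum>n. ennreal (exp \<theta> * B * exp (\<theta> - \<theta>') ^ n)))"
  proof (intro mult_left_mono add_left_mono suminf_le summableI)
    fix n
    have "(\<integral>\<^sup>+\<omega>. ennreal (exp (\<theta> * real (Suc n))) * indicator {real n + a<..} (V \<omega>) \<partial>M)
      = ennreal (exp (\<theta> * real (Suc n))) * (\<integral>\<^sup>+\<omega>. indicator {\<omega>\<in>space M. V \<omega> > real n + a} \<omega> \<partial>M)"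
      by (subst nn_integral_cmult[symmetric]) (auto intro!: nn_integral_cong simp: indicator_def)
    also have "\<dots> = ennreal (exp (\<theta> * real (Suc n)) * prob {\<omega>\<in>space M. V \<omega> > real n + a})"
      by (simp add: emeasure_eq_measure ennreal_mult)
    also have "\<dots> \<le> ennreal (exp (\<theta> * real (Suc n)) * (B * exp (- \<theta>' * real n)))"
      by (intro ennreal_leI mult_left_mono tail) simp
    also have "exp (\<theta> * real (Suc n)) * (B * exp (- \<theta>' * real n)) = exp \<theta> * B * exp (\<theta> - \<theta>') ^ n"
    proof -
      have "exp (\<theta> * real (Suc n)) * exp (- \<theta>' * real n) = exp \<theta> * exp (\<theta> - \<theta>') ^ n"
        by (simp add: exp_of_nat_mult[symmetric] flip: exp_add) (simp add: algebra_simps)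
      then show ?thesis by (simp add: mult_ac)
    qed
    finally show "(\<integral>\<^sup>+\<omega>. ennreal (exp (\<theta> * real (Suc n))) * indicator {real n + a<..} (V \<omega>) \<partial>M)
      \<le> ennreal (exp \<theta> * B * exp (\<theta> - \<theta>') ^ n)" .
  qed auto
  also have "(\<Sum>n. ennreal (exp \<theta> * B * exp (\<theta> - \<theta>') ^ n)) = ennreal (\<Sum>n. exp \<theta> * B * exp (\<theta> - \<theta>') ^ n)"
    using B \<theta> by (intro suminf_ennreal2 summable_mult summable_geometric) auto
  also have "(\<Sum>n. exp \<theta> * B * exp (\<theta> - \<theta>') ^ n) = exp \<theta> * B / (1 - exp (\<theta> - \<theta>'))"
    using \<theta> by (subst suminf_mult) (auto simp: suminf_geometric intro!: summable_geometric)
  also have "ennreal (exp (\<theta> * a)) * (1 + ennreal (exp \<theta> * B / (1 - exp (\<theta> - \<theta>')))) = ennreal (exp (\<theta> * a) * (1 + exp \<theta> * B / (1 - exp (\<theta> - \<theta>'))))"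
  proof -
    have "0 \<le> exp \<theta> * B / (1 - exp (\<theta> - \<theta>'))" using B \<theta> by (intro divide_nonneg_pos) auto
    then show ?thesis by (simp add: ennreal_mult flip: ennreal_1 ennreal_plus)
  qed
  finally show ?thesis .
qed

section \<open>Oscillations of a Levy process over unit intervals\<close>

locale levy =
  fixes M :: "'a measure" and Z :: "real \<Rightarrow> 'a \<Rightarrow> real"
  assumes levy: "levy_process M Z"
begin

sublocale prob_space M
  using levy unfolding levy_process_def by blast

lemma Z_measurable [measurable]: "t \<ge> 0 \<Longrightarrow> Z t \<in> borel_measurable M"
  using levy unfolding levy_process_def by blast

lemma Z_0: "AE \<omega> in M. Z 0 \<omega> = 0"
  using levy unfolding levy_process_def by blast

lemma stationary: "s \<ge> 0 \<Longrightarrow> h \<ge> 0 \<Longrightarrow> distr M borel (\<lambda>\<omega>. Z (s + h) \<omega> - Z s \<omega>) = distr M borel (\<lambda>\<omega>. Z h \<omega> - Z 0 \<omega>)"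
  using levy unfolding levy_process_def by blast

lemma indep_increments:
  "0 \<le> t 0 \<Longrightarrow> (\<And>i. i < n \<Longrightarrow> t i < t (Suc i)) \<Longrightarrow>
    indep_vars (\<lambda>_. borel) (\<lambda>i \<omega>. Z (t (Suc i)) \<omega> - Z (t i) \<omega>) {..<n}" for t :: "nat \<Rightarrow> real"
  using levy unfolding levy_process_def by blast

lemma path: "\<omega> \<in> space M \<Longrightarrow> cadlag (\<lambda>s. Z s \<omega>)"
  using levy unfolding levy_process_def cadlag_def by blast

lemma nn_integral_increment:
  assumes "s \<ge> 0" "h \<ge> 0" and [measurable]: "f \<in> borel_measurable borel"
  shows "(\<integral>\<^sup>+\<omega>. f (Z (s + h) \<omega> - Z s \<omega>) \<partial>M) = (\<integral>\<^sup>+\<omega>. f (Z h \<omega> - Z 0 \<omega>) \<partial>M)"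
proof -
  have [measurable]: "Z (s + h) \<in> borel_measurable M" "Z s \<in> borel_measurable M" "Z h \<in> borel_measurable M" "Z 0 \<in> borel_measurable M"
    using assms by auto
  have "(\<integral>\<^sup>+\<omega>. f (Z (s + h) \<omega> - Z s \<omega>) \<partial>M) = (\<integral>\<^sup>+x. f x \<partial>distr M borel (\<lambda>\<omega>. Z (s + h) \<omega> - Z s \<omega>))"
    by (rule nn_integral_distr[symmetric]) auto
  also have "\<dots> = (\<integral>\<^sup>+\<omega>. f (Z h \<omega> - Z 0 \<omega>) \<partial>M)"
    unfolding stationary[OF assms(1,2)] by (rule nn_integral_distr) auto
  finally show ?thesis .
qed

lemma prob_increment:
  assumes "s \<ge> 0" "h \<ge> 0"
  shows "prob {\<omega>\<in>space M. \<bar>Z (s + h) \<omega> - Z s \<omega>\<bar> > u} = prob {\<omega>\<in>space M. \<bar>Z h \<omega> - Z 0 \<omega>\<bar> > u}"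
proof -
  have [measurable]: "Z (s + h) \<in> borel_measurable M" "Z s \<in> borel_measurable M" "Z h \<in> borel_measurable M" "Z 0 \<in> borel_measurable M"
    using assms by auto
  have B: "{y::real. \<bar>y\<bar> > u} \<in> sets borel" by measurable
  have "prob {\<omega>\<in>space M. \<bar>Z (s + h) \<omega> - Z s \<omega>\<bar> > u} = measure (distr M borel (\<lambda>\<omega>. Z (s + h) \<omega> - Z s \<omega>)) {y. \<bar>y\<bar> > u}"
    by (subst measure_distr[OF _ B]) (auto intro!: arg_cong[where f=prob])
  also have "\<dots> = prob {\<omega>\<in>space M. \<bar>Z h \<omega> - Z 0 \<omega>\<bar> > u}"
    unfolding stationary[OF assms] by (subst measure_distr[OF _ B]) (auto intro!: arg_cong[where f=prob])
  finally show ?thesis .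
qed

definition Wk :: "nat \<Rightarrow> nat \<Rightarrow> 'a \<Rightarrow> real" where
  "Wk k j \<omega> = Max ((\<lambda>i. \<bar>Z (real j + real i / 2 ^ k) \<omega> - Z (real j) \<omega>\<bar>) ` {..2 ^ k})"

text \<open>By right-continuity the dyadic points suffice to bound the oscillation over [j, j + 1]
  (\<open>Z_le_W\<close>), and a countable supremum is measurable.\<close>

definition W :: "nat \<Rightarrow> 'a \<Rightarrow> real" where
  "W j \<omega> = (SUP k. Wk k j \<omega>)"

lemma Wk_measurable [measurable]: "Wk k j \<in> borel_measurable M"
proof -
  have "(\<lambda>\<omega>. Max ((\<lambda>i. \<bar>Z (real j + real i / 2 ^ k) \<omega> - Z (real j) \<omega>\<bar>) ` {..2 ^ k})) \<in> borel_measurable M"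
  proof (rule borel_measurable_Max)
    fix i :: nat
    have [measurable]: "Z (real j + real i / 2 ^ k) \<in> borel_measurable M" "Z (real j) \<in> borel_measurable M"
      by (auto intro!: Z_measurable)
    show "(\<lambda>\<omega>. \<bar>Z (real j + real i / 2 ^ k) \<omega> - Z (real j) \<omega>\<bar>) \<in> borel_measurable M" by measurable
  qed simp
  then show ?thesis unfolding Wk_def[abs_def] .
qed

lemma Wk_ge: "i \<le> 2 ^ k \<Longrightarrow> \<bar>Z (real j + real i / 2 ^ k) \<omega> - Z (real j) \<omega>\<bar> \<le> Wk k j \<omega>"
  unfolding Wk_def by (intro Max_ge) auto

lemma Wk_gt_iff: "Wk k j \<omega> > u \<longleftrightarrow> (\<exists>i\<le>2 ^ k. \<bar>Z (real j + real i / 2 ^ k) \<omega> - Z (real j) \<omega>\<bar> > u)"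
  unfolding Wk_def by (subst Max_gr_iff) auto

lemma Wk_nonneg: "0 \<le> Wk k j \<omega>"
  using Wk_ge[of 0 k j \<omega>] by simp

lemma Wk_Suc: "Wk k j \<omega> \<le> Wk (Suc k) j \<omega>"
  unfolding Wk_def[of k]
proof (intro Max.boundedI)
  fix a assume "a \<in> (\<lambda>i. \<bar>Z (real j + real i / 2 ^ k) \<omega> - Z (real j) \<omega>\<bar>) ` {..2 ^ k}"
  then obtain i where i: "i \<le> 2 ^ k" "a = \<bar>Z (real j + real i / 2 ^ k) \<omega> - Z (real j) \<omega>\<bar>" by auto
  have "real i / 2 ^ k = real (2 * i) / 2 ^ Suc k" by simp
  then have "a = \<bar>Z (real j + real (2 * i) / 2 ^ Suc k) \<omega> - Z (real j) \<omega>\<bar>" using i(2) by simp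
  also have "\<dots> \<le> Wk (Suc k) j \<omega>" by (rule Wk_ge) (use i in simp)
  finally show "a \<le> Wk (Suc k) j \<omega>" .
qed auto

lemma Wk_bdd:
  assumes "\<omega> \<in> space M" shows "bdd_above (range (\<lambda>k. Wk k j \<omega>))"
proof -
  obtain B where B: "\<And>u. 0 \<le> u \<Longrightarrow> u \<le> real j + 1 \<Longrightarrow> \<bar>Z u \<omega>\<bar> \<le> B"
    using cadlag_bounded[OF path[OF assms], of "real j + 1"] by blast
  show ?thesis
  proof (rule bdd_aboveI2)
    fix k
    show "Wk k j \<omega> \<le> 2 * B"
      unfolding Wk_def
    proof (intro Max.boundedI)
      fix a assume "a \<in> (\<lambda>i. \<bar>Z (real j + real i / 2 ^ k) \<omega> - Z (real j) \<omega>\<bar>) ` {..2 ^ k}"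
      then obtain i where i: "i \<le> 2 ^ k" "a = \<bar>Z (real j + real i / 2 ^ k) \<omega> - Z (real j) \<omega>\<bar>" by auto
      have "real i \<le> real (2 ^ k)" using i(1) by (simp only: of_nat_le_iff)
      then have "real i / 2 ^ k \<le> 1" by simp
      then have "\<bar>Z (real j + real i / 2 ^ k) \<omega>\<bar> \<le> B" "\<bar>Z (real j) \<omega>\<bar> \<le> B" by (auto intro!: B)
      then show "a \<le> 2 * B" using i(2) by linarith
    qed auto
  qed
qed

lemma W_measurable [measurable]: "W j \<in> borel_measurable M"
  unfolding W_def[abs_def] by (rule borel_measurable_cSUP) (auto intro: Wk_bdd)

lemma Wk_le_W: "\<omega> \<in> space M \<Longrightarrow> Wk k j \<omega> \<le> W j \<omega>"
  unfolding W_def by (rule cSUP_upper[OF _ Wk_bdd]) auto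

lemma W_nonneg: "\<omega> \<in> space M \<Longrightarrow> 0 \<le> W j \<omega>"
  using Wk_le_W[of \<omega> 0 j] Wk_nonneg[of 0 j \<omega>] by linarith

lemma Wk_tendsto: "\<omega> \<in> space M \<Longrightarrow> (\<lambda>k. Wk k j \<omega>) \<longlonglongrightarrow> W j \<omega>"
  unfolding W_def by (rule LIMSEQ_incseq_SUP[OF Wk_bdd]) (auto intro!: incseq_SucI Wk_Suc)

text \<open>s is approached by dyadic points strictly from the right, and these must not leave
  [j, j + 1]; hence the separate case \<open>s = 1\<close>.\<close>

lemma Z_le_W:
  assumes \<omega>: "\<omega> \<in> space M" and s: "0 \<le> s" "s \<le> 1"
  shows "\<bar>Z (real j + s) \<omega> - Z (real j) \<omega>\<bar> \<le> W j \<omega>"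
proof (cases "s = 1")
  case True
  have "\<bar>Z (real j + real (2 ^ 0) / 2 ^ 0) \<omega> - Z (real j) \<omega>\<bar> \<le> Wk 0 j \<omega>" by (rule Wk_ge) simp
  then show ?thesis using Wk_le_W[OF \<omega>, of 0 j] True by simp
next
  case False
  define i where "i k = nat \<lfloor>s * 2 ^ k\<rfloor> + 1" for k :: nat
  have i1: "real (i k) = of_int \<lfloor>s * 2 ^ k\<rfloor> + 1" for k unfolding i_def using s by simp
  have i2: "s * 2 ^ k < real (i k)" "real (i k) \<le> s * 2 ^ k + 1" for k unfolding i1 by linarith+
  have ik: "i k \<le> 2 ^ k" for k
  proof -
    have "s * 2 ^ k < 2 ^ k" using s False by simp
    then have "\<lfloor>s * 2 ^ k\<rfloor> < 2 ^ k" by (simp add: floor_less_iff)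
    then have "real_of_int (\<lfloor>s * 2 ^ k\<rfloor> + 1) \<le> real_of_int (2 ^ k)" by (subst of_int_le_iff) simp
    then have "real (i k) \<le> 2 ^ k" unfolding i1 by simp
    then show ?thesis by (metis of_nat_le_iff of_nat_numeral of_nat_power)
  qed
  have t: "(\<lambda>k. real j + real (i k) / 2 ^ k) \<longlonglongrightarrow> real j + s"
  proof (rule tendsto_sandwich[of "\<lambda>_. real j + s" _ _ "\<lambda>k. real j + s + (1 / 2) ^ k"])
    have "(\<lambda>k. real j + s + (1 / 2) ^ k) \<longlonglongrightarrow> real j + s + 0"
      by (intro tendsto_intros LIMSEQ_power_zero) simp
    then show "(\<lambda>k. real j + s + (1 / 2) ^ k) \<longlonglongrightarrow> real j + s" by simp
    have "s \<le> real (i k) / 2 ^ k" for k using i2(1)[of k] by (simp add: field_simps)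
    then show "\<forall>\<^sub>F k in sequentially. real j + s \<le> real j + real (i k) / 2 ^ k" by simp
    have "real (i k) / 2 ^ k \<le> (s * 2 ^ k + 1) / 2 ^ k" for k by (rule divide_right_mono[OF i2(2)]) simp
    then have "real (i k) / 2 ^ k \<le> s + (1 / 2) ^ k" for k by (simp add: add_divide_distrib power_divide)
    then show "\<forall>\<^sub>F k in sequentially. real j + real (i k) / 2 ^ k \<le> real j + s + (1 / 2) ^ k"
      by (simp add: add.assoc)
  qed simp
  have gt: "real j + real (i k) / 2 ^ k > real j + s" for k using i2(1)[of k] by (simp add: field_simps)
  have "filterlim (\<lambda>k. real j + real (i k) / 2 ^ k) (at_right (real j + s)) sequentially"
    unfolding filterlim_at using t gt by (simp add: less_imp_neq[symmetric] del: add_less_cancel_left)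
  moreover have "((\<lambda>u. Z u \<omega>) \<longlongrightarrow> Z (real j + s) \<omega>) (at_right (real j + s))"
    using path[OF \<omega>] s by (simp add: cadlag_def continuous_within)
  ultimately have "(\<lambda>k. Z (real j + real (i k) / 2 ^ k) \<omega>) \<longlonglongrightarrow> Z (real j + s) \<omega>"
    by (rule filterlim_compose[rotated])
  then have "(\<lambda>k. \<bar>Z (real j + real (i k) / 2 ^ k) \<omega> - Z (real j) \<omega>\<bar>) \<longlonglongrightarrow> \<bar>Z (real j + s) \<omega> - Z (real j) \<omega>\<bar>"
    by (intro tendsto_intros)
  then show ?thesis
    by (rule LIMSEQ_le_const2) (use order_trans[OF Wk_ge[OF ik] Wk_le_W[OF \<omega>]] in blast)
qed

text \<open>Provides the constant a of Ottaviani's inequality for all remainders and all meshes at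
  once: each remainder has the law of an increment from time 0, which \<open>W 0\<close>
  bounds.\<close>

lemma W_0_tight: "\<exists>a\<ge>0. prob {\<omega>\<in>space M. W 0 \<omega> > a} \<le> 1 / 2"
proof -
  define A where "A n = {\<omega>\<in>space M. W 0 \<omega> > real n}" for n
  have A: "A n \<in> events" for n unfolding A_def by measurable
  have "(\<lambda>n. prob (A n)) \<longlonglongrightarrow> prob (\<Inter>n. A n)"
    by (rule finite_Lim_measure_decseq) (use A in \<open>auto simp: A_def decseq_def\<close>)
  moreover have "(\<Inter>n. A n) = {}"
  proof (rule ccontr)
    assume "(\<Inter>n. A n) \<noteq> {}"
    then obtain \<omega> where "\<And>n. W 0 \<omega> > real n" by (auto simp: A_def)
    then show False using real_arch_simple[of "W 0 \<omega>"] by (meson not_le)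
  qed
  ultimately have "(\<lambda>n. prob (A n)) \<longlonglongrightarrow> 0" by simp
  then have "\<forall>\<^sub>F n in sequentially. prob (A n) < 1 / 2" by (rule order_tendstoD) simp
  then obtain n where "prob (A n) < 1 / 2" by (auto simp: eventually_sequentially)
  then show ?thesis unfolding A_def by (intro exI[of _ "real n"]) auto
qed

lemma telescope_grid:
  fixes L :: nat
  assumes "L > 0"
  shows "(\<Sum>i<l. Z (x + real (Suc (b + i)) / real L) \<omega> - Z (x + real (b + i) / real L) \<omega>)
    = Z (x + real (b + l) / real L) \<omega> - Z (x + real b / real L) \<omega>"
  using sum_lessThan_telescope[of "\<lambda>i. Z (x + real (b + i) / real L) \<omega>" l] by simp

text \<open>The bound does not depend on the mesh, so the moment bounds derived from it pass to W by
  Fatou's lemma.\<close>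

lemma Wk_tail:
  assumes a: "a \<ge> 0" "prob {\<omega>\<in>space M. W 0 \<omega> > a} \<le> 1 / 2"
  shows "prob {\<omega>\<in>space M. Wk k j \<omega> > u + a} \<le> 2 * prob {\<omega>\<in>space M. \<bar>Z 1 \<omega> - Z 0 \<omega>\<bar> > u}"
proof -
  define L :: nat where "L = 2 ^ k"
  have L: "L > 0" "real L = 2 ^ k" by (auto simp: L_def)
  define I where "I i \<omega> = Z (real j + real (Suc i) / real L) \<omega> - Z (real j + real i / real L) \<omega>" for i \<omega>
  have ind: "indep_vars (\<lambda>_. borel) I {..<L}"
    unfolding I_def by (rule indep_increments) (use L in \<open>auto simp: divide_strict_right_mono\<close>)
  have S: "(\<Sum>i<l. I i \<omega>) = Z (real j + real l / real L) \<omega> - Z (real j) \<omega>" for l \<omega>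
    using telescope_grid[OF L(1), of "real j" 0 \<omega> l] by (simp add: I_def)
  have R: "(\<Sum>i\<in>{l..<L}. I i \<omega>) = Z (real j + 1) \<omega> - Z (real j + real l / real L) \<omega>" if "l \<le> L" for l \<omega>
  proof -
    have "(\<Sum>i<l. I i \<omega>) + (\<Sum>i\<in>{l..<L}. I i \<omega>) = (\<Sum>i<L. I i \<omega>)"
      using that by (simp add: lessThan_atLeast0 sum.atLeastLessThan_concat)
    then show ?thesis unfolding S using L by simp
  qed
  have "prob {\<omega>\<in>space M. \<exists>l\<le>L. \<bar>\<Sum>i<l. I i \<omega>\<bar> > u + a} \<le> 2 * prob {\<omega>\<in>space M. \<bar>\<Sum>i<L. I i \<omega>\<bar> > u}"
  proof (rule ottaviani[OF ind])
    fix l assume l: "l \<le> L"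
    let ?s = "real j + real l / real L" and ?h = "1 - real l / real L"
    have h: "0 \<le> ?h" "?h \<le> 1" using l L by (auto simp: field_simps)
    have "prob {\<omega>\<in>space M. \<bar>\<Sum>i\<in>{l..<L}. I i \<omega>\<bar> > a} = prob {\<omega>\<in>space M. \<bar>Z (?s + ?h) \<omega> - Z ?s \<omega>\<bar> > a}"
      unfolding R[OF l] by simp
    also have "\<dots> = prob {\<omega>\<in>space M. \<bar>Z ?h \<omega> - Z 0 \<omega>\<bar> > a}" by (rule prob_increment) (use h in auto)
    also have "\<dots> \<le> prob {\<omega>\<in>space M. W 0 \<omega> > a}"
    proof (rule finite_measure_mono)
      show "{\<omega>\<in>space M. \<bar>Z ?h \<omega> - Z 0 \<omega>\<bar> > a} \<subseteq> {\<omega>\<in>space M. W 0 \<omega> > a}"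
        using Z_le_W[of _ ?h 0] h by (auto intro: less_le_trans)
    qed measurable
    also have "\<dots> \<le> 1 / 2" by (rule a(2))
    finally show "prob {\<omega>\<in>space M. \<bar>\<Sum>i\<in>{l..<L}. I i \<omega>\<bar> > a} \<le> 1 / 2" .
  qed
  also have "{\<omega>\<in>space M. \<exists>l\<le>L. \<bar>\<Sum>i<l. I i \<omega>\<bar> > u + a} = {\<omega>\<in>space M. Wk k j \<omega> > u + a}"
    unfolding S Wk_gt_iff L(2) by (simp add: L_def)
  also have "prob {\<omega>\<in>space M. \<bar>\<Sum>i<L. I i \<omega>\<bar> > u} = prob {\<omega>\<in>space M. \<bar>Z (real j + 1) \<omega> - Z (real j) \<omega>\<bar> > u}"
    unfolding S using L by simp
  also have "\<dots> = prob {\<omega>\<in>space M. \<bar>Z 1 \<omega> - Z 0 \<omega>\<bar> > u}" by (rule prob_increment) auto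
  finally show ?thesis .
qed

lemma exp_tail:
  assumes \<theta>: "\<theta> > 0" "mgf M (Z 1) \<theta> < \<infinity>" "mgf M (Z 1) (- \<theta>) < \<infinity>"
  shows "\<exists>B\<ge>0. \<forall>u. prob {\<omega>\<in>space M. \<bar>Z 1 \<omega> - Z 0 \<omega>\<bar> > u} \<le> B * exp (- \<theta> * u)"
proof -
  have [measurable]: "Z 1 \<in> borel_measurable M" "Z 0 \<in> borel_measurable M" by auto
  define B where "B = enn2real (mgf M (Z 1) \<theta>) + enn2real (mgf M (Z 1) (- \<theta>))"
  have "prob {\<omega>\<in>space M. \<bar>Z 1 \<omega> - Z 0 \<omega>\<bar> > u} \<le> B * exp (- \<theta> * u)" for u
  proof -
    let ?E = "{\<omega>\<in>space M. \<bar>Z 1 \<omega> - Z 0 \<omega>\<bar> > u}"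
    have "emeasure M ?E = (\<integral>\<^sup>+\<omega>. indicator ?E \<omega> \<partial>M)" by (rule nn_integral_indicator[symmetric]) measurable
    also have "\<dots> \<le> (\<integral>\<^sup>+\<omega>. ennreal (exp (- \<theta> * u)) * (ennreal (exp (\<theta> * Z 1 \<omega>)) + ennreal (exp (- \<theta> * Z 1 \<omega>))) \<partial>M)"
    proof (rule nn_integral_mono_AE, use Z_0 in eventually_elim)
      fix \<omega> assume z: "Z 0 \<omega> = 0"
      show "indicator ?E \<omega> \<le> ennreal (exp (- \<theta> * u)) * (ennreal (exp (\<theta> * Z 1 \<omega>)) + ennreal (exp (- \<theta> * Z 1 \<omega>)))"
      proof (cases "\<omega> \<in> ?E")
        case True
        then have "\<bar>Z 1 \<omega>\<bar> > u" using z by simp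
        then have "\<theta> * u \<le> \<theta> * \<bar>Z 1 \<omega>\<bar>" using \<theta>(1) by (intro mult_left_mono) auto
        then have "exp (\<theta> * u) \<le> exp (\<theta> * \<bar>Z 1 \<omega>\<bar>)" by simp
        also have "\<dots> \<le> exp (\<theta> * Z 1 \<omega>) + exp (- \<theta> * Z 1 \<omega>)" by (cases "0 \<le> Z 1 \<omega>") (auto simp: add_increasing add_increasing2)
        finally have "exp (- \<theta> * u) * exp (\<theta> * u) \<le> exp (- \<theta> * u) * (exp (\<theta> * Z 1 \<omega>) + exp (- \<theta> * Z 1 \<omega>))"
          by (rule mult_left_mono) simp
        moreover have "exp (- \<theta> * u) * exp (\<theta> * u) = 1" by (simp flip: exp_add)
        ultimately have "1 \<le> exp (- \<theta> * u) * (exp (\<theta> * Z 1 \<omega>) + exp (- \<theta> * Z 1 \<omega>))" by linarith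
        then have "ennreal 1 \<le> ennreal (exp (- \<theta> * u) * (exp (\<theta> * Z 1 \<omega>) + exp (- \<theta> * Z 1 \<omega>)))" by (rule ennreal_leI)
        also have "\<dots> = ennreal (exp (- \<theta> * u)) * (ennreal (exp (\<theta> * Z 1 \<omega>)) + ennreal (exp (- \<theta> * Z 1 \<omega>)))"
          by (subst ennreal_mult) (simp_all add: add_nonneg_nonneg)
        finally show ?thesis using True by simp
      qed simp
    qed
    also have "\<dots> = ennreal (exp (- \<theta> * u)) * (mgf M (Z 1) \<theta> + mgf M (Z 1) (- \<theta>))"
      unfolding mgf_def by (subst nn_integral_cmult) (auto simp: nn_integral_add)
    also have "mgf M (Z 1) \<theta> + mgf M (Z 1) (- \<theta>) = ennreal B"
      unfolding B_def by (subst ennreal_plus) (use \<theta> in \<open>simp_all add: ennreal_enn2real\<close>)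
    also have "ennreal (exp (- \<theta> * u)) * ennreal B = ennreal (B * exp (- \<theta> * u))"
      by (simp add: ennreal_mult B_def mult.commute)
    finally show ?thesis by (simp add: emeasure_eq_measure B_def ennreal_le_iff)
  qed
  moreover have "B \<ge> 0" by (simp add: B_def)
  ultimately show ?thesis by blast
qed

end

context levy
begin

text \<open>At a fixed mesh the maxima over different unit intervals are functions of disjoint
  groups of grid increments, hence independent.\<close>

lemma nn_integral_prod_Wk:
  assumes \<theta>: "\<theta> \<ge> 0"
  shows "(\<integral>\<^sup>+\<omega>. (\<Prod>r<n. ennreal (exp (\<theta> * Wk k (x + r) \<omega>))) \<partial>M) = (\<Prod>r<n. \<integral>\<^sup>+\<omega>. ennreal (exp (\<theta> * Wk k (x + r) \<omega>)) \<partial>M)"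
proof -
  define L :: nat where "L = 2 ^ k"
  have L: "L > 0" "real L = 2 ^ k" by (auto simp: L_def)
  define I where "I i \<omega> = Z (real x + real (Suc i) / real L) \<omega> - Z (real x + real i / real L) \<omega>" for i \<omega>
  have ind: "indep_vars (\<lambda>_. borel) I {..<n * L}"
    unfolding I_def by (rule indep_increments) (use L in \<open>auto simp: divide_strict_right_mono\<close>)
  define K where "K r = {r * L..<r * L + L}" for r
  define f :: "nat \<Rightarrow> (nat \<Rightarrow> real) \<Rightarrow> real" where "f r z = Max ((\<lambda>l. \<bar>\<Sum>i<l. z (r * L + i)\<bar>) ` {..L})" for r z
  have Kn: "K r \<subseteq> {..<n * L}" if "r < n" for r
  proof -
    have "Suc r * L \<le> n * L" using that by (intro mult_le_mono1) simp
    then show ?thesis by (auto simp: K_def)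
  qed
  have disj: "disjoint_family_on K {..<n}"
    unfolding K_def by (rule disjoint_consecutive_blocks)
  have fm: "f r \<in> borel_measurable (PiM (K r) (\<lambda>_. borel))" for r
    unfolding f_def
  proof (rule borel_measurable_Max)
    fix l assume l: "l \<in> {..L}"
    have c: "(\<lambda>z::nat \<Rightarrow> real. z (r * L + i)) \<in> borel_measurable (PiM (K r) (\<lambda>_. borel))" if "i \<in> {..<l}" for i
      by (rule measurable_component_singleton) (use that l in \<open>auto simp: K_def\<close>)
    have "(\<lambda>z::nat \<Rightarrow> real. \<Sum>i<l. z (r * L + i)) \<in> borel_measurable (PiM (K r) (\<lambda>_. borel))"
      using borel_measurable_sum[of "{..<l}" "\<lambda>i z. z (r * L + i)", OF c] by simp
    then show "(\<lambda>z::nat \<Rightarrow> real. \<bar>\<Sum>i<l. z (r * L + i)\<bar>) \<in> borel_measurable (PiM (K r) (\<lambda>_. borel))"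
      by (rule borel_measurable_abs)
  qed simp
  have Wk: "Wk k (x + r) \<omega> = f r (restrict (\<lambda>i. I i \<omega>) (K r))" for r \<omega>
  proof -
    have "(\<Sum>i<l. restrict (\<lambda>i. I i \<omega>) (K r) (r * L + i)) = Z (real (x + r) + real l / 2 ^ k) \<omega> - Z (real (x + r)) \<omega>" if "l \<le> L" for l
    proof -
      have "(\<Sum>i<l. restrict (\<lambda>i. I i \<omega>) (K r) (r * L + i)) = (\<Sum>i<l. I (r * L + i) \<omega>)"
        using that by (intro sum.cong) (auto simp: K_def)
      also have "\<dots> = Z (real x + real (r * L + l) / real L) \<omega> - Z (real x + real (r * L) / real L) \<omega>"
        unfolding I_def by (rule telescope_grid[OF L(1), of "real x" "r * L" \<omega> l])
      also have "real x + real (r * L + l) / real L = real (x + r) + real l / 2 ^ k"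
        using L by (simp add: add_divide_distrib)
      also have "real x + real (r * L) / real L = real (x + r)" using L by simp
      finally show ?thesis .
    qed
    then show ?thesis unfolding Wk_def f_def L_def by (intro arg_cong[where f=Max] image_cong) auto
  qed
  have "indep_vars (\<lambda>_. borel) (\<lambda>r \<omega>. ennreal (exp (\<theta> * f r (restrict (\<lambda>i. I i \<omega>) (K r))))) {..<n}"
    by (rule indep_vars_compose2[OF indep_vars_restrict[OF ind _ disj]]) (use fm Kn in auto)
  then have "(\<integral>\<^sup>+\<omega>. (\<Prod>r<n. ennreal (exp (\<theta> * f r (restrict (\<lambda>i. I i \<omega>) (K r))))) \<partial>M)
    = (\<Prod>r<n. \<integral>\<^sup>+\<omega>. ennreal (exp (\<theta> * f r (restrict (\<lambda>i. I i \<omega>) (K r)))) \<partial>M)"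
    by (intro indep_vars_nn_integral) auto
  then show ?thesis by (simp only: Wk)
qed

text \<open>The exponential moments of \<open>Wk k j\<close> are bounded by one constant C for all k
  and j. Independence multiplies them, Fatou's lemma passes to W, and q is
  \<open>ln C\<close>.\<close>

lemma W_moment:
  assumes t: "0 \<le> t" "t < \<theta>" and \<theta>: "mgf M (Z 1) \<theta> < \<infinity>" "mgf M (Z 1) (- \<theta>) < \<infinity>"
  shows "\<exists>q\<ge>0. \<forall>x n. (\<integral>\<^sup>+\<omega>. ennreal (exp (t * (\<Sum>j\<in>{x..<x + n}. W j \<omega>))) \<partial>M) \<le> ennreal (exp (q * real n))"
proof -
  obtain a where a: "a \<ge> 0" "prob {\<omega>\<in>space M. W 0 \<omega> > a} \<le> 1 / 2" using W_0_tight by blast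
  have \<theta>0: "\<theta> > 0" using t by simp
  obtain B where B: "B \<ge> 0" "\<And>u. prob {\<omega>\<in>space M. \<bar>Z 1 \<omega> - Z 0 \<omega>\<bar> > u} \<le> B * exp (- \<theta> * u)"
    using exp_tail[OF \<theta>0 \<theta>] by blast
  define C where "C = exp (t * a) * (1 + exp t * (2 * B) / (1 - exp (t - \<theta>)))"
  have E: "(\<integral>\<^sup>+\<omega>. ennreal (exp (t * Wk k j \<omega>)) \<partial>M) \<le> ennreal C" for k j
    unfolding C_def
  proof (rule exp_moment_of_tail[OF Wk_measurable a(1) _ t])
    fix n :: nat
    have "prob {\<omega>\<in>space M. Wk k j \<omega> > real n + a} \<le> 2 * prob {\<omega>\<in>space M. \<bar>Z 1 \<omega> - Z 0 \<omega>\<bar> > real n}"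
      by (rule Wk_tail[OF a])
    also have "\<dots> \<le> 2 * (B * exp (- \<theta> * real n))" by (intro mult_left_mono B) simp
    finally show "prob {\<omega>\<in>space M. Wk k j \<omega> > real n + a} \<le> 2 * B * exp (- \<theta> * real n)" by simp
  qed (use B in simp)
  have "0 \<le> exp t * (2 * B) / (1 - exp (t - \<theta>))" using B t by (intro divide_nonneg_pos) auto
  then have "1 * 1 \<le> C" unfolding C_def using t a by (intro mult_mono) auto
  then have C: "C \<ge> 1" by simp
  have "(\<integral>\<^sup>+\<omega>. ennreal (exp (t * (\<Sum>j\<in>{x..<x + n}. W j \<omega>))) \<partial>M) \<le> ennreal (exp (ln C * real n))" for x n
  proof -
    let ?g = "\<lambda>k \<omega>. ennreal (exp (t * (\<Sum>j\<in>{x..<x + n}. Wk k j \<omega>)))"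
    have "(\<integral>\<^sup>+\<omega>. ennreal (exp (t * (\<Sum>j\<in>{x..<x + n}. W j \<omega>))) \<partial>M) = (\<integral>\<^sup>+\<omega>. liminf (\<lambda>k. ?g k \<omega>) \<partial>M)"
    proof (rule nn_integral_cong)
      fix \<omega> assume \<omega>: "\<omega> \<in> space M"
      have "(\<lambda>k. ?g k \<omega>) \<longlonglongrightarrow> ennreal (exp (t * (\<Sum>j\<in>{x..<x + n}. W j \<omega>)))"
        by (intro tendsto_ennrealI tendsto_intros Wk_tendsto \<omega>)
      then show "ennreal (exp (t * (\<Sum>j\<in>{x..<x + n}. W j \<omega>))) = liminf (\<lambda>k. ?g k \<omega>)"
        by (rule lim_imp_Liminf[OF sequentially_bot, symmetric])
    qed
    also have "\<dots> \<le> liminf (\<lambda>k. \<integral>\<^sup>+\<omega>. ?g k \<omega> \<partial>M)"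
      by (rule nn_integral_liminf) measurable
    also have "\<dots> \<le> liminf (\<lambda>k::nat. ennreal (C ^ n))"
    proof (rule Liminf_mono, rule always_eventually, rule allI)
      fix k
      have "?g k \<omega> = (\<Prod>r<n. ennreal (exp (t * Wk k (x + r) \<omega>)))" for \<omega>
      proof -
        have "(\<Sum>j\<in>{x..<x + n}. Wk k j \<omega>) = (\<Sum>r<n. Wk k (x + r) \<omega>)"
          using sum.shift_bounds_nat_ivl[of "\<lambda>j. Wk k j \<omega>" 0 x n] by (simp add: lessThan_atLeast0 add.commute)
        then show ?thesis by (simp add: sum_distrib_left exp_sum prod_ennreal)
      qed
      then have "(\<integral>\<^sup>+\<omega>. ?g k \<omega> \<partial>M) = (\<Prod>r<n. \<integral>\<^sup>+\<omega>. ennreal (exp (t * Wk k (x + r) \<omega>)) \<partial>M)"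
        using nn_integral_prod_Wk[OF t(1), where n=n and k=k and x=x] by simp
      also have "\<dots> \<le> (\<Prod>r<n. ennreal C)"
        using E by (intro prod_mono_ennreal)
      also have "\<dots> = ennreal (C ^ n)" using C by (simp add: ennreal_power)
      finally show "(\<integral>\<^sup>+\<omega>. ?g k \<omega> \<partial>M) \<le> ennreal (C ^ n)" .
    qed
    also have "\<dots> = ennreal (C ^ n)" by (rule Liminf_const) simp
    also have "C ^ n = exp (ln C * real n)" using C by (simp add: exp_of_nat2_mult)
    finally show ?thesis .
  qed
  then show ?thesis using C by (intro exI[of _ "ln C"]) auto
qed

end

section \<open>Centred increments and their polygons\<close>

locale levy_exp = levy +
  fixes \<theta> \<mu> :: real and \<Phi>\<^sub>c :: "real \<Rightarrow> ennreal"
  assumes \<theta>: "\<theta> > 0" "mgf M (Z 1) \<theta> < \<infinity>" "mgf M (Z 1) (- \<theta>) < \<infinity>"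
    and \<mu>: "\<mu> = (LINT \<omega>|M. Z 1 \<omega>)"
    and \<Phi>\<^sub>c: "\<Phi>\<^sub>c = mgf M (\<lambda>\<omega>. Z 1 \<omega> - \<mu>)"
begin

definition X :: "nat \<Rightarrow> 'a \<Rightarrow> real" where
  "X j \<omega> = Z (real j + 1) \<omega> - Z (real j) \<omega> - \<mu>"

lemma integrable_Z1: "integrable M (Z 1)"
proof (rule integrableI_bounded)
  have "(\<integral>\<^sup>+\<omega>. ennreal (norm (Z 1 \<omega>)) \<partial>M) \<le> (\<integral>\<^sup>+\<omega>. ennreal (1 / \<theta>) * (ennreal (exp (\<theta> * Z 1 \<omega>)) + ennreal (exp (- \<theta> * Z 1 \<omega>))) \<partial>M)"
  proof (rule nn_integral_mono)
    fix \<omega>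
    have "y \<le> exp y + exp (- y)" "- y \<le> exp y + exp (- y)" for y :: real
      using exp_ge_add_one_self[of y] exp_ge_add_one_self[of "- y"] exp_gt_zero[of y] exp_gt_zero[of "- y"] by linarith+
    from this[of "\<theta> * Z 1 \<omega>"] have "\<theta> * \<bar>Z 1 \<omega>\<bar> \<le> exp (\<theta> * Z 1 \<omega>) + exp (- \<theta> * Z 1 \<omega>)"
      by (cases "0 \<le> Z 1 \<omega>") simp_all
    then have "norm (Z 1 \<omega>) \<le> 1 / \<theta> * (exp (\<theta> * Z 1 \<omega>) + exp (- \<theta> * Z 1 \<omega>))" using \<theta>(1) by (simp add: field_simps)
    then have "ennreal (norm (Z 1 \<omega>)) \<le> ennreal (1 / \<theta> * (exp (\<theta> * Z 1 \<omega>) + exp (- \<theta> * Z 1 \<omega>)))" by (rule ennreal_leI)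
    also have "\<dots> = ennreal (1 / \<theta>) * (ennreal (exp (\<theta> * Z 1 \<omega>)) + ennreal (exp (- \<theta> * Z 1 \<omega>)))"
      using \<theta>(1) by (subst ennreal_mult) (simp_all add: add_nonneg_nonneg)
    finally show "ennreal (norm (Z 1 \<omega>)) \<le> ennreal (1 / \<theta>) * (ennreal (exp (\<theta> * Z 1 \<omega>)) + ennreal (exp (- \<theta> * Z 1 \<omega>)))" .
  qed
  also have "\<dots> = ennreal (1 / \<theta>) * (mgf M (Z 1) \<theta> + mgf M (Z 1) (- \<theta>))"
    unfolding mgf_def by (subst nn_integral_cmult) (auto simp: nn_integral_add)
  also have "\<dots> < \<infinity>" using \<theta> by (simp add: ennreal_mult_less_top)
  finally show "(\<integral>\<^sup>+\<omega>. ennreal (norm (Z 1 \<omega>)) \<partial>M) < \<infinity>" .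
qed simp

lemma X_indep: "indep_vars (\<lambda>_. borel) X UNIV"
proof -
  have m: "X j \<in> borel_measurable M" for j
  proof -
    have [measurable]: "Z (real j + 1) \<in> borel_measurable M" "Z (real j) \<in> borel_measurable M" by auto
    show ?thesis unfolding X_def[abs_def] by measurable
  qed
  have n: "indep_vars (\<lambda>_. borel) X {..<n}" for n
  proof -
    have "indep_vars (\<lambda>_. borel) (\<lambda>i \<omega>. Z (real (Suc i)) \<omega> - Z (real i) \<omega>) {..<n}"
      by (rule indep_increments[of real]) auto
    then have "indep_vars (\<lambda>_. borel) (\<lambda>i \<omega>. (\<lambda>y. y - \<mu>) (Z (real (Suc i)) \<omega> - Z (real i) \<omega>)) {..<n}"
      by (rule indep_vars_compose2) auto
    then show ?thesis by (simp add: X_def[abs_def] add.commute)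
  qed
  show ?thesis
    unfolding indep_vars_def2
  proof (intro conjI ballI m)
    show "indep_sets (\<lambda>i. {X i -` A \<inter> space M |A. A \<in> sets borel}) UNIV"
    proof (subst indep_sets_finite_index_sets, intro allI impI)
      fix J :: "nat set" assume J: "finite J"
      then obtain n where "J \<subseteq> {..<n}" using finite_nat_iff_bounded by blast
      then show "indep_sets (\<lambda>i. {X i -` A \<inter> space M |A. A \<in> sets borel}) J"
        using indep_vars_subset[OF n] unfolding indep_vars_def2 by blast
    qed
  qed
qed

lemma X_distr: "distr M borel (X j) = distr M borel (X 0)"
proof -
  have d: "distr M borel (X i) = distr (distr M borel (\<lambda>\<omega>. Z 1 \<omega> - Z 0 \<omega>)) borel (\<lambda>y. y - \<mu>)" for i
  proof -
    have [measurable]: "Z (real i + 1) \<in> borel_measurable M" "Z (real i) \<in> borel_measurable M" by auto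
    have "distr (distr M borel (\<lambda>\<omega>. Z 1 \<omega> - Z 0 \<omega>)) borel (\<lambda>y. y - \<mu>)
      = distr (distr M borel (\<lambda>\<omega>. Z (real i + 1) \<omega> - Z (real i) \<omega>)) borel (\<lambda>y. y - \<mu>)"
      by (subst stationary) auto
    also have "\<dots> = distr M borel (X i)"
      by (subst distr_distr) (auto simp: comp_def X_def[abs_def])
    finally show ?thesis by simp
  qed
  show ?thesis unfolding d[of j] d[of 0] ..
qed

lemma Phi_X: "\<Phi>\<^sub>c t = (\<integral>\<^sup>+\<omega>. ennreal (exp (t * X 0 \<omega>)) \<partial>M)"
  unfolding \<Phi>\<^sub>c mgf_def
  by (rule nn_integral_cong_AE, use Z_0 in eventually_elim) (simp add: X_def)

text \<open>Jensen's inequality, from \<open>exp y \<ge> 1 + y\<close> and mean 0.\<close>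

lemma Phi_ge_1: "1 \<le> \<Phi>\<^sub>c t"
proof (cases "\<Phi>\<^sub>c t < \<infinity>")
  case True
  have [measurable]: "Z 1 \<in> borel_measurable M" by simp
  have i: "integrable M (\<lambda>\<omega>. exp (t * (Z 1 \<omega> - \<mu>)))"
    by (rule integrableI_nonneg) (use True in \<open>auto simp: \<Phi>\<^sub>c mgf_def\<close>)
  have "1 = (\<integral>\<omega>. 1 + t * (Z 1 \<omega> - \<mu>) \<partial>M)"
    using integrable_Z1 by (simp add: \<mu> prob_space)
  also have "\<dots> \<le> (\<integral>\<omega>. exp (t * (Z 1 \<omega> - \<mu>)) \<partial>M)"
    by (rule integral_mono[OF _ i]) (use integrable_Z1 in \<open>auto simp: exp_ge_add_one_self\<close>)
  finally have "ennreal 1 \<le> ennreal (\<integral>\<omega>. exp (t * (Z 1 \<omega> - \<mu>)) \<partial>M)" by (rule ennreal_leI)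
  also have "\<dots> = \<Phi>\<^sub>c t"
    unfolding \<Phi>\<^sub>c mgf_def by (rule nn_integral_eq_integral[OF i, symmetric]) simp
  finally show ?thesis by simp
next
  case False
  then have "\<Phi>\<^sub>c t = top" using less_top[of "\<Phi>\<^sub>c t"] by auto
  then show ?thesis by simp
qed

sublocale walk M X \<Phi>\<^sub>c
  by unfold_locales (rule X_indep X_distr Phi_X Phi_ge_1)+

lemma Phi_c_finite: "mgf M (Z 1) t < \<infinity> \<Longrightarrow> \<Phi>\<^sub>c t < \<infinity>"
proof -
  assume t: "mgf M (Z 1) t < \<infinity>"
  have [measurable]: "Z 1 \<in> borel_measurable M" by simp
  have "\<Phi>\<^sub>c t = (\<integral>\<^sup>+\<omega>. ennreal (exp (- t * \<mu>)) * ennreal (exp (t * Z 1 \<omega>)) \<partial>M)"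
    unfolding \<Phi>\<^sub>c mgf_def by (intro nn_integral_cong) (simp add: algebra_simps flip: ennreal_mult exp_add)
  also have "\<dots> = ennreal (exp (- t * \<mu>)) * mgf M (Z 1) t"
    unfolding mgf_def by (rule nn_integral_cmult) measurable
  also have "\<dots> < \<infinity>" using t by (simp add: ennreal_mult_less_top)
  finally show ?thesis .
qed

definition Y :: "real \<Rightarrow> 'a \<Rightarrow> real" where
  "Y t \<omega> = Z t \<omega> - \<mu> * t"

definition V :: "nat \<Rightarrow> 'a \<Rightarrow> real" where
  "V j \<omega> = W j \<omega> + \<bar>\<mu>\<bar>"

lemma V_measurable [measurable]: "V j \<in> borel_measurable M"
  unfolding V_def[abs_def] by measurable

lemma V_nonneg: "\<omega> \<in> space M \<Longrightarrow> 0 \<le> V j \<omega>"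
  using W_nonneg[of \<omega> j] by (simp add: V_def)

lemma Y_le_V:
  assumes "\<omega> \<in> space M" "0 \<le> s" "s \<le> 1"
  shows "\<bar>Y (real j + s) \<omega> - Y (real j) \<omega>\<bar> \<le> V j \<omega>"
proof -
  have "\<bar>\<mu> * s\<bar> \<le> \<bar>\<mu>\<bar>" unfolding abs_mult using assms by (intro mult_left_le) auto
  then show ?thesis using Z_le_W[OF assms, of j] unfolding Y_def V_def by (simp add: algebra_simps)
qed

lemma Y_le_sum_V:
  assumes \<omega>: "\<omega> \<in> space M" and t: "real a \<le> t" "t < real b + 1"
  shows "\<bar>Y t \<omega> - Y (real a) \<omega>\<bar> \<le> (\<Sum>j\<in>{a..b}. V j \<omega>)"
proof -
  define l where "l = nat \<lfloor>t\<rfloor>"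
  have t0: "t \<ge> 0" using t(1) by (rule order_trans[rotated]) simp
  have l: "real l \<le> t" "t \<le> real l + 1" using t0 unfolding l_def by linarith+
  have al: "a \<le> l" "l \<le> b" using t unfolding l_def by linarith+
  have 1: "\<bar>Y t \<omega> - Y (real l) \<omega>\<bar> \<le> V l \<omega>"
    using Y_le_V[OF \<omega>, of "t - real l" l] l by simp
  have "\<bar>Y (real l) \<omega> - Y (real a) \<omega>\<bar> = \<bar>\<Sum>j\<in>{a..<l}. Y (real (Suc j)) \<omega> - Y (real j) \<omega>\<bar>"
    using sum_Suc_diff'[OF al(1), of "\<lambda>j. Y (real j) \<omega>"] by simp
  also have "\<dots> \<le> (\<Sum>j\<in>{a..<l}. \<bar>Y (real (Suc j)) \<omega> - Y (real j) \<omega>\<bar>)" by (rule sum_abs)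
  also have "\<dots> \<le> (\<Sum>j\<in>{a..<l}. V j \<omega>)"
    using Y_le_V[OF \<omega>, of 1] by (intro sum_mono) (simp add: add.commute)
  finally have "\<bar>Y t \<omega> - Y (real a) \<omega>\<bar> \<le> V l \<omega> + (\<Sum>j\<in>{a..<l}. V j \<omega>)" using 1 by linarith
  also have "\<dots> = (\<Sum>j\<in>{a..l}. V j \<omega>)" using al by (simp add: sum.last_plus)
  also have "\<dots> \<le> (\<Sum>j\<in>{a..b}. V j \<omega>)"
    by (rule sum_mono2) (use al V_nonneg[OF \<omega>] in auto)
  finally show ?thesis .
qed

lemma V_tail:
  assumes t: "0 < t" "t < s" "mgf M (Z 1) s < \<infinity>" "mgf M (Z 1) (- s) < \<infinity>"
  obtains q where "q \<ge> 0" "\<And>x n u. prob {\<omega>\<in>space M. (\<Sum>j\<in>{x..<x + n}. V j \<omega>) > u} \<le> exp (q * real n - t * u)"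
proof -
  obtain q where q: "q \<ge> 0" "\<And>x n. (\<integral>\<^sup>+\<omega>. ennreal (exp (t * (\<Sum>j\<in>{x..<x + n}. W j \<omega>))) \<partial>M) \<le> ennreal (exp (q * real n))"
    using W_moment[OF less_imp_le[OF t(1)] t(2,3,4)] by blast
  have "prob {\<omega>\<in>space M. (\<Sum>j\<in>{x..<x + n}. V j \<omega>) > u} \<le> exp ((q + t * \<bar>\<mu>\<bar>) * real n - t * u)" for x n u
  proof -
    let ?E = "{\<omega>\<in>space M. (\<Sum>j\<in>{x..<x + n}. V j \<omega>) > u}"
    have E: "?E \<in> events" by measurable
    let ?c = "exp (t * \<bar>\<mu>\<bar> * real n - t * u)"
    have "emeasure M ?E = (\<integral>\<^sup>+\<omega>. indicator ?E \<omega> \<partial>M)" by (rule nn_integral_indicator[OF E, symmetric])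
    also have "\<dots> \<le> (\<integral>\<^sup>+\<omega>. ennreal ?c * ennreal (exp (t * (\<Sum>j\<in>{x..<x + n}. W j \<omega>))) \<partial>M)"
    proof (rule nn_integral_mono)
      fix \<omega>
      show "indicator ?E \<omega> \<le> ennreal ?c * ennreal (exp (t * (\<Sum>j\<in>{x..<x + n}. W j \<omega>)))"
      proof (cases "\<omega> \<in> ?E")
        case True
        have "(\<Sum>j\<in>{x..<x + n}. V j \<omega>) = (\<Sum>j\<in>{x..<x + n}. W j \<omega>) + real n * \<bar>\<mu>\<bar>"
          by (simp add: V_def sum.distrib)
        with True have "u \<le> (\<Sum>j\<in>{x..<x + n}. W j \<omega>) + real n * \<bar>\<mu>\<bar>" by simp
        then have "t * u \<le> t * ((\<Sum>j\<in>{x..<x + n}. W j \<omega>) + real n * \<bar>\<mu>\<bar>)" using t(1) by (intro mult_left_mono) auto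
        then have "0 \<le> t * \<bar>\<mu>\<bar> * real n - t * u + t * (\<Sum>j\<in>{x..<x + n}. W j \<omega>)" by (simp add: algebra_simps)
        then have "1 \<le> ?c * exp (t * (\<Sum>j\<in>{x..<x + n}. W j \<omega>))" unfolding exp_add[symmetric] by simp
        then have "ennreal 1 \<le> ennreal (?c * exp (t * (\<Sum>j\<in>{x..<x + n}. W j \<omega>)))" by (rule ennreal_leI)
        also have "\<dots> = ennreal ?c * ennreal (exp (t * (\<Sum>j\<in>{x..<x + n}. W j \<omega>)))" by (rule ennreal_mult) simp_all
        finally show ?thesis using True by simp
      qed simp
    qed
    also have "\<dots> = ennreal ?c * (\<integral>\<^sup>+\<omega>. ennreal (exp (t * (\<Sum>j\<in>{x..<x + n}. W j \<omega>))) \<partial>M)"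
      by (rule nn_integral_cmult) measurable
    also have "\<dots> \<le> ennreal ?c * ennreal (exp (q * real n))" by (intro mult_left_mono q) simp
    also have "\<dots> = ennreal (?c * exp (q * real n))" by (rule ennreal_mult[symmetric]) simp_all
    also have "?c * exp (q * real n) = exp ((q + t * \<bar>\<mu>\<bar>) * real n - t * u)"
      unfolding exp_add[symmetric] by (simp add: algebra_simps)
    finally show ?thesis by (simp add: emeasure_eq_measure)
  qed
  then show ?thesis using that[of "q + t * \<bar>\<mu>\<bar>"] q(1) t(1) by simp
qed

definition H :: "nat \<Rightarrow> nat \<Rightarrow> 'a \<Rightarrow> real \<Rightarrow> real" where
  "H A x \<omega> s = eta Z (real x) (real A) \<omega> s - \<mu> * s"

lemma H_eq: "A > 0 \<Longrightarrow> H A x \<omega> s = (Y (real x + s * real A) \<omega> - Y (real x) \<omega>) / real A"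
  by (simp add: H_def eta_def Y_def field_simps)

lemma D_eq: "D m A x \<omega> i = (Y (real (x + Suc i * A div m)) \<omega> - Y (real (x + i * A div m)) \<omega>) / real A"
proof -
  have "X j \<omega> = Y (real (Suc j)) \<omega> - Y (real j) \<omega>" for j
    by (simp add: X_def Y_def algebra_simps)
  moreover have "x + i * A div m \<le> x + Suc i * A div m" using blk_mono[of i "Suc i" A m] by simp
  ultimately show ?thesis
    unfolding D_def blk_def using sum_Suc_diff'[of "x + i * A div m" "x + Suc i * A div m" "\<lambda>j. Y (real j) \<omega>"] by simp
qed

lemma D_sum: "(\<Sum>l<i. D m A x \<omega> l) = (Y (real (x + i * A div m)) \<omega> - Y (real x) \<omega>) / real A"
  unfolding D_eq sum_divide_distrib[symmetric]
  using sum_lessThan_telescope[of "\<lambda>i. Y (real (x + i * A div m)) \<omega>" i] by simp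

text \<open>The upper end is included because the time \<open>(i + 1) * A / m\<close> may exceed the
  integer cut point, by less than 1.\<close>

definition Bk :: "nat \<Rightarrow> nat \<Rightarrow> nat \<Rightarrow> nat \<Rightarrow> 'a \<Rightarrow> real" where
  "Bk m A x i \<omega> = (\<Sum>j\<in>{x + i * A div m..x + Suc i * A div m}. V j \<omega>)"

lemma Bk_nonneg: "\<omega> \<in> space M \<Longrightarrow> 0 \<le> Bk m A x i \<omega>"
  unfolding Bk_def by (intro sum_nonneg V_nonneg)

text \<open>Both functions are compared with the path at the left cut point of block i, to which the
  partial sums of D telescope.\<close>

lemma H_pl_close:
  assumes \<omega>: "\<omega> \<in> space M" and m: "m > 0" and A: "A > 0" and i: "i < m"
    and s: "real i \<le> real m * s" "real m * s \<le> real (Suc i)"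
  shows "\<bar>H A x \<omega> s - pl m (D m A x \<omega>) s\<bar> \<le> 2 * Bk m A x i \<omega> / real A"
proof -
  let ?D = "D m A x \<omega>" and ?a = "x + i * A div m" and ?b = "x + Suc i * A div m"
  have ab: "?a \<le> ?b" using blk_mono[of i "Suc i" A m] by simp
  have q: "real (k * A div m) \<le> real k * real A / real m" "real k * real A / real m < real (k * A div m) + 1" for k
  proof -
    have "real (k * A) = real m * real (k * A div m) + real (k * A mod m)"
      by (simp only: of_nat_mult[symmetric] of_nat_add[symmetric] mult_div_mod_eq)
    moreover have "real (k * A mod m) < real m" using m by simp
    ultimately show "real (k * A div m) \<le> real k * real A / real m" "real k * real A / real m < real (k * A div m) + 1"
      using m by (simp_all add: field_simps)
  qed
  have sA: "real i * real A / real m \<le> s * real A" "s * real A \<le> real (Suc i) * real A / real m"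
  proof -
    have "real i * real A \<le> real m * s * real A" "real m * s * real A \<le> real (Suc i) * real A"
      using s by (intro mult_right_mono; simp)+
    then show "real i * real A / real m \<le> s * real A" "s * real A \<le> real (Suc i) * real A / real m"
      using m by (simp_all add: pos_divide_le_eq pos_le_divide_eq mult_ac)
  qed
  have 1: "\<bar>Y (real x + s * real A) \<omega> - Y (real ?a) \<omega>\<bar> \<le> Bk m A x i \<omega>"
    unfolding Bk_def
  proof (rule Y_le_sum_V[OF \<omega>])
    show "real ?a \<le> real x + s * real A" using q(1)[of i] sA(1) by simp
    have "s * real A < real (Suc i * A div m) + 1" using q(2)[of "Suc i"] sA(2) by linarith
    then show "real x + s * real A < real ?b + 1" by simp
  qed
  have 2: "\<bar>Y (real ?b) \<omega> - Y (real ?a) \<omega>\<bar> \<le> Bk m A x i \<omega>"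
    unfolding Bk_def by (rule Y_le_sum_V[OF \<omega>]) (use ab in auto)
  have "pl m ?D s = (\<Sum>l<i. ?D l) + ?D i * (real m * s - real i)" by (rule pl_cell[OF i s])
  then have eq: "H A x \<omega> s - pl m ?D s = (Y (real x + s * real A) \<omega> - Y (real ?a) \<omega>) / real A - ?D i * (real m * s - real i)"
    unfolding D_sum using A by (simp add: H_eq diff_divide_distrib)
  have "\<bar>?D i * (real m * s - real i)\<bar> \<le> \<bar>?D i\<bar>" unfolding abs_mult using s by (intro mult_left_le) auto
  also have "\<bar>?D i\<bar> = \<bar>Y (real ?b) \<omega> - Y (real ?a) \<omega>\<bar> / real A" unfolding D_eq by simp
  also have "\<dots> \<le> Bk m A x i \<omega> / real A" by (intro divide_right_mono 2) simp
  finally have 3: "\<bar>?D i * (real m * s - real i)\<bar> \<le> Bk m A x i \<omega> / real A" .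
  have "\<bar>(Y (real x + s * real A) \<omega> - Y (real ?a) \<omega>) / real A\<bar> \<le> Bk m A x i \<omega> / real A"
    using divide_right_mono[OF 1, of "real A"] by simp
  moreover have "2 * Bk m A x i \<omega> / real A = Bk m A x i \<omega> / real A + Bk m A x i \<omega> / real A" by simp
  ultimately show ?thesis unfolding eq using 3 by linarith
qed

lemma H_1: "A > 0 \<Longrightarrow> m > 0 \<Longrightarrow> H A x \<omega> 1 = pl m (D m A x \<omega>) 1"
  by (simp add: pl_1 D_sum H_eq)

end

lemma ex_closed_cell:
  assumes m: "m > 0" and s: "0 \<le> s" "s \<le> 1"
  obtains i where "i < m" "real i \<le> real m * s" "real m * s \<le> real (Suc i)"
proof (cases "s = 1")
  case True
  then show ?thesis using m by (intro that[of "m - 1"]) auto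
next
  case False
  then show ?thesis using ex_cell[OF m s(1)] s(2) that by (metis less_eq_real_def)
qed

context levy_exp
begin

text \<open>With all moments finite the exponent t can be taken so large that an oscillation of
  \<open>\<epsilon> * A / 2\<close> in one block is as rare as required. A union bound over the m
  blocks then suffices.\<close>

lemma close_unif:
  assumes all: "\<And>t. mgf M (Z 1) t < \<infinity>" and R: "R \<ge> 0" and \<epsilon>: "\<epsilon> > 0"
  shows "\<forall>\<^sub>F m in sequentially. \<forall>\<^sub>F A in sequentially. \<forall>x. \<exists>F\<in>events.
      prob F \<le> exp (- real A * R) \<and> (\<forall>\<omega>\<in>space M - F. d_unif (H A x \<omega>) (pl m (D m A x \<omega>)) \<le> \<epsilon>)"
proof -
  \<comment> \<open>Gives \<open>t * (\<epsilon> * A / 2) = (R + 2) * A\<close>. One A pays for the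
    moment factor \<open>q * A / m\<close>, as \<open>m > q\<close>; the other pays for the union
    bound and the constants.\<close>
  define t where "t = 2 * (R + 2) / \<epsilon>"
  have t: "0 < t" "t < t + 1" using R \<epsilon> by (auto simp: t_def)
  obtain q where q: "q \<ge> 0" "\<And>x n u. prob {\<omega>\<in>space M. (\<Sum>j\<in>{x..<x + n}. V j \<omega>) > u} \<le> exp (q * real n - t * u)"
    using V_tail[OF t all all] by blast
  have "\<forall>\<^sub>F m::nat in sequentially. real m > q" using filterlim_real_sequentially by (simp add: filterlim_at_top_dense)
  then show ?thesis
    using eventually_gt_at_top[of 0]
  proof eventually_elim
    case (elim m)
    have "\<forall>\<^sub>F A::nat in sequentially. real A > ln (real m) + 2 * q" using filterlim_real_sequentially by (simp add: filterlim_at_top_dense)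
    then show ?case
      using eventually_gt_at_top[of 0]
    proof eventually_elim
      case (elim A)
      show ?case
      proof
        fix x
        define Fi where "Fi i = {\<omega>\<in>space M. Bk m A x i \<omega> > \<epsilon> * real A / 2}" for i
        define F where "F = (\<Union>i<m. Fi i)"
        have Fi: "Fi i \<in> events" for i unfolding Fi_def Bk_def by measurable
        then have F: "F \<in> events" unfolding F_def by auto
        have pi: "prob (Fi i) \<le> exp (2 * q - real A) * exp (- real A * R)" for i
        proof -
          define n where "n = Suc (Suc i * A div m) - i * A div m"
          have le: "i * A div m \<le> Suc i * A div m" using blk_mono[of i "Suc i" A m] by simp
          then have iv: "{x + i * A div m..x + Suc i * A div m} = {x + i * A div m..<x + i * A div m + n}"
            unfolding n_def by auto
          have "real n \<le> real A / real m + 2"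
            using card_blk[OF \<open>m > 0\<close>, of A x i] le unfolding blk_def n_def by simp
          then have "q * real n \<le> q * (real A / real m + 2)" by (rule mult_left_mono[OF _ q(1)])
          also have "\<dots> \<le> real A + 2 * q"
          proof -
            have "q * real A \<le> real m * real A" using \<open>real m > q\<close> by (intro mult_right_mono) auto
            then show ?thesis using \<open>m > 0\<close> by (simp add: field_simps)
          qed
          finally have "q * real n \<le> real A + 2 * q" .
          then have "q * real n - t * (\<epsilon> * real A / 2) \<le> 2 * q - real A - real A * R"
          proof -
            have "t * (\<epsilon> * real A / 2) = (R + 2) * real A" using \<epsilon> by (simp add: t_def)
            also have "\<dots> = real A * R + 2 * real A" by (simp add: algebra_simps)
            finally show ?thesis using \<open>q * real n \<le> real A + 2 * q\<close> by linarith
          qed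
          then have "exp (q * real n - t * (\<epsilon> * real A / 2)) \<le> exp (2 * q - real A) * exp (- real A * R)"
            by (simp flip: exp_add)
          then show ?thesis using q(2)[of "\<epsilon> * real A / 2" "x + i * A div m" n] unfolding Fi_def Bk_def iv by linarith
        qed
        have "prob F \<le> (\<Sum>i<m. prob (Fi i))" unfolding F_def by (rule finite_measure_subadditive_finite) (use Fi in auto)
        also have "\<dots> \<le> (\<Sum>i<m. exp (2 * q - real A) * exp (- real A * R))" by (intro sum_mono pi)
        also have "\<dots> = exp (ln (real m) + 2 * q - real A) * exp (- real A * R)"
          using \<open>m > 0\<close> by (simp add: exp_add exp_diff)
        also have "\<dots> \<le> 1 * exp (- real A * R)" using elim by (intro mult_right_mono) auto
        finally have p: "prob F \<le> exp (- real A * R)" by simp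
        show "\<exists>F\<in>events. prob F \<le> exp (- real A * R) \<and> (\<forall>\<omega>\<in>space M - F. d_unif (H A x \<omega>) (pl m (D m A x \<omega>)) \<le> \<epsilon>)"
        proof (intro bexI[OF _ F] conjI ballI p)
          fix \<omega> assume \<omega>: "\<omega> \<in> space M - F"
          show "d_unif (H A x \<omega>) (pl m (D m A x \<omega>)) \<le> \<epsilon>"
            unfolding d_unif_def
          proof (rule cSUP_least)
            fix s :: real assume s: "s \<in> {0..1}"
            obtain i where i: "i < m" "real i \<le> real m * s" "real m * s \<le> real (Suc i)"
              by (rule ex_closed_cell[OF \<open>m > 0\<close>, of s]) (use s in auto)
            have "Bk m A x i \<omega> \<le> \<epsilon> * real A / 2" using \<omega> i(1) by (auto simp: F_def Fi_def not_less)
            then have "2 * Bk m A x i \<omega> / real A \<le> \<epsilon>" using \<open>A > 0\<close> by (simp add: field_simps)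
            with H_pl_close[OF _ \<open>m > 0\<close> \<open>A > 0\<close> i, of \<omega> x] \<omega>
            show "\<bar>H A x \<omega> s - pl m (D m A x \<omega>) s\<bar> \<le> \<epsilon>" by auto
          qed simp
        qed
      qed
    qed
  qed
qed

text \<open>Neighbouring blocks share a cut point, so the cut points are counted once more on top of
  the full sum. They are distinct because \<open>m \<le> A\<close>.\<close>

lemma sum_Bk_le:
  assumes \<omega>: "\<omega> \<in> space M" and m: "m > 0" and A: "m \<le> A"
  shows "(\<Sum>i<m. Bk m A x i \<omega>) \<le> 2 * (\<Sum>j\<in>{x..<x + (A + 1)}. V j \<omega>)"
proof -
  define b where "b i = x + i * A div m" for i
  have b_less: "b i < b (Suc i)" for i
  proof -
    have "i * A div m + 1 = (i * A + m) div m" using m by simp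
    also have "\<dots> \<le> Suc i * A div m" using A by (intro div_le_mono) simp
    finally show ?thesis by (simp add: b_def)
  qed
  then have mono: "strict_mono b" by (simp add: strict_mono_Suc_iff)
  have b0: "b 0 = x" "b m = x + A" using m by (simp_all add: b_def)
  have V: "V j \<omega> \<ge> 0" for j by (rule V_nonneg[OF \<omega>])
  have B: "Bk m A x i \<omega> = (\<Sum>j\<in>{b i..<b (Suc i)}. V j \<omega>) + V (b (Suc i)) \<omega>" for i
    using b_less[of i] unfolding Bk_def b_def[symmetric] by (simp add: sum.last_plus add.commute)
  have "(\<Sum>i<k. \<Sum>j\<in>{b i..<b (Suc i)}. V j \<omega>) = (\<Sum>j\<in>{b 0..<b k}. V j \<omega>)" for k
  proof (induction k)
    case (Suc k)
    have "b 0 \<le> b k" "b k \<le> b (Suc k)" using mono by (auto simp: strict_mono_less_eq)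
    then show ?case using Suc by (simp add: sum.atLeastLessThan_concat)
  qed simp
  then have 1: "(\<Sum>i<m. \<Sum>j\<in>{b i..<b (Suc i)}. V j \<omega>) \<le> (\<Sum>j\<in>{x..<x + (A + 1)}. V j \<omega>)"
    unfolding b0[symmetric] using b0 V by (auto intro!: sum_mono2)
  have "(\<Sum>i<m. V (b (Suc i)) \<omega>) = (\<Sum>j\<in>(\<lambda>i. b (Suc i)) ` {..<m}. V j \<omega>)"
    using strict_mono_eq[OF mono] by (subst sum.reindex) (auto simp: inj_on_def)
  also have "\<dots> \<le> (\<Sum>j\<in>{x..<x + (A + 1)}. V j \<omega>)"
  proof (rule sum_mono2)
    have "x \<le> b (Suc i)" "b (Suc i) \<le> x + A" if "i < m" for i
      using strict_mono_less_eq[OF mono, of 0 "Suc i"] strict_mono_less_eq[OF mono, of "Suc i" m] b0 that by auto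
    then show "(\<lambda>i. b (Suc i)) ` {..<m} \<subseteq> {x..<x + (A + 1)}" by fastforce
  qed (use V in auto)
  finally show ?thesis using 1 unfolding B sum.distrib by linarith
qed

text \<open>Only the fixed exponent \<open>\<theta> / 2\<close> is at hand. The integral is at most
  \<open>4 / (A * m)\<close> times the sum of V over the window, so it is enough that this sum stays
  below \<open>\<epsilon> * m * A / 4\<close>; for large m the contrary is as rare as
  required.\<close>

lemma close_hyb:
  assumes R: "R \<ge> 0" and \<epsilon>: "\<epsilon> > 0"
  shows "\<forall>\<^sub>F m in sequentially. \<forall>\<^sub>F A in sequentially. \<forall>x. \<exists>F\<in>events.
      prob F \<le> exp (- real A * R) \<and> (\<forall>\<omega>\<in>space M - F. d_hyb (H A x \<omega>) (pl m (D m A x \<omega>)) \<le> \<epsilon>)"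
proof -
  have t: "0 < \<theta> / 2" "\<theta> / 2 < \<theta>" using \<theta> by auto
  obtain q where q: "q \<ge> 0" "\<And>x n u. prob {\<omega>\<in>space M. (\<Sum>j\<in>{x..<x + n}. V j \<omega>) > u} \<le> exp (q * real n - \<theta> / 2 * u)"
    using V_tail[OF t \<theta>(2,3)] by blast
  have "\<forall>\<^sub>F m::nat in sequentially. real m > 8 * (R + 2 * q) / (\<theta> * \<epsilon>)"
    using filterlim_real_sequentially by (simp add: filterlim_at_top_dense)
  then show ?thesis
    using eventually_gt_at_top[of 0]
  proof eventually_elim
    case (elim m)
    then have "8 * (R + 2 * q) < real m * (\<theta> * \<epsilon>)" using \<theta> \<epsilon> by (simp add: pos_divide_less_eq)
    then have mR: "R + 2 * q \<le> \<theta> * \<epsilon> * real m / 8" by (simp add: mult_ac)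
    show ?case
      using eventually_ge_at_top[of m]
    proof eventually_elim
      case (elim A)
      have A: "A > 0" using elim \<open>m > 0\<close> by simp
      show ?case
      proof
        fix x
        define F where "F = {\<omega>\<in>space M. (\<Sum>j\<in>{x..<x + (A + 1)}. V j \<omega>) > \<epsilon> * real m * real A / 4}"
        have F: "F \<in> events" unfolding F_def by measurable
        have "prob F \<le> exp (q * real (A + 1) - \<theta> / 2 * (\<epsilon> * real m * real A / 4))"
          unfolding F_def by (rule q(2))
        also have "\<dots> \<le> exp (- real A * R)"
        proof -
          have "q * real (A + 1) \<le> q * (2 * real A)" using A q(1) by (intro mult_left_mono) auto
          moreover have "real A * (R + 2 * q) \<le> real A * (\<theta> * \<epsilon> * real m / 8)" by (intro mult_left_mono mR) simp
          moreover have "real A * (\<theta> * \<epsilon> * real m / 8) = \<theta> / 2 * (\<epsilon> * real m * real A / 4)" by simp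
          ultimately have "q * real (A + 1) - \<theta> / 2 * (\<epsilon> * real m * real A / 4) \<le> - real A * R"
            by (simp add: algebra_simps)
          then show ?thesis by simp
        qed
        finally have p: "prob F \<le> exp (- real A * R)" .
        show "\<exists>F\<in>events. prob F \<le> exp (- real A * R) \<and> (\<forall>\<omega>\<in>space M - F. d_hyb (H A x \<omega>) (pl m (D m A x \<omega>)) \<le> \<epsilon>)"
        proof (intro bexI[OF _ F] conjI ballI p)
          fix \<omega> assume \<omega>: "\<omega> \<in> space M - F"
          then have \<omega>M: "\<omega> \<in> space M" by simp
          let ?f = "\<lambda>u. \<bar>H A x \<omega> u - pl m (D m A x \<omega>) u\<bar>"
          let ?c = "\<lambda>i. 2 * Bk m A x i \<omega> / real A"
          define I where "I i = {real i / real m..real (Suc i) / real m}" for i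
          have I: "integrable lborel (indicator (I i) :: real \<Rightarrow> real)" "measure lborel (I i) = 1 / real m" for i
          proof -
            have "real i / real m \<le> real (Suc i) / real m" by (intro divide_right_mono) auto
            then show "measure lborel (I i) = 1 / real m" by (simp add: I_def diff_divide_distrib[symmetric])
            show "integrable lborel (indicator (I i) :: real \<Rightarrow> real)" unfolding I_def
              by (rule integrable_real_indicator) (simp_all add: emeasure_lborel_Icc_eq)
          qed
          define g where "g u = (\<Sum>i<m. ?c i * indicator (I i) u)" for u :: real
          have c: "?c i \<ge> 0" for i using Bk_nonneg[OF \<omega>M] by simp
          have "(LBINT u:{0..1}. ?f u) \<le> (LBINT u. g u)"
            unfolding set_lebesgue_integral_def
          proof (rule Bochner_Integration.integral_mono')
            show "integrable lborel g"
              unfolding g_def by (intro Bochner_Integration.integrable_sum integrable_mult_right I)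
            fix u :: real
            show "0 \<le> g u" unfolding g_def by (intro sum_nonneg mult_nonneg_nonneg c) simp
            show "indicat_real {0..1} u *\<^sub>R ?f u \<le> g u"
            proof (cases "u \<in> {0..1}")
              case True
              obtain i where i: "i < m" "real i \<le> real m * u" "real m * u \<le> real (Suc i)"
                by (rule ex_closed_cell[OF \<open>m > 0\<close>, of u]) (use True in auto)
              have "?f u \<le> ?c i" by (rule H_pl_close[OF \<omega>M \<open>m > 0\<close> A i])
              also have "\<dots> = ?c i * indicator (I i) u"
                using i \<open>m > 0\<close> by (simp add: I_def field_simps)
              also have "\<dots> \<le> g u"
                unfolding g_def by (rule member_le_sum) (use i in \<open>auto intro!: mult_nonneg_nonneg c simp del: times_divide_eq_left\<close>)
              finally show ?thesis using True by simp
            qed (use \<open>0 \<le> g u\<close> in simp)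
          qed
          also have "(LBINT u. g u) = (\<Sum>i<m. ?c i * (1 / real m))"
            unfolding g_def by (subst Bochner_Integration.integral_sum) (simp_all add: I del: times_divide_eq_left)
          also have "\<dots> = 2 / (real A * real m) * (\<Sum>i<m. Bk m A x i \<omega>)"
            by (simp add: sum_distrib_left)
          also have "\<dots> \<le> 2 / (real A * real m) * (2 * (\<Sum>j\<in>{x..<x + (A + 1)}. V j \<omega>))"
            by (intro mult_left_mono sum_Bk_le \<omega>M \<open>m > 0\<close> elim) simp
          also have "\<dots> \<le> 2 / (real A * real m) * (2 * (\<epsilon> * real m * real A / 4))"
            using \<omega> by (intro mult_left_mono) (auto simp: F_def)
          also have "\<dots> = \<epsilon>" using A \<open>m > 0\<close> by simp
          finally show "d_hyb (H A x \<omega>) (pl m (D m A x \<omega>)) \<le> \<epsilon>"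
            unfolding d_hyb_def using H_1[OF A \<open>m > 0\<close>] by simp
        qed
      qed
    qed
  qed
qed

end

subsection \<open>Bounded variation of the paths\<close>

lemma one_minus_cos_le: "1 - cos y \<le> 2 * min 1 (y\<^sup>2)" for y :: real
proof -
  have "(sin (y / 2))\<^sup>2 \<le> (y / 2)\<^sup>2"
    using abs_sin_x_le_abs_x[of "y / 2"] by (simp only: abs_le_square_iff)
  then have "1 - cos y \<le> 2 * (y / 2)\<^sup>2" using cos_double_sin[of "y / 2"] by simp
  also have "\<dots> \<le> 2 * y\<^sup>2" by (simp add: power2_eq_square)
  finally show ?thesis by (simp add: min_def)
qed

text \<open>The bound \<open>b(r)\<close> on the right satisfies \<open>min 1 r\<^sup>2 + b(2 r) / 2 \<le> b(r)\<close>.\<close>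

lemma dyadic_kernel_le:
  fixes r :: real
  assumes "r \<ge> 0"
  shows "(\<Sum>j<n. min 1 ((2 ^ j * r)\<^sup>2) / 2 ^ j) \<le> (if r \<le> 1 then 4 * r - 2 * r\<^sup>2 else 2)"
  using assms
proof (induction n arbitrary: r)
  case 0
  then have "r * r \<le> r * 1" if "r \<le> 1" using that by (intro mult_left_mono) auto
  then show ?case using 0 by (auto simp: power2_eq_square)
next
  case (Suc n)
  have "(\<Sum>j<Suc n. min 1 ((2 ^ j * r)\<^sup>2) / 2 ^ j) = min 1 (r\<^sup>2) + (\<Sum>j<n. min 1 ((2 ^ j * (2 * r))\<^sup>2) / 2 ^ j) / 2"
    by (subst sum.lessThan_Suc_shift) (simp add: sum_divide_distrib mult_ac)
  also have "\<dots> \<le> min 1 (r\<^sup>2) + (if 2 * r \<le> 1 then 4 * (2 * r) - 2 * (2 * r)\<^sup>2 else 2) / 2"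
    using Suc.IH[of "2 * r"] Suc.prems by simp
  also have "\<dots> \<le> (if r \<le> 1 then 4 * r - 2 * r\<^sup>2 else 2)"
  proof -
    consider "2 * r \<le> 1" | "1 < 2 * r" "r \<le> 1" | "r > 1" by linarith
    then show ?thesis
    proof cases
      case 1
      have "min 1 (r\<^sup>2) \<le> r\<^sup>2" "0 \<le> r\<^sup>2" by simp_all
      moreover have "(4 * (2 * r) - 2 * (2 * r)\<^sup>2) / 2 = 4 * r - 4 * r\<^sup>2" by (simp add: power_mult_distrib)
      ultimately have "min 1 (r\<^sup>2) + (4 * (2 * r) - 2 * (2 * r)\<^sup>2) / 2 \<le> 4 * r - 2 * r\<^sup>2" by linarith
      then show ?thesis using 1 by simp
    next
      case 2
      \<comment> \<open>In the middle range the recursion for b reduces to this product; it is 0 at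
        \<open>r = 1\<close>.\<close>
      have "0 \<le> (3 * r - 1) * (1 - r)" using 2 by simp
      then have "r\<^sup>2 + 1 \<le> 4 * r - 2 * r\<^sup>2" by (simp add: algebra_simps power2_eq_square)
      moreover have "min 1 (r\<^sup>2) \<le> r\<^sup>2" by simp
      ultimately show ?thesis using 2 by simp
    next
      case 3
      then show ?thesis by simp
    qed
  qed
  finally show ?case .
qed

lemma dyadic_kernel_le': "(\<Sum>j<n. min 1 ((2 ^ j * r)\<^sup>2) / 2 ^ j) \<le> 4 * (if \<bar>r\<bar> \<le> 1 then \<bar>r\<bar> else 1)" for r :: real
proof -
  have "(\<Sum>j<n. min 1 ((2 ^ j * r)\<^sup>2) / 2 ^ j) = (\<Sum>j<n. min 1 ((2 ^ j * \<bar>r\<bar>)\<^sup>2) / 2 ^ j)"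
    by (simp add: power_mult_distrib)
  also have "\<dots> \<le> (if \<bar>r\<bar> \<le> 1 then 4 * \<bar>r\<bar> - 2 * \<bar>r\<bar>\<^sup>2 else 2)" by (rule dyadic_kernel_le) simp
  also have "\<dots> \<le> 4 * (if \<bar>r\<bar> \<le> 1 then \<bar>r\<bar> else 1)" by simp
  finally show ?thesis .
qed

text \<open>j is chosen with \<open>2 ^ j * \<bar>y\<bar>\<close> between 1 and 2, where the cosine
  is at most cos 1.\<close>

lemma dyadic_kernel_ge:
  fixes y :: real
  assumes y: "\<bar>y\<bar> \<le> 1" "y \<noteq> 0"
  obtains j :: nat where "(1 - cos 1) / 2 * \<bar>y\<bar> \<le> (1 - cos (2 ^ j * y)) / 2 ^ j"
proof -
  define j where "j = (LEAST j::nat. 1 \<le> 2 ^ j * \<bar>y\<bar>)"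
  obtain k :: nat where "1 / \<bar>y\<bar> < 2 ^ k" using real_arch_pow[of 2 "1 / \<bar>y\<bar>"] by auto
  then have "1 \<le> 2 ^ k * \<bar>y\<bar>" using y by (simp add: field_simps)
  then have j: "1 \<le> 2 ^ j * \<bar>y\<bar>" unfolding j_def by (rule LeastI)
  have j2: "2 ^ j * \<bar>y\<bar> \<le> 2"
  proof (cases j)
    case (Suc i)
    then have "\<not> 1 \<le> 2 ^ i * \<bar>y\<bar>" using not_less_Least[of i "\<lambda>j. 1 \<le> 2 ^ j * \<bar>y\<bar>"] unfolding j_def by simp
    then show ?thesis using Suc by simp
  qed (use y in simp)
  have "cos (2 ^ j * y) = cos (2 ^ j * \<bar>y\<bar>)" by (cases "y \<ge> 0") auto
  also have "\<dots> \<le> cos 1" using j j2 pi_gt3 by (intro cos_monotone_0_pi_le) auto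
  finally have c: "1 - cos 1 \<le> 1 - cos (2 ^ j * y)" by simp
  have "\<bar>y\<bar> / 2 \<le> 1 / 2 ^ j" using j2 by (simp add: field_simps)
  then have "(1 - cos 1) * (\<bar>y\<bar> / 2) \<le> (1 - cos (2 ^ j * y)) * (1 / 2 ^ j)"
    using c by (intro mult_mono) auto
  then show ?thesis using that by simp
qed

text \<open>A continuous function with finite range on a connected set is constant.\<close>

lemma continuous_root_constant:
  fixes r :: "real \<Rightarrow> complex"
  assumes "continuous_on UNIV r" "\<And>u. r u ^ N = 1" "N > 0" "r 0 = 1"
  shows "r u = 1"
proof -
  have "finite (range r)"
    by (rule finite_subset[OF _ finite_roots_unity[of N]]) (use assms in auto)
  then have "r constant_on UNIV" by (intro continuous_finite_range_constant assms) auto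
  then obtain y where "\<And>v. r v = y" unfolding constant_on_def by blast
  from this[of u] this[of 0] assms(4) show ?thesis by simp
qed

context levy
begin

text \<open>The quotient of the two sides is continuous in u and takes values in the N-th roots of unity.\<close>

lemma char_dyadic:
  assumes \<psi>: "continuous_on UNIV \<psi>" "\<psi> 0 = 0" "\<And>u. char (distr M borel (Z 1)) u = exp (\<psi> u)" and N: "N > 0"
  shows "char (distr M borel (\<lambda>\<omega>. Z (1 / real N) \<omega> - Z 0 \<omega>)) u = exp (\<psi> u / of_nat N)"
proof -
  define \<phi> where "\<phi> = char (distr M borel (\<lambda>\<omega>. Z (1 / real N) \<omega> - Z 0 \<omega>))"
  have [measurable]: "Z 0 \<in> borel_measurable M" "Z 1 \<in> borel_measurable M" "Z (1 / real N) \<in> borel_measurable M" by auto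
  interpret d: real_distribution "distr M borel (\<lambda>\<omega>. Z (1 / real N) \<omega> - Z 0 \<omega>)"
    by (rule real_distribution_distr) measurable
  have pw: "\<phi> u ^ N = exp (\<psi> u)" for u
  proof -
    define I where "I i \<omega> = Z (real (Suc i) / real N) \<omega> - Z (real i / real N) \<omega>" for i \<omega>
    have ind: "indep_vars (\<lambda>_. borel) I {..<N}"
      unfolding I_def by (rule indep_increments) (use N in \<open>auto simp: divide_strict_right_mono\<close>)
    have I: "distr M borel (I i) = distr M borel (\<lambda>\<omega>. Z (1 / real N) \<omega> - Z 0 \<omega>)" for i
    proof -
      have "I i = (\<lambda>\<omega>. Z (real i / real N + 1 / real N) \<omega> - Z (real i / real N) \<omega>)"
        unfolding I_def by (simp add: add_divide_distrib add.commute)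
      then show ?thesis by (simp only:) (rule stationary, auto)
    qed
    have S: "(\<Sum>i<N. I i \<omega>) = Z 1 \<omega> - Z 0 \<omega>" for \<omega>
      using telescope_grid[OF N, of 0 0 \<omega> N] N by (simp add: I_def)
    have "\<phi> u ^ N = (\<Prod>i<N. char (distr M borel (I i)) u)" unfolding I \<phi>_def by simp
    also have "\<dots> = char (distr M borel (\<lambda>\<omega>. Z 1 \<omega> - Z 0 \<omega>)) u"
      unfolding char_distr_sum[OF ind, symmetric] S ..
    also have "distr M borel (\<lambda>\<omega>. Z 1 \<omega> - Z 0 \<omega>) = distr M borel (Z 1)"
      by (rule distr_cong_AE) (use Z_0 in auto)
    finally show ?thesis using \<psi>(3) by simp
  qed
  have c: "continuous_on UNIV \<phi>"
    unfolding \<phi>_def by (intro continuous_at_imp_continuous_on ballI d.isCont_char)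
  define r where "r u = \<phi> u * exp (- \<psi> u / of_nat N)" for u
  have "r u = 1"
  proof (rule continuous_root_constant[OF _ _ N])
    show "continuous_on UNIV r"
      unfolding r_def using N
      by (intro continuous_intros \<psi>(1) c) auto
    show "r u ^ N = 1" for u
      using N by (simp add: r_def power_mult_distrib pw flip: exp_of_nat_mult exp_add)
    show "r 0 = 1" using \<psi>(2) d.char_zero by (simp add: r_def \<phi>_def)
  qed
  then have "\<phi> u * exp (- \<psi> u / of_nat N) * exp (\<psi> u / of_nat N) = exp (\<psi> u / of_nat N)" by (simp add: r_def)
  then show ?thesis unfolding \<phi>_def by (simp add: mult.assoc flip: exp_add)
qed

end

text \<open>Separates the loss of modulus from the rotation.\<close>

lemma one_minus_Re_exp_le:
  assumes "Re z \<le> 0"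
  shows "1 - Re (exp z) \<le> - Re z + (1 - cos (Im z))"
proof -
  have "1 - exp (Re z) \<le> - Re z" using exp_ge_add_one_self[of "Re z"] by linarith
  moreover have "exp (Re z) * (1 - cos (Im z)) \<le> 1 * (1 - cos (Im z))"
    using assms by (intro mult_right_mono) auto
  ultimately have "(1 - exp (Re z)) + exp (Re z) * (1 - cos (Im z)) \<le> - Re z + 1 * (1 - cos (Im z))" by (rule add_mono)
  then show ?thesis by (simp add: Re_exp right_diff_distrib)
qed

section \<open>Levy--Khintchine exponents with integrable small jumps\<close>

locale bv_triplet =
  fixes \<nu> :: "real measure"
  assumes \<nu>: "levy_measure \<nu>" "(\<integral>\<^sup>+x\<in>{-1..1}. ennreal \<bar>x\<bar> \<partial>\<nu>) < \<infinity>"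
begin

lemma sets_\<nu> [measurable_cong, simp]: "sets \<nu> = sets borel"
  using \<nu> by (simp add: levy_measure_def)

definition w :: "real \<Rightarrow> real" where "w x = (if \<bar>x\<bar> \<le> 1 then \<bar>x\<bar> else 1)"

lemma w_measurable [measurable]: "w \<in> borel_measurable borel"
  unfolding w_def[abs_def] by measurable

lemma w_nonneg: "0 \<le> w x" by (simp add: w_def)

text \<open>w is the minimum of \<bar>x\<bar> and 1: the assumption of the locale covers the small
  jumps, the defining property of a Levy measure the large ones.\<close>

lemma integrable_w: "integrable \<nu> w"
proof (rule integrableI_nonneg)
  have "(\<integral>\<^sup>+x. ennreal (w x) \<partial>\<nu>) \<le> (\<integral>\<^sup>+x. ennreal \<bar>x\<bar> * indicator {-1..1} x + ennreal (min (x\<^sup>2) 1) \<partial>\<nu>)"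
  proof (rule nn_integral_mono)
    fix x :: real
    have "1 \<le> x\<^sup>2" if "\<not> \<bar>x\<bar> \<le> 1" using that abs_le_square_iff[of 1 x] by simp
    then show "ennreal (w x) \<le> ennreal \<bar>x\<bar> * indicator {-1..1} x + ennreal (min (x\<^sup>2) 1)"
      by (cases "\<bar>x\<bar> \<le> 1") (auto simp: w_def indicator_def abs_le_iff)
  qed
  also have "\<dots> = (\<integral>\<^sup>+x\<in>{-1..1}. ennreal \<bar>x\<bar> \<partial>\<nu>) + (\<integral>\<^sup>+x. ennreal (min (x\<^sup>2) 1) \<partial>\<nu>)"
    by (rule nn_integral_add) measurable
  also have "\<dots> < \<infinity>" using \<nu> by (simp add: levy_measure_def)
  finally show "(\<integral>\<^sup>+x. ennreal (w x) \<partial>\<nu>) < \<infinity>" .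
qed (auto simp: w_nonneg)

text \<open>The integrand of the Levy--Khintchine exponent.\<close>

definition g :: "real \<Rightarrow> real \<Rightarrow> complex" where
  "g u x = iexp (u * x) - 1 - \<i> * complex_of_real (u * x * indicator {-1..1} x)"

lemma g_measurable [measurable]: "g u \<in> borel_measurable borel"
  unfolding g_def[abs_def] by measurable

lemma norm_g_le: "norm (g u x) \<le> 2 * (1 + \<bar>u\<bar>) * w x"
proof (cases "\<bar>x\<bar> \<le> 1")
  case True
  then have "indicator {-1..1} x = (1::real)" by (simp add: abs_le_iff)
  have "norm (g u x) \<le> norm (iexp (u * x) - 1) + norm (\<i> * complex_of_real (u * x * indicator {-1..1} x))"
    unfolding g_def by (rule norm_triangle_ineq4)
  also have "\<dots> \<le> \<bar>u * x\<bar> + \<bar>u * x\<bar>"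
    using iexp_approx1[of "u * x" 0] \<open>indicator {-1..1} x = 1\<close> by (intro add_mono) (auto simp: norm_mult abs_mult)
  also have "\<dots> \<le> 2 * (1 + \<bar>u\<bar>) * w x" using True by (simp add: w_def abs_mult algebra_simps)
  finally show ?thesis .
next
  case False
  then have "g u x = iexp (u * x) - 1" by (auto simp: g_def abs_le_iff)
  then have "norm (g u x) \<le> norm (iexp (u * x)) + norm (1::complex)" by (metis norm_triangle_ineq4)
  also have "\<dots> = 2" by simp
  finally show ?thesis using False by (simp add: w_def)
qed

lemma integrable_g: "integrable \<nu> (g u)"
  by (rule Bochner_Integration.integrable_bound[OF integrable_mult_right[OF integrable_w, of "2 * (1 + \<bar>u\<bar>)"]])
    (use norm_g_le in \<open>auto simp: w_nonneg abs_mult\<close>)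

lemma g_integral_continuous: "continuous_on UNIV (\<lambda>u. CLINT x|\<nu>. g u x)"
proof (rule continuous_at_imp_continuous_on, rule ballI)
  fix u
  show "isCont (\<lambda>u. CLINT x|\<nu>. g u x) u"
    unfolding continuous_at_sequentially
  proof (intro allI impI)
    fix v :: "nat \<Rightarrow> real" assume v: "v \<longlonglongrightarrow> u"
    then have "Bseq v" by (intro convergent_imp_Bseq convergentI)
    then obtain K where K: "K > 0" "\<And>n. \<bar>v n\<bar> \<le> K" by (auto elim: BseqE)
    have "(\<lambda>n. CLINT x|\<nu>. g (v n) x) \<longlonglongrightarrow> (CLINT x|\<nu>. g u x)"
    proof (rule integral_dominated_convergence[where w="\<lambda>x. 2 * (1 + K) * w x"])
      show "integrable \<nu> (\<lambda>x. 2 * (1 + K) * w x)" by (rule integrable_mult_right[OF integrable_w])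
      show "AE x in \<nu>. (\<lambda>n. g (v n) x) \<longlonglongrightarrow> g u x"
        unfolding g_def by (intro AE_I2 tendsto_intros v)
      show "AE x in \<nu>. norm (g (v n) x) \<le> 2 * (1 + K) * w x" for n
      proof (rule AE_I2)
        fix x
        have "2 * (1 + \<bar>v n\<bar>) * w x \<le> 2 * (1 + K) * w x" using K w_nonneg[of x] by (intro mult_right_mono) auto
        then show "norm (g (v n) x) \<le> 2 * (1 + K) * w x" using norm_g_le[of "v n" x] by linarith
      qed
    qed measurable
    then show "((\<lambda>u. CLINT x|\<nu>. g u x) \<circ> v) \<longlonglongrightarrow> (CLINT x|\<nu>. g u x)" by (simp add: comp_def)
  qed
qed

lemma Re_g: "Re (g u x) = cos (u * x) - 1"
  by (simp add: g_def Re_exp)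

lemma Im_g_le:
  assumes "u \<ge> 1"
  shows "\<bar>Im (g u x)\<bar> \<le> 2 * u * w x"
proof (cases "\<bar>x\<bar> \<le> 1")
  case True
  then have "Im (g u x) = sin (u * x) - u * x" by (simp add: g_def Im_exp abs_le_iff)
  then have "\<bar>Im (g u x)\<bar> \<le> \<bar>sin (u * x)\<bar> + \<bar>u * x\<bar>" using abs_triangle_ineq4[of "sin (u * x)" "u * x"] by simp
  also have "\<dots> \<le> 2 * u * w x" using abs_sin_x_le_abs_x[of "u * x"] True assms by (simp add: w_def abs_mult)
  finally show ?thesis .
next
  case False
  then have "Im (g u x) = sin (u * x)" by (auto simp: g_def Im_exp abs_le_iff)
  moreover have "\<bar>sin (u * x)\<bar> \<le> 1" by simp
  moreover have "2 * u * w x = 2 * u" using False by (simp add: w_def)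
  ultimately show ?thesis using assms by linarith
qed

text \<open>The real parts of the exponents contribute at most \<open>8 * W / N\<close>, by the
  dyadic kernel bound under the integral over \<nu>. The imaginary parts are at most
  \<open>2 ^ j * r\<close> with \<open>r = (\<bar>\<gamma>\<bar> + 2 * W) / N\<close> and contribute
  at most \<open>8 * r\<close>, by the same bound at r. The sum is the constant claimed.\<close>

lemma dyadic_char_sum_le:
  fixes N :: nat
  assumes N: "N > 0"
  shows "(\<Sum>j<n. (1 - Re (exp ((\<i> * complex_of_real (\<gamma> * 2 ^ j) + (CLINT x|\<nu>. g (2 ^ j) x)) / of_nat N))) / 2 ^ j)
    \<le> (24 * (LINT x|\<nu>. w x) + 8 * \<bar>\<gamma>\<bar>) / real N"
proof -
  define W where "W = (LINT x|\<nu>. w x)"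
  have W: "W \<ge> 0" unfolding W_def by (rule Bochner_Integration.integral_nonneg) (simp add: w_nonneg)
  define z where "z j = (\<i> * complex_of_real (\<gamma> * 2 ^ j) + (CLINT x|\<nu>. g (2 ^ j) x)) / of_nat N" for j
  have int: "integrable \<nu> (\<lambda>x. Re (g u x))" "integrable \<nu> (\<lambda>x. Im (g u x))" for u
    using integrable_g[of u] by auto
  have int_cos: "integrable \<nu> (\<lambda>x. 1 - cos (u * x))" for u
    using integrable_minus[OF int(1)[of u]] by (simp add: Re_g)
  have Re_z: "- Re (z j) = (LINT x|\<nu>. 1 - cos (2 ^ j * x)) / real N" for j
  proof -
    have "Re (CLINT x|\<nu>. g (2 ^ j) x) = (LINT x|\<nu>. Re (g (2 ^ j) x))" by (rule integral_Re[OF integrable_g, symmetric])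
    also have "\<dots> = - (LINT x|\<nu>. 1 - cos (2 ^ j * x))" unfolding Bochner_Integration.integral_minus[symmetric] by (simp add: Re_g)
    finally show ?thesis by (simp add: z_def)
  qed
  define r where "r = (\<bar>\<gamma>\<bar> + 2 * W) / real N"
  have r: "r \<ge> 0" using W by (simp add: r_def)
  have Im_z: "\<bar>Im (z j)\<bar> \<le> 2 ^ j * r" for j
  proof -
    have "Im (CLINT x|\<nu>. g (2 ^ j) x) = (LINT x|\<nu>. Im (g (2 ^ j) x))" by (rule integral_Im[OF integrable_g, symmetric])
    moreover have "\<bar>LINT x|\<nu>. Im (g (2 ^ j) x)\<bar> \<le> (LINT x|\<nu>. 2 * 2 ^ j * w x)"
      by (rule Bochner_Integration.integral_abs_bound_integral) (use int integrable_w Im_g_le in auto)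
    ultimately have "\<bar>Im (CLINT x|\<nu>. g (2 ^ j) x)\<bar> \<le> 2 * 2 ^ j * W" by (simp add: W_def)
    then have "\<bar>\<gamma> * 2 ^ j + Im (CLINT x|\<nu>. g (2 ^ j) x)\<bar> \<le> 2 ^ j * (\<bar>\<gamma>\<bar> + 2 * W)"
      using abs_triangle_ineq[of "\<gamma> * 2 ^ j" "Im (CLINT x|\<nu>. g (2 ^ j) x)"] by (simp add: abs_mult algebra_simps)
    then have "\<bar>\<gamma> * 2 ^ j + Im (CLINT x|\<nu>. g (2 ^ j) x)\<bar> / real N \<le> 2 ^ j * (\<bar>\<gamma>\<bar> + 2 * W) / real N"
      by (rule divide_right_mono) simp
    then show ?thesis by (simp add: z_def r_def)
  qed
  have "(\<Sum>j<n. (1 - Re (exp (z j))) / 2 ^ j) \<le> (\<Sum>j<n. (- Re (z j)) / 2 ^ j + 2 * (min 1 ((2 ^ j * r)\<^sup>2) / 2 ^ j))"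
  proof (rule sum_mono)
    fix j
    have "0 \<le> - Re (z j)" unfolding Re_z by (intro divide_nonneg_nonneg Bochner_Integration.integral_nonneg) auto
    then have "1 - Re (exp (z j)) \<le> - Re (z j) + (1 - cos (Im (z j)))" by (intro one_minus_Re_exp_le) simp
    also have "1 - cos (Im (z j)) \<le> 2 * min 1 ((Im (z j))\<^sup>2)" by (rule one_minus_cos_le)
    also have "(Im (z j))\<^sup>2 \<le> (2 ^ j * r)\<^sup>2" using Im_z[of j] r by (simp add: abs_le_square_iff[symmetric] abs_mult)
    finally have "1 - Re (exp (z j)) \<le> - Re (z j) + 2 * min 1 ((2 ^ j * r)\<^sup>2)" by simp
    then have "(1 - Re (exp (z j))) / 2 ^ j \<le> (- Re (z j) + 2 * min 1 ((2 ^ j * r)\<^sup>2)) / 2 ^ j"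
      by (rule divide_right_mono) simp
    then show "(1 - Re (exp (z j))) / 2 ^ j \<le> (- Re (z j)) / 2 ^ j + 2 * (min 1 ((2 ^ j * r)\<^sup>2) / 2 ^ j)"
      by (simp add: add_divide_distrib diff_divide_distrib)
  qed
  also have "\<dots> = (\<Sum>j<n. (LINT x|\<nu>. (1 - cos (2 ^ j * x)) / 2 ^ j)) / real N + 2 * (\<Sum>j<n. min 1 ((2 ^ j * r)\<^sup>2) / 2 ^ j)"
    unfolding sum.distrib Re_z by (simp add: sum_distrib_left sum_divide_distrib mult_ac)
  also have "(\<Sum>j<n. (LINT x|\<nu>. (1 - cos (2 ^ j * x)) / 2 ^ j)) = (LINT x|\<nu>. (\<Sum>j<n. (1 - cos (2 ^ j * x)) / 2 ^ j))"
    by (subst Bochner_Integration.integral_sum) (use int_cos in auto)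
  also have "\<dots> \<le> (LINT x|\<nu>. 8 * w x)"
  proof (rule integral_mono)
    fix x :: real
    have "(\<Sum>j<n. (1 - cos (2 ^ j * x)) / 2 ^ j) \<le> (\<Sum>j<n. 2 * (min 1 ((2 ^ j * x)\<^sup>2) / 2 ^ j))"
    proof (rule sum_mono)
      fix j
      show "(1 - cos (2 ^ j * x)) / 2 ^ j \<le> 2 * (min 1 ((2 ^ j * x)\<^sup>2) / 2 ^ j)"
        using divide_right_mono[OF one_minus_cos_le[of "2 ^ j * x"], of "2 ^ j"] by simp
    qed
    then show "(\<Sum>j<n. (1 - cos (2 ^ j * x)) / 2 ^ j) \<le> 8 * w x"
      using dyadic_kernel_le'[where n=n and r=x] unfolding w_def sum_distrib_left[symmetric] by linarith
  qed (use int_cos integrable_w in auto)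
  also have "(LINT x|\<nu>. 8 * w x) = 8 * W" by (simp add: W_def)
  also have "(\<Sum>j<n. min 1 ((2 ^ j * r)\<^sup>2) / 2 ^ j) \<le> 4 * r"
    using dyadic_kernel_le'[where n=n and r=r] r by (auto split: if_splits)
  also have "8 * W / real N + 2 * (4 * r) = (24 * W + 8 * \<bar>\<gamma>\<bar>) / real N"
    by (simp add: r_def add_divide_distrib)
  finally show ?thesis unfolding z_def W_def by (simp add: divide_right_mono)
qed

end

locale levy_bv = levy + bv_triplet +
  fixes \<gamma> :: real
  assumes char_Z1: "char (distr M borel (Z 1)) u = exp (\<i> * complex_of_real (\<gamma> * u) + (CLINT x|\<nu>. g u x))"
begin

text \<open>On [-1, 1] the function \<bar>y\<bar> is at most a constant times the sum over j of
  \<open>(1 - cos (2 ^ j * y)) / 2 ^ j\<close>. The mean of this sum is expressed by the distance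
  from 1 of the real part of the characteristic function at the points \<open>2 ^ j\<close>, and is
  of order \<open>1 / N\<close>.\<close>

lemma small_increments:
  fixes N :: nat
  assumes N: "N > 0" and s: "s \<ge> 0"
  defines "C \<equiv> 2 / (1 - cos 1) * (24 * (LINT x|\<nu>. w x) + 8 * \<bar>\<gamma>\<bar>)"
  shows "(\<integral>\<^sup>+\<omega>. ennreal (\<bar>Z (s + 1 / real N) \<omega> - Z s \<omega>\<bar> * indicator {-1..1} (Z (s + 1 / real N) \<omega> - Z s \<omega>)) \<partial>M) \<le> ennreal (C / real N)"
proof -
  have c: "1 - cos 1 > (0::real)" using cos_monotone_0_pi[of 0 1] pi_gt3 by simp
  define P where "P = distr M borel (\<lambda>\<omega>. Z (1 / real N) \<omega> - Z 0 \<omega>)"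
  have [measurable]: "Z 0 \<in> borel_measurable M" "Z 1 \<in> borel_measurable M" "Z (1 / real N) \<in> borel_measurable M" by auto
  interpret P: real_distribution P unfolding P_def by (rule real_distribution_distr) measurable
  have P: "char P u = exp ((\<i> * complex_of_real (\<gamma> * u) + (CLINT x|\<nu>. g u x)) / of_nat N)" for u
    unfolding P_def
  proof (rule char_dyadic[OF _ _ char_Z1 N])
    show "continuous_on UNIV (\<lambda>u. \<i> * complex_of_real (\<gamma> * u) + (CLINT x|\<nu>. g u x))"
      by (intro continuous_intros g_integral_continuous)
    show "\<i> * complex_of_real (\<gamma> * 0) + (CLINT x|\<nu>. g 0 x) = 0" by (simp add: g_def)
  qed
  have cosP: "(\<integral>\<^sup>+y. ennreal ((1 - cos (u * y)) / 2 ^ j) \<partial>P) = ennreal ((1 - Re (char P u)) / 2 ^ j)" for u and j :: nat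
  proof -
    have i: "integrable P (\<lambda>y. cos (u * y))" by (rule P.integrable_const_bound[where B=1]) auto
    have "Re (char P u) = (LINT y|P. Re (iexp (u * y)))"
      unfolding char_def by (rule integral_Re[symmetric]) (auto intro!: P.integrable_iexp)
    then have "(1 - Re (char P u)) / 2 ^ j = (LINT y|P. (1 - cos (u * y)) / 2 ^ j)"
      using i P.prob_space by (simp add: Re_exp)
    moreover have "(\<integral>\<^sup>+y. ennreal ((1 - cos (u * y)) / 2 ^ j) \<partial>P) = ennreal (LINT y|P. (1 - cos (u * y)) / 2 ^ j)"
      by (rule nn_integral_eq_integral) (use i in auto)
    ultimately show ?thesis by simp
  qed
  let ?c = "(1 - cos 1) / 2 :: real"
  have "(\<integral>\<^sup>+\<omega>. ennreal (\<bar>Z (s + 1 / real N) \<omega> - Z s \<omega>\<bar> * indicator {-1..1} (Z (s + 1 / real N) \<omega> - Z s \<omega>)) \<partial>M)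
    = (\<integral>\<^sup>+\<omega>. ennreal (\<bar>Z (1 / real N) \<omega> - Z 0 \<omega>\<bar> * indicator {-1..1} (Z (1 / real N) \<omega> - Z 0 \<omega>)) \<partial>M)"
    by (rule nn_integral_increment[OF s, of "1 / real N" "\<lambda>y. ennreal (\<bar>y\<bar> * indicator {-1..1} y)"]) auto
  also have "\<dots> = (\<integral>\<^sup>+y. ennreal (\<bar>y\<bar> * indicator {-1..1} y) \<partial>P)"
    unfolding P_def by (rule nn_integral_distr[symmetric]) auto
  also have "\<dots> \<le> (\<integral>\<^sup>+y. ennreal (1 / ?c) * (\<Sum>j. ennreal ((1 - cos (2 ^ j * y)) / 2 ^ j)) \<partial>P)"
  proof (rule nn_integral_mono)
    fix y :: real
    let ?S = "\<Sum>j. ennreal ((1 - cos (2 ^ j * y)) / 2 ^ j)"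
    show "ennreal (\<bar>y\<bar> * indicator {-1..1} y) \<le> ennreal (1 / ?c) * ?S"
    proof (cases "\<bar>y\<bar> \<le> 1 \<and> y \<noteq> 0")
      case True
      then obtain j where j: "?c * \<bar>y\<bar> \<le> (1 - cos (2 ^ j * y)) / 2 ^ j" using dyadic_kernel_ge by blast
      have "\<bar>y\<bar> * indicator {-1..1} y \<le> \<bar>y\<bar>" by (simp add: indicator_def)
      also have "\<dots> = 1 / ?c * (?c * \<bar>y\<bar>)" using c by simp
      finally have "ennreal (\<bar>y\<bar> * indicator {-1..1} y) \<le> ennreal (1 / ?c * (?c * \<bar>y\<bar>))" by (rule ennreal_leI)
      also have "\<dots> = ennreal (1 / ?c) * ennreal (?c * \<bar>y\<bar>)" using c by (intro ennreal_mult) auto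
      also have "\<dots> \<le> ennreal (1 / ?c) * ?S"
      proof (rule mult_left_mono)
        have "ennreal (?c * \<bar>y\<bar>) \<le> (\<Sum>j\<in>{j}. ennreal ((1 - cos (2 ^ j * y)) / 2 ^ j))"
          using ennreal_leI[OF j] by simp
        also have "\<dots> \<le> ?S" by (rule sum_le_suminf[OF summableI]) auto
        finally show "ennreal (?c * \<bar>y\<bar>) \<le> ?S" .
      qed simp
      finally show ?thesis .
    qed (auto simp: indicator_def abs_le_iff)
  qed
  also have "\<dots> = ennreal (1 / ?c) * (\<Sum>j. \<integral>\<^sup>+y. ennreal ((1 - cos (2 ^ j * y)) / 2 ^ j) \<partial>P)"
    by (simp add: nn_integral_cmult nn_integral_suminf)
  also have "\<dots> \<le> ennreal (1 / ?c) * ennreal ((24 * (LINT x|\<nu>. w x) + 8 * \<bar>\<gamma>\<bar>) / real N)"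
    unfolding cosP
  proof (rule mult_left_mono[OF suminf_le_const[OF summableI]])
    fix n
    have "Re (char P u) \<le> 1" for u using complex_Re_le_cmod[of "char P u"] P.cmod_char_le_1[of u] by linarith
    then have "(\<Sum>j<n. ennreal ((1 - Re (char P (2 ^ j))) / 2 ^ j)) = ennreal (\<Sum>j<n. (1 - Re (char P (2 ^ j))) / 2 ^ j)"
      by (intro sum_ennreal) simp
    also have "\<dots> \<le> ennreal ((24 * (LINT x|\<nu>. w x) + 8 * \<bar>\<gamma>\<bar>) / real N)"
      unfolding P by (intro ennreal_leI dyadic_char_sum_le N)
    finally show "(\<Sum>j<n. ennreal ((1 - Re (char P (2 ^ j))) / 2 ^ j)) \<le> ennreal ((24 * (LINT x|\<nu>. w x) + 8 * \<bar>\<gamma>\<bar>) / real N)" .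
  qed simp
  also have "ennreal (1 / ?c) * ennreal ((24 * (LINT x|\<nu>. w x) + 8 * \<bar>\<gamma>\<bar>) / real N) = ennreal (C / real N)"
  proof -
    have "0 \<le> (24 * (LINT x|\<nu>. w x) + 8 * \<bar>\<gamma>\<bar>) / real N"
      by (intro divide_nonneg_nonneg add_nonneg_nonneg mult_nonneg_nonneg Bochner_Integration.integral_nonneg w_nonneg) auto
    then have "ennreal (1 / ?c) * ennreal ((24 * (LINT x|\<nu>. w x) + 8 * \<bar>\<gamma>\<bar>) / real N) = ennreal (1 / ?c * ((24 * (LINT x|\<nu>. w x) + 8 * \<bar>\<gamma>\<bar>) / real N))"
      using c by (intro ennreal_mult[symmetric]) auto
    then show ?thesis by (simp add: C_def)
  qed
  finally show ?thesis .
qed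

end

section \<open>From dyadic increments to bounded variation\<close>

lemma sum_abs_mono_subsequence:
  fixes f :: "nat \<Rightarrow> real"
  assumes "mono k"
  shows "(\<Sum>i<m. \<bar>f (k (Suc i)) - f (k i)\<bar>) \<le> (\<Sum>j\<in>{k 0..<k m}. \<bar>f (Suc j) - f j\<bar>)"
proof (induction m)
  case (Suc m)
  have le: "k 0 \<le> k m" "k m \<le> k (Suc m)" using monoD[OF assms] by simp_all
  have "f (k (Suc m)) - f (k m) = (\<Sum>j\<in>{k m..<k (Suc m)}. f (Suc j) - f j)"
    by (rule sum_Suc_diff'[OF le(2), symmetric])
  then have "\<bar>f (k (Suc m)) - f (k m)\<bar> \<le> (\<Sum>j\<in>{k m..<k (Suc m)}. \<bar>f (Suc j) - f j\<bar>)" by (simp only: sum_abs)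
  then show ?case using Suc sum.atLeastLessThan_concat[OF le, of "\<lambda>j. \<bar>f (Suc j) - f j\<bar>"]
    unfolding sum.lessThan_Suc by linarith
qed simp

lemma dyadic_above_tendsto:
  fixes s :: real
  assumes "s \<ge> 0"
  shows "filterlim (\<lambda>n. real (nat \<lfloor>2 ^ n * s\<rfloor> + 1) / 2 ^ n) (at_right s) sequentially"
proof -
  have "y < real (nat \<lfloor>y\<rfloor> + 1)" "real (nat \<lfloor>y\<rfloor> + 1) \<le> y + 1" if "0 \<le> y" for y :: real
    using that by linarith+
  then have b: "2 ^ n * s < real (nat \<lfloor>2 ^ n * s\<rfloor> + 1)" "real (nat \<lfloor>2 ^ n * s\<rfloor> + 1) \<le> 2 ^ n * s + 1" for n
    using assms by simp_all
  have g: "s < real (nat \<lfloor>2 ^ n * s\<rfloor> + 1) / 2 ^ n" for n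
    using b(1)[of n] by (subst pos_less_divide_eq) (simp_all add: mult.commute)
  have g': "real (nat \<lfloor>2 ^ n * s\<rfloor> + 1) / 2 ^ n \<le> s + (1 / 2) ^ n" for n
  proof -
    have "real (nat \<lfloor>2 ^ n * s\<rfloor> + 1) / 2 ^ n \<le> (2 ^ n * s + 1) / 2 ^ n" by (rule divide_right_mono[OF b(2)]) simp
    also have "\<dots> = s + (1 / 2) ^ n" by (simp add: add_divide_distrib power_divide)
    finally show ?thesis .
  qed
  have "(\<lambda>n. s + (1 / 2) ^ n) \<longlonglongrightarrow> s + 0"
    by (intro tendsto_add tendsto_const LIMSEQ_realpow_zero) simp_all
  then have lim: "(\<lambda>n. s + (1 / 2) ^ n) \<longlonglongrightarrow> s" by (simp only: add_0_right)
  have "(\<lambda>n. real (nat \<lfloor>2 ^ n * s\<rfloor> + 1) / 2 ^ n) \<longlonglongrightarrow> s"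
  proof (rule tendsto_sandwich[OF _ _ tendsto_const lim])
    show "\<forall>\<^sub>F n in sequentially. s \<le> real (nat \<lfloor>2 ^ n * s\<rfloor> + 1) / 2 ^ n"
      by (rule always_eventually, rule allI, rule less_imp_le, rule g)
    show "\<forall>\<^sub>F n in sequentially. real (nat \<lfloor>2 ^ n * s\<rfloor> + 1) / 2 ^ n \<le> s + (1 / 2) ^ n"
      by (rule always_eventually, rule allI, rule g')
  qed
  then show ?thesis by (rule tendsto_imp_filterlim_at_right) (rule always_eventually, rule allI, rule g)
qed

text \<open>Only the increments in [-1, 1] are summed: their mean is controlled by
  \<open>small_increments\<close>, while the number of larger ones is bounded path by path,
  uniformly in the mesh.\<close>

definition small_increment_sum :: "nat \<Rightarrow> nat \<Rightarrow> (real \<Rightarrow> real) \<Rightarrow> real" where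
  "small_increment_sum b n z = (\<Sum>k<b * 2 ^ n. \<bar>z (real (Suc k) / 2 ^ n) - z (real k / 2 ^ n)\<bar>
    * indicator {-1..1} (z (real (Suc k) / 2 ^ n) - z (real k / 2 ^ n)))"

text \<open>A grid cell with an increment above 1 contains a critical point of the path, so there
  are at most \<open>card C\<close> such cells, whatever the mesh. An arbitrary partition is
  approximated by grid points from the right, hence infinitely many good meshes suffice.\<close>

lemma cadlag_variation:
  fixes z :: "real \<Rightarrow> real" and b :: nat
  assumes z: "cadlag z"
    and freq: "\<exists>\<^sub>F n in sequentially. small_increment_sum b n z \<le> B"
  shows "\<exists>B'. \<forall>m t. mono t \<longrightarrow> range t \<subseteq> {0..<real b} \<longrightarrow> (\<Sum>i<m. \<bar>z (t (Suc i)) - z (t i)\<bar>) \<le> B'"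
proof -
  define \<Delta> where "\<Delta> n k = z (real (Suc k) / 2 ^ n) - z (real k / 2 ^ n)" for n k
  obtain C where C: "finite C" "\<And>u v. 0 \<le> u \<Longrightarrow> u \<le> v \<Longrightarrow> v \<le> real b \<Longrightarrow> {u<..v} \<inter> C = {} \<Longrightarrow> \<bar>z u - z v\<bar> \<le> 1"
    by (rule cadlag_critical_points[OF z, where b = "real b"]) (rule that)
  obtain S where S: "\<And>u. 0 \<le> u \<Longrightarrow> u \<le> real b \<Longrightarrow> \<bar>z u\<bar> \<le> S" by (rule cadlag_bounded[OF z, where b = "real b"]) (rule that)
  have S0: "S \<ge> 0" using S[of 0] by auto
  have large: "(\<Sum>k\<in>{k\<in>{..<b * 2 ^ n}. \<bar>\<Delta> n k\<bar> > 1}. \<bar>\<Delta> n k\<bar>) \<le> real (card C) * (2 * S)" for n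
  proof -
    let ?L = "{k\<in>{..<b * 2 ^ n}. \<bar>\<Delta> n k\<bar> > 1}"
    have k_le: "real (Suc k) / 2 ^ n \<le> real b" if "k < b * 2 ^ n" for k
    proof -
      have "real (Suc k) \<le> real (b * 2 ^ n)" using that by (simp only: of_nat_le_iff)
      then show ?thesis by (simp add: pos_divide_le_eq)
    qed
    \<comment> \<open>The half-open cell that contains c is determined by c: its index is
      \<open>\<lceil>2 ^ n * c\<rceil> - 1\<close>.\<close>
    have "?L \<subseteq> (\<lambda>c. nat (\<lceil>2 ^ n * c\<rceil> - 1)) ` C"
    proof
      fix k assume k: "k \<in> ?L"
      have "{real k / 2 ^ n<..real (Suc k) / 2 ^ n} \<inter> C \<noteq> {}"
      proof
        assume "{real k / 2 ^ n<..real (Suc k) / 2 ^ n} \<inter> C = {}"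
        then have "\<bar>z (real k / 2 ^ n) - z (real (Suc k) / 2 ^ n)\<bar> \<le> 1"
          by (intro C(2) k_le divide_right_mono) (use k in auto)
        moreover have "1 < \<bar>z (real (Suc k) / 2 ^ n) - z (real k / 2 ^ n)\<bar>" using k unfolding \<Delta>_def by blast
        ultimately show False by linarith
      qed
      then obtain c where c: "c \<in> C" "real k / 2 ^ n < c" "c \<le> real (Suc k) / 2 ^ n" by auto
      then have "real k < 2 ^ n * c" "2 ^ n * c \<le> real k + 1" by (simp_all add: field_simps)
      then have "\<lceil>2 ^ n * c\<rceil> = int k + 1" by linarith
      then show "k \<in> (\<lambda>c. nat (\<lceil>2 ^ n * c\<rceil> - 1)) ` C" using c(1) by (intro image_eqI[of _ _ c]) auto
    qed
    then have card: "card ?L \<le> card C" by (rule surj_card_le[OF C(1)])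
    have "(\<Sum>k\<in>?L. \<bar>\<Delta> n k\<bar>) \<le> real (card ?L) * (2 * S)"
    proof (rule sum_bounded_above)
      fix k assume k: "k \<in> ?L"
      have "real k / 2 ^ n \<le> real (Suc k) / 2 ^ n" by (intro divide_right_mono) auto
      then have "\<bar>z (real k / 2 ^ n)\<bar> \<le> S" "\<bar>z (real (Suc k) / 2 ^ n)\<bar> \<le> S"
        using k_le[of k] k by (auto intro!: S)
      then show "\<bar>\<Delta> n k\<bar> \<le> 2 * S" unfolding \<Delta>_def by linarith
    qed
    also have "\<dots> \<le> real (card C) * (2 * S)" using card S0 by (intro mult_right_mono) auto
    finally show ?thesis .
  qed
  define B' where "B' = B + real (card C) * (2 * S)"
  have freq': "\<exists>\<^sub>F n in sequentially. (\<Sum>k<b * 2 ^ n. \<bar>\<Delta> n k\<bar>) \<le> B'"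
  proof (rule frequently_elim1[OF freq])
    fix n
    assume small: "small_increment_sum b n z \<le> B"
    have "(\<Sum>k<b * 2 ^ n. \<bar>\<Delta> n k\<bar>) = (\<Sum>k<b * 2 ^ n. \<bar>\<Delta> n k\<bar> * indicator {-1..1} (\<Delta> n k) + (if \<bar>\<Delta> n k\<bar> > 1 then \<bar>\<Delta> n k\<bar> else 0))"
      by (intro sum.cong refl) (simp add: indicator_def abs_le_iff, linarith)
    also have "\<dots> = (\<Sum>k<b * 2 ^ n. \<bar>\<Delta> n k\<bar> * indicator {-1..1} (\<Delta> n k)) + (\<Sum>k\<in>{k\<in>{..<b * 2 ^ n}. \<bar>\<Delta> n k\<bar> > 1}. \<bar>\<Delta> n k\<bar>)"
      unfolding sum.distrib by (subst sum.inter_filter) simp_all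
    also have "\<dots> \<le> B'" unfolding B'_def by (intro add_mono large) (use small in \<open>simp add: \<Delta>_def small_increment_sum_def\<close>)
    finally show "(\<Sum>k<b * 2 ^ n. \<bar>\<Delta> n k\<bar>) \<le> B'" .
  qed
  have "(\<Sum>i<m. \<bar>z (t (Suc i)) - z (t i)\<bar>) \<le> B'" if t: "mono t" "range t \<subseteq> {0..<real b}" for m t
  proof (rule ccontr)
    assume "\<not> ?thesis"
    then have gt: "B' < (\<Sum>i<m. \<bar>z (t (Suc i)) - z (t i)\<bar>)" by simp
    \<comment> \<open>The index of the grid point strictly to the right of \<open>t i\<close>, where
      right-continuity applies; the point stays in [0, b] because the partition avoids b.\<close>
    define k where "k n i = nat \<lfloor>2 ^ n * t i\<rfloor> + 1" for n i
    have "t i \<in> {0..<real b}" for i using t(2) by (blast intro: rangeI)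
    then have t0: "0 \<le> t i" "t i < real b" for i by simp_all
    have lim: "(\<lambda>n. z (real (k n i) / 2 ^ n)) \<longlonglongrightarrow> z (t i)" for i
    proof -
      have "(z \<longlongrightarrow> z (t i)) (at_right (t i))" using z t0(1)[of i] by (simp add: cadlag_def continuous_within)
      then show ?thesis unfolding k_def by (rule filterlim_compose[OF _ dyadic_above_tendsto[OF t0(1)]])
    qed
    have "(\<lambda>n. \<Sum>i<m. \<bar>z (real (k n (Suc i)) / 2 ^ n) - z (real (k n i) / 2 ^ n)\<bar>) \<longlonglongrightarrow> (\<Sum>i<m. \<bar>z (t (Suc i)) - z (t i)\<bar>)"
      by (intro tendsto_sum tendsto_rabs tendsto_diff lim)
    then have "\<forall>\<^sub>F n in sequentially. B' < (\<Sum>i<m. \<bar>z (real (k n (Suc i)) / 2 ^ n) - z (real (k n i) / 2 ^ n)\<bar>)"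
      by (rule order_tendstoD(1)[OF _ gt])
    with freq' have "\<exists>\<^sub>F n in sequentially. (\<Sum>k<b * 2 ^ n. \<bar>\<Delta> n k\<bar>) \<le> B' \<and>
      B' < (\<Sum>i<m. \<bar>z (real (k n (Suc i)) / 2 ^ n) - z (real (k n i) / 2 ^ n)\<bar>)"
      by (rule frequently_eventually_frequently)
    from frequently_ex[OF this] obtain n where n: "(\<Sum>k<b * 2 ^ n. \<bar>\<Delta> n k\<bar>) \<le> B'"
      "B' < (\<Sum>i<m. \<bar>z (real (k n (Suc i)) / 2 ^ n) - z (real (k n i) / 2 ^ n)\<bar>)"
      by (elim exE conjE) (rule that)
    have "mono (k n)"
    proof (rule monoI)
      fix i j :: nat assume "i \<le> j"
      then have "2 ^ n * t i \<le> 2 ^ n * t j" using monoD[OF t(1)] by (intro mult_left_mono) simp_all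
      then show "k n i \<le> k n j" unfolding k_def by (intro add_right_mono nat_mono floor_mono)
    qed
    then have "(\<Sum>i<m. \<bar>z (real (k n (Suc i)) / 2 ^ n) - z (real (k n i) / 2 ^ n)\<bar>) \<le> (\<Sum>j\<in>{k n 0..<k n m}. \<bar>\<Delta> n j\<bar>)"
      unfolding \<Delta>_def by (rule sum_abs_mono_subsequence[where f="\<lambda>j. z (real j / 2 ^ n)"])
    also have "\<dots> \<le> (\<Sum>k<b * 2 ^ n. \<bar>\<Delta> n k\<bar>)"
    proof (rule sum_mono2)
      have "2 ^ n * t m < 2 ^ n * real b" using t0(2)[of m] by simp
      moreover have "2 ^ n * real b = real (b * 2 ^ n)" by simp
      moreover have "nat \<lfloor>y\<rfloor> + 1 \<le> K" if "0 \<le> y" "y < real K" for y K using that by linarith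
      ultimately have "k n m \<le> b * 2 ^ n" unfolding k_def using t0(1)[of m] by simp
      then show "{k n 0..<k n m} \<subseteq> {..<b * 2 ^ n}" by auto
    qed auto
    finally show False using n by simp
  qed
  then show ?thesis by (intro exI[of _ B'] allI impI)
qed

lemma bounded_variation01_add_drift:
  assumes "bounded_variation01 f"
  shows "bounded_variation01 (\<lambda>s. f s + \<mu> * s)"
proof -
  obtain B where B: "\<And>n t. mono t \<Longrightarrow> range t \<subseteq> {0..1} \<Longrightarrow> (\<Sum>i<n. \<bar>f (t (Suc i)) - f (t i)\<bar>) \<le> B"
    using assms unfolding bounded_variation01_def by blast
  have "(\<Sum>i<n. \<bar>(f (t (Suc i)) + \<mu> * t (Suc i)) - (f (t i) + \<mu> * t i)\<bar>) \<le> B + \<bar>\<mu>\<bar>"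
    if t: "mono t" "range t \<subseteq> {0..1}" for n t
  proof -
    have "(\<Sum>i<n. \<bar>(f (t (Suc i)) + \<mu> * t (Suc i)) - (f (t i) + \<mu> * t i)\<bar>)
      \<le> (\<Sum>i<n. \<bar>f (t (Suc i)) - f (t i)\<bar> + \<bar>\<mu>\<bar> * (t (Suc i) - t i))"
    proof (rule sum_mono)
      fix i
      have "t i \<le> t (Suc i)" using t(1) by (simp add: monoD)
      then have "\<bar>\<mu> * (t (Suc i) - t i)\<bar> = \<bar>\<mu>\<bar> * (t (Suc i) - t i)" by (simp add: abs_mult)
      moreover have "(f (t (Suc i)) + \<mu> * t (Suc i)) - (f (t i) + \<mu> * t i) = (f (t (Suc i)) - f (t i)) + \<mu> * (t (Suc i) - t i)"
        by (simp add: algebra_simps)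
      ultimately show "\<bar>(f (t (Suc i)) + \<mu> * t (Suc i)) - (f (t i) + \<mu> * t i)\<bar> \<le> \<bar>f (t (Suc i)) - f (t i)\<bar> + \<bar>\<mu>\<bar> * (t (Suc i) - t i)"
        using abs_triangle_ineq[of "f (t (Suc i)) - f (t i)" "\<mu> * (t (Suc i) - t i)"] by simp
    qed
    also have "\<dots> = (\<Sum>i<n. \<bar>f (t (Suc i)) - f (t i)\<bar>) + \<bar>\<mu>\<bar> * (t n - t 0)"
      unfolding sum.distrib sum_distrib_left[symmetric] sum_lessThan_telescope ..
    also have "\<dots> \<le> B + \<bar>\<mu>\<bar> * 1"
    proof (intro add_mono B t mult_left_mono)
      have "t n \<in> {0..1}" "t 0 \<in> {0..1}" using t(2) by (blast intro: rangeI)+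
      then show "t n - t 0 \<le> 1" by simp
    qed simp
    finally show ?thesis by simp
  qed
  then show ?thesis unfolding bounded_variation01_def by (intro exI[of _ "B + \<bar>\<mu>\<bar>"]) auto
qed

lemma BV0_add_drift: "f \<in> BV0 \<Longrightarrow> (\<lambda>s. f s + \<mu> * s) \<in> BV0"
  by (simp add: BV0_def bounded_variation01_add_drift)

context levy_bv
begin

text \<open>The means of the sums are bounded uniformly in n, so by Fatou's lemma their lower limit
  is almost surely finite. This bounds the sums for infinitely many n, not for all large n.\<close>

lemma small_variation:
  "AE \<omega> in M. \<exists>B. \<exists>\<^sub>F n in sequentially. small_increment_sum b n (\<lambda>t. Z t \<omega>) \<le> B" for b :: nat
proof -
  define T where "T n \<omega> = small_increment_sum b n (\<lambda>t. Z t \<omega>)" for n \<omega>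
  have [measurable]: "Z (real k / 2 ^ n) \<in> borel_measurable M" for k n :: nat by simp
  have T_m [measurable]: "T n \<in> borel_measurable M" for n unfolding T_def[abs_def] small_increment_sum_def by measurable
  obtain C where C: "C \<ge> 0" "\<And>N s. (N::nat) > 0 \<Longrightarrow> s \<ge> 0 \<Longrightarrow>
    (\<integral>\<^sup>+\<omega>. ennreal (\<bar>Z (s + 1 / real N) \<omega> - Z s \<omega>\<bar> * indicator {-1..1} (Z (s + 1 / real N) \<omega> - Z s \<omega>)) \<partial>M) \<le> ennreal (C / real N)"
  proof -
    define C0 where "C0 = 2 / (1 - cos 1) * (24 * (LINT x|\<nu>. w x) + 8 * \<bar>\<gamma>\<bar>)"
    have "(\<integral>\<^sup>+\<omega>. ennreal (\<bar>Z (s + 1 / real N) \<omega> - Z s \<omega>\<bar> * indicator {-1..1} (Z (s + 1 / real N) \<omega> - Z s \<omega>)) \<partial>M) \<le> ennreal (max 0 C0 / real N)"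
      if "N > 0" "s \<ge> 0" for s and N :: nat
      using small_increments[OF that] unfolding C0_def[symmetric]
      by (rule order_trans) (intro ennreal_leI divide_right_mono max.cobounded2 of_nat_0_le_iff)
    then show ?thesis by (intro that[of "max 0 C0"]) simp_all
  qed
  have ET: "(\<integral>\<^sup>+\<omega>. ennreal (T n \<omega>) \<partial>M) \<le> ennreal (real b * C)" for n
  proof -
    have "(\<integral>\<^sup>+\<omega>. ennreal (T n \<omega>) \<partial>M) = (\<Sum>k<b * 2 ^ n. \<integral>\<^sup>+\<omega>. ennreal (\<bar>Z (real (Suc k) / 2 ^ n) \<omega> - Z (real k / 2 ^ n) \<omega>\<bar>
      * indicator {-1..1} (Z (real (Suc k) / 2 ^ n) \<omega> - Z (real k / 2 ^ n) \<omega>)) \<partial>M)"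
      unfolding T_def small_increment_sum_def by (subst nn_integral_sum[symmetric]) (auto simp: sum_ennreal)
    also have "\<dots> \<le> (\<Sum>k<b * 2 ^ n. ennreal (C / 2 ^ n))"
    proof (rule sum_mono)
      fix k
      have eq: "real (Suc k) / 2 ^ n = real k / 2 ^ n + 1 / real (2 ^ n)" by (simp add: add_divide_distrib)
      show "(\<integral>\<^sup>+\<omega>. ennreal (\<bar>Z (real (Suc k) / 2 ^ n) \<omega> - Z (real k / 2 ^ n) \<omega>\<bar>
      * indicator {-1..1} (Z (real (Suc k) / 2 ^ n) \<omega> - Z (real k / 2 ^ n) \<omega>)) \<partial>M) \<le> ennreal (C / 2 ^ n)"
        unfolding eq using C(2)[of "2 ^ n" "real k / 2 ^ n"] by simp
    qed
    also have "\<dots> = ennreal (real b * C)"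
      using C(1) by (subst sum_ennreal) auto
    finally show ?thesis .
  qed
  have "(\<integral>\<^sup>+\<omega>. liminf (\<lambda>n. ennreal (T n \<omega>)) \<partial>M) \<le> liminf (\<lambda>n. \<integral>\<^sup>+\<omega>. ennreal (T n \<omega>) \<partial>M)"
    by (rule nn_integral_liminf) measurable
  also have "\<dots> \<le> liminf (\<lambda>n::nat. ennreal (real b * C))"
    by (rule Liminf_mono, rule always_eventually) (simp add: ET)
  also have "\<dots> = ennreal (real b * C)" by (rule Liminf_const) simp
  finally have "(\<integral>\<^sup>+\<omega>. liminf (\<lambda>n. ennreal (T n \<omega>)) \<partial>M) \<noteq> \<infinity>" by (auto simp: top_unique)
  then have "AE \<omega> in M. liminf (\<lambda>n. ennreal (T n \<omega>)) \<noteq> \<infinity>"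
    by (rule nn_integral_noteq_infinite[rotated]) measurable
  then show ?thesis
  proof eventually_elim
    case (elim \<omega>)
    define B where "B = enn2real (liminf (\<lambda>n. ennreal (T n \<omega>))) + 1"
    have "liminf (\<lambda>n. ennreal (T n \<omega>)) = ennreal (enn2real (liminf (\<lambda>n. ennreal (T n \<omega>))))"
      using elim by (simp add: ennreal_enn2real_if)
    also have "\<dots> < ennreal B" unfolding B_def by (intro ennreal_lessI) (auto intro: add_nonneg_pos)
    finally have B: "liminf (\<lambda>n. ennreal (T n \<omega>)) < ennreal B" .
    have "\<exists>\<^sub>F n in sequentially. T n \<omega> \<le> B"
      unfolding frequently_def
    proof
      assume "\<forall>\<^sub>F n in sequentially. \<not> T n \<omega> \<le> B"
      then have "\<forall>\<^sub>F n in sequentially. ennreal B \<le> ennreal (T n \<omega>)"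
        by eventually_elim (auto intro: ennreal_leI)
      then have "ennreal B \<le> liminf (\<lambda>n. ennreal (T n \<omega>))" by (rule Liminf_bounded)
      then show False using B by simp
    qed
    then show ?case unfolding T_def by blast
  qed
qed

lemma eta_bounded_variation: "AE \<omega> in M. \<forall>A>0. \<forall>x. eta Z (real x) (real A) \<omega> \<in> BV0"
proof -
  have "AE \<omega> in M. \<forall>b::nat. \<exists>B. \<exists>\<^sub>F n in sequentially. small_increment_sum b n (\<lambda>t. Z t \<omega>) \<le> B"
    unfolding AE_all_countable by (rule allI) (rule small_variation)
  then show ?thesis
    using AE_space
  proof eventually_elim
    case (elim \<omega>)
    show ?case
    proof (intro allI impI)
      fix A x :: nat assume A: "A > 0"
      \<comment> \<open>One more than the end of the window, since \<open>cadlag_variation\<close>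
        treats partitions that stay below b.\<close>
      define b where "b = x + A + 1"
      obtain B0 where "\<exists>\<^sub>F n in sequentially. small_increment_sum b n (\<lambda>t. Z t \<omega>) \<le> B0"
        using elim(1)[rule_format, of b] by (rule exE)
      from cadlag_variation[OF path[OF elim(2)] this]
      obtain B where B: "\<forall>m t. mono t \<longrightarrow> range t \<subseteq> {0..<real b} \<longrightarrow> (\<Sum>i<m. \<bar>Z (t (Suc i)) \<omega> - Z (t i) \<omega>\<bar>) \<le> B"
        by (rule exE)
      have "(\<Sum>i<n. \<bar>eta Z (real x) (real A) \<omega> (t (Suc i)) - eta Z (real x) (real A) \<omega> (t i)\<bar>) \<le> B / real A"
        if t: "mono t" "range t \<subseteq> {0..1}" for n t
      proof -
        have m: "mono (\<lambda>i. real x + t i * real A)"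
          by (intro monoI add_left_mono mult_right_mono monoD[OF t(1)]) auto
        have "0 \<le> real x + t i * real A" "real x + t i * real A < real b" for i
        proof -
          have "t i \<in> {0..1}" using t(2) by (blast intro: rangeI)
          then have "0 \<le> t i * real A" "t i * real A \<le> 1 * real A" by (simp, intro mult_right_mono) simp_all
          then show "0 \<le> real x + t i * real A" "real x + t i * real A < real b" by (simp_all add: b_def)
        qed
        then have r: "range (\<lambda>i. real x + t i * real A) \<subseteq> {0..<real b}" by auto
        have eq: "\<bar>eta Z (real x) (real A) \<omega> (t (Suc i)) - eta Z (real x) (real A) \<omega> (t i)\<bar>
          = \<bar>Z (real x + t (Suc i) * real A) \<omega> - Z (real x + t i * real A) \<omega>\<bar> / real A" for i
          by (simp add: eta_def diff_divide_distrib[symmetric])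
        show ?thesis unfolding eq sum_divide_distrib[symmetric] by (rule divide_right_mono[OF B[rule_format, OF m r]]) simp
      qed
      then have "bounded_variation01 (eta Z (real x) (real A) \<omega>)"
        unfolding bounded_variation01_def by (intro exI[of _ "B / real A"]) auto
      then show "eta Z (real x) (real A) \<omega> \<in> BV0" by (simp add: BV0_def eta_def)
    qed
  qed
qed

end

subsection \<open>The two functional laws\<close>

text \<open>Extending f by its value at 1 makes \<open>cadlag_bounded\<close> applicable.\<close>

lemma cadlag_of_D01:
  assumes f: "f \<in> D01"
  shows "cadlag (\<lambda>t. f (min t 1))"
  unfolding cadlag_def
proof (intro conjI allI impI)
  fix t :: real assume t: "t \<ge> 0"
  show "continuous (at_right t) (\<lambda>t. f (min t 1))"
  proof (cases "t < 1")
    case True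
    then have "(f \<longlongrightarrow> f t) (at_right t)" using f t by (simp add: D01_def continuous_within)
    moreover have "\<forall>\<^sub>F s in at_right t. s < 1" using True by (rule eventually_at_right_real[THEN eventually_mono]) auto
    then have "\<forall>\<^sub>F s in at_right t. f (min s 1) = f s" by eventually_elim simp
    ultimately show ?thesis using True by (simp add: continuous_within tendsto_cong)
  next
    case False
    have "\<forall>\<^sub>F s in at_right t. t < s" by (rule eventually_at_right_less)
    then have "\<forall>\<^sub>F s in at_right t. f (min s 1) = f 1" by eventually_elim (use False in simp)
    then show ?thesis using False by (simp add: continuous_within tendsto_cong)
  qed
next
  fix t :: real assume t: "t > 0"
  show "\<exists>l. ((\<lambda>t. f (min t 1)) \<longlongrightarrow> l) (at_left t)"
  proof (cases "t \<le> 1")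
    case True
    then have "t \<in> {0<..1}" using t by simp
    then obtain l where l: "(f \<longlongrightarrow> l) (at_left t)" using f unfolding D01_def by blast
    have "\<forall>\<^sub>F s in at_left t. s < t" by (simp add: eventually_at_filter)
    then have "\<forall>\<^sub>F s in at_left t. f (min s 1) = f s" by eventually_elim (use True in simp)
    then show ?thesis using l by (auto simp: tendsto_cong)
  next
    case False
    then have "\<forall>\<^sub>F s in at_left t. 1 < s" by (intro eventually_at_left_real[THEN eventually_mono]) auto
    then have "\<forall>\<^sub>F s in at_left t. f (min s 1) = f 1" by eventually_elim simp
    then show ?thesis by (auto simp: tendsto_cong)
  qed
qed

lemma D01_bounded:
  assumes "f \<in> D01"
  obtains B where "\<And>s. s \<in> {0..1} \<Longrightarrow> \<bar>f s\<bar> \<le> B"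
proof -
  obtain B where B: "\<And>u. 0 \<le> u \<Longrightarrow> u \<le> 1 \<Longrightarrow> \<bar>f (min u 1)\<bar> \<le> B"
    by (rule cadlag_bounded[OF cadlag_of_D01[OF assms], where b = 1]) (rule that)
  have "\<bar>f s\<bar> \<le> B" if "s \<in> {0..1}" for s using B[of s] that by simp
  then show ?thesis by (rule that)
qed

lemma d_unif_commute: "d_unif f g = d_unif g f"
  unfolding d_unif_def by (simp add: abs_minus_commute)

lemma d_unif_triangle:
  assumes "f \<in> D01" "g \<in> D01" "k \<in> D01"
  shows "d_unif f k \<le> d_unif f g + d_unif g k"
proof -
  have le: "\<bar>f s - g s\<bar> \<le> d_unif f g" if fg: "f \<in> D01" "g \<in> D01" and s: "s \<in> {0..1}" for f g s
  proof -
    obtain B where B: "\<And>s. s \<in> {0..1} \<Longrightarrow> \<bar>f s\<bar> \<le> B" by (rule D01_bounded[OF fg(1)]) (rule that)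
    obtain B' where B': "\<And>s. s \<in> {0..1} \<Longrightarrow> \<bar>g s\<bar> \<le> B'" by (rule D01_bounded[OF fg(2)]) (rule that)
    have "\<bar>f s - g s\<bar> \<le> B + B'" if "s \<in> {0..1}" for s using B[OF that] B'[OF that] by linarith
    then have "bdd_above ((\<lambda>s. \<bar>f s - g s\<bar>) ` {0..1})" by (rule bdd_aboveI2)
    then show ?thesis unfolding d_unif_def using s by (intro cSUP_upper)
  qed
  show ?thesis
    unfolding d_unif_def[of f k]
  proof (rule cSUP_least)
    fix s :: real assume s: "s \<in> {0..1}"
    show "\<bar>f s - k s\<bar> \<le> d_unif f g + d_unif g k"
      using le[OF assms(1,2) s] le[OF assms(2,3) s] by linarith
  qed simp
qed

lemma d_unif_pl_le: "d_unif (pl m v) (pl m w) \<le> 2 * (\<Sum>i<m. \<bar>v i - w i\<bar>)"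
  unfolding d_unif_def
proof (rule cSUP_least)
  fix s :: real
  have "0 \<le> (\<Sum>i<m. \<bar>v i - w i\<bar>)" by (simp add: sum_nonneg)
  then show "\<bar>pl m v s - pl m w s\<bar> \<le> 2 * (\<Sum>i<m. \<bar>v i - w i\<bar>)" using pl_diff_le[of m v s w] by linarith
qed simp

lemma D01_add_drift:
  assumes "f \<in> D01"
  shows "(\<lambda>s. f s + \<mu> * s) \<in> D01"
  unfolding D01_def
proof (intro CollectI conjI ballI)
  fix s :: real assume "s \<in> {0..<1}"
  then have "continuous (at_right s) f" using assms by (simp add: D01_def)
  then show "continuous (at_right s) (\<lambda>s. f s + \<mu> * s)" by (intro continuous_intros)
next
  fix s :: real assume "s \<in> {0<..1}"
  then obtain l where "(f \<longlongrightarrow> l) (at_left s)" using assms unfolding D01_def by blast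
  then have "((\<lambda>s. f s + \<mu> * s) \<longlongrightarrow> l + \<mu> * s) (at_left s)" by (intro tendsto_intros)
  then show "\<exists>l. ((\<lambda>s. f s + \<mu> * s) \<longlongrightarrow> l) (at_left s)" by (rule exI)
qed

lemma cadlag_increment_D01:
  assumes z: "cadlag z" and x: "x \<ge> 0" and l: "l > 0"
  shows "(\<lambda>s. (z (x + s * l) - z x) / l) \<in> D01"
  unfolding D01_def
proof (intro CollectI conjI ballI)
  fix s :: real assume s: "s \<in> {0..<1}"
  have "filterlim (\<lambda>s. x + s * l) (at_right (x + s * l)) (at_right s)"
  proof (rule tendsto_imp_filterlim_at_right)
    show "((\<lambda>s. x + s * l) \<longlongrightarrow> x + s * l) (at_right s)" by (intro tendsto_intros)
    show "\<forall>\<^sub>F t in at_right s. x + s * l < x + t * l" using l by (simp add: eventually_at_filter)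
  qed
  moreover have "(z \<longlongrightarrow> z (x + s * l)) (at_right (x + s * l))"
    using z x l s by (simp add: cadlag_def continuous_within)
  ultimately have "((\<lambda>s. z (x + s * l)) \<longlongrightarrow> z (x + s * l)) (at_right s)" by (rule filterlim_compose[rotated])
  then have "((\<lambda>s. (z (x + s * l) - z x) / l) \<longlongrightarrow> (z (x + s * l) - z x) / l) (at_right s)"
    using l by (intro tendsto_divide tendsto_diff tendsto_const) simp_all
  then show "continuous (at_right s) (\<lambda>s. (z (x + s * l) - z x) / l)" by (simp add: continuous_within)
next
  fix s :: real assume s: "s \<in> {0<..1}"
  have "filterlim (\<lambda>s. x + s * l) (at_left (x + s * l)) (at_left s)"
  proof (rule tendsto_imp_filterlim_at_left)
    show "((\<lambda>s. x + s * l) \<longlongrightarrow> x + s * l) (at_left s)" by (intro tendsto_intros)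
    show "\<forall>\<^sub>F t in at_left s. x + t * l < x + s * l" using l by (simp add: eventually_at_filter)
  qed
  moreover have "0 < x + s * l" using x l s by (simp add: add_nonneg_pos)
  then obtain y where "(z \<longlongrightarrow> y) (at_left (x + s * l))" using z unfolding cadlag_def by blast
  ultimately have "((\<lambda>s. z (x + s * l)) \<longlongrightarrow> y) (at_left s)" by (rule filterlim_compose[rotated])
  then have "((\<lambda>s. (z (x + s * l) - z x) / l) \<longlongrightarrow> (y - z x) / l) (at_left s)"
    using l by (intro tendsto_divide tendsto_diff tendsto_const) simp_all
  then show "\<exists>y. ((\<lambda>s. (z (x + s * l) - z x) / l) \<longlongrightarrow> y) (at_left s)" by (rule exI)
qed

text \<open>f is arbitrary outside [0,1] and need not be measurable there, so its composition with
  the projection onto [0,1] takes its place.\<close>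

lemma BV0_measurable_bounded:
  assumes "f \<in> BV0"
  obtains \<phi> B where "\<phi> \<in> borel_measurable borel" "\<And>s. s \<in> {0..1} \<Longrightarrow> \<phi> s = f s" "\<And>s. s \<in> {0..1} \<Longrightarrow> \<bar>f s\<bar> \<le> B"
proof -
  have bv: "bounded_variation01 f" and f0: "f 0 = 0" using assms by (auto simp: BV0_def)
  obtain v where v: "\<And>s t. 0 \<le> s \<Longrightarrow> s \<le> t \<Longrightarrow> t \<le> 1 \<Longrightarrow> v s + \<bar>f t - f s\<bar> \<le> v t"
    using bounded_variation01_split[OF bv] by blast
  define cl :: "real \<Rightarrow> real" where "cl s = max 0 (min 1 s)" for s
  have cl: "0 \<le> cl s" "cl s \<le> 1" "s \<le> t \<Longrightarrow> cl s \<le> cl t" for s t by (auto simp: cl_def)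
  have "mono (\<lambda>s. v (cl s))" "mono (\<lambda>s. v (cl s) - f (cl s))"
    by (intro monoI, use v[OF cl(1) cl(3) cl(2)] in fastforce)+
  then have "(\<lambda>s. v (cl s) - (v (cl s) - f (cl s))) \<in> borel_measurable borel"
    by (intro borel_measurable_diff borel_measurable_mono)
  moreover have "v (cl s) - (v (cl s) - f (cl s)) = f s" if "s \<in> {0..1}" for s
    using that by (simp add: cl_def)
  moreover have "\<bar>f s\<bar> \<le> v 1 - v 0" if "s \<in> {0..1}" for s
    using v[of 0 s] v[of s 1] that f0 by simp
  ultimately show ?thesis by (rule that)
qed

lemma BV0_set_integrable_diff:
  assumes "f \<in> BV0" "g \<in> BV0"
  shows "set_integrable lborel {0..1} (\<lambda>s. \<bar>f s - g s\<bar>)"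
proof -
  obtain \<phi> B where f: "\<phi> \<in> borel_measurable borel" "\<And>s. s \<in> {0..1} \<Longrightarrow> \<phi> s = f s" "\<And>s. s \<in> {0..1} \<Longrightarrow> \<bar>f s\<bar> \<le> B"
    by (rule BV0_measurable_bounded[OF assms(1)]) (rule that)
  obtain \<gamma> C where g: "\<gamma> \<in> borel_measurable borel" "\<And>s. s \<in> {0..1} \<Longrightarrow> \<gamma> s = g s" "\<And>s. s \<in> {0..1} \<Longrightarrow> \<bar>g s\<bar> \<le> C"
    by (rule BV0_measurable_bounded[OF assms(2)]) (rule that)
  have m: "(\<lambda>s. \<bar>\<phi> s - \<gamma> s\<bar>) \<in> borel_measurable borel" using f(1) g(1) by measurable
  have "integrable lborel (\<lambda>s. indicator {0..1} s *\<^sub>R \<bar>\<phi> s - \<gamma> s\<bar>)"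
  proof (rule integrableI_bounded_set_indicator[where B = "B + C"])
    show "AE s in lborel. s \<in> {0..1} \<longrightarrow> norm \<bar>\<phi> s - \<gamma> s\<bar> \<le> B + C"
    proof (rule AE_I2, rule impI)
      fix s :: real assume "s \<in> {0..1}"
      then show "norm \<bar>\<phi> s - \<gamma> s\<bar> \<le> B + C" using f(2,3)[of s] g(2,3)[of s] by simp
    qed
  qed (use m in auto)
  moreover have "indicator {0..1} s *\<^sub>R \<bar>\<phi> s - \<gamma> s\<bar> = indicator {0..1} s *\<^sub>R \<bar>f s - g s\<bar>" for s
    using f(2)[of s] g(2)[of s] by (cases "s \<in> {0..1}") auto
  ultimately show ?thesis unfolding set_integrable_def by (simp only:)
qed

lemma d_hyb_commute: "d_hyb f g = d_hyb g f"
  unfolding d_hyb_def by (simp add: abs_minus_commute)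

lemma d_hyb_triangle:
  assumes "f \<in> BV0" "g \<in> BV0" "k \<in> BV0"
  shows "d_hyb f k \<le> d_hyb f g + d_hyb g k"
proof -
  note i = BV0_set_integrable_diff
  have "(LBINT u:{0..1}. \<bar>f u - k u\<bar>) \<le> (LBINT u:{0..1}. \<bar>f u - g u\<bar> + \<bar>g u - k u\<bar>)"
    by (intro set_integral_mono set_integral_add(1) i assms) simp
  also have "\<dots> = (LBINT u:{0..1}. \<bar>f u - g u\<bar>) + (LBINT u:{0..1}. \<bar>g u - k u\<bar>)"
    by (intro set_integral_add(2) i assms)
  finally show ?thesis unfolding d_hyb_def by simp
qed

text \<open>The integral and the endpoint each contribute the sum once, whence the factor 2 in
  \<open>dpl\<close>.\<close>

lemma d_hyb_pl_le: "d_hyb (pl m v) (pl m w) \<le> 2 * (\<Sum>i<m. \<bar>v i - w i\<bar>)"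
proof -
  let ?S = "\<Sum>i<m. \<bar>v i - w i\<bar>"
  have "(LBINT u:{0..1}. \<bar>pl m v u - pl m w u\<bar>) \<le> (LBINT u:{0..1::real}. ?S)"
  proof (rule set_integral_mono)
    show "set_integrable lborel {0..1::real} (\<lambda>_. ?S)" by (simp add: set_integrable_def)
  qed (auto intro: BV0_set_integrable_diff pl_in_BV0 pl_diff_le)
  also have "\<dots> = ?S" by (simp add: set_lebesgue_integral_def)
  finally show ?thesis unfolding d_hyb_def using pl_diff_le[of m v 1 w] by simp
qed

lemma A_seq_at_top: "c > 0 \<Longrightarrow> filterlim (A_seq c) at_top sequentially"
  unfolding A_seq_def
  by (intro filterlim_compose[OF filterlim_nat_sequentially] filterlim_compose[OF filterlim_floor_sequentially]
    filterlim_tendsto_pos_mult_at_top[OF tendsto_const] filterlim_compose[OF ln_at_top] filterlim_real_sequentially)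

lemma A_seq_bounds:
  assumes c: "c > 0" and n: "n > 0"
  shows "exp (real (A_seq c n) * (1 / c)) \<le> real n" "real n \<le> exp ((real (A_seq c n) + 1) * (1 / c))"
proof -
  have "0 \<le> c * ln (real n)" using c n by simp
  then have A: "real (A_seq c n) \<le> c * ln (real n)" "c * ln (real n) \<le> real (A_seq c n) + 1"
    unfolding A_seq_def by linarith+
  then have "real (A_seq c n) * (1 / c) \<le> ln (real n)" "ln (real n) \<le> (real (A_seq c n) + 1) * (1 / c)"
    using c by (simp_all add: pos_divide_le_eq pos_le_divide_eq mult.commute)
  then have "exp (real (A_seq c n) * (1 / c)) \<le> exp (ln (real n))" "exp (ln (real n)) \<le> exp ((real (A_seq c n) + 1) * (1 / c))"
    by (simp_all only: exp_le_cancel_iff)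
  then show "exp (real (A_seq c n) * (1 / c)) \<le> real n" "real n \<le> exp ((real (A_seq c n) + 1) * (1 / c))"
    using n by simp_all
qed

section \<open>From window lengths back to n\<close>

context levy_exp
begin

lemma eta_H: "eta Z (real x) (real A) \<omega> = (\<lambda>s. H A x \<omega> s + \<mu> * s)"
  by (simp add: H_def)

text \<open>The inclusions are indexed by the window length A. Every positive n with
  \<open>A_seq c n = A\<close> lies between \<open>exp (A / c)\<close> and
  \<open>exp ((A + 1) / c)\<close>, so the positions in \<open>upper\<close> include all those that
  occur for n, and the windows in \<open>lower\<close> all fit below n. The drift is added at the
  end because the metric is invariant under it.\<close>

lemma FERL_of_inclusions:
  assumes c: "c > 0" and K: "K \<subseteq> E" and drift: "\<And>f. f \<in> E \<Longrightarrow> (\<lambda>s. f s + \<mu> * s) \<in> E"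
    and inv: "\<And>f g. d (\<lambda>s. f s + \<mu> * s) (\<lambda>s. g s + \<mu> * s) = d f g"
    and HE: "AE \<omega> in M. \<forall>A>0. \<forall>x. H A x \<omega> \<in> E"
    and upper: "\<And>\<epsilon>. \<epsilon> > 0 \<Longrightarrow> AE \<omega> in M. \<forall>\<^sub>F A in sequentially. \<forall>x. real x \<le> exp ((real A + 1) * (1 / c)) \<longrightarrow> (\<exists>g\<in>K. d (H A x \<omega>) g < \<epsilon>)"
    and lower: "\<And>\<epsilon>. \<epsilon> > 0 \<Longrightarrow> AE \<omega> in M. \<forall>\<^sub>F A in sequentially. \<forall>g\<in>K. \<exists>x. real x + real A \<le> exp (real A * (1 / c)) \<and> d g (H A x \<omega>) < \<epsilon>"
  shows "FERL M E d (increments Z c) (add_drift K \<mu>)"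
  unfolding FERL_def
proof (intro conjI allI impI)
  show sub: "add_drift K \<mu> \<subseteq> E" unfolding add_drift_def using K drift by blast
  have A0: "\<forall>\<^sub>F n in sequentially. A_seq c n > 0"
    by (rule eventually_compose_filterlim[OF eventually_gt_at_top A_seq_at_top[OF c]])
  note seq = eventually_compose_filterlim[OF _ A_seq_at_top[OF c]]
  fix \<epsilon> :: real assume \<epsilon>: "\<epsilon> > 0"
  show "AE \<omega> in M. \<forall>\<^sub>F n in sequentially. increments Z c n \<omega> \<subseteq> nbhd E d (add_drift K \<mu>) \<epsilon>"
    using upper[OF \<epsilon>] HE
  proof eventually_elim
    case (elim \<omega>)
    from seq[OF elim(1)] A0 eventually_gt_at_top[of 0] show ?case
    proof eventually_elim
      case (elim n)
      show ?case
      proof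
        fix f assume "f \<in> increments Z c n \<omega>"
        then obtain x where x: "real x \<le> real n - real (A_seq c n)" and f: "f = (\<lambda>s. H (A_seq c n) x \<omega> s + \<mu> * s)"
          unfolding increments_def eta_H by blast
        have "real x \<le> exp ((real (A_seq c n) + 1) * (1 / c))"
          using x A_seq_bounds(2)[OF c \<open>0 < n\<close>] by linarith
        then obtain g where g: "g \<in> K" "d (H (A_seq c n) x \<omega>) g < \<epsilon>" using elim(1) by blast
        have "f \<in> E" unfolding f using \<open>\<forall>A>0. \<forall>x. H A x \<omega> \<in> E\<close> \<open>A_seq c n > 0\<close> by (intro drift) blast
        moreover have "(\<lambda>s. g s + \<mu> * s) \<in> add_drift K \<mu>" unfolding add_drift_def using g(1) by blast
        moreover have "d f (\<lambda>s. g s + \<mu> * s) < \<epsilon>" unfolding f inv by (rule g(2))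
        ultimately show "f \<in> nbhd E d (add_drift K \<mu>) \<epsilon>" unfolding nbhd_def by blast
      qed
    qed
  qed
  show "AE \<omega> in M. \<forall>\<^sub>F n in sequentially. add_drift K \<mu> \<subseteq> nbhd E d (increments Z c n \<omega>) \<epsilon>"
    using lower[OF \<epsilon>]
  proof eventually_elim
    case (elim \<omega>)
    from seq[OF elim] eventually_gt_at_top[of 0] show ?case
    proof eventually_elim
      case (elim n)
      show ?case
      proof
        fix f assume f: "f \<in> add_drift K \<mu>"
        then obtain g where g: "g \<in> K" "f = (\<lambda>s. g s + \<mu> * s)" unfolding add_drift_def by blast
        obtain x where x: "real x + real (A_seq c n) \<le> exp (real (A_seq c n) * (1 / c))" "d g (H (A_seq c n) x \<omega>) < \<epsilon>"
          using elim(1) g(1) by blast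
        have "real x \<le> real n - real (A_seq c n)"
          using x(1) A_seq_bounds(1)[OF c \<open>0 < n\<close>] by linarith
        then have "eta Z (real x) (real (A_seq c n)) \<omega> \<in> increments Z c n \<omega>" unfolding increments_def by blast
        moreover have "d f (eta Z (real x) (real (A_seq c n)) \<omega>) < \<epsilon>" unfolding eta_H g(2) inv by (rule x(2))
        moreover have "f \<in> E" using f sub by blast
        ultimately show "f \<in> nbhd E d (increments Z c n \<omega>) \<epsilon>" unfolding nbhd_def by blast
      qed
    qed
  qed
qed

lemma FERL_unif:
  assumes all: "\<And>t. mgf M (Z 1) t < \<infinity>" and c: "c > 0"
  shows "FERL M D01 d_unif (increments Z c) (add_drift (K_set \<Phi>\<^sub>c (1 / c)) \<mu>)"
proof -
  have \<alpha>: "1 / c > 0" using c by simp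
  have HE: "AE \<omega> in M. \<forall>A>0. \<forall>x. H A x \<omega> \<in> D01"
  proof (rule AE_I2, intro allI impI)
    fix \<omega> A x assume "\<omega> \<in> space M" "(0::nat) < A"
    then have "eta Z (real x) (real A) \<omega> \<in> D01"
      unfolding eta_def by (intro cadlag_increment_D01 path) auto
    from D01_add_drift[OF this, of "- \<mu>"] show "H A x \<omega> \<in> D01" by (simp add: H_def[abs_def])
  qed
  interpret F: ferl M X \<Phi>\<^sub>c H D01 "K_set \<Phi>\<^sub>c (1 / c)" d_unif "1 / c" \<theta>
  proof unfold_locales
    show "\<Phi>\<^sub>c \<theta> < \<infinity>" "\<Phi>\<^sub>c (- \<theta>) < \<infinity>" by (intro Phi_c_finite \<theta>)+
    show "K_set \<Phi>\<^sub>c (1 / c) \<subseteq> D01" by (auto simp: K_set_def)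
    show "\<forall>\<^sub>F m in sequentially. \<forall>f\<in>K_set \<Phi>\<^sub>c (1 / c). \<exists>v. rate \<Phi>\<^sub>c m v \<le> ennreal (1 / c) \<and> d_unif f (pl m v) \<le> \<epsilon>" if "\<epsilon> > 0" for \<epsilon>
      by (rule K_set_approx) (use that \<alpha> Phi_c_finite all in auto)
    show "\<forall>\<^sub>F m in sequentially. \<forall>\<^sub>F A in sequentially. \<forall>x. \<exists>F\<in>events. prob F \<le> exp (- real A * (1 / c + 1)) \<and>
      (\<forall>\<omega>\<in>space M - F. d_unif (H A x \<omega>) (pl m (D m A x \<omega>)) \<le> \<epsilon>)" if "\<epsilon> > 0" for \<epsilon>
      by (rule close_unif[OF all _ that]) (use \<alpha> in simp)
  qed (fact \<alpha> \<theta> d_unif_triangle d_unif_commute pl_in_D01 d_unif_pl_le HE | rule pl_in_K_set; assumption)+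
  show ?thesis
    by (rule FERL_of_inclusions[OF c F.KE D01_add_drift _ HE F.upper_inclusion F.lower_inclusion]) (simp_all add: d_unif_def)
qed

lemma FERL_hyb:
  assumes bv: "AE \<omega> in M. \<forall>A>0. \<forall>x. eta Z (real x) (real A) \<omega> \<in> BV0" and c: "c > 0"
  shows "FERL M BV0 d_hyb (increments Z c) (add_drift (L_set \<Phi>\<^sub>c (1 / c)) \<mu>)"
proof -
  have \<alpha>: "1 / c > 0" using c by simp
  have HE: "AE \<omega> in M. \<forall>A>0. \<forall>x. H A x \<omega> \<in> BV0"
    using bv
  proof eventually_elim
    case (elim \<omega>)
    show ?case
    proof (intro allI impI)
      fix A x :: nat assume "0 < A"
      then have "eta Z (real x) (real A) \<omega> \<in> BV0" using elim by blast
      from BV0_add_drift[OF this, of "- \<mu>"] show "H A x \<omega> \<in> BV0" by (simp add: H_def[abs_def])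
    qed
  qed
  have fin: "\<Phi>\<^sub>c \<theta> < \<infinity>" "\<Phi>\<^sub>c (- \<theta>) < \<infinity>" by (intro Phi_c_finite \<theta>)+
  interpret F: ferl M X \<Phi>\<^sub>c H BV0 "L_set \<Phi>\<^sub>c (1 / c)" d_hyb "1 / c" \<theta>
  proof unfold_locales
    show "L_set \<Phi>\<^sub>c (1 / c) \<subseteq> BV0" by (auto simp: L_set_def)
    show "\<forall>\<^sub>F m in sequentially. \<forall>f\<in>L_set \<Phi>\<^sub>c (1 / c). \<exists>v. rate \<Phi>\<^sub>c m v \<le> ennreal (1 / c) \<and> d_hyb f (pl m v) \<le> \<epsilon>" if "\<epsilon> > 0" for \<epsilon>
      by (rule L_set_approx) (use that \<alpha> fin \<theta> in auto)
    show "\<forall>\<^sub>F m in sequentially. \<forall>\<^sub>F A in sequentially. \<forall>x. \<exists>F\<in>events. prob F \<le> exp (- real A * (1 / c + 1)) \<and>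
      (\<forall>\<omega>\<in>space M - F. d_hyb (H A x \<omega>) (pl m (D m A x \<omega>)) \<le> \<epsilon>)" if "\<epsilon> > 0" for \<epsilon>
      by (rule close_hyb[OF _ that]) (use \<alpha> in simp)
  qed (fact \<alpha> \<theta> fin d_hyb_triangle d_hyb_commute pl_in_BV0 d_hyb_pl_le HE | rule pl_in_L_set; assumption)+
  show ?thesis
    by (rule FERL_of_inclusions[OF c F.KE BV0_add_drift _ HE F.upper_inclusion F.lower_inclusion]) (simp_all add: d_hyb_def)
qed

end

theorem theorem4:
  fixes M :: "'a measure" and Z :: "real \<Rightarrow> 'a \<Rightarrow> real" and c \<mu> :: real
    and \<Phi> \<Phi>\<^sub>c :: "real \<Rightarrow> ennreal"
  assumes "levy_process M Z" and "c > 0"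
    and "\<Phi> = mgf M (Z 1)"
    and "\<mu> = (LINT \<omega>|M. Z 1 \<omega>)"
    and "\<Phi>\<^sub>c = mgf M (\<lambda>\<omega>. Z 1 \<omega> - \<mu>)"
  shows "((\<forall>\<theta>. \<Phi> \<theta> < \<infinity>) \<longrightarrow>
            FERL M D01 d_unif (increments Z c) (add_drift (K_set \<Phi>\<^sub>c (1 / c)) \<mu>)) \<and>
         (\<forall>A \<nu> \<gamma>. generating_triplet M Z A \<nu> \<gamma> \<longrightarrow> A = 0 \<longrightarrow>
            (\<integral>\<^sup>+x\<in>{-1..1}. ennreal \<bar>x\<bar> \<partial>\<nu>) < \<infinity> \<longrightarrow>
            (\<forall>\<^sub>F \<theta> in nhds 0. \<Phi> \<theta> < \<infinity>) \<longrightarrow>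
            FERL M BV0 d_hyb (increments Z c) (add_drift (L_set \<Phi>\<^sub>c (1 / c)) \<mu>))"
proof (intro conjI impI allI)
  assume all: "\<forall>\<theta>. \<Phi> \<theta> < \<infinity>"
  \<comment> \<open>Any positive exponent serves, as all exponential moments are finite.\<close>
  interpret levy_exp M Z 1 \<mu> \<Phi>\<^sub>c
    by unfold_locales (use assms all in auto)
  show "FERL M D01 d_unif (increments Z c) (add_drift (K_set \<Phi>\<^sub>c (1 / c)) \<mu>)"
    by (rule FERL_unif) (use assms all in auto)
next
  fix A \<nu> \<gamma>
  assume tr: "generating_triplet M Z A \<nu> \<gamma>" "A = 0" and \<nu>: "(\<integral>\<^sup>+x\<in>{-1..1}. ennreal \<bar>x\<bar> \<partial>\<nu>) < \<infinity>"
    and fin: "\<forall>\<^sub>F \<theta> in nhds 0. \<Phi> \<theta> < \<infinity>"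
  obtain e where e: "e > 0" "\<And>\<theta>. \<bar>\<theta>\<bar> < e \<Longrightarrow> \<Phi> \<theta> < \<infinity>"
    using fin unfolding eventually_nhds_metric by (auto simp: dist_real_def)
  \<comment> \<open>Both \<open>e / 2\<close> and its negative lie in the interval where \<Phi> is
    finite.\<close>
  interpret levy_exp M Z "e / 2" \<mu> \<Phi>\<^sub>c
    by unfold_locales (use assms e in auto)
  interpret T: bv_triplet \<nu>
    by unfold_locales (use tr \<nu> in \<open>auto simp: generating_triplet_def\<close>)
  interpret B: levy_bv M Z \<nu> \<gamma>
    by unfold_locales (use tr in \<open>simp add: generating_triplet_def T.g_def\<close>)
  show "FERL M BV0 d_hyb (increments Z c) (add_drift (L_set \<Phi>\<^sub>c (1 / c)) \<mu>)"
    by (rule FERL_hyb[OF B.eta_bounded_variation assms(2)])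
qed

end
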